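(* Let $X$ be a spectrally negative Lévy process, let $e_r$ be an exponential random variable with rate $r$ independent of $X$, and let $$T^+(r):=\sup\{0<t\le e_r: X_t<0\},\qquad \sup\emptyset:=0 .$$ For any $p,q,r,\theta>0$ and $x\in\mathbb{R}$ we have $$\mathbb{E}_x\Big[e^{-pT^+(r)-q\int_0^{T^+(r)}1_{\{X_s\le 0\}}\,ds};\,T^+(r)<e_r\Big]=\frac{r\,(W^{(r)}(x)-W^{(p+r)}(x))}{\Phi(r)}+\frac{r\,(\Phi(p+q+r)-\Phi(p+r))}{q\,\Phi(r)}\,Z^{(p+r)}(x,\Phi(p+q+r))-r\int_0^x W^{(r)}(y)\,dy$$ and $$\mathbb{E}_x\Big[e^{-pT^+(r)-q\int_0^{T^+(r)}1_{\{X_s\le 0\}}\,ds+\theta X_{T^+(r)}};\,T^+(r)=e_r\Big]=\frac{r}{p+q+r-\psi(\theta)}\left(-\frac{p+r-\psi(\theta)}{q}\cdot\frac{\Phi(p+q+r)-\Phi(p+r)}{\Phi(p+r)-\theta}\right)Z^{(p+r)}(x,\Phi(p+q+r))+\frac{r}{p+q+r-\psi(\theta)}\,Z^{(p+r)}(x,\theta).$$ At the values of $\theta$ where a denominator vanishes ($\theta=\Phi(p+r)$ or $\theta=\Phi(p+q+r)$), the right-hand side is understood as its limit.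
   Context: A spectrally negative Lévy process $X$ is a real-valued Lévy process with right-continuous sample paths and no positive jumps; processes with monotone decreasing paths (negatives of subordinators, including the zero process and negative deterministic drift) are excluded. Under $\mathbb{P}_x$ (expectation $\mathbb{E}_x$) the process starts at $X_0=x$; $\mathbb{E}=\mathbb{E}_0$. For an event $A$ and a random variable $Y$, $\mathbb{E}_x[Y;A]:=\mathbb{E}_x[Y1_A]$. Laplace exponent: $\frac1t\log\mathbb{E}e^{\lambda X_t}=\psi(\lambda)$ for $t>0$, $\lambda\ge0$, with $\psi(\lambda)=a\lambda+\frac12\sigma^2\lambda^2+\int_{-\infty}^0(e^{\lambda x}-1-\lambda x1_{\{x>-1\}})\,\Pi(dx)$, where $\Pi$ is a $\sigma$-finite measure on $(-\infty,0)$ with $\int_{-\infty}^0(x^2\wedge1)\,\Pi(dx)<\infty$. $\Phi:[0,\infty)\to[0,\infty)$ is the (right) inverse of $\psi$: $\Phi(q)=\sup\{\lambda\ge0:\psi(\lambda)=q\}$. Scale functions: for $q\ge0$, $W^{(q)}$ is the nonnegative increasing function on $[0,\infty)$ (continuous on $(0,\infty)$, right-continuous at $0$) with $\int_0^\infty e^{-\lambda x}W^{(q)}(x)\,dx=\frac{1}{\psi(\lambda)-q}$ for $\lambda>\Phi(q)$, and $W^{(q)}(x):=0$ for $x<0$. Further, $Z^{(q)}(x,\theta):=e^{\theta x}\Big(1+(q-\psi(\theta))\int_0^x e^{-\theta y}W^{(q)}(y)\,dy\Big)$ for $x\ge0$, and $Z^{(q)}(x,\theta):=e^{\theta x}$ for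 $x<0$. *)

theory Defs
  imports "HOL-Probability.Probability"
begin

text \<open>A spectrally negative Levy process started at \<open>0\<close>: right-continuous paths with left limits
  and without positive jumps; processes with almost surely decreasing paths are excluded.\<close>

locale spectrally_negative_levy = prob_space M
  for M :: "'a measure" and X :: "real \<Rightarrow> 'a \<Rightarrow> real" +
  assumes random_variable_X: "\<And>t. 0 \<le> t \<Longrightarrow> random_variable borel (X t)"
    and start_at_0: "AE \<omega> in M. X 0 \<omega> = 0"
    and independent_increments:
      "\<And>(n::nat) (t :: nat \<Rightarrow> real). 0 \<le> t 0 \<Longrightarrow> (\<And>i. i < n \<Longrightarrow> t i < t (Suc i)) \<Longrightarrow>
         indep_vars (\<lambda>_. borel) (\<lambda>i \<omega>. X (t (Suc i)) \<omega> - X (t i) \<omega>) {..<n}"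
    and stationary_increments:
      "\<And>s t. 0 \<le> s \<Longrightarrow> 0 \<le> t \<Longrightarrow>
         distr M borel (\<lambda>\<omega>. X (s + t) \<omega> - X s \<omega>) = distr M borel (X t)"
    and right_continuous_paths:
      "\<And>\<omega> t. \<omega> \<in> space M \<Longrightarrow> 0 \<le> t \<Longrightarrow> ((\<lambda>s. X s \<omega>) \<longlongrightarrow> X t \<omega>) (at_right t)"
    and no_positive_jumps:
      "\<And>\<omega> t. \<omega> \<in> space M \<Longrightarrow> 0 < t \<Longrightarrow>
         \<exists>l. ((\<lambda>s. X s \<omega>) \<longlongrightarrow> l) (at_left t) \<and> X t \<omega> \<le> l"
    and not_decreasing: "\<not> (AE \<omega> in M. antimono_on {0..} (\<lambda>t. X t \<omega>))"

text \<open>The path of \<open>X\<close> under \<open>P\<^sub>x\<close>: the law \<open>P\<^sub>x\<close> is realised as that of \<open>x + X\<close> under \<open>P = P\<^sub>0\<close>.\<close>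

definition path_from :: "real \<Rightarrow> (real \<Rightarrow> 'a \<Rightarrow> real) \<Rightarrow> 'a \<Rightarrow> real \<Rightarrow> real" where
  "path_from x X \<omega> t = x + X t \<omega>"

text \<open>\<open>(1 / t) log E exp(\<beta> X\<^sub>t)\<close> does not depend on \<open>t > 0\<close>; it is taken at \<open>t = 1\<close>.\<close>

definition laplace_exponent :: "'a measure \<Rightarrow> (real \<Rightarrow> 'a \<Rightarrow> real) \<Rightarrow> real \<Rightarrow> real" where
  "laplace_exponent M X \<beta> = ln (LINT \<omega>|M. exp (\<beta> * X 1 \<omega>))"

definition right_inverse :: "(real \<Rightarrow> real) \<Rightarrow> real \<Rightarrow> real" where
  "right_inverse \<psi> q = Sup {\<beta>. 0 \<le> \<beta> \<and> \<psi> \<beta> = q}"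

definition scale_function :: "(real \<Rightarrow> real) \<Rightarrow> real \<Rightarrow> (real \<Rightarrow> real) \<Rightarrow> bool" where
  "scale_function \<psi> q W \<longleftrightarrow>
     (\<forall>x<0. W x = 0) \<and> (\<forall>x\<ge>0. 0 \<le> W x) \<and> mono_on {0..} W \<and> continuous_on {0..} W \<and>
     (\<forall>\<beta>>right_inverse \<psi> q.
        set_integrable lborel {0..} (\<lambda>x. exp (- \<beta> * x) * W x) \<and>
        (LBINT x:{0..}. exp (- \<beta> * x) * W x) = 1 / (\<psi> \<beta> - q))"

definition scale_Z ::
  "(real \<Rightarrow> real) \<Rightarrow> (real \<Rightarrow> real \<Rightarrow> real) \<Rightarrow> real \<Rightarrow> real \<Rightarrow> real \<Rightarrow> real" where
  "scale_Z \<psi> W q x \<theta> =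
     (if x < 0 then exp (\<theta> * x)
      else exp (\<theta> * x) * (1 + (q - \<psi> \<theta>) * (LBINT y:{0..x}. exp (- \<theta> * y) * W q y)))"

definition last_negative_time :: "(real \<Rightarrow> real) \<Rightarrow> real \<Rightarrow> real" where
  "last_negative_time Y s =
     (if {t. 0 < t \<and> t \<le> s \<and> Y t < 0} = {} then 0 else Sup {t. 0 < t \<and> t \<le> s \<and> Y t < 0})"

definition occupation_time :: "(real \<Rightarrow> real) \<Rightarrow> real \<Rightarrow> real" where
  "occupation_time Y t = (LBINT s:{0..t}. indicator {..0} (Y s))"

text \<open>\<open>v\<close> is the value at \<open>\<theta>\<close> of an expression \<open>f\<close> which at the points of \<open>S\<close> is to be read as
  its limit.\<close>

definition value_or_limit :: "real set \<Rightarrow> (real \<Rightarrow> real) \<Rightarrow> real \<Rightarrow> real \<Rightarrow> bool" where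
  "value_or_limit S f \<theta> v \<longleftrightarrow> (if \<theta> \<in> S then (f \<longlongrightarrow> v) (at \<theta>) else v = f \<theta>)"

end

theory Submission
  imports Defs
begin

text \<open>
  Write \<open>\<Phi>\<close> for the right inverse of the Laplace exponent \<open>\<psi>\<close>, and \<open>U\<^sub>\<mu>(dz) = \<integral> e\<^sup>-\<^sup>\<mu>\<^sup>t P(X\<^sub>t \<in> dz) dt\<close> for the
  \<open>\<mu>\<close>-potential measure of \<open>X\<close> started at \<open>0\<close>, with resolvent \<open>R\<^sub>\<mu> g(x) = \<integral> g(x + z) U\<^sub>\<mu>(dz)\<close>.

  Both expectations, as functions \<open>u\<close> of the starting point, solve a linear equation
  \<open>u = R\<^sub>r (g - (p + q 1\<^bsub>(-\<infinity>,0)\<^esub>) u)\<close>, in which discounting at rate \<open>p + q 1\<^bsub>(-\<infinity>,0)\<^esub>\<close> appears as killing.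
  Since there are no positive jumps and the path is almost surely nonzero at the exponential time, \<open>T\<^sup>+(r) = e\<^sub>r\<close> means
  that the path is negative at time \<open>e\<^sub>r\<close>; so the second expectation is a discounted terminal value, with
  \<open>g(y) = r e\<^bsup>\<theta>y\<^esup> 1\<^bsub>(-\<infinity>,0)\<^esub>(y)\<close> (lemma \<open>expect_at_discounted\<close>). For the first expectation \<open>g = r 1\<^bsub>[0,\<infinity>)\<^esub> + p N\<close>,
  where \<open>N(y)\<close> is the probability that the path from \<open>y\<close> is nonnegative up to time \<open>e\<^sub>r\<close>
  (lemma \<open>expect_at_before_end\<close>). Both equations integrate a pathwise identity for exponentials of additive
  functionals, with the Markov property at fixed times.

  The resolvent equation absorbs the constant rate \<open>p\<close> and replaces \<open>R\<^sub>r\<close> by \<open>R\<^bsub>p+r\<^esub>\<close>. What remains is killing at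
  rate \<open>q\<close> on the negative half-line, and lemma \<open>feynman_kac_solution\<close> solves that equation. Using the
  resolvent \<open>R\<^bsub>p+q+r\<^esub>\<close>, the solution is seen to be, on the negative half-line, a combination of \<open>e\<^bsup>\<theta>x\<^esup>\<close> and
  \<open>e\<^bsup>\<Phi>(p+q+r)x\<^esup>\<close>. Inserting this into the equation for \<open>R\<^bsub>p+r\<^esub>\<close> turns these exponentials into \<open>Z\<^sup>(\<^sup>p\<^sup>+\<^sup>r\<^sup>)\<close> and produces
  a multiple of \<open>e\<^bsup>\<Phi>(p+r)x\<^esup>\<close>. That multiple must vanish, and this fixes the one unknown coefficient.

  Everything thus rests on the explicit kernel (lemma \<open>potential_density\<close>)
  \<open>U\<^sub>\<mu>(dz) = (C e\<^bsup>-\<Phi>(\<mu>)z\<^esup> - W\<^sup>(\<^sup>\<mu>\<^sup>)(-z)) dz\<close>. On the positive half-line it comes from the strong Markov property at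
  first passage times, obtained as limits along dyadic grids: levels are hit exactly, so the tails of \<open>U\<^sub>\<mu>\<close>
  are multiplicative and hence exponential (lemmas \<open>tail_factor\<close>, \<open>passage_exponential\<close>). These tails also give the
  exponential moments of \<open>X\<close> and identify the rate as \<open>\<Phi>(\<mu>)\<close> (lemma \<open>right_inverse_psi\<close>). On the negative
  half-line the Laplace transform of \<open>U\<^sub>\<mu>\<close> is computed from the resolvent equation (lemma
  \<open>laplace_potential_negative\<close>), and the density follows from uniqueness of Laplace transforms.

  The function \<open>N\<close> is the limit of the solutions for \<open>p = 0\<close> and \<open>q \<rightarrow> \<infinity>\<close> (lemma \<open>stays_nonneg_formula\<close>), and a
  comparison of Laplace transforms simplifies its convolution with \<open>W\<^sup>(\<^sup>p\<^sup>+\<^sup>r\<^sup>)\<close> (lemma \<open>scale_convolution_source\<close>).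
  At the two exceptional values of \<open>\<theta>\<close> the second identity follows from its other values by dominated convergence.
\<close>

section \<open>Additive functions and uniqueness of Laplace transforms\<close>

text \<open>Subtracting \<open>t f(1)\<close> leaves an additive function that vanishes on the integers, hence is 1-periodic and
  bounded above; being additive, such a function is at most zero, and then zero because \<open>g(t) + g(n - t) = 0\<close>.\<close>

lemma additive_bounded_above_linear:
  fixes f :: "real \<Rightarrow> real"
  assumes add: "\<And>s t. 0 \<le> s \<Longrightarrow> 0 \<le> t \<Longrightarrow> f (s + t) = f s + f t"
    and bound: "\<And>t. 0 \<le> t \<Longrightarrow> t \<le> 1 \<Longrightarrow> f t \<le> B"
    and "0 \<le> t"
  shows "f t = t * f 1"
proof -
  define g where "g t = f t - t * f 1" for t
  have g_add: "g (s + t) = g s + g t" if "0 \<le> s" "0 \<le> t" for s t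
    using add[OF that] by (simp add: g_def algebra_simps)
  have g1: "g 1 = 0" by (simp add: g_def)
  have g0: "g 0 = 0" using add[of 0 0] by (simp add: g_def)
  have g_mult: "g (real n * t) = real n * g t" if "0 \<le> t" for n t
  proof (induction n)
    case (Suc n)
    have "g (real n * t + t) = g (real n * t) + g t"
      using that by (intro g_add) auto
    then show ?case using Suc by (simp add: algebra_simps)
  qed (simp add: g0)
  have g_nat: "g (real n) = 0" for n
    using g_mult[of 1 n] g1 by simp
  have g_bound: "g t \<le> B + \<bar>f 1\<bar>" if "0 \<le> t" for t
  proof -
    have fl: "real (nat \<lfloor>t\<rfloor>) = of_int \<lfloor>t\<rfloor>" using that by simp
    have "g t = g (real (nat \<lfloor>t\<rfloor>) + frac t)"
      unfolding fl by (simp add: frac_def)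
    also have "\<dots> = g (frac t)"
      by (subst g_add) (auto simp: g_nat simp del: of_nat_nat)
    also have "\<dots> \<le> B + \<bar>f 1\<bar>"
    proof -
      have "f (frac t) \<le> B" using frac_lt_1[of t] by (intro bound) auto
      moreover have "- (frac t * f 1) \<le> \<bar>f 1\<bar>"
      proof -
        have "\<bar>frac t * f 1\<bar> \<le> 1 * \<bar>f 1\<bar>"
          unfolding abs_mult using frac_lt_1[of t] by (intro mult_right_mono) auto
        then show ?thesis by linarith
      qed
      ultimately show ?thesis by (simp add: g_def)
    qed
    finally show ?thesis .
  qed
  have g_le: "g t \<le> 0" if "0 \<le> t" for t
  proof (rule ccontr)
    assume "\<not> g t \<le> 0"
    then obtain n where "B + \<bar>f 1\<bar> < real n * g t"
      using reals_Archimedean3[of "g t" ] by (auto simp: not_le)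
    moreover have "real n * g t \<le> B + \<bar>f 1\<bar>"
      using g_bound[of "real n * t"] g_mult[OF that] that by simp
    ultimately show False by simp
  qed
  obtain n where n: "t \<le> real n" using real_arch_simple by blast
  have "g t + g (real n - t) = 0"
    using g_add[of t "real n - t"] n \<open>0 \<le> t\<close> g_nat by simp
  with g_le[of t] g_le[of "real n - t"] n \<open>0 \<le> t\<close> have "g t = 0" by linarith
  then show ?thesis by (simp add: g_def)
qed

text \<open>Continuous functions that approximate the indicator of an open half-line; they reduce statements on tails
  of measures to continuous test functions.\<close>

lemma ramp_tendsto_indicator:
  "(\<lambda>n. max 0 (min 1 (real n * (y - a)))) \<longlonglongrightarrow> indicator {a<..} (y::real)"
proof (cases "y > a")
  case True
  obtain m where m: "1 / (y - a) < real m" using reals_Archimedean2 by blast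
  have "max 0 (min 1 (real n * (y - a))) = 1" if "n \<ge> m" for n
  proof -
    have "1 / (y - a) \<le> real n" using m that by linarith
    then have "1 \<le> real n * (y - a)" using True by (simp add: field_simps)
    then show ?thesis by simp
  qed
  then show ?thesis using True by (intro tendsto_eventually) (auto simp: eventually_sequentially)
next
  case False
  then have "real n * (y - a) \<le> 0" for n by (intro mult_nonneg_nonpos) auto
  then have "min 1 (real n * (y - a)) \<le> 0" for n by (rule min.coboundedI2)
  then have "max 0 (min 1 (real n * (y - a))) = 0" for n by (rule max_absorb1)
  then show ?thesis using False by simp
qed

lemma integral_ramp_tendsto:
  fixes N :: "real measure"
  assumes "finite_measure N" and [measurable_cong]: "sets N = sets borel"
  shows "(\<lambda>n. LINT y|N. max 0 (min 1 (real n * (y - a)))) \<longlonglongrightarrow> measure N {a<..}"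
proof -
  have "(\<lambda>n. LINT y|N. max 0 (min 1 (real n * (y - a)))) \<longlonglongrightarrow> (LINT y|N. indicator {a<..} y)"
  proof (rule integral_dominated_convergence[where w="\<lambda>_. 1"])
    show "integrable N (\<lambda>_. 1::real)" by (rule finite_measure.integrable_const[OF assms(1)])
  qed (auto simp: ramp_tendsto_indicator)
  also have "(LINT y|N. indicator {a<..} y) = measure N {a<..}"
    by (simp add: sets_eq_imp_space_eq[OF assms(2)])
  finally show ?thesis .
qed

text \<open>The moments determine the integrals of the Bernstein polynomials, which approximate a continuous function
  uniformly on the unit interval.\<close>

lemma moments_determine_measure:
  fixes P Q :: "real measure"
  assumes [simp]: "sets P = sets borel" "sets Q = sets borel"
    and fin: "finite_measure P" "finite_measure Q"
    and supp: "AE y in P. y \<in> {0..1}" "AE y in Q. y \<in> {0..1}"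
    and mom: "\<And>n. (LINT y|P. y ^ n) = (LINT y|Q. y ^ n)"
  shows "P = Q"
proof -
  let ?B = "\<lambda>(f :: real \<Rightarrow> real) n y. \<Sum>k\<le>n. f (real k/real n) * Bernstein n k y"
  interpret P: finite_measure P by (rule fin)
  interpret Q: finite_measure Q by (rule fin)
  note [measurable_cong] = assms(1,2)
  have pow: "integrable N (\<lambda>y. c * y ^ n)" if "finite_measure N" "AE y in N. y \<in> {0..1}" "sets N = sets borel"
    for N :: "real measure" and n c
  proof -
    note [measurable_cong] = that(3)
    show ?thesis
  proof (rule finite_measure.integrable_const_bound[OF that(1), where B="\<bar>c\<bar>"])
    show "AE y in N. norm (c * y ^ n) \<le> \<bar>c\<bar>"
      using that(2)
    proof eventually_elim
      case (elim y)
      have "\<bar>c\<bar> * y ^ n \<le> \<bar>c\<bar> * 1"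
        using elim by (intro mult_left_mono power_le_one) auto
      then show ?case using elim by (simp add: abs_mult)
    qed
  qed measurable
  qed
  have Bern: "integrable N (Bernstein n k) \<and>
      (LINT y|N. Bernstein n k y) = (\<Sum>j\<le>n-k. real (n choose k) * real ((n-k) choose j) * (-1)^j * (LINT y|N. y ^ (k + j)))"
    if "finite_measure N" "AE y in N. y \<in> {0..1}" "sets N = sets borel" for N :: "real measure" and n k
  proof -
    have "Bernstein n k y = (\<Sum>j\<le>n-k. real (n choose k) * real ((n-k) choose j) * (-1)^j * y ^ (k + j))" for y :: real
    proof -
      have "(1 - y) ^ (n - k) = (\<Sum>j\<le>n-k. real ((n-k) choose j) * (-y)^j)"
        using binomial_ring[of "-y" 1 "n-k"] by simp
      also have "\<dots> = (\<Sum>j\<le>n-k. real ((n-k) choose j) * (-1)^j * y^j)"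
        by (intro sum.cong refl) (simp add: power_minus[of y])
      finally show ?thesis
        by (simp add: Bernstein_def sum_distrib_left power_add algebra_simps)
    qed
    then have eq: "Bernstein n k = (\<lambda>y::real. \<Sum>j\<le>n-k. real (n choose k) * real ((n-k) choose j) * (-1)^j * y ^ (k + j))"
      by auto
    show ?thesis
      unfolding eq
    proof (intro conjI)
      show "integrable N (\<lambda>y::real. \<Sum>j\<le>n-k. real (n choose k) * real ((n-k) choose j) * (-1)^j * y ^ (k + j))"
        by (intro Bochner_Integration.integrable_sum pow that)
      show "(LINT y|N. (\<Sum>j\<le>n-k. real (n choose k) * real ((n-k) choose j) * (-1)^j * y ^ (k + j))) =
        (\<Sum>j\<le>n-k. real (n choose k) * real ((n-k) choose j) * (-1)^j * (LINT y|N. y ^ (k + j)))"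
        by (subst Bochner_Integration.integral_sum) (simp_all add: pow[OF that] pow[OF that, of 1, simplified])
    qed
  qed
  have cont: "(LINT y|P. f y) = (LINT y|Q. f y)"
    if f: "continuous_on UNIV f" "\<And>y. \<bar>f y\<bar> \<le> 1" for f :: "real \<Rightarrow> real"
  proof -
    have [measurable]: "f \<in> borel_measurable borel" by (rule borel_measurable_continuous_onI[OF f(1)])
    have fint: "integrable N f" if "finite_measure N" "sets N = sets borel" for N :: "real measure"
    proof -
      note [measurable_cong] = that(2)
      show ?thesis using f by (intro finite_measure.integrable_const_bound[OF that(1), of _ 1]) auto
    qed
    have approx: "\<bar>(LINT y|N. f y) - (LINT y|N. ?B f n y)\<bar> \<le> e * measure N (space N)"
      if N: "finite_measure N" "AE y in N. y \<in> {0..1}" "sets N = sets borel"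
        and e: "\<And>y. y \<in> {0..1} \<Longrightarrow> \<bar>f y - (\<Sum>k\<le>n. f(real k/real n) * Bernstein n k y)\<bar> < e" for N :: "real measure" and n e
    proof -
      have i2: "integrable N (\<lambda>y. \<Sum>k\<le>n. f (real k/real n) * Bernstein n k y)"
        by (intro Bochner_Integration.integrable_sum integrable_mult_right) (use Bern[OF N] in auto)
      have "\<bar>(LINT y|N. f y) - (LINT y|N. ?B f n y)\<bar>
        = \<bar>(LINT y|N. f y - ?B f n y)\<bar>"
        using fint[OF N(1,3)] i2 by simp
      also have "\<dots> \<le> (LINT y|N. \<bar>f y - ?B f n y\<bar>)"
        by (rule integral_abs_bound)
      also have "\<dots> \<le> (LINT y|N. e)"
      proof (intro integral_mono_AE integrable_abs Bochner_Integration.integrable_diff fint[OF N(1,3)] i2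
           finite_measure.integrable_const[OF N(1)])
        show "AE y in N. \<bar>f y - ?B f n y\<bar> \<le> e"
          using N(2) by (rule eventually_mono) (rule less_imp_le[OF e])
      qed
      finally show ?thesis by (simp add: mult.commute)
    qed
    show ?thesis
    proof (rule ccontr)
      assume neq: "(LINT y|P. f y) \<noteq> (LINT y|Q. f y)"
      define d where "d = \<bar>(LINT y|P. f y) - (LINT y|Q. f y)\<bar>"
      have d: "d > 0" using neq by (simp add: d_def)
      \<comment> \<open>The summand \<open>1\<close> makes \<open>K\<close> positive and the final estimate strict.\<close>
      define K where "K = measure P (space P) + measure Q (space Q) + 1"
      have K: "K > 0" by (simp add: K_def add_nonneg_pos)
      have cf: "continuous_on {0..1} f" using f(1) by (rule continuous_on_subset) simp
      have dK: "0 < d / K" using d K by simp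
      obtain n where nn: "\<forall>m x. n \<le> m \<and> x \<in> {0..1}
          \<longrightarrow> \<bar>f x - (\<Sum>k\<le>m. f(real k/real m) * Bernstein m k x)\<bar> < d / K"
        using Bernstein_Weierstrass[OF cf dK] by blast
      have n: "\<bar>f y - (\<Sum>k\<le>n. f(real k/real n) * Bernstein n k y)\<bar> < d / K" if "y \<in> {0..1}" for y
        using nn that by blast
      have eq: "(LINT y|P. ?B f n y) = (LINT y|Q. ?B f n y)"
        using Bern[OF fin(1) supp(1)] Bern[OF fin(2) supp(2)] by (simp add: mom)
      have "d \<le> d / K * measure P (space P) + d / K * measure Q (space Q)"
        using approx[OF fin(1) supp(1) _ n] approx[OF fin(2) supp(2) _ n] eq unfolding d_def by simp
      also have "\<dots> = d / K * (measure P (space P) + measure Q (space Q))"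
        by (simp add: distrib_left)
      also have "\<dots> = d * ((K - 1) / K)" by (simp add: K_def)
      also have "\<dots> < d * 1" using d K by (intro mult_strict_left_mono) auto
      finally show False by simp
    qed
  qed
  show ?thesis
  proof (rule measure_eqI_lessThan)
    fix a :: real
    show "emeasure P {a<..} < \<infinity>" by (simp add: P.emeasure_eq_measure)
    define f where "f n y = max 0 (min 1 (real n * (y - a)))" for n y
    have lim: "(\<lambda>n. LINT y|P. f n y) \<longlonglongrightarrow> measure P {a<..}" "(\<lambda>n. LINT y|Q. f n y) \<longlonglongrightarrow> measure Q {a<..}"
      unfolding f_def by (intro integral_ramp_tendsto fin assms)+
    have "(LINT y|P. f n y) = (LINT y|Q. f n y)" for n
      by (rule cont) (auto simp: f_def intro!: continuous_intros)
    with lim have "measure P {a<..} = measure Q {a<..}"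
      using LIMSEQ_unique by auto
    then show "emeasure P {a<..} = emeasure Q {a<..}"
      by (simp add: P.emeasure_eq_measure Q.emeasure_eq_measure)
  qed auto
qed

text \<open>The substitution \<open>y = e\<^sup>-\<^sup>x\<close> maps the half-line to the unit interval and the values of the Laplace
  transform at \<open>c, c + 1, c + 2, \<dots>\<close> to moments.\<close>

lemma laplace_transform_determines_measure:
  fixes P Q :: "real measure"
  assumes [simp]: "sets P = sets borel" "sets Q = sets borel"
    and supp: "AE x in P. 0 \<le> x" "AE x in Q. 0 \<le> x"
    and fin: "\<And>\<beta>. \<beta> > b \<Longrightarrow> (\<integral>\<^sup>+x. ennreal (exp (- \<beta> * x)) \<partial>P) < \<infinity>"
    and eq: "\<And>\<beta>. \<beta> > b \<Longrightarrow> (\<integral>\<^sup>+x. ennreal (exp (- \<beta> * x)) \<partial>P) = (\<integral>\<^sup>+x. ennreal (exp (- \<beta> * x)) \<partial>Q)"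
  shows "P = Q"
proof -
  note [measurable_cong] = assms(1,2)
  define c where "c = b + 1"
  \<comment> \<open>The factor \<open>e\<^bsup>-cx\<^esup>\<close> makes the image measure finite.\<close>
  define F where "F N = distr (density N (\<lambda>x. ennreal (exp (- c * x)))) borel (\<lambda>x. exp (- x))" for N :: "real measure"
  have int_F: "(\<integral>\<^sup>+y. g y \<partial>F N) = (\<integral>\<^sup>+x. ennreal (exp (- c * x)) * g (exp (- x)) \<partial>N)"
    if N: "sets N = sets borel" and g [measurable]: "g \<in> borel_measurable borel" for N g
  proof -
    note [measurable_cong] = N
    show ?thesis unfolding F_def by (simp add: nn_integral_distr nn_integral_density)
  qed
  have mom: "(\<integral>\<^sup>+y. ennreal (y ^ n) \<partial>F N) = (\<integral>\<^sup>+x. ennreal (exp (- (c + real n) * x)) \<partial>N)"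
    if N: "sets N = sets borel" for N n
  proof -
    note [measurable_cong] = N
    have "(\<integral>\<^sup>+y. ennreal (y ^ n) \<partial>F N) = (\<integral>\<^sup>+x. ennreal (exp (- c * x)) * ennreal (exp (- x) ^ n) \<partial>N)"
      by (subst int_F[OF N]) auto
    also have "\<dots> = (\<integral>\<^sup>+x. ennreal (exp (- (c + real n) * x)) \<partial>N)"
      by (intro nn_integral_cong)
         (simp add: ennreal_mult'[symmetric] exp_of_nat_mult[symmetric] exp_add[symmetric] algebra_simps)
    finally show ?thesis .
  qed
  have total: "emeasure (F N) (space (F N)) = (\<integral>\<^sup>+x. ennreal (exp (- c * x)) \<partial>N)"
    if "sets N = sets borel" for N
    using mom[OF that, of 0] by simp
  have finF: "finite_measure (F N)" if "sets N = sets borel"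
     "\<And>\<beta>. \<beta> > b \<Longrightarrow> (\<integral>\<^sup>+x. ennreal (exp (- \<beta> * x)) \<partial>N) < \<infinity>" for N
    using that(2)[of c] total[OF that(1)] by (intro finite_measureI) (simp add: c_def)
  have suppF: "AE y in F N. y \<in> {0..1}" if "sets N = sets borel" "AE x in N. 0 \<le> x" for N
  proof -
    note [measurable_cong] = that(1)
    show ?thesis unfolding F_def
      using that(2) by (subst AE_distr_iff) (auto simp: AE_density elim!: eventually_mono)
  qed
  have finP: "(\<integral>\<^sup>+x. ennreal (exp (- \<beta> * x)) \<partial>Q) < \<infinity>" if "\<beta> > b" for \<beta>
    using fin[OF that] eq[OF that] by simp
  have FF: "F P = F Q"
  proof (rule moments_determine_measure)
    fix n
    have *: "(LINT y|F N. y ^ n) = enn2real (\<integral>\<^sup>+y. ennreal (y ^ n) \<partial>F N)"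
      if "sets N = sets borel" "AE x in N. 0 \<le> x" for N
      using suppF[OF that] by (intro integral_eq_nn_integral) (auto simp: F_def elim!: eventually_mono)
    show "(LINT y|F P. y ^ n) = (LINT y|F Q. y ^ n)"
      using eq[of "c + real n"] * supp by (simp add: mom c_def)
  qed (use finF[OF assms(1) fin] finF[OF assms(2) finP] suppF[OF assms(1) supp(1)] suppF[OF assms(2) supp(2)]
        in \<open>simp_all add: F_def\<close>)
  have recover: "emeasure N B = (\<integral>\<^sup>+y. indicator B (- ln y) * ennreal (exp (c * (- ln y))) \<partial>F N)"
    if N: "sets N = sets borel" and B [measurable]: "B \<in> sets borel" for N B
  proof -
    note [measurable_cong] = N
    have "(\<integral>\<^sup>+y. indicator B (- ln y) * ennreal (exp (c * (- ln y))) \<partial>F N)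
      = (\<integral>\<^sup>+x. ennreal (exp (- c * x)) * (indicator B x * ennreal (exp (c * x))) \<partial>N)"
      by (subst int_F[OF N]) auto
    also have "\<dots> = (\<integral>\<^sup>+x. indicator B x \<partial>N)"
      by (intro nn_integral_cong)
         (auto split: split_indicator simp: ennreal_mult'[symmetric] exp_add[symmetric])
    finally show ?thesis using N by simp
  qed
  show ?thesis
    by (rule measure_eqI) (simp_all add: recover FF)
qed

section \<open>Independence of past and future\<close>

lemma finite_set_increasing_enumeration:
  fixes S :: "'a :: linorder set"
  assumes "finite S" "S \<noteq> {}"
  obtains n t where "S = t ` {..n::nat}" "\<And>i j. i < j \<Longrightarrow> j \<le> n \<Longrightarrow> t i < t j"
proof
  let ?L = "sorted_list_of_set S"
  have len: "length ?L = card S" "card S > 0"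
    using assms by (auto simp: card_gt_0_iff)
  show "S = (!) ?L ` {..card S - 1}"
  proof -
    have "{..card S - 1} = {..<length ?L}" using len by auto
    then have "(!) ?L ` {..card S - 1} = set ?L" by (auto simp: set_conv_nth)
    then show ?thesis using assms by simp
  qed
  show "?L ! i < ?L ! j" if "i < j" "j \<le> card S - 1" for i j
    using that len by (intro sorted_wrt_nth_less[OF strict_sorted_list_of_set]) auto
qed

abbreviation path_space :: "(real \<Rightarrow> real) measure" where
  "path_space \<equiv> PiM {0..} (\<lambda>_. borel)"

context spectrally_negative_levy
begin

definition path :: "'a \<Rightarrow> real \<Rightarrow> real" where
  "path \<omega> = (\<lambda>u\<in>{0..}. X u \<omega>)"

text \<open>The path stopped at time \<open>s\<close>, and below the path after time \<open>s\<close> relative to its value then: both are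
  points of the same path space, so that the Markov property can be stated with one product measure.\<close>

definition past :: "real \<Rightarrow> 'a \<Rightarrow> real \<Rightarrow> real" where
  "past s \<omega> = (\<lambda>u\<in>{0..}. X (min u s) \<omega>)"

definition future :: "real \<Rightarrow> 'a \<Rightarrow> real \<Rightarrow> real" where
  "future s \<omega> = (\<lambda>u\<in>{0..}. X (s + u) \<omega> - X s \<omega>)"

lemma measurable_X: "0 \<le> t \<Longrightarrow> X t \<in> borel_measurable M"
  using random_variable_X .

lemma measurable_path [measurable]: "path \<in> measurable M path_space"
  unfolding path_def by (intro measurable_restrict measurable_X) auto

lemma measurable_past: "0 \<le> s \<Longrightarrow> past s \<in> measurable M path_space"
  unfolding past_def by (intro measurable_restrict measurable_X) auto

lemma measurable_future: "0 \<le> s \<Longrightarrow> future s \<in> measurable M path_space"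
  unfolding future_def by (intro measurable_restrict borel_measurable_diff measurable_X) auto

lemma increment_sum:
  "i \<le> j \<Longrightarrow> X (t j) \<omega> - X (t i) \<omega> = (\<Sum>k\<in>{i..<j}. X (t (Suc k)) \<omega> - X (t k) \<omega>)"
  using sum_Suc_diff'[of i j "\<lambda>k. X (t k) \<omega>"] by simp

text \<open>Values at finitely many times are sums of increments over the common refinement of the times, so
  independence passes from disjoint blocks of increments to past and future.\<close>

lemma indep_var_finite_past_future:
  assumes s: "0 \<le> s" and J: "finite J" "J \<subseteq> {0..s}" and J': "finite J'" "J' \<subseteq> {s..}"
  shows "indep_var (PiM J (\<lambda>_. borel)) (\<lambda>\<omega>. \<lambda>u\<in>J. X u \<omega> - X 0 \<omega>)
     (PiM J' (\<lambda>_. borel)) (\<lambda>\<omega>. \<lambda>u\<in>J'. X u \<omega> - X s \<omega>)"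
proof -
  define S where "S = insert 0 (insert s (J \<union> J'))"
  have "finite S" "S \<noteq> {}" using J J' by (auto simp: S_def)
  then obtain n t where t: "S = t ` {..n::nat}" "\<And>i j. i < j \<Longrightarrow> j \<le> n \<Longrightarrow> t i < t j"
    using finite_set_increasing_enumeration by metis
  have S_nonneg: "x \<ge> 0" if "x \<in> S" for x using that s J J' by (auto simp: S_def)
  have t_le: "t i \<le> t j \<longleftrightarrow> i \<le> j" if "i \<le> n" "j \<le> n" for i j
    using t(2)[of i j] t(2)[of j i] that by (metis le_less linorder_not_less order_less_imp_not_less)
  have "0 \<in> t ` {..n}" unfolding t(1)[symmetric] by (simp add: S_def)
  then obtain i0 where i0: "i0 \<le> n" "t i0 = 0" by auto
  have t0: "t 0 = 0"
    using S_nonneg[of "t 0"] t(1) t_le[of 0 i0] i0 by force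
  have "s \<in> t ` {..n}" unfolding t(1)[symmetric] by (simp add: S_def)
  then obtain m where m: "m \<le> n" "t m = s" by auto
  have "\<forall>u\<in>S. \<exists>i\<le>n. t i = u" using t(1) by auto
  then obtain idx where idx: "\<And>u. u \<in> S \<Longrightarrow> idx u \<le> n \<and> t (idx u) = u" by metis
  let ?D = "\<lambda>i \<omega>. X (t (Suc i)) \<omega> - X (t i) \<omega>"
  have "indep_vars (\<lambda>_. borel) ?D {..<n}"
    using t(2) t0 by (intro independent_increments) auto
  then have ind: "indep_var (PiM {..<m} (\<lambda>_. borel)) (\<lambda>\<omega>. \<lambda>i\<in>{..<m}. ?D i \<omega>)
     (PiM {m..<n} (\<lambda>_. borel)) (\<lambda>\<omega>. \<lambda>i\<in>{m..<n}. ?D i \<omega>)"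
    by (rule indep_var_restrict) (use m in auto)
  have idxJ: "idx u \<le> m" if "u \<in> J" for u
    using idx[of u] that J m t_le[of "idx u" m] by (auto simp: S_def)
  have idxJ': "m \<le> idx u" "idx u \<le> n" if "u \<in> J'" for u
    using idx[of u] that J' m t_le[of m "idx u"] by (auto simp: S_def)
  have m1: "(\<lambda>d. \<lambda>u\<in>J. \<Sum>k\<in>{0..<idx u}. d k) \<in> measurable (PiM {..<m} (\<lambda>_. borel)) (PiM J (\<lambda>_. borel :: real measure))"
    using idxJ by (intro measurable_restrict borel_measurable_sum measurable_component_singleton) force
  have m2: "(\<lambda>d. \<lambda>u\<in>J'. \<Sum>k\<in>{m..<idx u}. d k) \<in> measurable (PiM {m..<n} (\<lambda>_. borel)) (PiM J' (\<lambda>_. borel :: real measure))"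
    using idxJ' by (intro measurable_restrict borel_measurable_sum measurable_component_singleton) force
  note indep_var_compose[OF ind m1 m2]
  also have "(\<lambda>d. \<lambda>u\<in>J. \<Sum>k\<in>{0..<idx u}. d k) \<circ> (\<lambda>\<omega>. \<lambda>i\<in>{..<m}. ?D i \<omega>) = (\<lambda>\<omega>. \<lambda>u\<in>J. X u \<omega> - X 0 \<omega>)"
  proof (intro ext)
    fix \<omega> u
    have "(\<Sum>k\<in>{0..<idx u}. restrict (\<lambda>i. ?D i \<omega>) {..<m} k) = X u \<omega> - X 0 \<omega>" if "u \<in> J"
    proof -
      have "(\<Sum>k\<in>{0..<idx u}. restrict (\<lambda>i. ?D i \<omega>) {..<m} k) = (\<Sum>k\<in>{0..<idx u}. ?D k \<omega>)"
        using idxJ[OF that] by (intro sum.cong) auto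
      also have "\<dots> = X (t (idx u)) \<omega> - X (t 0) \<omega>"
        by (subst increment_sum) auto
      finally show ?thesis using idx[of u] that t0 by (simp add: S_def)
    qed
    then show "((\<lambda>d. \<lambda>u\<in>J. \<Sum>k\<in>{0..<idx u}. d k) \<circ> (\<lambda>\<omega>. \<lambda>i\<in>{..<m}. ?D i \<omega>)) \<omega> u = (\<lambda>u\<in>J. X u \<omega> - X 0 \<omega>) u"
      by (simp add: restrict_def)
  qed
  also have "(\<lambda>d. \<lambda>u\<in>J'. \<Sum>k\<in>{m..<idx u}. d k) \<circ> (\<lambda>\<omega>. \<lambda>i\<in>{m..<n}. ?D i \<omega>) = (\<lambda>\<omega>. \<lambda>u\<in>J'. X u \<omega> - X s \<omega>)"
  proof (intro ext)
    fix \<omega> u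
    have "(\<Sum>k\<in>{m..<idx u}. restrict (\<lambda>i. ?D i \<omega>) {m..<n} k) = X u \<omega> - X s \<omega>" if "u \<in> J'"
    proof -
      have "(\<Sum>k\<in>{m..<idx u}. restrict (\<lambda>i. ?D i \<omega>) {m..<n} k) = (\<Sum>k\<in>{m..<idx u}. ?D k \<omega>)"
        using idxJ'[OF that] by (intro sum.cong) auto
      also have "\<dots> = X (t (idx u)) \<omega> - X (t m) \<omega>"
        using idxJ'[OF that] by (subst increment_sum) auto
      finally show ?thesis using idx[of u] that m by (simp add: S_def)
    qed
    then show "((\<lambda>d. \<lambda>u\<in>J'. \<Sum>k\<in>{m..<idx u}. d k) \<circ> (\<lambda>\<omega>. \<lambda>i\<in>{m..<n}. ?D i \<omega>)) \<omega> u = (\<lambda>u\<in>J'. X u \<omega> - X s \<omega>) u"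
      by (simp add: restrict_def)
  qed
  finally show ?thesis .
qed

text \<open>Both laws are the image, under the same summation map, of a product of increment laws that depend only on
  the lengths of the time intervals.\<close>

lemma distr_finite_future:
  assumes s: "0 \<le> s" and J: "finite J" "J \<subseteq> {0..}"
  shows "distr M (PiM J (\<lambda>_. borel)) (\<lambda>\<omega>. \<lambda>u\<in>J. X (s + u) \<omega> - X s \<omega>) =
    distr M (PiM J (\<lambda>_. borel)) (\<lambda>\<omega>. \<lambda>u\<in>J. X u \<omega> - X 0 \<omega>)"
proof -
  define S where "S = insert 0 (insert 1 J)"
  have "finite S" "S \<noteq> {}" using J by (auto simp: S_def)
  then obtain n t where t: "S = t ` {..n::nat}" "\<And>i j. i < j \<Longrightarrow> j \<le> n \<Longrightarrow> t i < t j"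
    using finite_set_increasing_enumeration by metis
  have S_nonneg: "x \<ge> 0" if "x \<in> S" for x using that s J by (auto simp: S_def)
  have t_nonneg: "t i \<ge> 0" if "i \<le> n" for i using S_nonneg t(1) that by auto
  have t_le: "t i \<le> t j \<longleftrightarrow> i \<le> j" if "i \<le> n" "j \<le> n" for i j
    using t(2)[of i j] t(2)[of j i] that by (metis le_less linorder_not_less order_less_imp_not_less)
  have "0 \<in> t ` {..n}" unfolding t(1)[symmetric] by (simp add: S_def)
  then obtain i0 where i0: "i0 \<le> n" "t i0 = 0" by auto
  have t0: "t 0 = 0"
    using S_nonneg[of "t 0"] t(1) t_le[of 0 i0] i0 by force
  have n: "{..<n} \<noteq> {}"
  proof
    assume "{..<n} = {}"
    then have "n = 0" by auto
    moreover have "1 \<in> S" "0 \<in> S" by (auto simp: S_def)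
    ultimately show False using t(1) by auto
  qed
  have "\<forall>u\<in>S. \<exists>i\<le>n. t i = u" using t(1) by auto
  then obtain idx where idx: "\<And>u. u \<in> S \<Longrightarrow> idx u \<le> n \<and> t (idx u) = u" by metis
  let ?D = "\<lambda>a i \<omega>. X (a + t (Suc i)) \<omega> - X (a + t i) \<omega>"
  let ?P = "PiM {..<n} (\<lambda>_. borel :: real measure)"
  let ?g = "\<lambda>d::nat \<Rightarrow> real. \<lambda>u\<in>J. \<Sum>k\<in>{0..<idx u}. d k"
  have g: "?g \<in> measurable ?P (PiM J (\<lambda>_. borel))"
    using idx by (intro measurable_restrict borel_measurable_sum measurable_component_singleton)
      (force simp: S_def)
  have law: "distr M ?P (\<lambda>\<omega>. \<lambda>i\<in>{..<n}. ?D a i \<omega>) = PiM {..<n} (\<lambda>i. distr M borel (X (t (Suc i) - t i)))"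
    if a: "0 \<le> a" for a
  proof -
    have *: "0 \<le> a + t i" "0 \<le> a + t (Suc i)" "0 \<le> t (Suc i) - t i" if "i < n" for i
      using that a t(2)[of i "Suc i"] t_nonneg[of i] t_nonneg[of "Suc i"] by auto
    have rvD: "?D a i \<in> borel_measurable M" if "i < n" for i
      by (intro borel_measurable_diff measurable_X *[OF that])
    have "indep_vars (\<lambda>_. borel) (?D a) {..<n}"
      using t(2) t0 a by (intro independent_increments) auto
    then have "distr M ?P (\<lambda>\<omega>. \<lambda>i\<in>{..<n}. ?D a i \<omega>) = PiM {..<n} (\<lambda>i. distr M borel (?D a i))"
      using rvD by (subst (asm) indep_vars_iff_distr_eq_PiM'[OF n]) auto
    also have "\<dots> = PiM {..<n} (\<lambda>i. distr M borel (X (t (Suc i) - t i)))"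
    proof (intro PiM_cong refl)
      fix i assume "i \<in> {..<n}"
      then show "distr M borel (?D a i) = distr M borel (X (t (Suc i) - t i))"
        using stationary_increments[of "a + t i" "t (Suc i) - t i"] *[of i] by (simp add: algebra_simps)
    qed
    finally show ?thesis .
  qed
  have rv: "(\<lambda>\<omega>. \<lambda>i\<in>{..<n}. ?D a i \<omega>) \<in> measurable M ?P" if a: "0 \<le> a" for a
    using a t_nonneg by (intro measurable_restrict borel_measurable_diff measurable_X) auto
  have comp: "?g \<circ> (\<lambda>\<omega>. \<lambda>i\<in>{..<n}. ?D a i \<omega>) = (\<lambda>\<omega>. \<lambda>u\<in>J. X (a + u) \<omega> - X a \<omega>)" for a
  proof (intro ext)
    fix \<omega> u
    have "(\<Sum>k\<in>{0..<idx u}. restrict (\<lambda>i. ?D a i \<omega>) {..<n} k) = X (a + u) \<omega> - X a \<omega>" if "u \<in> J"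
    proof -
      have "idx u \<le> n" using idx[of u] that by (simp add: S_def)
      then have "(\<Sum>k\<in>{0..<idx u}. restrict (\<lambda>i. ?D a i \<omega>) {..<n} k) = (\<Sum>k\<in>{0..<idx u}. ?D a k \<omega>)"
        by (intro sum.cong) auto
      also have "\<dots> = X (a + t (idx u)) \<omega> - X (a + t 0) \<omega>"
        using increment_sum[of 0 "idx u" "\<lambda>i. a + t i"] by simp
      finally show ?thesis using idx[of u] that t0 by (simp add: S_def)
    qed
    then show "(?g \<circ> (\<lambda>\<omega>. \<lambda>i\<in>{..<n}. ?D a i \<omega>)) \<omega> u = (\<lambda>u\<in>J. X (a + u) \<omega> - X a \<omega>) u"
      by (simp add: restrict_def)
  qed
  have "distr M (PiM J (\<lambda>_. borel)) (\<lambda>\<omega>. \<lambda>u\<in>J. X (a + u) \<omega> - X a \<omega>) =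
     distr (PiM {..<n} (\<lambda>i. distr M borel (X (t (Suc i) - t i)))) (PiM J (\<lambda>_. borel)) ?g" if a: "0 \<le> a" for a
    unfolding law[OF a, symmetric] by (subst distr_distr[OF g rv[OF a]]) (simp add: comp)
  from this[OF s] this[of 0] show ?thesis by simp
qed

lemma distr_future:
  assumes s: "0 \<le> s"
  shows "distr M path_space (future s) = distr M path_space path"
proof -
  let ?p = "\<lambda>\<omega>. \<lambda>u\<in>{0..}. X u \<omega> - X 0 \<omega>"
  have p: "?p \<in> measurable M path_space"
    by (intro measurable_restrict borel_measurable_diff measurable_X) auto
  have "distr M path_space (future s) = distr M path_space ?p"
  proof (rule measure_eqI_PiM_infinite[where I="{0..}" and M="\<lambda>_. borel"])
    show "finite_measure (distr M path_space (future s))"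
      by (intro prob_space.finite_measure prob_space_distr measurable_future s)
  next
    fix A J assume J: "finite J" "J \<subseteq> {0::real..}" and A: "\<And>i. i \<in> J \<Longrightarrow> A i \<in> sets (borel :: real measure)"
    have S: "Pi\<^sub>E J A \<in> sets (PiM J (\<lambda>_. borel))" using A J by (intro sets_PiM_I_finite) auto
    have E: "prod_emb {0..} (\<lambda>_. borel) J (Pi\<^sub>E J A) \<in> sets path_space"
      using S J by (intro measurable_prod_emb) auto
    have *: "emeasure (distr M path_space f) (prod_emb {0..} (\<lambda>_. borel) J (Pi\<^sub>E J A)) =
      emeasure (distr M (PiM J (\<lambda>_. borel)) g) (Pi\<^sub>E J A)"
      if f: "f \<in> measurable M path_space" and fg: "\<And>\<omega>. g \<omega> = restrict (f \<omega>) J" for f g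
    proof -
      have "(\<lambda>\<omega>. restrict (f \<omega>) J) \<in> measurable M (PiM J (\<lambda>_. borel))"
        by (rule measurable_compose[OF f measurable_restrict_subset]) (use J in auto)
      then have g: "g \<in> measurable M (PiM J (\<lambda>_. borel))"
        by (rule back_subst[of "\<lambda>f. f \<in> measurable M (PiM J (\<lambda>_. borel))"]) (simp add: fg fun_eq_iff)
      have fsp: "f \<omega> \<in> extensional {0..}" if "\<omega> \<in> space M" for \<omega>
        using measurable_space[OF f that] by (simp add: space_PiM PiE_def)
      have "f -` prod_emb {0..} (\<lambda>_. borel) J (Pi\<^sub>E J A) \<inter> space M = g -` Pi\<^sub>E J A \<inter> space M"
        using fsp by (auto simp: prod_emb_def fg PiE_def)
      then show ?thesis using f g E S by (simp add: emeasure_distr)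
    qed
    have "emeasure (distr M path_space (future s)) (prod_emb {0..} (\<lambda>_. borel) J (Pi\<^sub>E J A)) =
      emeasure (distr M (PiM J (\<lambda>_. borel)) (\<lambda>\<omega>. \<lambda>u\<in>J. X (s + u) \<omega> - X s \<omega>)) (Pi\<^sub>E J A)"
      using J by (intro * measurable_future s) (auto simp: future_def fun_eq_iff)
    also have "\<dots> = emeasure (distr M (PiM J (\<lambda>_. borel)) (\<lambda>\<omega>. \<lambda>u\<in>J. X u \<omega> - X 0 \<omega>)) (Pi\<^sub>E J A)"
      using J by (simp add: distr_finite_future s)
    also have "\<dots> = emeasure (distr M path_space ?p) (prod_emb {0..} (\<lambda>_. borel) J (Pi\<^sub>E J A))"
      using J by (intro *[symmetric] p) (auto simp: fun_eq_iff)
    finally show "emeasure (distr M path_space (future s)) (prod_emb {0..} (\<lambda>_. borel) J (Pi\<^sub>E J A)) =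
      emeasure (distr M path_space ?p) (prod_emb {0..} (\<lambda>_. borel) J (Pi\<^sub>E J A))" .
  qed auto
  also have "\<dots> = distr M path_space path"
    using start_at_0 by (intro distr_cong_AE p measurable_path) (auto simp: path_def)
  finally show ?thesis .
qed

text \<open>Finite-dimensional cylinders are a generator stable under intersection, so the finite-dimensional case
  suffices.\<close>

lemma indep_var_past_future:
  assumes s: "0 \<le> s"
  shows "indep_var path_space (\<lambda>\<omega>. \<lambda>u\<in>{0..}. X (min u s) \<omega> - X 0 \<omega>) path_space (future s)"
proof -
  let ?p = "\<lambda>\<omega>. \<lambda>u\<in>{0..}. X (min u s) \<omega> - X 0 \<omega>"
  have p: "?p \<in> measurable M path_space"
    using s by (intro measurable_restrict borel_measurable_diff measurable_X) auto
  note f = measurable_future[OF s]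
  have gen: "sigma_sets (space M) {Y -` A \<inter> space M |A. A \<in> sets path_space} =
     sigma_sets (space M) {Y -` A \<inter> space M |A. A \<in> prod_algebra {0..} (\<lambda>_. borel)}"
    if "Y \<in> measurable M path_space" for Y
  proof -
    have "Y \<in> space M \<rightarrow> (\<Pi>\<^sub>E i\<in>{0::real..}. space (borel :: real measure))"
      using measurable_space[OF that] by (auto simp: space_PiM)
    from sigma_sets_vimage_commute[OF this, of "prod_algebra {0..} (\<lambda>_. borel)"]
    have "{Y -` A \<inter> space M |A. A \<in> sets path_space} =
       sigma_sets (space M) {Y -` A \<inter> space M |A. A \<in> prod_algebra {0..} (\<lambda>_. borel)}"
      unfolding sets_PiM .
    moreover have "{Y -` A \<inter> space M |A. A \<in> prod_algebra {0..} (\<lambda>_. borel)} \<subseteq> Pow (space M)"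
      by auto
    ultimately show ?thesis by (simp add: sigma_sets_sigma_sets_eq)
  qed
  have stable: "Int_stable {Y -` A \<inter> space M |A. A \<in> prod_algebra {0..} (\<lambda>_. borel)}" for Y :: "'a \<Rightarrow> real \<Rightarrow> real"
    unfolding Int_stable_def
  proof safe
    fix A B assume AB: "A \<in> prod_algebra {0::real..} (\<lambda>_. borel :: real measure)" "B \<in> prod_algebra {0::real..} (\<lambda>_. borel :: real measure)"
    have "A \<inter> B \<in> prod_algebra {0::real..} (\<lambda>_. borel :: real measure)"
      using Int_stable_prod_algebra AB unfolding Int_stable_def by blast
    then show "\<exists>C. Y -` A \<inter> space M \<inter> (Y -` B \<inter> space M) = Y -` C \<inter> space M \<and> C \<in> prod_algebra {0::real..} (\<lambda>_. borel :: real measure)"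
      by (intro exI[of _ "A \<inter> B"]) auto
  qed
  have alg_sets: "A \<in> sets path_space" if "A \<in> prod_algebra {0..} (\<lambda>_. borel)" for A
    using that unfolding sets_PiM by (rule sigma_sets.Basic)
  have "indep_set {?p -` A \<inter> space M |A. A \<in> prod_algebra {0..} (\<lambda>_. borel)}
     {future s -` A \<inter> space M |A. A \<in> prod_algebra {0..} (\<lambda>_. borel)}"
  proof (rule indep_setI)
    show "{?p -` A \<inter> space M |A. A \<in> prod_algebra {0..} (\<lambda>_. borel)} \<subseteq> events"
      using measurable_sets[OF p alg_sets] by auto
    show "{future s -` A \<inter> space M |A. A \<in> prod_algebra {0..} (\<lambda>_. borel)} \<subseteq> events"
      using measurable_sets[OF f alg_sets] by auto
    fix a b
    assume "a \<in> {?p -` A \<inter> space M |A. A \<in> prod_algebra {0..} (\<lambda>_. borel)}"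
    then obtain A where A: "a = ?p -` A \<inter> space M" "A \<in> prod_algebra {0..} (\<lambda>_. borel)" by auto
    assume "b \<in> {future s -` A \<inter> space M |A. A \<in> prod_algebra {0..} (\<lambda>_. borel)}"
    then obtain B where B: "b = future s -` B \<inter> space M" "B \<in> prod_algebra {0..} (\<lambda>_. borel)" by auto
    obtain J E where J: "A = prod_emb {0..} (\<lambda>_. borel) J (\<Pi>\<^sub>E j\<in>J. E j)" "finite J" "J \<subseteq> {0..}" "\<And>i. i \<in> J \<Longrightarrow> E i \<in> sets borel"
      using A(2) by (rule prod_algebraE) auto
    obtain K F where K: "B = prod_emb {0..} (\<lambda>_. borel) K (\<Pi>\<^sub>E j\<in>K. F j)" "finite K" "K \<subseteq> {0..}" "\<And>i. i \<in> K \<Longrightarrow> F i \<in> sets borel"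
      using B(2) by (rule prod_algebraE) auto
    let ?J = "(\<lambda>u. min u s) ` J" and ?K = "(\<lambda>u. s + u) ` K"
    have ind: "indep_var (PiM ?J (\<lambda>_. borel)) (\<lambda>\<omega>. \<lambda>u\<in>?J. X u \<omega> - X 0 \<omega>)
     (PiM ?K (\<lambda>_. borel)) (\<lambda>\<omega>. \<lambda>u\<in>?K. X u \<omega> - X s \<omega>)"
      using J K s by (intro indep_var_finite_past_future) auto
    let ?A = "{f \<in> space (PiM ?J (\<lambda>_. borel)). \<forall>u\<in>J. f (min u s) \<in> E u}"
    let ?B = "{f \<in> space (PiM ?K (\<lambda>_. borel)). \<forall>u\<in>K. f (s + u) \<in> F u}"
    have A': "?A \<in> sets (PiM ?J (\<lambda>_. borel))"
    proof (rule sets.sets_Collect_finite_All)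
      fix u assume u: "u \<in> J"
      have "(\<lambda>f. f (min u s)) \<in> measurable (PiM ?J (\<lambda>_. borel)) (borel :: real measure)"
        using u by (intro measurable_component_singleton) auto
      then show "{f \<in> space (PiM ?J (\<lambda>_. borel)). f (min u s) \<in> E u} \<in> sets (PiM ?J (\<lambda>_. borel))"
        using J(4)[OF u] by (auto intro!: measurable_sets_Collect)
    qed fact
    have B': "?B \<in> sets (PiM ?K (\<lambda>_. borel))"
    proof (rule sets.sets_Collect_finite_All)
      fix u assume u: "u \<in> K"
      have "(\<lambda>f. f (s + u)) \<in> measurable (PiM ?K (\<lambda>_. borel)) (borel :: real measure)"
        using u by (intro measurable_component_singleton) auto
      then show "{f \<in> space (PiM ?K (\<lambda>_. borel)). f (s + u) \<in> F u} \<in> sets (PiM ?K (\<lambda>_. borel))"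
        using K(4)[OF u] by (auto intro!: measurable_sets_Collect)
    qed fact
    have a: "a = (\<lambda>\<omega>. \<lambda>u\<in>?J. X u \<omega> - X 0 \<omega>) -` ?A \<inter> space M"
    proof -
      have "0 \<le> u" if "u \<in> J" for u using J(3) that by auto
      then show ?thesis
        unfolding A(1) J(1) by (auto simp: prod_emb_def space_PiM PiE_def Pi_iff extensional_def)
    qed
    have b: "b = (\<lambda>\<omega>. \<lambda>u\<in>?K. X u \<omega> - X s \<omega>) -` ?B \<inter> space M"
    proof -
      have "0 \<le> u" if "u \<in> K" for u using K(3) that by auto
      then show ?thesis
        unfolding B(1) K(1) future_def by (auto simp: prod_emb_def space_PiM PiE_def Pi_iff extensional_def)
    qed
    have "a \<inter> b = (\<lambda>\<omega>. ((\<lambda>u\<in>?J. X u \<omega> - X 0 \<omega>), (\<lambda>u\<in>?K. X u \<omega> - X s \<omega>))) -` (?A \<times> ?B) \<inter> space M"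
      unfolding a b by auto
    then show "prob (a \<inter> b) = prob a * prob b"
      using indep_varD[OF ind A' B'] a b by simp
  qed
  from indep_set_sigma_sets[OF this stable stable] show ?thesis
    unfolding indep_var_eq gen[OF p] gen[OF f] using p f by simp
qed

text \<open>The Markov property at a fixed time: given the past, the future is a fresh copy of the path.\<close>

lemma markov_past_future:
  assumes s: "0 \<le> s" and F: "case_prod F \<in> borel_measurable (path_space \<Otimes>\<^sub>M path_space)"
  shows "(\<integral>\<^sup>+\<omega>. F (past s \<omega>) (future s \<omega>) \<partial>M) = (\<integral>\<^sup>+\<omega>. \<integral>\<^sup>+\<omega>'. (F (past s \<omega>) (path \<omega>') :: ennreal) \<partial>M \<partial>M)"
proof -
  let ?p = "\<lambda>\<omega>. \<lambda>u\<in>{0..}. X (min u s) \<omega> - X 0 \<omega>"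
  have p: "?p \<in> measurable M path_space"
    using s by (intro measurable_restrict borel_measurable_diff measurable_X) auto
  note f = measurable_future[OF s]
  interpret P: prob_space "distr M path_space path" by (rule prob_space_distr) measurable
  have ae: "AE \<omega> in M. past s \<omega> = ?p \<omega>"
    using start_at_0 by eventually_elim (auto simp: past_def)
  have "(\<integral>\<^sup>+\<omega>. F (past s \<omega>) (future s \<omega>) \<partial>M) = (\<integral>\<^sup>+\<omega>. F (?p \<omega>) (future s \<omega>) \<partial>M)"
    using ae by (intro nn_integral_cong_AE) (auto elim: eventually_mono)
  also have "\<dots> = (\<integral>\<^sup>+z. case_prod F z \<partial>distr M (path_space \<Otimes>\<^sub>M path_space) (\<lambda>\<omega>. (?p \<omega>, future s \<omega>)))"
    using p f F by (subst nn_integral_distr) auto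
  also have "distr M (path_space \<Otimes>\<^sub>M path_space) (\<lambda>\<omega>. (?p \<omega>, future s \<omega>)) = distr M path_space ?p \<Otimes>\<^sub>M distr M path_space path"
    using indep_var_past_future[OF s] unfolding indep_var_distribution_eq distr_future[OF s] by simp
  also have "(\<integral>\<^sup>+z. case_prod F z \<partial>(distr M path_space ?p \<Otimes>\<^sub>M distr M path_space path)) =
     (\<integral>\<^sup>+v. \<integral>\<^sup>+w. F v w \<partial>distr M path_space path \<partial>distr M path_space ?p)"
    using F by (subst P.nn_integral_fst[symmetric]) (auto simp: measurable_cong_sets[OF sets_pair_measure_cong[OF sets_distr sets_distr] refl])
  also have "\<dots> = (\<integral>\<^sup>+v. \<integral>\<^sup>+\<omega>'. F v (path \<omega>') \<partial>M \<partial>distr M path_space ?p)"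
    using F by (intro nn_integral_cong nn_integral_distr) auto
  also have "\<dots> = (\<integral>\<^sup>+\<omega>. \<integral>\<^sup>+\<omega>'. F (?p \<omega>) (path \<omega>') \<partial>M \<partial>M)"
  proof -
    have "(\<lambda>(v, \<omega>'). F v (path \<omega>')) \<in> borel_measurable (path_space \<Otimes>\<^sub>M M)"
      using F by measurable
    from borel_measurable_nn_integral[OF this]
    have "(\<lambda>v. \<integral>\<^sup>+\<omega>'. F v (path \<omega>') \<partial>M) \<in> borel_measurable path_space"
      by simp
    then show ?thesis by (simp add: nn_integral_distr[OF p])
  qed
  also have "\<dots> = (\<integral>\<^sup>+\<omega>. \<integral>\<^sup>+\<omega>'. F (past s \<omega>) (path \<omega>') \<partial>M \<partial>M)"
    using ae by (intro nn_integral_cong_AE) (auto elim: eventually_mono)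
  finally show ?thesis .
qed

end

section \<open>Potential measures and the resolvent equation\<close>

text \<open>The value at \<open>t\<close> of a right-continuous path, read off from the dyadic times just after \<open>t\<close>. Unlike
  evaluation, this is jointly measurable in time and path on the product space; it agrees with evaluation on the
  paths of \<open>X\<close>.\<close>

definition path_value :: "real \<Rightarrow> (real \<Rightarrow> real) \<Rightarrow> real" where
  "path_value t w = lim (\<lambda>n. w (real (nat \<lfloor>2 ^ n * t\<rfloor> + 1) / 2 ^ n))"

lemma measurable_path_value [measurable]:
  "(\<lambda>z. path_value (fst z) (snd z)) \<in> borel_measurable (borel \<Otimes>\<^sub>M path_space)"
  unfolding path_value_def
proof (rule borel_measurable_lim_metric)
  fix n
  show "(\<lambda>z :: real \<times> (real \<Rightarrow> real). snd z (real (nat \<lfloor>2 ^ n * fst z\<rfloor> + 1) / 2 ^ n)) \<in> borel_measurable (borel \<Otimes>\<^sub>M path_space)"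
  proof (rule measurable_compose_countable[where f="\<lambda>i z :: real \<times> (real \<Rightarrow> real). snd z (real (i + 1) / 2 ^ n)" and g="\<lambda>z :: real \<times> (real \<Rightarrow> real). nat \<lfloor>2 ^ n * fst z\<rfloor>"])
    fix i :: nat
    show "(\<lambda>z. snd z (real (i + 1) / 2 ^ n)) \<in> borel_measurable (borel \<Otimes>\<^sub>M path_space)"
      by (rule measurable_compose[OF measurable_snd measurable_component_singleton]) simp
  qed measurable
qed

lemma measurable_path_value_compose [measurable (raw)]:
  assumes [measurable]: "f \<in> borel_measurable N" "g \<in> measurable N path_space"
  shows "(\<lambda>z. path_value (f z) (g z)) \<in> borel_measurable N"
  using measurable_compose[OF _ measurable_path_value, of "\<lambda>z. (f z, g z)" N] by simp

lemma right_limit_along_dyadics: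
  fixes w :: "real \<Rightarrow> 'b :: topological_space"
  assumes t: "0 \<le> t" and w: "(w \<longlongrightarrow> l) (at_right t)"
  shows "(\<lambda>n. w (real (nat \<lfloor>2 ^ n * t\<rfloor> + 1) / 2 ^ n)) \<longlonglongrightarrow> l"
proof -
  define a where "a n = real (nat \<lfloor>2 ^ n * t\<rfloor> + 1) / 2 ^ n" for n
  have bounds: "t < a n" "a n \<le> t + 1 / 2 ^ n" for n
  proof -
    have nn: "real (nat \<lfloor>2 ^ n * t\<rfloor>) = of_int \<lfloor>2 ^ n * t\<rfloor>" using t by simp
    have "2 ^ n * t < real (nat \<lfloor>2 ^ n * t\<rfloor> + 1)" "real (nat \<lfloor>2 ^ n * t\<rfloor> + 1) \<le> 2 ^ n * t + 1"
      using nn by (simp_all del: of_nat_nat) linarith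
    then show "t < a n" "a n \<le> t + 1 / 2 ^ n"
      unfolding a_def by (simp_all add: field_simps)
  qed
  have "(\<lambda>n. 1 / 2 ^ n :: real) \<longlonglongrightarrow> 0"
    using LIMSEQ_power_zero[of "1/2::real"] by (simp add: power_divide)
  then have "(\<lambda>n. t + 1 / 2 ^ n) \<longlonglongrightarrow> t" by (auto intro: tendsto_eq_intros)
  then have "a \<longlonglongrightarrow> t"
    by (rule tendsto_sandwich[rotated 3]) (auto intro!: always_eventually less_imp_le bounds)
  then have "filterlim a (at_right t) sequentially"
    using bounds(1) by (auto simp: filterlim_at less_imp_neq[THEN not_sym])
  from filterlim_compose[OF w this] show ?thesis by (simp add: a_def)
qed

lemma path_value_right_continuous:
  assumes "0 \<le> t" and "(w \<longlongrightarrow> l) (at_right t)"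
  shows "path_value t w = l"
  unfolding path_value_def by (rule limI[OF right_limit_along_dyadics[OF assms]])

lemma nn_integral_exp_Ici:
  "(\<integral>\<^sup>+t. ennreal (exp (- a * t)) * indicator {0..} t \<partial>lborel) = (if a > 0 then ennreal (1 / a) else \<infinity>)"
proof (cases "a > 0")
  case True
  interpret prob_space "density lborel (exponential_density a)"
    by (rule prob_space_exponential_density[OF True])
  have "(\<integral>\<^sup>+t. ennreal (exp (- a * t)) * indicator {0..} t \<partial>lborel) =
    (\<integral>\<^sup>+t. ennreal (1 / a) * ennreal (exponential_density a t) \<partial>lborel)"
    using True by (intro nn_integral_cong)
      (auto simp: exponential_density_def ennreal_mult'[symmetric] mult.commute split: split_indicator)
  also have "\<dots> = ennreal (1 / a) * (\<integral>\<^sup>+t. ennreal (exponential_density a t) \<partial>lborel)"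
    by (rule nn_integral_cmult) simp
  also have "(\<integral>\<^sup>+t. ennreal (exponential_density a t) \<partial>lborel) = 1"
    using emeasure_space_1 by (simp add: emeasure_density)
  finally show ?thesis using True by simp
next
  case False
  have "\<infinity> = emeasure lborel {0::real..}"
  proof -
    have "ennreal (real n) \<le> emeasure lborel {0::real..}" for n
      using emeasure_mono[of "{0..real n}" "{0::real..}" lborel] by simp
    then have "\<not> emeasure lborel {0::real..} < of_nat n" for n
      by (simp add: ennreal_of_nat_eq_real_of_nat not_less)
    then have "\<not> emeasure lborel {0::real..} < top"
      using ennreal_Ex_less_of_nat by blast
    then show ?thesis by (simp add: not_less top_unique)
  qed
  also have "\<dots> = (\<integral>\<^sup>+t. indicator {0::real..} t \<partial>lborel)" by simp
  also have "\<dots> \<le> (\<integral>\<^sup>+t. ennreal (exp (- a * t)) * indicator {0..} t \<partial>lborel)"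
    using False by (intro nn_integral_mono) (auto split: split_indicator simp: mult_nonpos_nonneg)
  finally show ?thesis using False by (simp add: top_unique)
qed

context spectrally_negative_levy
begin

lemma path_value_path:
  assumes "\<omega> \<in> space M" "0 \<le> t"
  shows "path_value t (path \<omega>) = X t \<omega>"
proof (rule path_value_right_continuous[OF assms(2)])
  have "eventually (\<lambda>s. X s \<omega> = path \<omega> s) (at_right t)"
    using assms(2) by (auto simp: path_def eventually_at_filter)
  from tendsto_cong[OF this] show "(path \<omega> \<longlongrightarrow> X t \<omega>) (at_right t)"
    using right_continuous_paths[OF assms] by simp
qed

lemma path_value_future:
  assumes "\<omega> \<in> space M" "0 \<le> s" "0 \<le> t"
  shows "path_value t (future s \<omega>) = X (s + t) \<omega> - X s \<omega>"
proof (rule path_value_right_continuous[OF assms(3)])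
  have "((\<lambda>u. X u \<omega>) \<longlongrightarrow> X (s + t) \<omega>) (at_right (s + t))"
    using assms by (intro right_continuous_paths) auto
  moreover have "filterlim (\<lambda>u. s + u) (at_right (s + t)) (at_right t)"
    unfolding filterlim_at by (auto simp: eventually_at_filter intro!: tendsto_intros)
  ultimately have "((\<lambda>u. X (s + u) \<omega>) \<longlongrightarrow> X (s + t) \<omega>) (at_right t)"
    by (rule filterlim_compose)
  then have "((\<lambda>u. X (s + u) \<omega> - X s \<omega>) \<longlongrightarrow> X (s + t) \<omega> - X s \<omega>) (at_right t)"
    by (rule tendsto_diff) (rule tendsto_const)
  moreover have "eventually (\<lambda>u. X (s + u) \<omega> - X s \<omega> = future s \<omega> u) (at_right t)"
    using assms(3) by (auto simp: future_def eventually_at_filter)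
  ultimately show "(future s \<omega> \<longlongrightarrow> X (s + t) \<omega> - X s \<omega>) (at_right t)"
    by (rule Lim_transform_eventually)
qed

text \<open>The \<open>\<mu>\<close>-potential measure \<open>\<integral> e\<^sup>-\<^sup>\<mu>\<^sup>t P(X\<^sub>t \<in> dz) dt\<close>.\<close>

definition potential :: "real \<Rightarrow> real measure" where
  "potential \<mu> = distr (density lborel (\<lambda>t. ennreal (exp (- \<mu> * t)) * indicator {0..} t) \<Otimes>\<^sub>M M) borel
     (\<lambda>z. path_value (fst z) (path (snd z)))"

lemma sets_potential [simp, measurable_cong]: "sets (potential \<mu>) = sets borel"
  by (simp add: potential_def)

lemma space_potential [simp]: "space (potential \<mu>) = UNIV"
  by (simp add: potential_def)

definition mean :: "(real \<Rightarrow> ennreal) \<Rightarrow> real \<Rightarrow> ennreal" where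
  "mean g t = (\<integral>\<^sup>+\<omega>. g (path_value t (path \<omega>)) \<partial>M)"

lemma measurable_mean [measurable]:
  assumes [measurable]: "g \<in> borel_measurable borel"
  shows "mean g \<in> borel_measurable borel"
  unfolding mean_def by measurable

lemma mean_eq: "0 \<le> t \<Longrightarrow> mean g t = (\<integral>\<^sup>+\<omega>. g (X t \<omega>) \<partial>M)"
  unfolding mean_def by (intro nn_integral_cong) (simp add: path_value_path)

lemma nn_integral_potential:
  assumes [measurable]: "g \<in> borel_measurable borel"
  shows "(\<integral>\<^sup>+z. g z \<partial>potential \<mu>) = (\<integral>\<^sup>+t. ennreal (exp (- \<mu> * t)) * indicator {0..} t * mean g t \<partial>lborel)"
proof -
  have "(\<integral>\<^sup>+z. g z \<partial>potential \<mu>) = (\<integral>\<^sup>+z. g (path_value (fst z) (path (snd z)))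
      \<partial>(density lborel (\<lambda>t. ennreal (exp (- \<mu> * t)) * indicator {0..} t) \<Otimes>\<^sub>M M))"
    unfolding potential_def by (subst nn_integral_distr) auto
  also have "\<dots> = (\<integral>\<^sup>+t. mean g t \<partial>density lborel (\<lambda>t. ennreal (exp (- \<mu> * t)) * indicator {0..} t))"
    unfolding mean_def by (subst nn_integral_fst[symmetric]) auto
  also have "\<dots> = (\<integral>\<^sup>+t. ennreal (exp (- \<mu> * t)) * indicator {0..} t * mean g t \<partial>lborel)"
    by (subst nn_integral_density) auto
  finally show ?thesis .
qed

lemma emeasure_potential_UNIV: "\<mu> > 0 \<Longrightarrow> emeasure (potential \<mu>) UNIV = ennreal (1 / \<mu>)"
  using nn_integral_potential[of "\<lambda>_. 1" \<mu>] nn_integral_exp_Ici[of \<mu>]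
  by (simp add: mean_def emeasure_space_1)

lemma finite_measure_potential: "\<mu> > 0 \<Longrightarrow> finite_measure (potential \<mu>)"
  by (intro finite_measureI) (simp add: emeasure_potential_UNIV)

lemma semigroup:
  assumes [measurable]: "g \<in> borel_measurable borel" and s: "0 \<le> s" and t: "0 \<le> t"
  shows "mean g (s + t) = (\<integral>\<^sup>+\<omega>. mean (\<lambda>y. g (X s \<omega> + y)) t \<partial>M)"
proof -
  let ?F = "\<lambda>v w :: real \<Rightarrow> real. g (v s + w t)"
  have F: "case_prod ?F \<in> borel_measurable (path_space \<Otimes>\<^sub>M path_space)"
  proof -
    have [measurable]: "(\<lambda>z. fst z s) \<in> borel_measurable (path_space \<Otimes>\<^sub>M path_space)"
      "(\<lambda>z. snd z t) \<in> borel_measurable (path_space \<Otimes>\<^sub>M path_space)"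
      using s t by (auto intro!: measurable_compose[OF measurable_fst measurable_component_singleton]
           measurable_compose[OF measurable_snd measurable_component_singleton])
    show ?thesis by (simp add: case_prod_beta)
  qed
  from markov_past_future[OF s F] have "(\<integral>\<^sup>+\<omega>. g (X (s + t) \<omega>) \<partial>M) = (\<integral>\<^sup>+\<omega>. \<integral>\<^sup>+\<omega>'. g (X s \<omega> + X t \<omega>') \<partial>M \<partial>M)"
    using s t by (simp add: past_def future_def path_def)
  then show ?thesis using s t by (simp add: mean_eq)
qed

text \<open>The identity \<open>U\<^sub>\<mu> = U\<^sub>\<mu>\<^sub>' + (\<mu>' - \<mu>) U\<^sub>\<mu>\<^sub>' * U\<^sub>\<mu>\<close>. By the semigroup property the convolution integrates
  the mean of \<open>g(X\<^sub>v)\<close> against \<open>\<integral> e\<^bsup>-\<mu>t - \<mu>'(v - t)\<^esup> dt\<close> over \<open>0 \<le> t \<le> v\<close>, which is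
  \<open>(e\<^sup>-\<^sup>\<mu>\<^sup>v - e\<^bsup>-\<mu>'v\<^esup>) / (\<mu>' - \<mu>)\<close>.\<close>

lemma resolvent_equation:
  assumes [measurable]: "g \<in> borel_measurable borel" and \<mu>: "0 < \<mu>" "\<mu> < \<mu>'"
  shows "(\<integral>\<^sup>+z. g z \<partial>potential \<mu>) = (\<integral>\<^sup>+z. g z \<partial>potential \<mu>') +
     ennreal (\<mu>' - \<mu>) * (\<integral>\<^sup>+z. \<integral>\<^sup>+w. g (z + w) \<partial>potential \<mu>' \<partial>potential \<mu>)"
proof -
  let ?UU = "\<integral>\<^sup>+z. \<integral>\<^sup>+w. g (z + w) \<partial>potential \<mu>' \<partial>potential \<mu>"
  let ?I = "\<lambda>v. \<integral>\<^sup>+t. ennreal (exp ((\<mu>' - \<mu>) * t)) * indicator {0..v} t \<partial>lborel"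
  interpret LM: pair_sigma_finite lborel M ..
  let ?e = "\<lambda>\<mu> t. ennreal (exp (- \<mu> * t)) * indicator {0::real..} t"
  have inner: "mean (\<lambda>z. \<integral>\<^sup>+w. g (z + w) \<partial>potential \<mu>') t =
     (\<integral>\<^sup>+v. ennreal (exp (- \<mu>' * (v - t))) * indicator {t..} v * mean g v \<partial>lborel)" if t: "0 \<le> t" for t
  proof -
    have "mean (\<lambda>z. \<integral>\<^sup>+w. g (z + w) \<partial>potential \<mu>') t =
      (\<integral>\<^sup>+\<omega>. (\<integral>\<^sup>+s. ?e \<mu>' s * mean (\<lambda>w. g (path_value t (path \<omega>) + w)) s \<partial>lborel) \<partial>M)"
      unfolding mean_def[of _ t] by (subst nn_integral_potential) auto
    also have "\<dots> = (\<integral>\<^sup>+s. (\<integral>\<^sup>+\<omega>. ?e \<mu>' s * mean (\<lambda>w. g (path_value t (path \<omega>) + w)) s \<partial>M) \<partial>lborel)"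
    proof (rule LM.Fubini')
      show "(\<lambda>(s, \<omega>). ?e \<mu>' s * mean (\<lambda>w. g (path_value t (path \<omega>) + w)) s) \<in> borel_measurable (lborel \<Otimes>\<^sub>M M)"
        unfolding mean_def by measurable
    qed
    also have "\<dots> = (\<integral>\<^sup>+s. ?e \<mu>' s * (\<integral>\<^sup>+\<omega>. mean (\<lambda>w. g (path_value t (path \<omega>) + w)) s \<partial>M) \<partial>lborel)"
      unfolding mean_def by (intro nn_integral_cong nn_integral_cmult) measurable
    also have "\<dots> = (\<integral>\<^sup>+s. ?e \<mu>' s * mean g (t + s) \<partial>lborel)"
    proof (intro nn_integral_cong)
      fix s :: real
      show "?e \<mu>' s * (\<integral>\<^sup>+\<omega>. mean (\<lambda>w. g (path_value t (path \<omega>) + w)) s \<partial>M) = ?e \<mu>' s * mean g (t + s)"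
      proof (cases "0 \<le> s")
        case True
        have "(\<integral>\<^sup>+\<omega>. mean (\<lambda>w. g (path_value t (path \<omega>) + w)) s \<partial>M) = (\<integral>\<^sup>+\<omega>. mean (\<lambda>w. g (X t \<omega> + w)) s \<partial>M)"
          using t by (intro nn_integral_cong) (simp add: path_value_path)
        then show ?thesis using semigroup[of g t s] t True by simp
      qed simp
    qed
    also have "\<dots> = (\<integral>\<^sup>+v. ?e \<mu>' (v - t) * mean g v \<partial>lborel)"
      using nn_integral_real_affine[of "\<lambda>v. ?e \<mu>' (v - t) * mean g v" 1 t] by simp
    also have "\<dots> = (\<integral>\<^sup>+v. ennreal (exp (- \<mu>' * (v - t))) * indicator {t..} v * mean g v \<partial>lborel)"
      by (intro nn_integral_cong) (auto split: split_indicator)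
    finally show ?thesis .
  qed
  have exp_int: "?I v =
      ennreal ((exp ((\<mu>' - \<mu>) * v) - 1) / (\<mu>' - \<mu>))" if v: "0 \<le> v" for v
  proof -
    have "?I v =
      ennreal (exp ((\<mu>' - \<mu>) * v) / (\<mu>' - \<mu>) - exp ((\<mu>' - \<mu>) * 0) / (\<mu>' - \<mu>))"
      using \<mu> v by (intro nn_integral_FTC_Icc[where F="\<lambda>t. exp ((\<mu>' - \<mu>) * t) / (\<mu>' - \<mu>)"])
        (auto intro!: derivative_eq_intros)
    then show ?thesis by (simp add: diff_divide_distrib)
  qed
  have [measurable]: "(\<lambda>z. \<integral>\<^sup>+w. g (z + w) \<partial>potential \<mu>') \<in> borel_measurable borel"
  proof -
    interpret finite_measure "potential \<mu>'"
      using \<mu> by (intro finite_measure_potential) auto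
    show ?thesis by measurable
  qed
  have "?UU =
     (\<integral>\<^sup>+t. ?e \<mu> t * mean (\<lambda>z. \<integral>\<^sup>+w. g (z + w) \<partial>potential \<mu>') t \<partial>lborel)"
    by (rule nn_integral_potential) simp
  also have "\<dots> = (\<integral>\<^sup>+t. (\<integral>\<^sup>+v. ?e \<mu> t * (ennreal (exp (- \<mu>' * (v - t))) * indicator {t..} v * mean g v) \<partial>lborel) \<partial>lborel)"
  proof (intro nn_integral_cong)
    fix t :: real
    show "?e \<mu> t * mean (\<lambda>z. \<integral>\<^sup>+w. g (z + w) \<partial>potential \<mu>') t =
      (\<integral>\<^sup>+v. ?e \<mu> t * (ennreal (exp (- \<mu>' * (v - t))) * indicator {t..} v * mean g v) \<partial>lborel)"
      by (cases "0 \<le> t") (simp_all add: inner nn_integral_cmult)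
  qed
  also have "\<dots> = (\<integral>\<^sup>+v. (\<integral>\<^sup>+t. ?e \<mu> t * (ennreal (exp (- \<mu>' * (v - t))) * indicator {..v} t * mean g v) \<partial>lborel) \<partial>lborel)"
  proof -
    have *: "indicator {t..} v = (if t \<le> v then 1 else 0 :: ennreal)"
      "indicator {..v} t = (if t \<le> v then 1 else 0 :: ennreal)" for t v :: real
      by (auto split: split_indicator)
    show ?thesis unfolding * by (rule lborel_pair.Fubini') measurable
  qed
  also have "\<dots> = (\<integral>\<^sup>+v. ennreal (exp (- \<mu>' * v)) * indicator {0..} v * mean g v *
       ?I v \<partial>lborel)"
  proof (intro nn_integral_cong)
    fix v :: real
    have "(\<integral>\<^sup>+t. ?e \<mu> t * (ennreal (exp (- \<mu>' * (v - t))) * indicator {..v} t * mean g v) \<partial>lborel) =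
       (\<integral>\<^sup>+t. ennreal (exp (- \<mu>' * v)) * indicator {0..} v * mean g v * (ennreal (exp ((\<mu>' - \<mu>) * t)) * indicator {0..v} t) \<partial>lborel)"
    proof (intro nn_integral_cong)
      fix t :: real
      have "ennreal (exp (- \<mu> * t)) * ennreal (exp (- \<mu>' * (v - t))) = ennreal (exp (- \<mu>' * v)) * ennreal (exp ((\<mu>' - \<mu>) * t))"
        by (simp add: ennreal_mult'[symmetric] exp_add[symmetric] algebra_simps)
      then show "?e \<mu> t * (ennreal (exp (- \<mu>' * (v - t))) * indicator {..v} t * mean g v) =
        ennreal (exp (- \<mu>' * v)) * indicator {0..} v * mean g v * (ennreal (exp ((\<mu>' - \<mu>) * t)) * indicator {0..v} t)"
        by (auto split: split_indicator simp: mult_ac)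
    qed
    also have "\<dots> = ennreal (exp (- \<mu>' * v)) * indicator {0..} v * mean g v * ?I v"
      by (rule nn_integral_cmult) simp
    finally show "(\<integral>\<^sup>+t. ?e \<mu> t * (ennreal (exp (- \<mu>' * (v - t))) * indicator {..v} t * mean g v) \<partial>lborel) = \<dots>" .
  qed
  finally have dbl: "?UU =
    (\<integral>\<^sup>+v. ennreal (exp (- \<mu>' * v)) * indicator {0..} v * mean g v *
       ?I v \<partial>lborel)" .
  have [measurable]: "(\<lambda>v. \<integral>\<^sup>+t. ennreal (exp ((\<mu>' - \<mu>) * t)) * indicator {0..v} t \<partial>lborel) \<in> borel_measurable borel"
  proof -
    have *: "indicator {0..v} t = (if 0 \<le> t \<and> t \<le> v then 1 else 0 :: ennreal)" for t v :: real
      by (auto split: split_indicator)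
    show ?thesis unfolding * by measurable
  qed
  have alg: "a * m + d * (a * m * k) = (a + d * a * k) * m" for a m d k :: ennreal
    by (simp add: distrib_right distrib_left mult_ac)
  have "(\<integral>\<^sup>+z. g z \<partial>potential \<mu>') + ennreal (\<mu>' - \<mu>) * ?UU =
    (\<integral>\<^sup>+v. ?e \<mu>' v * mean g v + ennreal (\<mu>' - \<mu>) * (ennreal (exp (- \<mu>' * v)) * indicator {0..} v * mean g v *
       ?I v) \<partial>lborel)"
  proof -
    have "ennreal (\<mu>' - \<mu>) * ?UU =
      (\<integral>\<^sup>+v. ennreal (\<mu>' - \<mu>) * (ennreal (exp (- \<mu>' * v)) * indicator {0..} v * mean g v *
       ?I v) \<partial>lborel)"
      unfolding dbl by (rule nn_integral_cmult[symmetric]) measurable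
    then show ?thesis
      unfolding nn_integral_potential[OF assms(1), of \<mu>']
      by (simp only:) (rule nn_integral_add[symmetric], measurable)
  qed
  also have "\<dots> = (\<integral>\<^sup>+v. ?e \<mu> v * mean g v \<partial>lborel)"
  proof (intro nn_integral_cong)
    fix v :: real
    show "?e \<mu>' v * mean g v + ennreal (\<mu>' - \<mu>) * (ennreal (exp (- \<mu>' * v)) * indicator {0..} v * mean g v *
       ?I v) = ?e \<mu> v * mean g v"
    proof (cases "0 \<le> v")
      case True
      let ?k = "(exp ((\<mu>' - \<mu>) * v) - 1) / (\<mu>' - \<mu>)"
      have k: "0 \<le> ?k" using \<mu> True by simp
      have "ennreal (exp (- \<mu>' * v)) + ennreal (\<mu>' - \<mu>) * ennreal (exp (- \<mu>' * v)) * ennreal ?k =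
          ennreal (exp (- \<mu>' * v) + (\<mu>' - \<mu>) * exp (- \<mu>' * v) * ?k)"
        using \<mu> k by (subst ennreal_plus) (auto simp: ennreal_mult simp del: times_divide_eq_right)
      also have "exp (- \<mu>' * v) + (\<mu>' - \<mu>) * exp (- \<mu>' * v) * ?k = exp (- \<mu>' * v) * exp ((\<mu>' - \<mu>) * v)"
        using \<mu> by (simp add: field_simps)
      also have "\<dots> = exp (- \<mu> * v)" by (simp add: exp_add[symmetric] algebra_simps)
      finally have "ennreal (exp (- \<mu>' * v)) * mean g v + ennreal (\<mu>' - \<mu>) * (ennreal (exp (- \<mu>' * v)) * mean g v * ennreal ?k) =
         ennreal (exp (- \<mu> * v)) * mean g v"
        unfolding alg by simp
      then show ?thesis using True exp_int[OF True] by simp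
    qed simp
  qed
  finally show ?thesis by (simp add: nn_integral_potential)
qed

end

section \<open>First passage over a level\<close>

lemma suminf_first_index:
  fixes f :: "nat \<Rightarrow> ennreal"
  shows "(\<Sum>k. if P k \<and> (\<forall>j<k. \<not> P j) then f k else 0) = (if \<exists>k. P k then f (LEAST k. P k) else 0)"
proof (cases "\<exists>k. P k")
  case True
  let ?k = "LEAST k. P k"
  have "P k \<and> (\<forall>j<k. \<not> P j) \<longleftrightarrow> k = ?k" for k
    using True by (metis LeastI_ex Least_le linorder_neqE_nat not_less_Least order_le_less_trans less_irrefl)
  then have "(\<Sum>k. if P k \<and> (\<forall>j<k. \<not> P j) then f k else 0) = (\<Sum>k. if k = ?k then f k else 0)"
    by simp
  also have "\<dots> = f ?k"
    using sums_single[of ?k f] by (simp add: sums_unique[symmetric])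
  finally show ?thesis using True by simp
qed simp

context spectrally_negative_levy
begin

text \<open>First passage over the level \<open>y\<close> observed on the dyadic grid of mesh \<open>2\<^bsup>-n\<^esup>\<close>. On a grid the strong Markov
  property is the Markov property at each of countably many times; the passage time itself enters only as the
  limit of the discount factors.\<close>

definition crossing_time :: "nat \<Rightarrow> real \<Rightarrow> 'a \<Rightarrow> real" where
  "crossing_time n y \<omega> = real (LEAST k. X (real k / 2 ^ n) \<omega> > y) / 2 ^ n"

definition crosses :: "nat \<Rightarrow> real \<Rightarrow> 'a \<Rightarrow> bool" where
  "crosses n y \<omega> \<longleftrightarrow> (\<exists>k::nat. X (real k / 2 ^ n) \<omega> > y)"

definition crossing_discount :: "real \<Rightarrow> nat \<Rightarrow> real \<Rightarrow> 'a \<Rightarrow> real" where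
  "crossing_discount \<mu> n y \<omega> = (if crosses n y \<omega> then exp (- \<mu> * crossing_time n y \<omega>) else 0)"

text \<open>The discount factor \<open>e\<^bsup>-\<mu>\<tau>\<^esup>\<close> at the first passage time \<open>\<tau>\<close> over \<open>y\<close>, with value \<open>0\<close> if the level is never
  passed.\<close>

definition passage_discount :: "real \<Rightarrow> real \<Rightarrow> 'a \<Rightarrow> real" where
  "passage_discount \<mu> y \<omega> = lim (\<lambda>n. crossing_discount \<mu> n y \<omega>)"

lemma measurable_X_grid [measurable]: "(\<lambda>\<omega>. X (real k / 2 ^ n) \<omega>) \<in> borel_measurable M"
  by (rule measurable_X) simp

lemma measurable_crosses [measurable]: "Measurable.pred M (crosses n y)"
  unfolding crosses_def[abs_def] by measurable

lemma measurable_crossing_time [measurable]: "crossing_time n y \<in> borel_measurable M"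
  unfolding crossing_time_def[abs_def] by measurable

lemma measurable_X_crossing [measurable]: "(\<lambda>\<omega>. X (crossing_time n y \<omega>) \<omega>) \<in> borel_measurable M"
  unfolding crossing_time_def
  by (rule measurable_compose_countable[where f="\<lambda>k \<omega>. X (real k / 2 ^ n) \<omega>"]) measurable

lemma measurable_crossing_discount [measurable]: "crossing_discount \<mu> n y \<in> borel_measurable M"
  unfolding crossing_discount_def[abs_def] by measurable

lemma measurable_passage_discount [measurable]: "passage_discount \<mu> y \<in> borel_measurable M"
  unfolding passage_discount_def[abs_def] by measurable

lemma crossing_time_nonneg: "0 \<le> crossing_time n y \<omega>"
  by (simp add: crossing_time_def)

lemma crossing_time_le: "X (real k / 2 ^ n) \<omega> > y \<Longrightarrow> crossing_time n y \<omega> \<le> real k / 2 ^ n"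
  unfolding crossing_time_def by (intro divide_right_mono) (auto intro: Least_le)

lemma X_crossing_time: "crosses n y \<omega> \<Longrightarrow> X (crossing_time n y \<omega>) \<omega> > y"
  unfolding crosses_def crossing_time_def by (rule LeastI_ex)

lemma grid_refine:
  assumes "crosses n y \<omega>"
  shows "crosses (Suc n) y \<omega> \<and> crossing_time (Suc n) y \<omega> \<le> crossing_time n y \<omega>"
proof -
  let ?k = "LEAST k. X (real k / 2 ^ n) \<omega> > y"
  have "X (real (2 * ?k) / 2 ^ Suc n) \<omega> > y"
    using X_crossing_time[OF assms] by (simp add: crossing_time_def)
  then show ?thesis using crossing_time_le[of y "2 * ?k" "Suc n" \<omega>]
    by (auto simp: crosses_def crossing_time_def intro: exI[of _ "2 * ?k"])
qed

text \<open>Without positive jumps a path above \<open>y\<close> at time \<open>t\<close> is above \<open>y\<close> shortly before \<open>t\<close>, where fine grids have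
  points.\<close>

lemma crossing_before:
  assumes \<omega>: "\<omega> \<in> space M" "X 0 \<omega> = 0" and y: "0 \<le> y" and t: "0 \<le> t" "X t \<omega> > y"
  shows "\<forall>\<^sub>F n in sequentially. \<exists>k. real k / 2 ^ n < t \<and> X (real k / 2 ^ n) \<omega> > y"
proof -
  have t0: "0 < t" using assms by (cases "t = 0") auto
  obtain l where l: "((\<lambda>s. X s \<omega>) \<longlongrightarrow> l) (at_left t)" "X t \<omega> \<le> l"
    using no_positive_jumps[OF \<omega>(1) t0] by blast
  then have "\<forall>\<^sub>F s in at_left t. X s \<omega> > y"
    using t(2) by (intro order_tendstoD(1)[OF l(1)]) auto
  then obtain d where d: "d < t" "\<And>s. d < s \<Longrightarrow> s < t \<Longrightarrow> X s \<omega> > y"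
    using t0 by (auto simp: eventually_at_left[OF t0])
  have "(\<lambda>n. 1 / 2 ^ n :: real) \<longlonglongrightarrow> 0"
    using LIMSEQ_power_zero[of "1/2::real"] by (simp add: power_divide)
  then have "\<forall>\<^sub>F n in sequentially. 1 / 2 ^ n < t - d"
    using d(1) by (intro order_tendstoD) auto
  then show ?thesis
  proof eventually_elim
    case (elim n)
    \<comment> \<open>The last grid index strictly before \<open>t\<close>.\<close>
    define k where "k = nat (\<lceil>2 ^ n * t\<rceil> - 1)"
    have pos: "0 < 2 ^ n * t" using t0 by simp
    have k: "real k = of_int \<lceil>2 ^ n * t\<rceil> - 1"
      using pos unfolding k_def by (subst of_nat_nat) auto
    have "real k < 2 ^ n * t" "2 ^ n * t - 1 \<le> real k" unfolding k by linarith+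
    then have "real k / 2 ^ n < t" "t \<le> (real k + 1) / 2 ^ n"
      by (simp_all add: field_simps)
    then have "real k / 2 ^ n < t" "t - 1 / 2 ^ n \<le> real k / 2 ^ n"
      by (simp_all add: add_divide_distrib)
    then show ?case using d(2)[of "real k / 2 ^ n"] elim by (intro exI[of _ k]) auto
  qed
qed

text \<open>The grid passage times decrease to a time \<open>T\<close>, and \<open>X\<^sub>T \<ge> y\<close> by right-continuity. If \<open>X\<^sub>T > y\<close>, a fine
  grid would have seen the passage before \<open>T\<close>. So the level is hit exactly and the overshoots tend to zero; this
  is the place where the absence of positive jumps is decisive.\<close>

lemma crossing_limit:
  assumes \<omega>: "\<omega> \<in> space M" "X 0 \<omega> = 0" and y: "0 \<le> y" and \<mu>: "0 < \<mu>"
  shows "(\<lambda>n. crossing_discount \<mu> n y \<omega>) \<longlonglongrightarrow> passage_discount \<mu> y \<omega>"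
    and "isCont h 0 \<Longrightarrow> (\<lambda>n. crossing_discount \<mu> n y \<omega> * h (X (crossing_time n y \<omega>) \<omega> - y)) \<longlonglongrightarrow> passage_discount \<mu> y \<omega> * h (0::real)"
    and "0 \<le> passage_discount \<mu> y \<omega>" "passage_discount \<mu> y \<omega> \<le> 1"
proof -
  let ?D = "\<lambda>n. crossing_discount \<mu> n y \<omega>"
  have bounds: "0 \<le> ?D n" "?D n \<le> 1" for n
    using \<mu> crossing_time_nonneg by (auto simp: crossing_discount_def)
  have incr: "incseq ?D"
  proof (rule incseq_SucI)
    fix n show "?D n \<le> ?D (Suc n)"
      using grid_refine[of n y \<omega>] \<mu> by (auto simp: crossing_discount_def)
  qed
  have "?D \<longlonglongrightarrow> (SUP n. ?D n)"
    by (rule LIMSEQ_incseq_SUP) (use bounds incr in \<open>auto intro!: bdd_aboveI2[of _ _ 1]\<close>)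
  then show D: "?D \<longlonglongrightarrow> passage_discount \<mu> y \<omega>"
    unfolding passage_discount_def using limI by metis
  show "0 \<le> passage_discount \<mu> y \<omega>" "passage_discount \<mu> y \<omega> \<le> 1"
    using LIMSEQ_le_const[OF D] LIMSEQ_le_const2[OF D] bounds by blast+
  assume h: "isCont h 0"
  show "(\<lambda>n. ?D n * h (X (crossing_time n y \<omega>) \<omega> - y)) \<longlonglongrightarrow> passage_discount \<mu> y \<omega> * h 0"
  proof (cases "\<exists>n. crosses n y \<omega>")
    case False
    then have "?D n = 0" for n by (simp add: crossing_discount_def)
    then show ?thesis using LIMSEQ_unique[OF D, of 0] by simp
  next
    case True
    then obtain n0 where n0: "crosses n0 y \<omega>" by blast
    define \<tau> where "\<tau> n = crossing_time (n + n0) y \<omega>" for n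
    have cr: "crosses (n + n0) y \<omega>" for n
      by (induction n) (use n0 grid_refine in auto)
    have "decseq \<tau>"
      by (rule decseq_SucI) (use grid_refine[OF cr] in \<open>simp add: \<tau>_def\<close>)
    then obtain T where T: "\<tau> \<longlonglongrightarrow> T" "\<And>n. T \<le> \<tau> n"
      using decseq_convergent[of \<tau> 0] crossing_time_nonneg by (auto simp: \<tau>_def)
    have T0: "0 \<le> T" using T(1) by (rule LIMSEQ_le_const) (auto simp: \<tau>_def crossing_time_nonneg)
    have "continuous (at T within {T..}) (\<lambda>s. X s \<omega>)"
      using right_continuous_paths[OF \<omega>(1) T0] by (simp add: continuous_within at_within_Ici_at_right)
    from continuous_within_tendsto_compose'[OF this _ T(1)] T(2)
    have XT: "(\<lambda>n. X (\<tau> n) \<omega>) \<longlonglongrightarrow> X T \<omega>" by simp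
    have "X T \<omega> \<ge> y"
      using XT by (rule LIMSEQ_le_const) (auto simp: \<tau>_def intro!: exI less_imp_le X_crossing_time cr)
    moreover have "\<not> X T \<omega> > y"
    proof
      assume "X T \<omega> > y"
      from crossing_before[OF \<omega> y T0 this]
      obtain N where N: "\<And>n. n \<ge> N \<Longrightarrow> \<exists>k. real k / 2 ^ n < T \<and> X (real k / 2 ^ n) \<omega> > y"
        by (auto simp: eventually_sequentially)
      obtain k where k: "real k / 2 ^ (N + n0) < T" "X (real k / 2 ^ (N + n0)) \<omega> > y"
        using N[of "N + n0"] by auto
      from crossing_time_le[OF k(2)] k(1) T(2)[of N] show False by (simp add: \<tau>_def)
    qed
    ultimately have "(\<lambda>n. X (\<tau> n) \<omega> - y) \<longlonglongrightarrow> 0" using XT by (auto intro!: tendsto_eq_intros)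
    then have "(\<lambda>n. h (X (\<tau> n) \<omega> - y)) \<longlonglongrightarrow> h 0"
      by (rule isCont_tendsto_compose[OF h])
    then have "(\<lambda>n. h (X (crossing_time n y \<omega>) \<omega> - y)) \<longlonglongrightarrow> h 0"
      unfolding \<tau>_def by (rule LIMSEQ_offset)
    then show ?thesis by (intro tendsto_mult D)
  qed
qed

definition passage :: "real \<Rightarrow> real \<Rightarrow> real" where
  "passage \<mu> y = (LINT \<omega>|M. passage_discount \<mu> y \<omega>)"

lemma AE_start: "AE \<omega> in M. \<omega> \<in> space M \<and> X 0 \<omega> = 0"
  using start_at_0 by (auto elim: eventually_mono)

lemma AE_passage_discount_bounds:
  assumes "0 < \<mu>" "0 \<le> y"
  shows "AE \<omega> in M. 0 \<le> passage_discount \<mu> y \<omega> \<and> passage_discount \<mu> y \<omega> \<le> 1"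
  using AE_start by eventually_elim (use crossing_limit(3,4) assms in auto)

lemma integrable_passage_discount:
  assumes "0 < \<mu>" "0 \<le> y" shows "integrable M (passage_discount \<mu> y)"
  by (rule integrable_const_bound[of _ 1]) (use AE_passage_discount_bounds[OF assms] in \<open>auto elim: eventually_mono\<close>)

lemma passage_nonneg: "0 < \<mu> \<Longrightarrow> 0 \<le> y \<Longrightarrow> 0 \<le> passage \<mu> y"
  unfolding passage_def using AE_passage_discount_bounds
  by (intro integral_nonneg_AE) (auto elim: eventually_mono)

text \<open>Split according to the first grid point above the level and apply the Markov property there: the time
  after it contributes the potential of a fresh path started from the overshoot.\<close>

lemma potential_strong_markov_grid:
  assumes g [measurable]: "g \<in> borel_measurable borel"
  shows "(\<integral>\<^sup>+\<omega>. \<integral>\<^sup>+t. ennreal (exp (- \<mu> * t)) * indicator {0..} t * g (path_value t (path \<omega>) - y)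
      * (if \<exists>k::nat. real k / 2 ^ n \<le> t \<and> X (real k / 2 ^ n) \<omega> > y then 1 else 0) \<partial>lborel \<partial>M)
    = (\<integral>\<^sup>+\<omega>. ennreal (crossing_discount \<mu> n y \<omega>) * (\<integral>\<^sup>+z. g (X (crossing_time n y \<omega>) \<omega> - y + z) \<partial>potential \<mu>) \<partial>M)"
proof -
  define e where "e t = ennreal (exp (- \<mu> * t)) * indicator {0..} t" for t
  have [measurable]: "e \<in> borel_measurable borel" unfolding e_def[abs_def] by measurable
  let ?T = "\<lambda>\<omega> a. \<integral>\<^sup>+t. e t * g (path_value t (path \<omega>) - y) * indicator {a..} t \<partial>lborel"
  \<comment> \<open>The event that \<open>k\<close> is the first grid index above the level.\<close>
  define H where "H k \<omega> \<longleftrightarrow> X (real k / 2 ^ n) \<omega> > y \<and> (\<forall>j<k. \<not> X (real j / 2 ^ n) \<omega> > y)" for k :: nat and \<omega>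
  have [measurable]: "Measurable.pred M (H k)" for k unfolding H_def[abs_def] by measurable
  define R where "R x = (\<integral>\<^sup>+z. g (x + z) \<partial>potential \<mu>)" for x
  have R_eq: "R x = (\<integral>\<^sup>+\<omega>'. \<integral>\<^sup>+s. e s * g (x + path_value s (path \<omega>')) \<partial>lborel \<partial>M)" for x
  proof -
    interpret LM: pair_sigma_finite lborel M ..
    have "R x = (\<integral>\<^sup>+s. e s * mean (\<lambda>z. g (x + z)) s \<partial>lborel)"
      unfolding R_def e_def by (rule nn_integral_potential) measurable
    also have "\<dots> = (\<integral>\<^sup>+s. \<integral>\<^sup>+\<omega>'. e s * g (x + path_value s (path \<omega>')) \<partial>M \<partial>lborel)"
      unfolding mean_def by (intro nn_integral_cong nn_integral_cmult[symmetric]) measurable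
    also have "\<dots> = (\<integral>\<^sup>+\<omega>'. \<integral>\<^sup>+s. e s * g (x + path_value s (path \<omega>')) \<partial>lborel \<partial>M)"
      by (rule LM.Fubini'[symmetric]) measurable
    finally show ?thesis .
  qed
  have [measurable]: "R \<in> borel_measurable borel"
    unfolding R_eq[abs_def] by measurable
  have summand: "(\<integral>\<^sup>+\<omega>. (if H k \<omega> then 1 else 0) * (?T \<omega> (real k / 2 ^ n)) \<partial>M)
      = (\<integral>\<^sup>+\<omega>. (if H k \<omega> then ennreal (exp (- \<mu> * (real k / 2 ^ n))) * R (X (real k / 2 ^ n) \<omega> - y) else 0) \<partial>M)" for k
  proof -
    define a where "a = real k / 2 ^ n"
    have a: "0 \<le> a" by (simp add: a_def)
    note [measurable] = measurable_X[OF a]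
    define F where "F v w = (if v a > y \<and> (\<forall>j<k. \<not> v (real j / 2 ^ n) > y) then 1 else 0) *
       (\<integral>\<^sup>+s. e s * g (v a - y + path_value s w) \<partial>lborel)" for v w :: "real \<Rightarrow> real"
    have F: "case_prod F \<in> borel_measurable (path_space \<Otimes>\<^sub>M path_space)"
    proof -
      have [measurable]: "(\<lambda>z. fst z b) \<in> borel_measurable (path_space \<Otimes>\<^sub>M path_space)" if "0 \<le> b" for b
        using that by (intro measurable_compose[OF measurable_fst measurable_component_singleton]) auto
      have [measurable]: "(\<lambda>z. fst z a) \<in> borel_measurable (path_space \<Otimes>\<^sub>M path_space)"
        "\<And>j. (\<lambda>z. fst z (real j / 2 ^ n)) \<in> borel_measurable (path_space \<Otimes>\<^sub>M path_space)"
        using a by auto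
      show ?thesis unfolding F_def case_prod_beta by measurable
    qed
    have past: "past a \<omega> a = X a \<omega>" "\<And>j. j < k \<Longrightarrow> past a \<omega> (real j / 2 ^ n) = X (real j / 2 ^ n) \<omega>" for \<omega>
    proof -
      show "past a \<omega> a = X a \<omega>" using a by (simp add: past_def)
      fix j assume "j < k"
      then have "real j / 2 ^ n \<le> a" by (simp add: a_def divide_right_mono)
      then show "past a \<omega> (real j / 2 ^ n) = X (real j / 2 ^ n) \<omega>" by (simp add: past_def)
    qed
    have H: "H k \<omega> \<longleftrightarrow> past a \<omega> a > y \<and> (\<forall>j<k. \<not> past a \<omega> (real j / 2 ^ n) > y)" for \<omega>
      using past by (simp add: H_def a_def)
    have "(\<integral>\<^sup>+\<omega>. (if H k \<omega> then 1 else 0) * (?T \<omega> (real k / 2 ^ n)) \<partial>M) =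
      (\<integral>\<^sup>+\<omega>. ennreal (exp (- \<mu> * a)) * F (past a \<omega>) (future a \<omega>) \<partial>M)"
    proof (rule nn_integral_cong)
      fix \<omega> assume \<omega>: "\<omega> \<in> space M"
      have "(\<integral>\<^sup>+t. e t * g (path_value t (path \<omega>) - y) * indicator {a..} t \<partial>lborel) =
         (\<integral>\<^sup>+s. e (a + s) * g (path_value (a + s) (path \<omega>) - y) * indicator {a..} (a + s) \<partial>lborel)"
        using \<omega> by (subst nn_integral_real_affine[where c=1 and t=a]) auto
      also have "\<dots> = (\<integral>\<^sup>+s. ennreal (exp (- \<mu> * a)) * (e s * g (X a \<omega> - y + path_value s (future a \<omega>))) \<partial>lborel)"
      proof (rule nn_integral_cong)
        fix s :: real
        show "e (a + s) * g (path_value (a + s) (path \<omega>) - y) * indicator {a..} (a + s) =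
          ennreal (exp (- \<mu> * a)) * (e s * g (X a \<omega> - y + path_value s (future a \<omega>)))"
        proof (cases "0 \<le> s")
          case True
          have "ennreal (exp (- \<mu> * (a + s))) = ennreal (exp (- \<mu> * a)) * ennreal (exp (- \<mu> * s))"
            by (simp add: ennreal_mult'[symmetric] exp_add[symmetric] algebra_simps)
          then show ?thesis
            using True a path_value_path[OF \<omega>, of "a + s"] path_value_future[OF \<omega> a True]
            by (simp add: e_def mult_ac)
        qed (simp add: e_def)
      qed
      also have "\<dots> = ennreal (exp (- \<mu> * a)) * (\<integral>\<^sup>+s. e s * g (X a \<omega> - y + path_value s (future a \<omega>)) \<partial>lborel)"
      proof (rule nn_integral_cmult)
        have [measurable]: "future a \<omega> \<in> space path_space"
          using measurable_space[OF measurable_future[OF a] \<omega>] .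
        show "(\<lambda>s. e s * g (X a \<omega> - y + path_value s (future a \<omega>))) \<in> borel_measurable lborel"
          by measurable
      qed
      finally show "(if H k \<omega> then 1 else 0) * (?T \<omega> (real k / 2 ^ n)) =
        ennreal (exp (- \<mu> * a)) * F (past a \<omega>) (future a \<omega>)"
        unfolding F_def H by (simp add: past(1) a_def[symmetric])
    qed
    also have "\<dots> = ennreal (exp (- \<mu> * a)) * (\<integral>\<^sup>+\<omega>. F (past a \<omega>) (future a \<omega>) \<partial>M)"
    proof (rule nn_integral_cmult)
      note [measurable] = measurable_past[OF a] measurable_future[OF a]
      show "(\<lambda>\<omega>. F (past a \<omega>) (future a \<omega>)) \<in> borel_measurable M"
        using measurable_compose[OF _ F, of "\<lambda>\<omega>. (past a \<omega>, future a \<omega>)"] by simp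
    qed
    also have "(\<integral>\<^sup>+\<omega>. F (past a \<omega>) (future a \<omega>) \<partial>M) = (\<integral>\<^sup>+\<omega>. \<integral>\<^sup>+\<omega>'. F (past a \<omega>) (path \<omega>') \<partial>M \<partial>M)"
      by (rule markov_past_future[OF a F])
    also have "\<dots> = (\<integral>\<^sup>+\<omega>. (if H k \<omega> then R (X a \<omega> - y) else 0) \<partial>M)"
    proof (rule nn_integral_cong)
      fix \<omega> assume \<omega>: "\<omega> \<in> space M"
      show "(\<integral>\<^sup>+\<omega>'. F (past a \<omega>) (path \<omega>') \<partial>M) = (if H k \<omega> then R (X a \<omega> - y) else 0)"
        unfolding F_def H R_eq by (auto simp: past(1))
    qed
    also have "ennreal (exp (- \<mu> * a)) * \<dots> = (\<integral>\<^sup>+\<omega>. ennreal (exp (- \<mu> * a)) * (if H k \<omega> then R (X a \<omega> - y) else 0) \<partial>M)"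
      by (rule nn_integral_cmult[symmetric]) measurable
    finally show ?thesis unfolding a_def by (simp add: if_distrib cong: if_cong)
  qed
  have "(\<integral>\<^sup>+\<omega>. \<integral>\<^sup>+t. ennreal (exp (- \<mu> * t)) * indicator {0..} t * g (path_value t (path \<omega>) - y)
      * (if \<exists>k::nat. real k / 2 ^ n \<le> t \<and> X (real k / 2 ^ n) \<omega> > y then 1 else 0) \<partial>lborel \<partial>M) =
    (\<integral>\<^sup>+\<omega>. (\<Sum>k. (if H k \<omega> then 1 else 0) * (?T \<omega> (real k / 2 ^ n))) \<partial>M)"
  proof (rule nn_integral_cong)
    fix \<omega> assume \<omega>: "\<omega> \<in> space M"
    let ?P = "\<lambda>k::nat. X (real k / 2 ^ n) \<omega> > y"
    have "(if \<exists>k::nat. real k / 2 ^ n \<le> t \<and> ?P k then 1 else 0 :: ennreal) =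
        (if \<exists>k. ?P k then indicator {real (LEAST k. ?P k) / 2 ^ n..} t else 0)" for t
    proof -
      have "(\<exists>k::nat. real k / 2 ^ n \<le> t \<and> ?P k) \<longleftrightarrow> (\<exists>k. ?P k) \<and> real (LEAST k. ?P k) / 2 ^ n \<le> t"
      proof safe
        fix k :: nat assume k: "real k / 2 ^ n \<le> t" "?P k"
        then have "(LEAST k. ?P k) \<le> k" by (intro Least_le)
        then have "real (LEAST k. ?P k) / 2 ^ n \<le> real k / 2 ^ n" by (intro divide_right_mono) auto
        with k show "real (LEAST k. ?P k) / 2 ^ n \<le> t" by linarith
      next
        fix k assume "?P k" and le: "real (LEAST k. ?P k) / 2 ^ n \<le> t"
        then have "?P (LEAST k. ?P k)" by (intro LeastI)
        with le show "\<exists>k. real k / 2 ^ n \<le> t \<and> ?P k" by blast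
      qed blast
      then show ?thesis by (auto split: split_indicator)
    qed
    then have "(\<integral>\<^sup>+t. ennreal (exp (- \<mu> * t)) * indicator {0..} t * g (path_value t (path \<omega>) - y)
      * (if \<exists>k::nat. real k / 2 ^ n \<le> t \<and> ?P k then 1 else 0) \<partial>lborel) =
      (if \<exists>k. ?P k then \<integral>\<^sup>+t. e t * g (path_value t (path \<omega>) - y) * indicator {real (LEAST k. ?P k) / 2 ^ n..} t \<partial>lborel else 0)"
      by (simp add: e_def)
    also have "\<dots> = (\<Sum>k. if ?P k \<and> (\<forall>j<k. \<not> ?P j) then \<integral>\<^sup>+t. e t * g (path_value t (path \<omega>) - y) * indicator {real k / 2 ^ n..} t \<partial>lborel else 0)"
      by (rule suminf_first_index[symmetric])
    also have "\<dots> = (\<Sum>k. (if H k \<omega> then 1 else 0) * (?T \<omega> (real k / 2 ^ n)))"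
      by (intro suminf_cong) (auto simp: H_def)
    finally show "(\<integral>\<^sup>+t. ennreal (exp (- \<mu> * t)) * indicator {0..} t * g (path_value t (path \<omega>) - y)
      * (if \<exists>k::nat. real k / 2 ^ n \<le> t \<and> ?P k then 1 else 0) \<partial>lborel) = \<dots>" .
  qed
  also have "\<dots> = (\<Sum>k. \<integral>\<^sup>+\<omega>. (if H k \<omega> then 1 else 0) * (?T \<omega> (real k / 2 ^ n)) \<partial>M)"
    by (rule nn_integral_suminf) measurable
  also have "\<dots> = (\<Sum>k. \<integral>\<^sup>+\<omega>. (if H k \<omega> then ennreal (exp (- \<mu> * (real k / 2 ^ n))) * R (X (real k / 2 ^ n) \<omega> - y) else 0) \<partial>M)"
    unfolding summand ..
  also have "\<dots> = (\<integral>\<^sup>+\<omega>. (\<Sum>k. if H k \<omega> then ennreal (exp (- \<mu> * (real k / 2 ^ n))) * R (X (real k / 2 ^ n) \<omega> - y) else 0) \<partial>M)"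
    by (rule nn_integral_suminf[symmetric]) measurable
  also have "\<dots> = (\<integral>\<^sup>+\<omega>. ennreal (crossing_discount \<mu> n y \<omega>) * R (X (crossing_time n y \<omega>) \<omega> - y) \<partial>M)"
    unfolding H_def suminf_first_index
    by (intro nn_integral_cong) (simp add: crossing_discount_def crosses_def crossing_time_def)
  finally show ?thesis by (simp add: R_def)
qed

lemma nn_integral_potential_swap:
  assumes [measurable]: "g \<in> borel_measurable borel"
  shows "(\<integral>\<^sup>+z. g z \<partial>potential \<mu>) =
    (\<integral>\<^sup>+\<omega>. \<integral>\<^sup>+t. ennreal (exp (- \<mu> * t)) * indicator {0..} t * g (path_value t (path \<omega>)) \<partial>lborel \<partial>M)"
proof -
  interpret LM: pair_sigma_finite lborel M ..
  have "(\<integral>\<^sup>+z. g z \<partial>potential \<mu>) = (\<integral>\<^sup>+t. \<integral>\<^sup>+\<omega>. ennreal (exp (- \<mu> * t)) * indicator {0..} t * g (path_value t (path \<omega>)) \<partial>M \<partial>lborel)"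
    unfolding nn_integral_potential[OF assms] mean_def by (intro nn_integral_cong nn_integral_cmult[symmetric]) measurable
  also have "\<dots> = (\<integral>\<^sup>+\<omega>. \<integral>\<^sup>+t. ennreal (exp (- \<mu> * t)) * indicator {0..} t * g (path_value t (path \<omega>)) \<partial>lborel \<partial>M)"
    by (rule LM.Fubini'[symmetric]) measurable
  finally show ?thesis .
qed

lemma integrable_potential_bounded:
  assumes "0 < \<mu>" and [measurable]: "g \<in> borel_measurable borel" and "\<And>z. \<bar>g z\<bar> \<le> B"
  shows "integrable (potential \<mu>) (g :: real \<Rightarrow> real)"
  using assms by (intro finite_measure.integrable_const_bound[OF finite_measure_potential, of _ _ B]) auto

text \<open>Refining the grid in \<open>potential_strong_markov_grid\<close>: since \<open>g\<close> vanishes on the negative half-line, only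
  times after the passage over \<open>y\<close> matter, and at the passage the path is exactly at \<open>y\<close>.\<close>

lemma passage_factor:
  assumes \<mu>: "0 < \<mu>" and y: "0 \<le> y" and g [measurable]: "g \<in> borel_measurable borel"
    and g01: "\<And>z. 0 \<le> g z" "\<And>z. g z \<le> 1" and g0: "\<And>z. z \<le> 0 \<Longrightarrow> g z = 0"
    and cont: "isCont (\<lambda>x. LINT z|potential \<mu>. g (x + z)) 0"
  shows "(LINT z|potential \<mu>. g (z - y)) = passage \<mu> y * (LINT z|potential \<mu>. (g z :: real))"
proof -
  define e where "e t = ennreal (exp (- \<mu> * t)) * indicator {0..} t" for t
  have [measurable]: "e \<in> borel_measurable borel" unfolding e_def[abs_def] by measurable
  have e_int: "(\<integral>\<^sup>+t. e t \<partial>lborel) < \<infinity>"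
    unfolding e_def using nn_integral_exp_Ici[of \<mu>] \<mu> by simp
  define G where "G x = (LINT z|potential \<mu>. g (x + z))" for x
  have G: "(\<integral>\<^sup>+z. ennreal (g (x + z)) \<partial>potential \<mu>) = ennreal (G x)" for x
    unfolding G_def using g01
    by (intro nn_integral_eq_integral integrable_potential_bounded[OF \<mu>, where B=1]) auto
  have G_nonneg: "0 \<le> G x" for x unfolding G_def by (intro Bochner_Integration.integral_nonneg g01)
  have [measurable]: "G \<in> borel_measurable borel"
  proof -
    interpret finite_measure "potential \<mu>" by (rule finite_measure_potential[OF \<mu>])
    show ?thesis unfolding G_def[abs_def] by measurable
  qed
  have G_le: "G x \<le> 1 / \<mu>" for x
  proof -
    have "ennreal (G x) \<le> (\<integral>\<^sup>+z. 1 \<partial>potential \<mu>)"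
      unfolding G[symmetric] using g01 by (intro nn_integral_mono) (simp add: ennreal_le_1)
    then show ?thesis using \<mu> by (simp add: emeasure_potential_UNIV)
  qed
  let ?c = "\<lambda>n t \<omega>. if \<exists>k::nat. real k / 2 ^ n \<le> t \<and> X (real k / 2 ^ n) \<omega> > y then 1 else 0 :: ennreal"
  define I where "I n = (\<integral>\<^sup>+\<omega>. \<integral>\<^sup>+t. e t * ennreal (g (path_value t (path \<omega>) - y)) * ?c n t \<omega> \<partial>lborel \<partial>M)" for n
  have gy: "ennreal (g z) \<le> 1" for z using g01[of z] by (simp add: ennreal_le_1)
  have dom: "e t * ennreal (g z) * ?c n t \<omega> \<le> e t" for t z n \<omega>
  proof -
    have "e t * ennreal (g z) * ?c n t \<omega> \<le> e t * 1 * 1"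
      by (intro mult_mono gy) auto
    then show ?thesis by simp
  qed
  \<comment> \<open>The restriction to times after the grid passage disappears in the limit, as \<open>g\<close> is nonzero only above the
    level.\<close>
  have lim1: "I \<longlonglongrightarrow> (\<integral>\<^sup>+\<omega>. \<integral>\<^sup>+t. e t * ennreal (g (path_value t (path \<omega>) - y)) \<partial>lborel \<partial>M)"
    unfolding I_def
  proof (rule nn_integral_dominated_convergence[where w="\<lambda>_. \<integral>\<^sup>+t. e t \<partial>lborel"])
    show "AE \<omega> in M. (\<integral>\<^sup>+t. e t * ennreal (g (path_value t (path \<omega>) - y)) * ?c n t \<omega> \<partial>lborel) \<le> (\<integral>\<^sup>+t. e t \<partial>lborel)" for n
      by (intro AE_I2 nn_integral_mono dom)
    show "(\<integral>\<^sup>+\<omega>. (\<integral>\<^sup>+t. e t \<partial>lborel) \<partial>M) < \<infinity>"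
      using e_int by (simp add: emeasure_space_1)
    show "AE \<omega> in M. (\<lambda>n. \<integral>\<^sup>+t. e t * ennreal (g (path_value t (path \<omega>) - y)) * ?c n t \<omega> \<partial>lborel)
       \<longlonglongrightarrow> (\<integral>\<^sup>+t. e t * ennreal (g (path_value t (path \<omega>) - y)) \<partial>lborel)"
      using AE_start
    proof eventually_elim
      case (elim \<omega>)
      have [measurable]: "path \<omega> \<in> space path_space"
        using elim measurable_space[OF measurable_path] by blast
      show ?case
      proof (rule nn_integral_dominated_convergence[where w=e])
        show "AE t in lborel. (\<lambda>n. e t * ennreal (g (path_value t (path \<omega>) - y)) * ?c n t \<omega>)
          \<longlonglongrightarrow> e t * ennreal (g (path_value t (path \<omega>) - y))"
        proof (rule AE_I2)
          fix t :: real
          show "(\<lambda>n. e t * ennreal (g (path_value t (path \<omega>) - y)) * ?c n t \<omega>)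
            \<longlonglongrightarrow> e t * ennreal (g (path_value t (path \<omega>) - y))"
          proof (cases "0 \<le> t \<and> X t \<omega> > y")
            case True
            then have "\<forall>\<^sub>F n in sequentially. \<exists>k. real k / 2 ^ n < t \<and> X (real k / 2 ^ n) \<omega> > y"
              using elim y by (intro crossing_before) auto
            then have "\<forall>\<^sub>F n in sequentially. \<exists>k. real k / 2 ^ n \<le> t \<and> X (real k / 2 ^ n) \<omega> > y"
              by (rule eventually_mono) (blast intro: less_imp_le)
            then have "\<forall>\<^sub>F n in sequentially. e t * ennreal (g (path_value t (path \<omega>) - y)) * ?c n t \<omega> =
                e t * ennreal (g (path_value t (path \<omega>) - y))"
              by (rule eventually_mono) simp
            then show ?thesis by (rule tendsto_eventually)
          next
            case False
            then have z: "e t * ennreal (g (path_value t (path \<omega>) - y)) = 0"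
              using elim by (cases "0 \<le> t") (auto simp: path_value_path g0 e_def)
            show ?thesis unfolding z by simp
          qed
        qed
      qed (use e_int dom in auto)
    qed
  qed measurable
  also have "(\<integral>\<^sup>+\<omega>. \<integral>\<^sup>+t. e t * ennreal (g (path_value t (path \<omega>) - y)) \<partial>lborel \<partial>M) = ennreal (G (- y))"
    using nn_integral_potential_swap[of "\<lambda>z. ennreal (g (z - y))" \<mu>] G[of "- y"] by (simp add: e_def)
  finally have lim1: "I \<longlonglongrightarrow> ennreal (G (- y))" .
  have "I n = (\<integral>\<^sup>+\<omega>. ennreal (crossing_discount \<mu> n y \<omega> * G (X (crossing_time n y \<omega>) \<omega> - y)) \<partial>M)" for n
    unfolding I_def e_def
    by (subst potential_strong_markov_grid)
       (auto simp: G G_nonneg ennreal_mult'' intro!: nn_integral_cong)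
  then have I2: "I = (\<lambda>n. \<integral>\<^sup>+\<omega>. ennreal (crossing_discount \<mu> n y \<omega> * G (X (crossing_time n y \<omega>) \<omega> - y)) \<partial>M)"
    by auto
  have cd: "0 \<le> crossing_discount \<mu> n y \<omega>" "crossing_discount \<mu> n y \<omega> \<le> 1" for n \<omega>
    using \<mu> crossing_time_nonneg[of n y \<omega>] by (auto simp: crossing_discount_def)
  have "I \<longlonglongrightarrow> (\<integral>\<^sup>+\<omega>. ennreal (passage_discount \<mu> y \<omega> * G 0) \<partial>M)"
    unfolding I2
  proof (rule nn_integral_dominated_convergence[where w="\<lambda>_. ennreal (1 / \<mu>)"])
    show "AE \<omega> in M. ennreal (crossing_discount \<mu> n y \<omega> * G (X (crossing_time n y \<omega>) \<omega> - y)) \<le> ennreal (1 / \<mu>)" for n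
    proof (intro AE_I2 ennreal_leI)
      fix \<omega>
      show "crossing_discount \<mu> n y \<omega> * G (X (crossing_time n y \<omega>) \<omega> - y) \<le> 1 / \<mu>"
        using mult_mono[OF cd(2)[of n \<omega>] G_le[of "X (crossing_time n y \<omega>) \<omega> - y"]] G_nonneg by simp
    qed
    show "(\<integral>\<^sup>+\<omega>. ennreal (1 / \<mu>) \<partial>M) < \<infinity>" by (simp add: emeasure_space_1)
    show "AE \<omega> in M. (\<lambda>n. ennreal (crossing_discount \<mu> n y \<omega> * G (X (crossing_time n y \<omega>) \<omega> - y)))
       \<longlonglongrightarrow> ennreal (passage_discount \<mu> y \<omega> * G 0)"
      using AE_start
    proof eventually_elim
      case (elim \<omega>)
      have "isCont G 0" using cont by (simp add: G_def[abs_def])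
      then show ?case using elim y \<mu> by (intro tendsto_ennrealI crossing_limit(2)) auto
    qed
  qed measurable
  also have "(\<integral>\<^sup>+\<omega>. ennreal (passage_discount \<mu> y \<omega> * G 0) \<partial>M) = ennreal (passage \<mu> y * G 0)"
    unfolding passage_def
    using AE_passage_discount_bounds[OF \<mu> y] G_nonneg integrable_passage_discount[OF \<mu> y]
    by (subst nn_integral_eq_integral) (auto elim!: eventually_mono)
  finally have "ennreal (G (- y)) = ennreal (passage \<mu> y * G 0)"
    using lim1 LIMSEQ_unique by blast
  then have "G (- y) = passage \<mu> y * G 0"
    using G_nonneg passage_nonneg[OF \<mu> y] by simp
  then show ?thesis by (simp add: G_def)
qed

text \<open>\<open>passage_factor\<close> for ramps converging to the indicator of \<open>(z, \<infinity>)\<close>.\<close>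

lemma tail_factor:
  assumes \<mu>: "0 < \<mu>" and y: "0 \<le> y" and z: "0 \<le> z"
  shows "measure (potential \<mu>) {y + z<..} = passage \<mu> y * measure (potential \<mu>) {z<..}"
proof -
  note fin = finite_measure_potential[OF \<mu>]
  define g where "g m x = max 0 (min 1 (real m * (x - z)))" for m x
  have [measurable]: "g m \<in> borel_measurable borel" for m unfolding g_def[abs_def] by measurable
  have g_cont: "continuous_on UNIV (g m)" for m unfolding g_def[abs_def] by (intro continuous_intros)
  have "(LINT w|potential \<mu>. g m (w - y)) = passage \<mu> y * (LINT w|potential \<mu>. g m w)" for m
  proof (rule passage_factor[OF \<mu> y])
    show "g m w = 0" if "w \<le> 0" for w
    proof -
      have "real m * (w - z) \<le> 0" using that z by (intro mult_nonneg_nonpos) auto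
      then have "min 1 (real m * (w - z)) \<le> 0" by (rule min.coboundedI2)
      then show ?thesis unfolding g_def by (rule max_absorb1)
    qed
    show "isCont (\<lambda>x. LINT w|potential \<mu>. g m (x + w)) 0"
      unfolding continuous_at_sequentially
    proof (intro allI impI)
      fix x :: "nat \<Rightarrow> real" assume x: "x \<longlonglongrightarrow> 0"
      have "(\<lambda>n. LINT w|potential \<mu>. g m (x n + w)) \<longlonglongrightarrow> (LINT w|potential \<mu>. g m (0 + w))"
      proof (rule integral_dominated_convergence[where w="\<lambda>_. 1"])
        show "integrable (potential \<mu>) (\<lambda>_. 1::real)" by (rule finite_measure.integrable_const[OF fin])
        show "AE w in potential \<mu>. (\<lambda>n. g m (x n + w)) \<longlonglongrightarrow> g m (0 + w)"
          by (intro AE_I2 continuous_on_tendsto_compose[OF g_cont] tendsto_add x tendsto_const) auto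
      qed (auto simp: g_def)
      then show "((\<lambda>x. LINT w|potential \<mu>. g m (x + w)) \<circ> x) \<longlonglongrightarrow> (LINT w|potential \<mu>. g m (0 + w))"
        by (simp add: o_def)
    qed
  qed (auto simp: g_def)
  moreover have "(\<lambda>m. LINT w|potential \<mu>. g m (w - y)) \<longlonglongrightarrow> measure (potential \<mu>) {y + z<..}"
    using integral_ramp_tendsto[OF fin sets_potential, of "y + z"] by (simp add: g_def algebra_simps)
  moreover have "(\<lambda>m. passage \<mu> y * (LINT w|potential \<mu>. g m w)) \<longlonglongrightarrow> passage \<mu> y * measure (potential \<mu>) {z<..}"
    using integral_ramp_tendsto[OF fin sets_potential, of z] by (intro tendsto_mult tendsto_const) (simp add: g_def)
  ultimately show ?thesis using LIMSEQ_unique by simp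
qed

lemma AE_lborel_exists:
  assumes "AE x in lborel. P x" "a < (b::real)"
  shows "\<exists>x. a < x \<and> x < b \<and> P x"
proof (rule ccontr)
  assume "\<not> ?thesis"
  then have "AE x in lborel. x \<notin> {a<..<b}"
    using assms(1) by (auto elim!: eventually_mono)
  then have "emeasure lborel {a<..<b} = 0"
    by (subst (asm) AE_iff_measurable[of "{a<..<b}"]) auto
  then show False using assms(2) by simp
qed

text \<open>If \<open>U\<^sub>\<mu>\<close> did not charge \<open>(0, \<infinity>)\<close>, then \<open>X\<^sub>t \<le> 0\<close> almost surely, for almost all \<open>t\<close> and by right-continuity
  for all; by stationarity all increments would be nonpositive and the paths decreasing, which is excluded.\<close>

lemma potential_positive_half_line:
  assumes \<mu>: "0 < \<mu>"
  shows "0 < measure (potential \<mu>) {0<..}"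
proof (rule ccontr)
  assume "\<not> ?thesis"
  then have "emeasure (potential \<mu>) {0<..} = 0"
    using finite_measure.emeasure_eq_measure[OF finite_measure_potential[OF \<mu>], of "{0<..}"]
      measure_nonneg[of "potential \<mu>" "{0<..}"] by (simp add: not_less)
  then have "(\<integral>\<^sup>+t. ennreal (exp (- \<mu> * t)) * indicator {0..} t * mean (indicator {0<..}) t \<partial>lborel) = 0"
    using nn_integral_potential[of "indicator {0<..}" \<mu>] by simp
  then have ae: "AE t in lborel. 0 \<le> t \<longrightarrow> mean (indicator {0<..}) t = 0"
    by (subst (asm) nn_integral_0_iff_AE) (auto elim!: eventually_mono split: split_indicator_asm)
  have nonpos: "AE \<omega> in M. X t \<omega> \<le> 0" if t: "0 \<le> t" for t
  proof -
    have "\<exists>s. t < s \<and> s < t + 1 / real (Suc n) \<and> (0 \<le> s \<longrightarrow> mean (indicator {0<..}) s = 0)" for n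
      by (rule AE_lborel_exists[OF ae]) simp
    then obtain s where s: "\<And>n. t < s n" "\<And>n. s n < t + 1 / real (Suc n)"
      "\<And>n. 0 \<le> s n \<Longrightarrow> mean (indicator {0<..}) (s n) = 0" by metis
    have "AE \<omega> in M. X (s n) \<omega> \<le> 0" for n
    proof -
      have sn: "0 \<le> s n" using s(1)[of n] t by simp
      note [measurable] = measurable_X[OF sn]
      have "(\<integral>\<^sup>+\<omega>. indicator {0<..} (X (s n) \<omega>) \<partial>M) = 0"
        using s(3)[OF sn] mean_eq[OF sn] by simp
      then show ?thesis
        by (subst (asm) nn_integral_0_iff_AE) (auto elim!: eventually_mono split: split_indicator_asm)
    qed
    then have "AE \<omega> in M. \<forall>n. X (s n) \<omega> \<le> 0" by (simp add: AE_all_countable)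
    then show ?thesis using AE_space
    proof eventually_elim
      case (elim \<omega>)
      have "(\<lambda>n. t + 1 / real (Suc n)) \<longlonglongrightarrow> t + 0"
        by (intro tendsto_add tendsto_const LIMSEQ_Suc lim_1_over_n)
      then have lim: "(\<lambda>n. t + 1 / real (Suc n)) \<longlonglongrightarrow> t" by simp
      have "s \<longlonglongrightarrow> t"
        by (rule tendsto_sandwich[OF _ _ tendsto_const lim]) (simp_all add: s less_imp_le del: of_nat_Suc)
      then have "filterlim s (at_right t) sequentially"
        using s(1) by (auto simp: filterlim_at less_imp_neq[THEN not_sym])
      from filterlim_compose[OF right_continuous_paths[OF elim(2) t] this]
      show ?case by (rule LIMSEQ_le_const2) (use elim in auto)
    qed
  qed
  have incr: "AE \<omega> in M. X (s + t) \<omega> \<le> X s \<omega>" if "0 \<le> s" "0 \<le> t" for s t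
  proof -
    have [measurable]: "(\<lambda>\<omega>. X (s + t) \<omega> - X s \<omega>) \<in> borel_measurable M"
      using that by (intro borel_measurable_diff measurable_X) auto
    note [measurable] = measurable_X[OF that(2)]
    have "AE x in distr M borel (X t). x \<le> 0"
      using nonpos[OF that(2)] by (subst AE_distr_iff) auto
    then have "AE x in distr M borel (\<lambda>\<omega>. X (s + t) \<omega> - X s \<omega>). x \<le> 0"
      unfolding stationary_increments[OF that] .
    then show ?thesis by (subst (asm) AE_distr_iff) auto
  qed
  have "AE \<omega> in M. \<forall>n i j. i \<le> j \<longrightarrow> X (real j / 2 ^ n) \<omega> \<le> X (real i / 2 ^ n) \<omega>"
    unfolding AE_all_countable
  proof (intro allI)
    fix n i j :: nat
    show "AE \<omega> in M. i \<le> j \<longrightarrow> X (real j / 2 ^ n) \<omega> \<le> X (real i / 2 ^ n) \<omega>"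
    proof (cases "i \<le> j")
      case True
      then show ?thesis using incr[of "real i / 2 ^ n" "real (j - i) / 2 ^ n"]
        by (simp add: of_nat_diff diff_divide_distrib divide_right_mono)
    qed simp
  qed
  then have "AE \<omega> in M. antimono_on {0..} (\<lambda>t. X t \<omega>)"
    using AE_space
  proof eventually_elim
    case (elim \<omega>)
    show ?case
    proof (rule monotone_onI)
      fix s t :: real assume st: "s \<in> {0..}" "t \<in> {0..}" "s \<le> t"
      have fl: "nat \<lfloor>2 ^ n * s\<rfloor> \<le> nat \<lfloor>2 ^ n * t\<rfloor>" for n
        using st by (intro nat_mono floor_mono) auto
      have Ls: "(\<lambda>n. X (real (nat \<lfloor>2 ^ n * s\<rfloor> + 1) / 2 ^ n) \<omega>) \<longlonglongrightarrow> X s \<omega>"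
        by (rule right_limit_along_dyadics[OF _ right_continuous_paths[OF elim(2)]]) (use st in simp_all)
      have Lt: "(\<lambda>n. X (real (nat \<lfloor>2 ^ n * t\<rfloor> + 1) / 2 ^ n) \<omega>) \<longlonglongrightarrow> X t \<omega>"
        by (rule right_limit_along_dyadics[OF _ right_continuous_paths[OF elim(2)]]) (use st in simp_all)
      show "X t \<omega> \<le> X s \<omega>"
        by (rule LIMSEQ_le[OF Lt Ls], intro exI[of _ 0] allI impI)
           (intro elim(1)[rule_format] add_right_mono fl)
    qed
  qed
  then show False using not_decreasing by simp
qed

text \<open>Shown below to equal \<open>\<Phi>(\<mu>)\<close>; defined through passage times because at this stage the Laplace exponent is
  not yet known to be finite.\<close>

definition passage_rate :: "real \<Rightarrow> real" where
  "passage_rate \<mu> = - ln (passage \<mu> 1)"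

text \<open>The discount of passage over \<open>y\<close> is multiplicative in \<open>y\<close> and bounded by one, hence exponential. It is
  positive since otherwise it would vanish at arbitrarily small levels, and \<open>U\<^sub>\<mu>\<close> would not charge \<open>(0, \<infinity>)\<close>; it
  is not constant since the tails of a finite measure tend to zero.\<close>

lemma passage_exponential:
  assumes \<mu>: "0 < \<mu>"
  shows "0 < passage_rate \<mu>"
    and "\<And>y. 0 \<le> y \<Longrightarrow> passage \<mu> y = exp (- passage_rate \<mu> * y)"
    and "\<And>y. 0 \<le> y \<Longrightarrow> measure (potential \<mu>) {y<..} = measure (potential \<mu>) {0<..} * exp (- passage_rate \<mu> * y)"
proof -
  interpret P: finite_measure "potential \<mu>" by (rule finite_measure_potential[OF \<mu>])
  define V where "V y = measure (potential \<mu>) {y<..}" for y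
  have V0: "0 < V 0" unfolding V_def by (rule potential_positive_half_line[OF \<mu>])
  have fac: "V (y + z) = passage \<mu> y * V z" if "0 \<le> y" "0 \<le> z" for y z
    unfolding V_def by (rule tail_factor[OF \<mu> that])
  have b_eq: "passage \<mu> y = V y / V 0" if "0 \<le> y" for y
    using fac[of y 0] that V0 by simp
  have V_mono: "V z \<le> V y" if "y \<le> z" for y z
    unfolding V_def using that by (intro P.finite_measure_mono) auto
  have b_mult: "passage \<mu> (y + z) = passage \<mu> y * passage \<mu> z" if "0 \<le> y" "0 \<le> z" for y z
    using b_eq[of "y + z"] b_eq[of z] fac[OF that] that by simp
  have b_le: "passage \<mu> y \<le> 1" if "0 \<le> y" for y
    using b_eq[OF that] V_mono[OF that] V0 by simp
  have b_pos: "0 < passage \<mu> y" if y: "0 \<le> y" for y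
  proof (rule ccontr)
    assume "\<not> 0 < passage \<mu> y"
    then have by0: "passage \<mu> y = 0" using passage_nonneg[OF \<mu> y] by simp
    have half: "passage \<mu> (y / 2 ^ n) = 0" for n
    proof (induction n)
      case (Suc n)
      have "passage \<mu> (y / 2 ^ Suc n + y / 2 ^ Suc n) = passage \<mu> (y / 2 ^ Suc n) * passage \<mu> (y / 2 ^ Suc n)"
        using y by (intro b_mult) auto
      then show ?case using Suc by (simp add: field_simps)
    qed (simp add: by0)
    have "(\<lambda>n. V (y / 2 ^ n)) \<longlonglongrightarrow> measure (potential \<mu>) (\<Union>n. {y / 2 ^ n<..})"
      unfolding V_def
      by (rule P.finite_Lim_measure_incseq)
         (use y in \<open>auto intro!: incseq_SucI simp: field_simps elim!: order.strict_trans1[rotated]\<close>)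
    also have "(\<Union>n. {y / 2 ^ n<..}) = {0<..}"
    proof (intro equalityI subsetI)
      fix x :: real assume "x \<in> {0<..}"
      then have x: "0 < x" by simp
      have "(\<lambda>n. y * (1/2) ^ n) \<longlonglongrightarrow> y * 0"
        by (intro tendsto_mult tendsto_const LIMSEQ_power_zero) auto
      then have "\<forall>\<^sub>F n in sequentially. y * (1/2) ^ n < x"
        using x by (intro order_tendstoD) auto
      then obtain n where "y * (1/2) ^ n < x" by (auto simp: eventually_sequentially)
      then show "x \<in> (\<Union>n. {y / 2 ^ n<..})" by (auto simp: power_divide)
    next
      fix x :: real assume "x \<in> (\<Union>n. {y / 2 ^ n<..})"
      then obtain n where "y / 2 ^ n < x" by auto
      moreover have "0 \<le> y / 2 ^ n" using y by simp
      ultimately show "x \<in> {0<..}" by simp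
    qed
    finally have "(\<lambda>n. V (y / 2 ^ n)) \<longlonglongrightarrow> V 0" by (simp add: V_def)
    moreover have "V (y / 2 ^ n) = 0" for n
      using half[of n] b_eq[of "y / 2 ^ n"] y V0 by simp
    ultimately have "V 0 = 0" using LIMSEQ_unique[of "\<lambda>_. 0" 0 "V 0"] by simp
    then show False using V0 by simp
  qed
  have lin: "ln (passage \<mu> y) = y * ln (passage \<mu> 1)" if "0 \<le> y" for y
  proof (rule additive_bounded_above_linear[where f="\<lambda>y. ln (passage \<mu> y)" and B=0])
    show "ln (passage \<mu> (s + t)) = ln (passage \<mu> s) + ln (passage \<mu> t)" if "0 \<le> s" "0 \<le> t" for s t
      using b_pos[OF that(1)] b_pos[OF that(2)] b_mult[OF that] by (simp add: ln_mult)
    show "ln (passage \<mu> t) \<le> 0" if "0 \<le> t" for t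
      using b_le[OF that] b_pos[OF that] by simp
  qed fact
  show exp: "passage \<mu> y = exp (- passage_rate \<mu> * y)" if "0 \<le> y" for y
  proof -
    have "passage \<mu> y = exp (ln (passage \<mu> y))" using b_pos[OF that] by simp
    then show ?thesis unfolding lin[OF that] by (simp add: passage_rate_def mult.commute)
  qed
  show "measure (potential \<mu>) {y<..} = measure (potential \<mu>) {0<..} * exp (- passage_rate \<mu> * y)" if "0 \<le> y" for y
    using fac[of y 0] exp[OF that] that by (simp add: V_def mult.commute)
  have "0 \<le> passage_rate \<mu>" using b_le[of 1] b_pos[of 1] by (simp add: passage_rate_def)
  moreover have "passage_rate \<mu> \<noteq> 0"
  proof
    assume "passage_rate \<mu> = 0"
    then have const: "V (real n) = V 0" for n using fac[of "real n" 0] exp[of "real n"] by simp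
    have "(\<lambda>n. V (real n)) \<longlonglongrightarrow> measure (potential \<mu>) (\<Inter>n. {real n<..})"
      unfolding V_def by (rule P.finite_Lim_measure_decseq) (auto intro!: decseq_SucI)
    also have "(\<Inter>n. {real n<..}) = {}"
    proof -
      have "\<exists>n. \<not> real n < x" for x using real_arch_simple[of x] by (auto simp: not_less)
      then show ?thesis by auto
    qed
    finally have "V 0 = 0" using const LIMSEQ_unique[of "\<lambda>_. V 0" "V 0" 0] by simp
    then show False using V0 by simp
  qed
  ultimately show "0 < passage_rate \<mu>" by simp
qed

text \<open>If \<open>X\<^sub>t > y\<close>, the passage over \<open>y\<close> has happened by time \<open>t\<close>, with a discount of at least \<open>e\<^sup>-\<^sup>\<mu>\<^sup>t\<close>.\<close>

lemma tail_probability: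
  assumes \<mu>: "0 < \<mu>" and t: "0 \<le> t" and y: "0 \<le> y"
  shows "prob {\<omega> \<in> space M. y < X t \<omega>} \<le> exp (\<mu> * t) * exp (- passage_rate \<mu> * y)"
proof -
  note [measurable] = measurable_X[OF t]
  have "exp (- \<mu> * t) * prob {\<omega> \<in> space M. y < X t \<omega>} = (LINT \<omega>|M. exp (- \<mu> * t) * indicator {\<omega> \<in> space M. y < X t \<omega>} \<omega>)"
    by simp
  also have "\<dots> \<le> passage \<mu> y"
    unfolding passage_def
  proof (rule integral_mono_AE)
    show "integrable M (passage_discount \<mu> y)" by (rule integrable_passage_discount[OF \<mu> y])
    show "integrable M (\<lambda>\<omega>. exp (- \<mu> * t) * indicator {\<omega> \<in> space M. y < X t \<omega>} \<omega>)"
      by (intro integrable_mult_right) (auto simp: integrable_indicator_iff less_top[symmetric])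
    show "AE \<omega> in M. exp (- \<mu> * t) * indicator {\<omega> \<in> space M. y < X t \<omega>} \<omega> \<le> passage_discount \<mu> y \<omega>"
      using AE_start
    proof eventually_elim
      case (elim \<omega>)
      show ?case
      proof (cases "y < X t \<omega>")
        case True
        have "\<forall>\<^sub>F n in sequentially. \<exists>k. real k / 2 ^ n < t \<and> X (real k / 2 ^ n) \<omega> > y"
          using elim y t True by (intro crossing_before) auto
        then have "\<forall>\<^sub>F n in sequentially. exp (- \<mu> * t) \<le> crossing_discount \<mu> n y \<omega>"
        proof eventually_elim
          case (elim n)
          then obtain k where k: "real k / 2 ^ n < t" "X (real k / 2 ^ n) \<omega> > y" by blast
          have "crossing_time n y \<omega> \<le> t" using crossing_time_le[OF k(2)] k(1) by linarith
          then show ?case using k \<mu> by (auto simp: crossing_discount_def crosses_def)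
        qed
        then have "exp (- \<mu> * t) \<le> passage_discount \<mu> y \<omega>"
          using elim y \<mu> by (intro tendsto_lowerbound[OF crossing_limit(1)]) auto
        then show ?thesis using True elim by (simp add: indicator_def)
      next
        case False
        then show ?thesis using crossing_limit(3)[of \<omega> y \<mu>] elim y \<mu> by simp
      qed
    qed
  qed
  also have "passage \<mu> y = exp (- passage_rate \<mu> * y)" by (rule passage_exponential(2)[OF \<mu> y])
  finally have "exp (\<mu> * t) * (exp (- \<mu> * t) * prob {\<omega> \<in> space M. y < X t \<omega>}) \<le> exp (\<mu> * t) * exp (- passage_rate \<mu> * y)"
    by (intro mult_left_mono) auto
  then show ?thesis by (simp add: mult.assoc[symmetric] exp_add[symmetric])
qed

text \<open>The passage over level \<open>1\<close> takes a positive time by right-continuity, so its discount tends to zero as \<open>\<mu>\<close>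
  grows.\<close>

lemma passage_rate_at_top:
  assumes \<mu>s: "filterlim \<mu>s at_top sequentially" and pos: "\<And>n. 0 < \<mu>s n"
  shows "filterlim (\<lambda>n. passage_rate (\<mu>s n)) at_top sequentially"
proof -
  have "(\<lambda>n. passage (\<mu>s n) 1) \<longlonglongrightarrow> (LINT \<omega>|M. 0)"
    unfolding passage_def
  proof (rule integral_dominated_convergence[where w="\<lambda>_. 1"])
    show "AE \<omega> in M. norm (passage_discount (\<mu>s n) 1 \<omega>) \<le> 1" for n
    proof -
      have "AE \<omega> in M. 0 \<le> passage_discount (\<mu>s n) 1 \<omega> \<and> passage_discount (\<mu>s n) 1 \<omega> \<le> 1"
        by (rule AE_passage_discount_bounds[OF pos]) simp
      then show ?thesis by (rule eventually_mono) auto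
    qed
    show "AE \<omega> in M. (\<lambda>n. passage_discount (\<mu>s n) 1 \<omega>) \<longlonglongrightarrow> 0"
      using AE_start
    proof eventually_elim
      case (elim \<omega>)
      have "\<forall>\<^sub>F s in at_right 0. X s \<omega> < 1"
        using right_continuous_paths[of \<omega> 0] elim by (intro order_tendstoD) auto
      then obtain d where d: "0 < d" "\<And>s. 0 < s \<Longrightarrow> s < d \<Longrightarrow> X s \<omega> < 1"
        by (auto simp: eventually_at_right[OF zero_less_one])
      have d': "d \<le> s" if "0 \<le> s" "1 < X s \<omega>" for s
        using d(2)[of s] that elim by (cases "s = 0") (auto simp: not_less[symmetric])
      have "crossing_discount \<mu> k 1 \<omega> \<le> exp (- d * \<mu>)" if \<mu>: "0 < \<mu>" for \<mu> k
      proof (cases "crosses k 1 \<omega>")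
        case True
        have "d \<le> crossing_time k 1 \<omega>"
          by (intro d' crossing_time_nonneg X_crossing_time True)
        then show ?thesis using True \<mu> by (simp add: crossing_discount_def)
      qed (simp add: crossing_discount_def)
      then have le: "passage_discount (\<mu>s n) 1 \<omega> \<le> exp (- d * \<mu>s n)" for n
        using elim pos by (intro LIMSEQ_le_const2[OF crossing_limit(1)]) auto
      have "filterlim (\<lambda>n. - d * \<mu>s n) at_bot sequentially"
        using \<mu>s d(1) by (intro filterlim_tendsto_neg_mult_at_bot[OF tendsto_const]) auto
      then have "(\<lambda>n. exp (- d * \<mu>s n)) \<longlonglongrightarrow> 0"
        by (rule filterlim_compose[OF exp_at_bot])
      then have lim: "(\<lambda>n. exp (- d * \<mu>s n)) \<longlonglongrightarrow> 0" .
      have "0 \<le> passage_discount (\<mu>s n) 1 \<omega>" for n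
        using crossing_limit(3)[of \<omega> 1 "\<mu>s n"] elim pos[of n] by simp
      with le show ?case
        by (intro tendsto_sandwich[OF always_eventually always_eventually tendsto_const lim] allI)
    qed
  qed auto
  then have "(\<lambda>n. passage (\<mu>s n) 1) \<longlonglongrightarrow> 0" by simp
  moreover have "passage (\<mu>s n) 1 > 0" for n
    using passage_exponential(2)[OF pos, of 1 n] by simp
  ultimately have "filterlim (\<lambda>n. passage (\<mu>s n) 1) (at_right 0) sequentially"
    by (auto simp: filterlim_at less_imp_neq[THEN not_sym])
  from filterlim_compose[OF ln_at_0 this] show ?thesis
    unfolding passage_rate_def by (simp add: filterlim_uminus_at_top)
qed

end

section \<open>Exponential moments and the Laplace exponent\<close>

text \<open>Convexity of the exponential function on the segment from \<open>0\<close> to \<open>a\<close>, obtained from the tangent at \<open>\<theta> a\<close>.\<close>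

lemma exp_convex_bound:
  fixes a \<theta> :: real
  assumes "0 \<le> \<theta>" "\<theta> \<le> 1"
  shows "exp (\<theta> * a) \<le> \<theta> * exp a + (1 - \<theta>)"
proof -
  have "exp (\<theta> * a) * (1 + (1 - \<theta>) * a) \<le> exp (\<theta> * a) * exp ((1 - \<theta>) * a)"
    by (intro mult_left_mono) auto
  also have "\<dots> = exp a" by (simp add: exp_add[symmetric] algebra_simps)
  finally have 1: "\<theta> * (exp (\<theta> * a) * (1 + (1 - \<theta>) * a)) \<le> \<theta> * exp a"
    using assms by (intro mult_left_mono) auto
  have "exp (\<theta> * a) * (1 + - (\<theta> * a)) \<le> exp (\<theta> * a) * exp (- (\<theta> * a))"
    by (rule mult_left_mono[OF exp_ge_add_one_self]) simp
  also have "\<dots> = 1" by (simp add: exp_add[symmetric] del: exp_minus)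
  finally have 2: "(1 - \<theta>) * (exp (\<theta> * a) * (1 + - (\<theta> * a))) \<le> (1 - \<theta>) * 1"
    using assms by (intro mult_left_mono) auto
  have "exp (\<theta> * a) = \<theta> * (exp (\<theta> * a) * (1 + (1 - \<theta>) * a)) + (1 - \<theta>) * (exp (\<theta> * a) * (1 + - (\<theta> * a)))"
    by (simp add: algebra_simps)
  also have "\<dots> \<le> \<theta> * exp a + (1 - \<theta>) * 1"
    by (rule add_mono[OF 1 2])
  finally show ?thesis by simp
qed

context spectrally_negative_levy
begin

abbreviation psi :: "real \<Rightarrow> real" where
  "psi \<equiv> laplace_exponent M X"

text \<open>The tails of \<open>X\<^sub>t\<close> decay at every rate \<open>passage_rate \<mu>\<close>, and these rates are unbounded, so every
  exponential moment is finite, with a bound locally uniform in \<open>t\<close>.\<close>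

lemma mean_exp_le:
  assumes \<beta>: "0 \<le> \<beta>"
  shows "\<exists>\<mu>>0. \<exists>A. \<forall>t\<ge>0. mean (\<lambda>x. ennreal (exp (\<beta> * x))) t \<le> ennreal (1 + A * exp (\<mu> * t))"
proof -
  have "filterlim (\<lambda>n. passage_rate (real (Suc n))) at_top sequentially"
    by (rule passage_rate_at_top[OF filterlim_sequentially_Suc[THEN iffD2, OF filterlim_real_sequentially]]) simp
  then have "\<forall>\<^sub>F n in sequentially. \<beta> < passage_rate (real (Suc n))"
    by (simp add: filterlim_at_top_dense)
  then obtain n where n: "\<beta> < passage_rate (real (Suc n))" by (auto simp: eventually_sequentially)
  define \<mu> where "\<mu> = real (Suc n)"
  define c where "c = passage_rate \<mu>"
  have \<mu>: "0 < \<mu>" and c: "\<beta> < c" using n by (auto simp: \<mu>_def c_def)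
  define q where "q = exp (\<beta> - c)"
  have q: "0 < q" "q < 1" using c by (auto simp: q_def)
  have "mean (\<lambda>x. ennreal (exp (\<beta> * x))) t \<le> ennreal (1 + (exp \<beta> / (1 - q)) * exp (\<mu> * t))" if t: "0 \<le> t" for t
  proof -
    note [measurable] = measurable_X[OF t]
    \<comment> \<open>Layers of unit width, to which the tail estimate applies.\<close>
    have pw: "ennreal (exp (\<beta> * x)) \<le> 1 + (\<Sum>k. ennreal (exp (\<beta> * (real k + 1))) * indicator {real k<..} x)" for x
    proof (cases "x \<le> 0")
      case True
      then have "exp (\<beta> * x) \<le> 1" using \<beta> by (simp add: mult_nonneg_nonpos)
      then have "ennreal (exp (\<beta> * x)) \<le> 1" by (simp add: ennreal_le_1)
      then show ?thesis by (rule order_trans) simp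
    next
      case False
      define k where "k = nat (\<lceil>x\<rceil> - 1)"
      have k: "real k = of_int \<lceil>x\<rceil> - 1"
        using False unfolding k_def by (subst of_nat_nat) auto
      have kx: "real k < x" "x \<le> real k + 1" unfolding k by linarith+
      have "ennreal (exp (\<beta> * x)) \<le> ennreal (exp (\<beta> * (real k + 1))) * indicator {real k<..} x"
        using kx \<beta> by (auto simp: mult_left_mono)
      also have "\<dots> \<le> (\<Sum>k. ennreal (exp (\<beta> * (real k + 1))) * indicator {real k<..} x)"
      proof -
        have "f k \<le> suminf f" for f :: "nat \<Rightarrow> ennreal"
          using sum_le_suminf[of f "{k}"] by simp
        then show ?thesis .
      qed
      also have "\<dots> \<le> 1 + \<dots>" by simp
      finally show ?thesis .
    qed
    have "mean (\<lambda>x. ennreal (exp (\<beta> * x))) t \<le>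
      (\<integral>\<^sup>+\<omega>. 1 + (\<Sum>k. ennreal (exp (\<beta> * (real k + 1))) * indicator {real k<..} (X t \<omega>)) \<partial>M)"
      unfolding mean_eq[OF t] by (intro nn_integral_mono pw)
    also have "\<dots> = 1 + (\<Sum>k. \<integral>\<^sup>+\<omega>. ennreal (exp (\<beta> * (real k + 1))) * indicator {real k<..} (X t \<omega>) \<partial>M)"
      by (subst nn_integral_add) (auto simp: emeasure_space_1 nn_integral_suminf)
    also have "\<dots> \<le> 1 + (\<Sum>k. ennreal (exp \<beta> * exp (\<mu> * t) * q ^ k))"
    proof (intro add_left_mono suminf_le)
      fix k :: nat
      have "(\<integral>\<^sup>+\<omega>. ennreal (exp (\<beta> * (real k + 1))) * indicator {real k<..} (X t \<omega>) \<partial>M) =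
         ennreal (exp (\<beta> * (real k + 1))) * (\<integral>\<^sup>+\<omega>. indicator {\<omega> \<in> space M. real k < X t \<omega>} \<omega> \<partial>M)"
        by (subst nn_integral_cmult[symmetric]) (auto intro!: nn_integral_cong split: split_indicator)
      also have "\<dots> = ennreal (exp (\<beta> * (real k + 1)) * prob {\<omega> \<in> space M. real k < X t \<omega>})"
        by (simp add: emeasure_eq_measure ennreal_mult'')
      also have "\<dots> \<le> ennreal (exp (\<beta> * (real k + 1)) * (exp (\<mu> * t) * exp (- c * real k)))"
        unfolding c_def by (intro ennreal_leI mult_left_mono tail_probability \<mu> t) auto
      also have "exp (\<beta> * (real k + 1)) * (exp (\<mu> * t) * exp (- c * real k)) = exp \<beta> * exp (\<mu> * t) * q ^ k"
        by (simp add: q_def exp_of_nat_mult[symmetric] exp_add[symmetric] algebra_simps)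
      finally show "(\<integral>\<^sup>+\<omega>. ennreal (exp (\<beta> * (real k + 1))) * indicator {real k<..} (X t \<omega>) \<partial>M) \<le> ennreal (exp \<beta> * exp (\<mu> * t) * q ^ k)" .
    qed auto
    also have "(\<Sum>k. ennreal (exp \<beta> * exp (\<mu> * t) * q ^ k)) = ennreal (\<Sum>k. exp \<beta> * exp (\<mu> * t) * q ^ k)"
      using q by (intro suminf_ennreal2 summable_mult summable_geometric) auto
    also have "(\<Sum>k. exp \<beta> * exp (\<mu> * t) * q ^ k) = exp \<beta> * exp (\<mu> * t) * (1 / (1 - q))"
      using q by (subst suminf_mult) (auto simp: suminf_geometric summable_geometric)
    also have "1 + ennreal (exp \<beta> * exp (\<mu> * t) * (1 / (1 - q))) = ennreal (1 + (exp \<beta> / (1 - q)) * exp (\<mu> * t))"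
      using q by (simp add: ennreal_plus mult.commute)
    finally show ?thesis .
  qed
  then show ?thesis using \<mu> by blast
qed

text \<open>The moment function is multiplicative in \<open>t\<close> by the Markov property and locally bounded, hence
  exponential; its exponent is \<open>psi \<beta>\<close> because the Laplace exponent is taken at \<open>t = 1\<close>.\<close>

lemma
  assumes \<beta>: "0 \<le> \<beta>" and t: "0 \<le> t"
  shows mean_exp: "mean (\<lambda>x. ennreal (exp (\<beta> * x))) t = ennreal (exp (t * psi \<beta>))"
    and integrable_exp: "integrable M (\<lambda>\<omega>. exp (\<beta> * X t \<omega>))"
    and integral_exp: "(LINT \<omega>|M. exp (\<beta> * X t \<omega>)) = exp (t * psi \<beta>)"
proof -
  let ?m = "\<lambda>t. mean (\<lambda>x. ennreal (exp (\<beta> * x))) t"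
  obtain \<mu> A where A: "\<mu> > 0" "\<And>t. 0 \<le> t \<Longrightarrow> ?m t \<le> ennreal (1 + A * exp (\<mu> * t))"
    using mean_exp_le[OF \<beta>] by blast
  have int: "integrable M (\<lambda>\<omega>. exp (\<beta> * X t \<omega>))" if t: "0 \<le> t" for t
  proof -
    note [measurable] = measurable_X[OF t]
    have "(\<integral>\<^sup>+\<omega>. ennreal (exp (\<beta> * X t \<omega>)) \<partial>M) < \<infinity>"
      using A(2)[OF t] mean_eq[OF t, of "\<lambda>x. ennreal (exp (\<beta> * x))"] by (auto intro: le_less_trans)
    then show ?thesis by (intro integrableI_nonneg) auto
  qed
  define r where "r t = (LINT \<omega>|M. exp (\<beta> * X t \<omega>))" for t
  have m_r: "?m t = ennreal (r t)" if "0 \<le> t" for t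
    unfolding mean_eq[OF that] r_def by (intro nn_integral_eq_integral int that) auto
  have r_pos: "0 < r t" if "0 \<le> t" for t
  proof -
    have "r t \<noteq> 0"
    proof
      assume "r t = 0"
      then have "(\<integral>\<^sup>+\<omega>. ennreal (exp (\<beta> * X t \<omega>)) \<partial>M) = 0"
        using m_r[OF that] mean_eq[OF that, of "\<lambda>x. ennreal (exp (\<beta> * x))"] by simp
      moreover note [measurable] = measurable_X[OF that]
      ultimately have "AE \<omega> in M. False"
        by (subst (asm) nn_integral_0_iff_AE) auto
      then show False by (simp add: AE_False)
    qed
    moreover have "0 \<le> r t" unfolding r_def by (intro Bochner_Integration.integral_nonneg) auto
    ultimately show ?thesis by simp
  qed
  have r_mult: "r (s + t) = r s * r t" if st: "0 \<le> s" "0 \<le> t" for s t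
  proof -
    note [measurable] = measurable_X[OF st(1)]
    have "ennreal (r (s + t)) = (\<integral>\<^sup>+\<omega>. mean (\<lambda>y. ennreal (exp (\<beta> * (X s \<omega> + y)))) t \<partial>M)"
      using st m_r[of "s + t"] semigroup[of "\<lambda>x. ennreal (exp (\<beta> * x))" s t] by simp
    also have "\<dots> = (\<integral>\<^sup>+\<omega>. ennreal (exp (\<beta> * X s \<omega>)) * ?m t \<partial>M)"
    proof (rule nn_integral_cong)
      fix \<omega>
      have "mean (\<lambda>y. ennreal (exp (\<beta> * (X s \<omega> + y)))) t = (\<integral>\<^sup>+\<omega>'. ennreal (exp (\<beta> * X s \<omega>)) * ennreal (exp (\<beta> * path_value t (path \<omega>'))) \<partial>M)"
        unfolding mean_def by (simp add: ennreal_mult'[symmetric] exp_add[symmetric] algebra_simps)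
      also have "\<dots> = ennreal (exp (\<beta> * X s \<omega>)) * ?m t"
        unfolding mean_def by (rule nn_integral_cmult) measurable
      finally show "mean (\<lambda>y. ennreal (exp (\<beta> * (X s \<omega> + y)))) t = ennreal (exp (\<beta> * X s \<omega>)) * ?m t" .
    qed
    also have "\<dots> = (\<integral>\<^sup>+\<omega>. ennreal (exp (\<beta> * X s \<omega>)) \<partial>M) * ?m t"
      by (rule nn_integral_multc) measurable
    also have "\<dots> = ennreal (r s * r t)"
      using m_r[OF st(1)] m_r[OF st(2)] mean_eq[OF st(1), of "\<lambda>x. ennreal (exp (\<beta> * x))"] r_pos[OF st(1)] r_pos[OF st(2)]
      by (simp add: ennreal_mult)
    finally show ?thesis using r_pos[OF st(1)] r_pos[OF st(2)] r_pos[of "s + t"] st by simp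
  qed
  have "ln (r t) = t * ln (r 1)" if t: "0 \<le> t" for t
  proof (rule additive_bounded_above_linear[where f="\<lambda>t. ln (r t)" and B="ln (1 + \<bar>A\<bar> * exp \<mu>)"])
    show "ln (r (s + t)) = ln (r s) + ln (r t)" if "0 \<le> s" "0 \<le> t" for s t
      using r_pos[OF that(1)] r_pos[OF that(2)] r_mult[OF that] by (simp add: ln_mult)
    show "ln (r t) \<le> ln (1 + \<bar>A\<bar> * exp \<mu>)" if t: "0 \<le> t" "t \<le> 1" for t
    proof -
      have "A * exp (\<mu> * t) \<le> \<bar>A\<bar> * exp \<mu>"
        using t A(1) by (intro mult_mono) (auto simp: mult_left_le)
      then have "ennreal (1 + A * exp (\<mu> * t)) \<le> ennreal (1 + \<bar>A\<bar> * exp \<mu>)"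
        by (intro ennreal_leI) linarith
      with A(2)[OF t(1)] have "ennreal (r t) \<le> ennreal (1 + \<bar>A\<bar> * exp \<mu>)"
        unfolding m_r[OF t(1)] by (rule order_trans)
      then have "r t \<le> 1 + \<bar>A\<bar> * exp \<mu>"
        by (subst (asm) ennreal_le_iff) (auto intro!: add_nonneg_nonneg)
      then show ?thesis using r_pos[OF t(1)] by (subst ln_le_cancel_iff) (auto intro: add_pos_nonneg)
    qed
  qed fact
  then have "r t = exp (t * ln (r 1))"
    using t r_pos[OF t] by (metis exp_ln)
  then have r: "r t = exp (t * psi \<beta>)"
    by (simp add: r_def laplace_exponent_def)
  then show "?m t = ennreal (exp (t * psi \<beta>))" using m_r[OF t] by simp
  show "integrable M (\<lambda>\<omega>. exp (\<beta> * X t \<omega>))" by (rule int[OF t])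
  show "(LINT \<omega>|M. exp (\<beta> * X t \<omega>)) = exp (t * psi \<beta>)" using r by (simp add: r_def)
qed

lemma nn_integral_exp_potential:
  assumes \<beta>: "0 \<le> \<beta>"
  shows "(\<integral>\<^sup>+z. ennreal (exp (\<beta> * z)) \<partial>potential \<mu>) = (if psi \<beta> < \<mu> then ennreal (1 / (\<mu> - psi \<beta>)) else \<infinity>)"
proof -
  have "(\<integral>\<^sup>+z. ennreal (exp (\<beta> * z)) \<partial>potential \<mu>) = (\<integral>\<^sup>+t. ennreal (exp (- (\<mu> - psi \<beta>) * t)) * indicator {0..} t \<partial>lborel)"
  proof -
    have "(\<integral>\<^sup>+z. ennreal (exp (\<beta> * z)) \<partial>potential \<mu>) =
      (\<integral>\<^sup>+t. ennreal (exp (- \<mu> * t)) * indicator {0..} t * mean (\<lambda>z. ennreal (exp (\<beta> * z))) t \<partial>lborel)"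
      by (rule nn_integral_potential) measurable
    also have "\<dots> = (\<integral>\<^sup>+t. ennreal (exp (- (\<mu> - psi \<beta>) * t)) * indicator {0..} t \<partial>lborel)"
    proof (intro nn_integral_cong)
      fix t :: real
      show "ennreal (exp (- \<mu> * t)) * indicator {0..} t * mean (\<lambda>z. ennreal (exp (\<beta> * z))) t =
        ennreal (exp (- (\<mu> - psi \<beta>) * t)) * indicator {0..} t"
      proof (cases "0 \<le> t")
        case True
        show ?thesis unfolding mean_exp[OF \<beta> True]
          by (simp add: ennreal_mult'[symmetric] exp_add[symmetric] algebra_simps split: split_indicator)
      qed simp
    qed
    finally show ?thesis .
  qed
  then show ?thesis unfolding nn_integral_exp_Ici by simp
qed

text \<open>The convexity bound above, with \<open>a = \<beta> X\<^sub>1 - psi \<beta>\<close>, whose exponential has mean one.\<close>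

lemma psi_star_shaped:
  assumes \<beta>: "0 \<le> \<beta>" and \<theta>: "0 \<le> \<theta>" "\<theta> \<le> 1"
  shows "psi (\<theta> * \<beta>) \<le> \<theta> * psi \<beta>"
proof -
  have int: "integrable M (\<lambda>\<omega>. exp (\<beta> * X 1 \<omega> - psi \<beta>))"
    using integrable_exp[OF \<beta>, of 1] by (simp add: exp_diff)
  have int2: "integrable M (\<lambda>\<omega>. exp (\<theta> * (\<beta> * X 1 \<omega> - psi \<beta>)))"
    using integrable_exp[of "\<theta> * \<beta>" 1] \<beta> \<theta> by (simp add: right_diff_distrib exp_diff mult.assoc)
  have "exp (psi (\<theta> * \<beta>) - \<theta> * psi \<beta>) = (LINT \<omega>|M. exp (\<theta> * (\<beta> * X 1 \<omega> - psi \<beta>)))"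
    using integral_exp[of "\<theta> * \<beta>" 1] \<beta> \<theta> by (simp add: right_diff_distrib exp_diff mult.assoc)
  also have "\<dots> \<le> (LINT \<omega>|M. \<theta> * exp (\<beta> * X 1 \<omega> - psi \<beta>) + (1 - \<theta>))"
    using int int2 \<theta> by (intro integral_mono exp_convex_bound) auto
  also have "\<dots> = \<theta> * (LINT \<omega>|M. exp (\<beta> * X 1 \<omega> - psi \<beta>)) + (1 - \<theta>)"
    using int by (simp add: prob_space)
  also have "(LINT \<omega>|M. exp (\<beta> * X 1 \<omega> - psi \<beta>)) = 1"
    using integral_exp[OF \<beta>, of 1] by (simp add: exp_diff)
  finally have "exp (psi (\<theta> * \<beta>) - \<theta> * psi \<beta>) \<le> exp 0" by simp
  then show ?thesis by (simp only: exp_le_cancel_iff)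
qed

text \<open>One-sided continuity of \<open>psi\<close>, by dominated convergence of the exponential moments.\<close>

lemma psi_left_limit:
  assumes \<beta>: "0 < \<beta>" and le: "\<And>b. 0 \<le> b \<Longrightarrow> b < \<beta> \<Longrightarrow> psi b \<le> \<mu>"
  shows "psi \<beta> \<le> \<mu>"
proof -
  define b where "b n = \<beta> * (1 - 1 / real (Suc n))" for n
  have b: "0 \<le> b n" "b n < \<beta>" for n using \<beta> by (auto simp: b_def field_simps)
  have "(\<lambda>n. \<beta> * (1 - 1 / real (Suc n))) \<longlonglongrightarrow> \<beta> * (1 - 0)"
    by (intro tendsto_intros LIMSEQ_Suc lim_1_over_n)
  then have b_lim: "b \<longlonglongrightarrow> \<beta>" by (simp add: b_def[abs_def])
  note [measurable] = measurable_X[of 1, simplified]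
  have "(\<lambda>n. LINT \<omega>|M. exp (b n * X 1 \<omega>)) \<longlonglongrightarrow> (LINT \<omega>|M. exp (\<beta> * X 1 \<omega>))"
  proof (rule integral_dominated_convergence[where w="\<lambda>\<omega>. 1 + exp (\<beta> * X 1 \<omega>)"])
    show "integrable M (\<lambda>\<omega>. 1 + exp (\<beta> * X 1 \<omega>))"
      using integrable_exp[of \<beta> 1] \<beta> by auto
    show "AE \<omega> in M. (\<lambda>n. exp (b n * X 1 \<omega>)) \<longlonglongrightarrow> exp (\<beta> * X 1 \<omega>)"
      by (intro AE_I2 tendsto_intros b_lim)
    show "AE \<omega> in M. norm (exp (b n * X 1 \<omega>)) \<le> 1 + exp (\<beta> * X 1 \<omega>)" for n
    proof (rule AE_I2)
      fix \<omega>
      show "norm (exp (b n * X 1 \<omega>)) \<le> 1 + exp (\<beta> * X 1 \<omega>)"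
      proof (cases "0 \<le> X 1 \<omega>")
        case True
        then have "exp (b n * X 1 \<omega>) \<le> exp (\<beta> * X 1 \<omega>)"
          using b[of n] by (auto intro: mult_right_mono)
        then show ?thesis by (simp del: exp_le_cancel_iff)
      next
        case False
        then have "exp (b n * X 1 \<omega>) \<le> 1" using b[of n] by (simp add: mult_nonneg_nonpos)
        then show ?thesis by (simp add: add_increasing2)
      qed
    qed
  qed auto
  moreover have "(LINT \<omega>|M. exp (b n * X 1 \<omega>)) \<le> exp \<mu>" for n
    using integral_exp[of "b n" 1] b[of n] le[of "b n"] by simp
  ultimately have "(LINT \<omega>|M. exp (\<beta> * X 1 \<omega>)) \<le> exp \<mu>"
    using LIMSEQ_le_const2 by blast
  then show ?thesis using integral_exp[of \<beta> 1] \<beta> by simp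
qed

text \<open>The constant \<open>C\<close> for which \<open>U\<^sub>\<mu>\<close> has density \<open>C e\<^bsup>-\<Phi>(\<mu>)z\<^esup>\<close> on \<open>(0, \<infinity>)\<close>.\<close>

definition potential_const :: "real \<Rightarrow> real" where
  "potential_const \<mu> = passage_rate \<mu> * measure (potential \<mu>) {0<..}"

lemma potential_const_pos: "0 < \<mu> \<Longrightarrow> 0 < potential_const \<mu>"
  unfolding potential_const_def using passage_exponential(1) potential_positive_half_line by simp

lemma nn_integral_exp_above:
  assumes "0 < c"
  shows "(\<integral>\<^sup>+z. ennreal (exp (- c * z)) * indicator {a<..} z \<partial>lborel) = ennreal (exp (- c * a) / c)"
proof -
  have "(\<integral>\<^sup>+z. ennreal (exp (- c * z)) * indicator {a<..} z \<partial>lborel) = (\<integral>\<^sup>+z. ennreal (exp (- c * z)) * indicator {a..} z \<partial>lborel)"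
    using AE_lborel_singleton[of a] by (intro nn_integral_cong_AE) (auto elim!: eventually_mono split: split_indicator)
  also have "\<dots> = (\<integral>\<^sup>+z. ennreal (exp (- c * (a + z))) * indicator {a..} (a + z) \<partial>lborel)"
    by (subst nn_integral_real_affine[where c=1 and t=a]) auto
  also have "\<dots> = (\<integral>\<^sup>+z. ennreal (exp (- c * a)) * (ennreal (exp (- c * z)) * indicator {0..} z) \<partial>lborel)"
    by (intro nn_integral_cong) (auto simp: ennreal_mult'[symmetric] exp_add[symmetric] algebra_simps split: split_indicator)
  also have "\<dots> = ennreal (exp (- c * a)) * (\<integral>\<^sup>+z. ennreal (exp (- c * z)) * indicator {0..} z \<partial>lborel)"
    by (rule nn_integral_cmult) measurable
  also have "\<dots> = ennreal (exp (- c * a) / c)"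
    unfolding nn_integral_exp_Ici using assms by (simp add: ennreal_mult''[symmetric])
  finally show ?thesis .
qed

lemma potential_density_positive:
  assumes \<mu>: "0 < \<mu>" and [measurable]: "g \<in> borel_measurable borel"
  shows "(\<integral>\<^sup>+z. g z * indicator {0<..} z \<partial>potential \<mu>) =
    (\<integral>\<^sup>+z. ennreal (potential_const \<mu> * exp (- passage_rate \<mu> * z)) * indicator {0<..} z * g z \<partial>lborel)"
proof -
  let ?c = "passage_rate \<mu>" and ?V = "measure (potential \<mu>) {0<..}"
  have c: "0 < ?c" by (rule passage_exponential(1)[OF \<mu>])
  interpret P: finite_measure "potential \<mu>" by (rule finite_measure_potential[OF \<mu>])
  have *: "{0<..} \<inter> {a<..} = {max a 0<..}" for a :: real by auto
  have "density (potential \<mu>) (indicator {0<..}) =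
    density lborel (\<lambda>z. ennreal (potential_const \<mu> * exp (- ?c * z)) * indicator {0<..} z)"
  proof (rule measure_eqI_lessThan)
    fix a :: real
    have 1: "emeasure (density (potential \<mu>) (indicator {0<..})) {a<..} = ennreal (?V * exp (- ?c * max a 0))"
    proof -
      have "emeasure (density (potential \<mu>) (indicator {0<..})) {a<..} = emeasure (potential \<mu>) ({0<..} \<inter> {a<..})"
        by (subst emeasure_density) (auto simp: indicator_inter_arith[symmetric])
      also have "\<dots> = ennreal (?V * exp (- ?c * max a 0))"
        unfolding * P.emeasure_eq_measure by (subst passage_exponential(3)[OF \<mu>]) auto
      finally show ?thesis .
    qed
    have "emeasure (density lborel (\<lambda>z. ennreal (potential_const \<mu> * exp (- ?c * z)) * indicator {0<..} z)) {a<..} =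
      (\<integral>\<^sup>+z. ennreal (potential_const \<mu>) * (ennreal (exp (- ?c * z)) * indicator {max a 0<..} z) \<partial>lborel)"
      by (subst emeasure_density)
         (auto intro!: nn_integral_cong simp: ennreal_mult'' split: split_indicator)
    also have "\<dots> = ennreal (potential_const \<mu>) * (\<integral>\<^sup>+z. ennreal (exp (- ?c * z)) * indicator {max a 0<..} z \<partial>lborel)"
      by (rule nn_integral_cmult) measurable
    also have "\<dots> = ennreal (?V * exp (- ?c * max a 0))"
      using c potential_const_pos[OF \<mu>] unfolding nn_integral_exp_above[OF c]
      by (subst ennreal_mult'[symmetric]) (auto simp: potential_const_def)
    finally show "emeasure (density (potential \<mu>) (indicator {0<..})) {a<..} =
      emeasure (density lborel (\<lambda>z. ennreal (potential_const \<mu> * exp (- ?c * z)) * indicator {0<..} z)) {a<..}"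
      using 1 by simp
    show "emeasure (density (potential \<mu>) (indicator {0<..})) {a<..} < \<infinity>" using 1 by simp
  qed auto
  from arg_cong[OF this, of "\<lambda>N. \<integral>\<^sup>+z. g z \<partial>N"] show ?thesis
    by (simp add: nn_integral_density mult.commute)
qed

text \<open>Both sides say that \<open>e\<^bsup>\<beta>z\<^esup>\<close> is integrable for \<open>U\<^sub>\<mu>\<close>: integrating over time first gives the left condition,
  and the exponential density on \<open>(0, \<infinity>)\<close> gives the right one.\<close>

lemma psi_less_iff:
  assumes \<mu>: "0 < \<mu>" and \<beta>: "0 \<le> \<beta>"
  shows "psi \<beta> < \<mu> \<longleftrightarrow> \<beta> < passage_rate \<mu>"
proof -
  let ?neg = "\<integral>\<^sup>+z. ennreal (exp (\<beta> * z)) * indicator {..0} z \<partial>potential \<mu>"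
  let ?pos = "\<integral>\<^sup>+z. ennreal (exp (\<beta> * z)) * indicator {0<..} z \<partial>potential \<mu>"
  let ?c = "passage_rate \<mu>" and ?C = "potential_const \<mu>"
  have C: "0 < ?C" by (rule potential_const_pos[OF \<mu>])
  have pos: "?pos =
    ennreal ?C * (\<integral>\<^sup>+z. ennreal (exp (- (?c - \<beta>) * z)) * indicator {0..} z \<partial>lborel)"
  proof -
    have "?pos =
      (\<integral>\<^sup>+z. ennreal (?C * exp (- ?c * z)) * indicator {0<..} z * ennreal (exp (\<beta> * z)) \<partial>lborel)"
      by (rule potential_density_positive[OF \<mu>]) measurable
    also have "\<dots> = (\<integral>\<^sup>+z. ennreal ?C * (ennreal (exp (- (?c - \<beta>) * z)) * indicator {0..} z) \<partial>lborel)"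
      using AE_lborel_singleton[of 0] C
      by (intro nn_integral_cong_AE)
        (auto elim!: eventually_mono split: split_indicator simp: ennreal_mult'[symmetric] mult.assoc exp_add[symmetric] algebra_simps)
    also have "\<dots> = ennreal ?C * (\<integral>\<^sup>+z. ennreal (exp (- (?c - \<beta>) * z)) * indicator {0..} z \<partial>lborel)"
      by (rule nn_integral_cmult) measurable
    finally show ?thesis .
  qed
  have neg: "?neg < \<infinity>"
  proof -
    have "?neg \<le> (\<integral>\<^sup>+z. 1 \<partial>potential \<mu>)"
      using \<beta> by (intro nn_integral_mono) (auto split: split_indicator simp: ennreal_le_1 mult_nonneg_nonpos)
    also have "\<dots> < \<infinity>" using \<mu> by (simp add: emeasure_potential_UNIV)
    finally show ?thesis .
  qed
  have split: "(\<integral>\<^sup>+z. ennreal (exp (\<beta> * z)) \<partial>potential \<mu>) =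
    ?neg +
    ?pos"
    by (subst nn_integral_add[symmetric]) (auto intro!: nn_integral_cong split: split_indicator)
  have "psi \<beta> < \<mu> \<longleftrightarrow> (\<integral>\<^sup>+z. ennreal (exp (\<beta> * z)) \<partial>potential \<mu>) < \<infinity>"
    unfolding nn_integral_exp_potential[OF \<beta>] by simp
  also have "\<dots> \<longleftrightarrow> ?pos < \<infinity>"
    unfolding split using neg by simp
  also have "\<dots> \<longleftrightarrow> \<beta> < ?c"
    unfolding pos nn_integral_exp_Ici using C by (simp add: ennreal_mult_less_top ennreal_mult_top)
  finally show ?thesis .
qed

lemma psi_passage_rate:
  assumes \<mu>: "0 < \<mu>" shows "psi (passage_rate \<mu>) = \<mu>"
proof (rule antisym)
  have c: "0 < passage_rate \<mu>" by (rule passage_exponential(1)[OF \<mu>])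
  show "psi (passage_rate \<mu>) \<le> \<mu>"
    using psi_less_iff[OF \<mu>] by (intro psi_left_limit[OF c]) (auto intro: less_imp_le)
  show "\<mu> \<le> psi (passage_rate \<mu>)"
    using psi_less_iff[OF \<mu>, of "passage_rate \<mu>"] c by simp
qed

text \<open>Since \<open>psi\<close> is star-shaped, it increases strictly once it is positive.\<close>

lemma psi_greater:
  assumes \<mu>: "0 < \<mu>" and \<beta>: "passage_rate \<mu> < \<beta>"
  shows "\<mu> < psi \<beta>"
proof -
  let ?c = "passage_rate \<mu>"
  have c: "0 < ?c" by (rule passage_exponential(1)[OF \<mu>])
  have "\<mu> = psi ((?c / \<beta>) * \<beta>)" using psi_passage_rate[OF \<mu>] c \<beta> by simp
  also have "\<dots> \<le> (?c / \<beta>) * psi \<beta>" using c \<beta> by (intro psi_star_shaped) auto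
  finally have le: "\<mu> \<le> (?c / \<beta>) * psi \<beta>" .
  then have "0 < (?c / \<beta>) * psi \<beta>" using \<mu> by linarith
  then have pos: "0 < psi \<beta>" using c \<beta> by (simp add: zero_less_divide_iff zero_less_mult_iff)
  have "(?c / \<beta>) * psi \<beta> < 1 * psi \<beta>" using c \<beta> pos by (intro mult_strict_right_mono) auto
  with le show ?thesis by simp
qed

lemma right_inverse_psi:
  assumes \<mu>: "0 < \<mu>" shows "right_inverse psi \<mu> = passage_rate \<mu>"
proof -
  have "{\<beta>. 0 \<le> \<beta> \<and> psi \<beta> = \<mu>} = {passage_rate \<mu>}"
  proof (intro equalityI subsetI)
    fix \<beta> assume "\<beta> \<in> {\<beta>. 0 \<le> \<beta> \<and> psi \<beta> = \<mu>}"
    then show "\<beta> \<in> {passage_rate \<mu>}"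
      using psi_less_iff[OF \<mu>, of \<beta>] psi_greater[OF \<mu>, of \<beta>] by force
  next
    fix \<beta> assume "\<beta> \<in> {passage_rate \<mu>}"
    then show "\<beta> \<in> {\<beta>. 0 \<le> \<beta> \<and> psi \<beta> = \<mu>}"
      using psi_passage_rate[OF \<mu>] passage_exponential(1)[OF \<mu>] by auto
  qed
  then show ?thesis by (simp add: right_inverse_def)
qed

lemma passage_rate_strict_mono:
  assumes "0 < \<mu>" "\<mu> < \<mu>'" shows "passage_rate \<mu> < passage_rate \<mu>'"
  using psi_less_iff[of \<mu>' "passage_rate \<mu>"] psi_passage_rate[of \<mu>] passage_exponential(1)[of \<mu>] assms by auto

end

section \<open>The potential density\<close>

text \<open>With the sum of two measures, the density of \<open>U\<^sub>\<mu>\<close> can be found without a subtraction of measures.\<close>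

definition plus_measure :: "'b measure \<Rightarrow> 'b measure \<Rightarrow> 'b measure" where
  "plus_measure P Q = measure_of (space P) (sets P) (\<lambda>A. emeasure P A + emeasure Q A)"

lemma sets_plus_measure [simp, measurable_cong]: "sets (plus_measure P Q) = sets P"
  by (simp add: plus_measure_def)

lemma space_plus_measure [simp]: "space (plus_measure P Q) = space P"
  by (simp add: plus_measure_def)

lemma emeasure_plus_measure:
  assumes "sets Q = sets P" "A \<in> sets P"
  shows "emeasure (plus_measure P Q) A = emeasure P A + emeasure Q A"
  unfolding plus_measure_def
proof (rule emeasure_measure_of_sigma)
  show "sigma_algebra (space P) (sets P)" ..
  show "positive (sets P) (\<lambda>A. emeasure P A + emeasure Q A)" by (simp add: positive_def)
  show "countably_additive (sets P) (\<lambda>A. emeasure P A + emeasure Q A)"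
  proof (rule countably_additiveI)
    fix A :: "nat \<Rightarrow> 'a set"
    assume A: "range A \<subseteq> sets P" "disjoint_family A"
    have "(\<Sum>i. emeasure P (A i) + emeasure Q (A i)) = (\<Sum>i. emeasure P (A i)) + (\<Sum>i. emeasure Q (A i))"
      by (rule suminf_add[symmetric]) auto
    then show "(\<Sum>i. emeasure P (A i) + emeasure Q (A i)) = emeasure P (\<Union>i. A i) + emeasure Q (\<Union>i. A i)"
      using A assms(1) by (simp add: suminf_emeasure)
  qed
qed fact

lemma nn_integral_plus_measure:
  assumes Q: "sets Q = sets P" and f: "f \<in> borel_measurable P"
  shows "(\<integral>\<^sup>+x. f x \<partial>plus_measure P Q) = (\<integral>\<^sup>+x. f x \<partial>P) + (\<integral>\<^sup>+x. f x \<partial>Q)"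
proof -
  have sp: "space Q = space P" using Q by (rule sets_eq_imp_space_eq)
  note [measurable_cong] = Q
  show ?thesis using f
  proof (induction rule: borel_measurable_induct)
    case (cong f g)
    then show ?case using sp by (simp cong: nn_integral_cong_simp)
  next
    case (set A)
    then show ?case using Q by (simp add: emeasure_plus_measure)
  next
    case (mult u c)
    then show ?case by (simp add: nn_integral_cmult distrib_left)
  next
    case (add u v)
    then show ?case by (simp add: nn_integral_add ac_simps)
  next
    case (seq U)
    have *: "(\<integral>\<^sup>+x. (SUP i. U i x) \<partial>N) = (SUP i. \<integral>\<^sup>+x. U i x \<partial>N)" if "sets N = sets P" for N
    proof -
      note [measurable_cong] = that
      show ?thesis using seq by (intro nn_integral_monotone_convergence_SUP) auto
    qed
    have "(SUP i. (\<integral>\<^sup>+x. U i x \<partial>P) + (\<integral>\<^sup>+x. U i x \<partial>Q)) = (SUP i. \<integral>\<^sup>+x. U i x \<partial>P) + (SUP i. \<integral>\<^sup>+x. U i x \<partial>Q)"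
      using seq(3) by (intro ennreal_SUP_add) (auto simp: incseq_def le_fun_def intro!: nn_integral_mono)
    then show ?case using Q by (simp add: * SUP_apply image_image seq)
  qed
qed

lemma scale_function_measurable:
  assumes "scale_function \<psi> q W" shows "W \<in> borel_measurable borel"
proof -
  have "(\<lambda>x. indicator {0..} x *\<^sub>R W x) \<in> borel_measurable borel"
    using assms by (intro borel_measurable_continuous_on_indicator) (auto simp: scale_function_def)
  also have "(\<lambda>x. indicator {0..} x *\<^sub>R W x) = W"
    using assms by (auto simp: scale_function_def fun_eq_iff indicator_def)
  finally show ?thesis .
qed

lemma scale_function_nonneg: "scale_function \<psi> q W \<Longrightarrow> 0 \<le> W x"
  by (cases "x < 0") (auto simp: scale_function_def)

context spectrally_negative_levy
begin

lemma nn_integral_exp_scale_function: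
  assumes \<mu>: "0 < \<mu>" and W: "scale_function psi \<mu> W" and \<beta>: "passage_rate \<mu> < \<beta>"
  shows "(\<integral>\<^sup>+x. ennreal (W x) * ennreal (exp (- \<beta> * x)) \<partial>lborel) = ennreal (1 / (psi \<beta> - \<mu>))"
proof -
  have "set_integrable lborel {0..} (\<lambda>x. exp (- \<beta> * x) * W x)" "(LBINT x:{0..}. exp (- \<beta> * x) * W x) = 1 / (psi \<beta> - \<mu>)"
    using W \<beta> by (auto simp: scale_function_def right_inverse_psi[OF \<mu>])
  then have "(\<integral>\<^sup>+x. ennreal (indicator {0..} x * (exp (- \<beta> * x) * W x)) \<partial>lborel) = ennreal (1 / (psi \<beta> - \<mu>))"
    using scale_function_nonneg[OF W]
    by (subst nn_integral_eq_integral) (auto simp: set_integrable_def set_lebesgue_integral_def)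
  moreover have "indicator {0..} x * (exp (- \<beta> * x) * W x) = W x * exp (- \<beta> * x)" for x
    using W by (auto simp: scale_function_def indicator_def)
  ultimately have "(\<integral>\<^sup>+x. ennreal (W x * exp (- \<beta> * x)) \<partial>lborel) = ennreal (1 / (psi \<beta> - \<mu>))"
    by (simp only:)
  then show ?thesis by (simp add: ennreal_mult'')
qed

text \<open>For \<open>\<beta> > \<Phi>(\<mu>)\<close> the function \<open>e\<^bsup>\<beta>z\<^esup>\<close> is not integrable for \<open>U\<^sub>\<mu>\<close>, but it is for \<open>U\<^sub>\<mu>\<^sub>'\<close> with
  \<open>\<mu>' = psi \<beta> + 1\<close>. The resolvent equation for \<open>\<mu>\<close> and \<open>\<mu>'\<close> is therefore applied to the truncations
  \<open>e\<^bsup>\<beta>z\<^esup> 1\<^bsub>z \<le> n\<^esub>\<close>. The measure \<open>k(z) dz\<close> with \<open>k(z) = C e\<^bsup>-\<Phi>(\<mu>)z\<^esup>\<close> agrees with \<open>U\<^sub>\<mu>\<close> on \<open>(0, \<infinity>)\<close> and solves the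
  homogeneous resolvent equation. In the difference of the two equations the terms from the positive half-line,
  which blow up with \<open>n\<close>, cancel; what is left converges and can be solved for the Laplace transform on the
  negative half-line.\<close>

lemma laplace_potential_negative:
  assumes \<mu>: "0 < \<mu>" and \<beta>: "passage_rate \<mu> < \<beta>"
  shows "(\<integral>\<^sup>+z. ennreal (exp (\<beta> * z)) * indicator {..0} z \<partial>potential \<mu>) + ennreal (1 / (psi \<beta> - \<mu>)) =
    ennreal (potential_const \<mu> / (\<beta> - passage_rate \<mu>))"
proof -
  define \<Phi> where "\<Phi> = passage_rate \<mu>"
  define C where "C = potential_const \<mu>"
  \<comment> \<open>With this choice \<open>e\<^bsup>\<beta>w\<^esup>\<close> has integral exactly \<open>1\<close> for \<open>U\<^sub>\<mu>\<^sub>'\<close>.\<close>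
  define \<mu>' where "\<mu>' = psi \<beta> + 1"
  define \<delta> where "\<delta> = \<mu>' - \<mu>"
  have C: "0 < C" unfolding C_def by (rule potential_const_pos[OF \<mu>])
  have \<Phi>: "0 < \<Phi>" unfolding \<Phi>_def by (rule passage_exponential(1)[OF \<mu>])
  have \<beta>\<Phi>: "\<Phi> < \<beta>" using \<beta> by (simp add: \<Phi>_def)
  have psi\<beta>: "\<mu> < psi \<beta>" by (rule psi_greater[OF \<mu> \<beta>])
  have \<mu>': "\<mu> < \<mu>'" "0 < \<mu>'" using psi\<beta> \<mu> by (auto simp: \<mu>'_def)
  have \<delta>: "1 < \<delta>" "\<delta> - 1 = psi \<beta> - \<mu>" using psi\<beta> by (auto simp: \<delta>_def \<mu>'_def)
  interpret U': finite_measure "potential \<mu>'" by (rule finite_measure_potential[OF \<mu>'(2)])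
  interpret LU: pair_sigma_finite lborel "potential \<mu>'" ..
  have full: "(\<integral>\<^sup>+w. ennreal (exp (\<beta> * w)) \<partial>potential \<mu>') = 1"
    using nn_integral_exp_potential[of \<beta> \<mu>'] \<beta>\<Phi> \<Phi> by (simp add: \<mu>'_def)
  have fullP: "(\<integral>\<^sup>+w. ennreal (exp (\<Phi> * w)) \<partial>potential \<mu>') = ennreal (1 / \<delta>)"
    using nn_integral_exp_potential[of \<Phi> \<mu>'] \<Phi> \<mu>' psi_passage_rate[OF \<mu>] by (simp add: \<delta>_def \<Phi>_def)
  define g where "g n z = ennreal (exp (\<beta> * z)) * indicator {..real n} z" for n :: nat and z
  have g_m [measurable]: "g n \<in> borel_measurable borel" for n unfolding g_def[abs_def] by measurable
  have g_le: "g n z \<le> ennreal (exp (\<beta> * z))" for n z by (auto simp: g_def split: split_indicator)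
  have g_inc: "g n z \<le> g m z" if "n \<le> m" for n m z
    using that by (auto simp: g_def split: split_indicator)
  have g_lim: "(\<lambda>n. g n z) \<longlonglongrightarrow> ennreal (exp (\<beta> * z))" for z
  proof (rule tendsto_eventually)
    obtain m where "z \<le> real m" using real_arch_simple by blast
    then show "\<forall>\<^sub>F n in sequentially. g n z = ennreal (exp (\<beta> * z))"
      unfolding eventually_sequentially by (intro exI[of _ m]) (auto simp: g_def)
  qed
  define A where "A n z = (\<integral>\<^sup>+w. g n (z + w) \<partial>potential \<mu>')" for n z
  have A_m [measurable]: "A n \<in> borel_measurable borel" for n unfolding A_def[abs_def] by measurable
  have A_inc: "A n z \<le> A m z" if "n \<le> m" for n m z
    unfolding A_def by (intro nn_integral_mono g_inc that)
  have A_lim: "(\<lambda>n. A n z) \<longlonglongrightarrow> ennreal (exp (\<beta> * z))" for z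
  proof -
    have "(\<lambda>n. A n z) \<longlonglongrightarrow> (\<integral>\<^sup>+w. ennreal (exp (\<beta> * (z + w))) \<partial>potential \<mu>')"
      unfolding A_def
      by (rule nn_integral_LIMSEQ) (auto simp: incseq_def le_fun_def intro!: g_inc g_lim)
    also have "(\<integral>\<^sup>+w. ennreal (exp (\<beta> * (z + w))) \<partial>potential \<mu>') = (\<integral>\<^sup>+w. ennreal (exp (\<beta> * z)) * ennreal (exp (\<beta> * w)) \<partial>potential \<mu>')"
      by (intro nn_integral_cong) (simp add: ennreal_mult'[symmetric] exp_add[symmetric] distrib_left)
    also have "\<dots> = ennreal (exp (\<beta> * z)) * (\<integral>\<^sup>+w. ennreal (exp (\<beta> * w)) \<partial>potential \<mu>')"
      by (rule nn_integral_cmult) measurable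
    finally show ?thesis by (simp add: full)
  qed
  define k where "k z = ennreal (C * exp (- \<Phi> * z))" for z
  have [measurable]: "k \<in> borel_measurable borel" unfolding k_def[abs_def] by measurable
  \<comment> \<open>Here \<open>a\<close> is the unknown; in the other names \<open>p\<close> and \<open>m\<close> stand for the positive and the negative half-line,
    \<open>E\<close> for the measure \<open>k(z) dz\<close> and \<open>U\<close> for \<open>U\<^sub>\<mu>\<close>.\<close>
  define a where "a = (\<integral>\<^sup>+z. ennreal (exp (\<beta> * z)) * indicator {..0} z \<partial>potential \<mu>)"
  define b where "b n = (\<integral>\<^sup>+z. g n z \<partial>potential \<mu>')" for n
  define Ep where "Ep n = (\<integral>\<^sup>+z. k z * indicator {0<..} z * g n z \<partial>lborel)" for n
  define Em where "Em = (\<integral>\<^sup>+z. k z * indicator {..0} z * ennreal (exp (\<beta> * z)) \<partial>lborel)"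
  define EpA where "EpA n = (\<integral>\<^sup>+z. k z * indicator {0<..} z * A n z \<partial>lborel)" for n
  define EmA where "EmA n = (\<integral>\<^sup>+z. k z * indicator {..0} z * A n z \<partial>lborel)" for n
  define UmA where "UmA n = (\<integral>\<^sup>+z. A n z * indicator {..0} z \<partial>potential \<mu>)" for n
  have split: "(\<integral>\<^sup>+z. h z \<partial>potential \<mu>) = (\<integral>\<^sup>+z. h z * indicator {..0} z \<partial>potential \<mu>) + (\<integral>\<^sup>+z. k z * indicator {0<..} z * h z \<partial>lborel)"
    if [measurable]: "h \<in> borel_measurable borel" for h
  proof -
    have "(\<integral>\<^sup>+z. h z \<partial>potential \<mu>) = (\<integral>\<^sup>+z. h z * indicator {..0} z + h z * indicator {0<..} z \<partial>potential \<mu>)"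
      by (intro nn_integral_cong) (auto split: split_indicator)
    also have "\<dots> = (\<integral>\<^sup>+z. h z * indicator {..0} z \<partial>potential \<mu>) + (\<integral>\<^sup>+z. h z * indicator {0<..} z \<partial>potential \<mu>)"
      by (rule nn_integral_add) measurable
    finally show ?thesis
      unfolding potential_density_positive[OF \<mu> that] by (simp add: k_def C_def \<Phi>_def)
  qed
  have res: "a + Ep n = b n + ennreal \<delta> * (UmA n + EpA n)" for n
  proof -
    have "(\<integral>\<^sup>+z. g n z * indicator {..0} z \<partial>potential \<mu>) = a"
      unfolding a_def by (intro nn_integral_cong) (auto simp: g_def split: split_indicator)
    then have "(\<integral>\<^sup>+z. g n z \<partial>potential \<mu>) = a + Ep n" using split[OF g_m] by (simp add: Ep_def)
    moreover have "(\<integral>\<^sup>+z. A n z \<partial>potential \<mu>) = UmA n + EpA n" using split[OF A_m] by (simp add: UmA_def EpA_def)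
    ultimately show ?thesis
      using resolvent_equation[of "g n" \<mu> \<mu>'] \<mu> \<mu>' by (simp add: b_def A_def \<delta>_def)
  qed
  \<comment> \<open>The homogeneous equation for \<open>k(z) dz\<close>: shifting by \<open>w\<close> multiplies \<open>k\<close> by \<open>e\<^bsup>\<Phi>w\<^esup>\<close>, whose integral for
    \<open>U\<^sub>\<mu>\<^sub>'\<close> is \<open>1 / \<delta>\<close>.\<close>
  have harm: "Ep n + Em = ennreal \<delta> * (EpA n + EmA n)" for n
  proof -
    have E: "(\<integral>\<^sup>+z. k z * h z \<partial>lborel) = (\<integral>\<^sup>+z. k z * indicator {0<..} z * h z \<partial>lborel) + (\<integral>\<^sup>+z. k z * indicator {..0} z * h z \<partial>lborel)"
      if [measurable]: "h \<in> borel_measurable borel" for h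
      by (subst nn_integral_add[symmetric]) (auto intro!: nn_integral_cong split: split_indicator)
    have "EpA n + EmA n = (\<integral>\<^sup>+z. k z * A n z \<partial>lborel)"
      using E[OF A_m] by (simp add: EpA_def EmA_def)
    also have "\<dots> = (\<integral>\<^sup>+z. \<integral>\<^sup>+w. k z * g n (z + w) \<partial>potential \<mu>' \<partial>lborel)"
      unfolding A_def by (intro nn_integral_cong nn_integral_cmult[symmetric]) measurable
    also have "\<dots> = (\<integral>\<^sup>+w. \<integral>\<^sup>+z. k z * g n (z + w) \<partial>lborel \<partial>potential \<mu>')"
      by (rule LU.Fubini'[symmetric]) measurable
    also have "\<dots> = (\<integral>\<^sup>+w. ennreal (exp (\<Phi> * w)) * (\<integral>\<^sup>+z. k z * g n z \<partial>lborel) \<partial>potential \<mu>')"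
    proof (rule nn_integral_cong)
      fix w
      have "(\<integral>\<^sup>+z. k z * g n (z + w) \<partial>lborel) = (\<integral>\<^sup>+z. k (- w + z) * g n (- w + z + w) \<partial>lborel)"
        by (subst nn_integral_real_affine[where c=1 and t="- w"]) auto
      also have "\<dots> = (\<integral>\<^sup>+z. ennreal (exp (\<Phi> * w)) * (k z * g n z) \<partial>lborel)"
      proof (rule nn_integral_cong)
        fix z
        have "k (- w + z) = ennreal (exp (\<Phi> * w)) * k z"
          unfolding k_def using C by (subst ennreal_mult'[symmetric]) (auto simp: exp_add[symmetric] exp_diff algebra_simps)
        then show "k (- w + z) * g n (- w + z + w) = ennreal (exp (\<Phi> * w)) * (k z * g n z)"
          by (simp add: mult.assoc)
      qed
      also have "\<dots> = ennreal (exp (\<Phi> * w)) * (\<integral>\<^sup>+z. k z * g n z \<partial>lborel)"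
        by (rule nn_integral_cmult) measurable
      finally show "(\<integral>\<^sup>+z. k z * g n (z + w) \<partial>lborel) = ennreal (exp (\<Phi> * w)) * (\<integral>\<^sup>+z. k z * g n z \<partial>lborel)" .
    qed
    also have "\<dots> = ennreal (1 / \<delta>) * (\<integral>\<^sup>+z. k z * g n z \<partial>lborel)"
      by (subst nn_integral_multc) (auto simp: fullP)
    also have "(\<integral>\<^sup>+z. k z * g n z \<partial>lborel) = Ep n + Em"
    proof -
      have "(\<integral>\<^sup>+z. k z * indicator {..0} z * g n z \<partial>lborel) = Em"
        unfolding Em_def by (intro nn_integral_cong) (auto simp: g_def split: split_indicator)
      then show ?thesis using E[OF g_m] by (simp add: Ep_def)
    qed
    finally have "ennreal \<delta> * (EpA n + EmA n) = ennreal \<delta> * (ennreal (1 / \<delta>) * (Ep n + Em))" by simp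
    also have "\<dots> = Ep n + Em" using \<delta>(1) by (simp add: mult.assoc[symmetric] ennreal_mult''[symmetric])
    finally show ?thesis ..
  qed
  have Em: "Em = ennreal (C / (\<beta> - \<Phi>))"
  proof -
    have "Em = (\<integral>\<^sup>+x. k (- x) * indicator {..0} (- x) * ennreal (exp (\<beta> * (- x))) \<partial>lborel)"
      unfolding Em_def by (subst nn_integral_real_affine[where c="-1" and t=0]) auto
    also have "\<dots> = (\<integral>\<^sup>+x. ennreal C * (ennreal (exp (- (\<beta> - \<Phi>) * x)) * indicator {0..} x) \<partial>lborel)"
      using C by (intro nn_integral_cong)
        (auto simp: k_def ennreal_mult'[symmetric] ennreal_mult''[symmetric] mult.assoc exp_add[symmetric] algebra_simps split: split_indicator)
    also have "\<dots> = ennreal C * (\<integral>\<^sup>+x. ennreal (exp (- (\<beta> - \<Phi>) * x)) * indicator {0..} x \<partial>lborel)"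
      by (rule nn_integral_cmult) measurable
    also have "\<dots> = ennreal (C / (\<beta> - \<Phi>))"
      unfolding nn_integral_exp_Ici using \<beta>\<Phi> C by (simp add: ennreal_mult''[symmetric])
    finally show ?thesis .
  qed
  have a_fin: "a < \<infinity>"
  proof -
    have "a \<le> (\<integral>\<^sup>+z. 1 \<partial>potential \<mu>)"
      unfolding a_def using \<beta>\<Phi> \<Phi> by (intro nn_integral_mono) (auto split: split_indicator simp: ennreal_le_1 mult_nonneg_nonpos)
    then show ?thesis using \<mu> by (simp add: emeasure_potential_UNIV le_less_trans)
  qed
  have b_fin: "b n < \<infinity>" for n
  proof -
    have "b n \<le> 1" unfolding b_def full[symmetric] by (intro nn_integral_mono g_le)
    then show ?thesis by (simp add: le_less_trans)
  qed
  have Ep_fin: "Ep n < \<infinity>" for n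
  proof -
    have "Ep n \<le> (\<integral>\<^sup>+z. ennreal (C * exp (\<beta> * real n)) * indicator {0..real n} z \<partial>lborel)"
      unfolding Ep_def
    proof (rule nn_integral_mono)
      fix z :: real
      have "C * exp (- \<Phi> * z) * exp (\<beta> * z) \<le> C * 1 * exp (\<beta> * real n)" if "0 < z" "z \<le> real n"
        using that C \<Phi> \<beta>\<Phi> by (intro mult_mono) auto
      then show "k z * indicator {0<..} z * g n z \<le> ennreal (C * exp (\<beta> * real n)) * indicator {0..real n} z"
        using C by (auto simp: k_def g_def ennreal_mult''[symmetric] split: split_indicator intro!: ennreal_leI)
    qed
    also have "\<dots> < \<infinity>" by (simp add: nn_integral_cmult_indicator ennreal_mult_less_top)
    finally show ?thesis .
  qed
  \<comment> \<open>Subtraction of the two equations; all terms are finite for each \<open>n\<close>, so it is carried out in the reals.\<close>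
  have key: "a + ennreal \<delta> * EmA n = b n + ennreal \<delta> * UmA n + Em" for n
  proof -
    have "ennreal \<delta> * (EpA n + EmA n) < \<infinity>" unfolding harm[symmetric] using Ep_fin Em by simp
    then have fin1: "EpA n < \<infinity>" "EmA n < \<infinity>" using \<delta> by (auto simp: ennreal_mult_less_top)
    have "ennreal \<delta> * (UmA n + EpA n) \<le> a + Ep n" unfolding res by simp
    also have "\<dots> < \<infinity>" using a_fin Ep_fin by simp
    finally have fin2: "UmA n < \<infinity>" using \<delta> by (auto simp: ennreal_mult_less_top)
    obtain a' where a': "a = ennreal a'" "0 \<le> a'" using a_fin by (cases a) auto
    obtain b' where b': "b n = ennreal b'" "0 \<le> b'" using b_fin[of n] by (cases "b n") auto
    obtain e' where e': "Ep n = ennreal e'" "0 \<le> e'" using Ep_fin[of n] by (cases "Ep n") auto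
    obtain p' where p': "EpA n = ennreal p'" "0 \<le> p'" using fin1 by (cases "EpA n") auto
    obtain m' where m': "EmA n = ennreal m'" "0 \<le> m'" using fin1 by (cases "EmA n") auto
    obtain u' where u': "UmA n = ennreal u'" "0 \<le> u'" using fin2 by (cases "UmA n") auto
    define em where "em = C / (\<beta> - \<Phi>)"
    have em: "0 \<le> em" using C \<beta>\<Phi> by (simp add: em_def)
    have \<delta>0: "0 \<le> \<delta>" using \<delta> by simp
    have "ennreal (a' + e') = ennreal (b' + \<delta> * (u' + p'))"
      using res[of n] a' b' e' p' u' \<delta>0 by (simp add: ennreal_plus ennreal_mult)
    then have 1: "a' + e' = b' + \<delta> * (u' + p')"
      using a' b' e' p' u' \<delta>0 by (subst (asm) ennreal_inj) auto
    have "ennreal (e' + em) = ennreal (\<delta> * (p' + m'))"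
      using harm[of n] Em em e' p' m' \<delta>0 by (simp add: ennreal_plus ennreal_mult em_def[symmetric])
    then have 2: "e' + em = \<delta> * (p' + m')"
      using em e' p' m' \<delta>0 by (subst (asm) ennreal_inj) auto
    have "a' + \<delta> * m' = b' + \<delta> * u' + em" using 1 2 by (simp add: distrib_left)
    then have "ennreal (a' + \<delta> * m') = ennreal (b' + \<delta> * u' + em)" by simp
    then show ?thesis
      using a' b' m' u' em \<delta>0 Em by (simp add: ennreal_plus ennreal_mult em_def[symmetric])
  qed
  have "(\<lambda>n. a + ennreal \<delta> * EmA n) \<longlonglongrightarrow> a + ennreal \<delta> * Em"
  proof (intro tendsto_add tendsto_const ennreal_tendsto_cmult)
    show "EmA \<longlonglongrightarrow> Em" unfolding EmA_def[abs_def] Em_def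
      by (rule nn_integral_LIMSEQ)
         (auto simp: incseq_def le_fun_def intro!: mult_left_mono A_inc ennreal_tendsto_cmult A_lim simp: k_def ennreal_mult_less_top split: split_indicator)
  qed simp
  moreover have "(\<lambda>n. b n + ennreal \<delta> * UmA n + Em) \<longlonglongrightarrow> 1 + ennreal \<delta> * a + Em"
  proof (intro tendsto_add tendsto_const ennreal_tendsto_cmult)
    show "b \<longlonglongrightarrow> 1" unfolding b_def[abs_def] full[symmetric]
      by (rule nn_integral_LIMSEQ) (auto simp: incseq_def le_fun_def intro!: g_inc g_lim)
    show "UmA \<longlonglongrightarrow> a" unfolding UmA_def[abs_def] a_def
      by (rule nn_integral_LIMSEQ)
         (auto simp: incseq_def le_fun_def intro!: mult_right_mono A_inc A_lim split: split_indicator)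
  qed simp
  ultimately have lim: "a + ennreal \<delta> * Em = 1 + ennreal \<delta> * a + Em"
    unfolding key using LIMSEQ_unique by blast
  obtain a' where a': "a = ennreal a'" "0 \<le> a'" using a_fin by (cases a) auto
  define em where "em = C / (\<beta> - \<Phi>)"
  have em: "0 \<le> em" using C \<beta>\<Phi> by (simp add: em_def)
  have \<delta>0: "0 \<le> \<delta>" using \<delta> by simp
  have "ennreal (a' + \<delta> * em) = ennreal (1 + \<delta> * a' + em)"
    using lim a' em \<delta>0 Em by (simp add: ennreal_plus ennreal_mult em_def[symmetric])
  then have "a' + \<delta> * em = 1 + \<delta> * a' + em"
    using a' em \<delta>0 by (subst (asm) ennreal_inj) auto
  then have "(\<delta> - 1) * em = 1 + (\<delta> - 1) * a'" by (simp add: algebra_simps)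
  then have "em = a' + 1 / (psi \<beta> - \<mu>)"
    using \<delta> psi\<beta> by (simp add: \<delta>(2) field_simps)
  then have "ennreal em = ennreal a' + ennreal (1 / (psi \<beta> - \<mu>))"
    using a' psi\<beta> by (simp add: ennreal_plus)
  then show ?thesis using a' by (simp add: a_def em_def C_def \<Phi>_def)
qed

text \<open>The formula \<open>U\<^sub>\<mu>(dz) = (C e\<^bsup>-\<Phi>(\<mu>)z\<^esup> - W(-z)) dz\<close>, with the term of \<open>W\<close> moved to the other side. On the
  negative half-line both sides, reflected, have the same Laplace transform by the previous lemma; on the
  positive half-line \<open>W(-z) = 0\<close> and the density is known.\<close>

lemma potential_density:
  assumes \<mu>: "0 < \<mu>" and W: "scale_function psi \<mu> W" and g [measurable]: "g \<in> borel_measurable borel"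
  shows "(\<integral>\<^sup>+z. g z \<partial>potential \<mu>) + (\<integral>\<^sup>+z. ennreal (W (- z)) * g z \<partial>lborel) =
    (\<integral>\<^sup>+z. ennreal (potential_const \<mu> * exp (- passage_rate \<mu> * z)) * g z \<partial>lborel)"
proof -
  let ?\<Phi> = "passage_rate \<mu>" and ?C = "potential_const \<mu>"
  have C: "0 < ?C" by (rule potential_const_pos[OF \<mu>])
  note W_m [measurable] = scale_function_measurable[OF W]
  define P1 where "P1 = distr (density (potential \<mu>) (indicator {..0})) borel uminus"
  define P2 where "P2 = density lborel (\<lambda>x. ennreal (W x))"
  define Q where "Q = density lborel (\<lambda>x. ennreal (?C * exp (?\<Phi> * x)) * indicator {0..} x)"
  have sets [measurable_cong]: "sets P1 = sets borel" "sets P2 = sets borel" "sets Q = sets borel"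
    by (simp_all add: P1_def P2_def Q_def)
  have int1: "(\<integral>\<^sup>+x. h x \<partial>P1) = (\<integral>\<^sup>+z. h (- z) * indicator {..0} z \<partial>potential \<mu>)" if [measurable]: "h \<in> borel_measurable borel" for h
    unfolding P1_def by (simp add: nn_integral_distr nn_integral_density mult.commute)
  have int2: "(\<integral>\<^sup>+x. h x \<partial>P2) = (\<integral>\<^sup>+x. ennreal (W x) * h x \<partial>lborel)" if [measurable]: "h \<in> borel_measurable borel" for h
    unfolding P2_def by (simp add: nn_integral_density)
  have int3: "(\<integral>\<^sup>+x. h x \<partial>Q) = (\<integral>\<^sup>+x. ennreal (?C * exp (?\<Phi> * x)) * indicator {0..} x * h x \<partial>lborel)" if [measurable]: "h \<in> borel_measurable borel" for h
    unfolding Q_def by (simp add: nn_integral_density)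
  have lapQ: "(\<integral>\<^sup>+x. ennreal (exp (- \<beta> * x)) \<partial>Q) = ennreal (?C / (\<beta> - ?\<Phi>))" if \<beta>: "?\<Phi> < \<beta>" for \<beta>
  proof -
    have "(\<integral>\<^sup>+x. ennreal (exp (- \<beta> * x)) \<partial>Q) = (\<integral>\<^sup>+x. ennreal ?C * (ennreal (exp (- (\<beta> - ?\<Phi>) * x)) * indicator {0..} x) \<partial>lborel)"
      using C by (subst int3) (auto intro!: nn_integral_cong
          simp: ennreal_mult'[symmetric] ennreal_mult''[symmetric] mult.assoc exp_add[symmetric] algebra_simps split: split_indicator)
    also have "\<dots> = ennreal ?C * (\<integral>\<^sup>+x. ennreal (exp (- (\<beta> - ?\<Phi>) * x)) * indicator {0..} x \<partial>lborel)"
      by (rule nn_integral_cmult) measurable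
    also have "\<dots> = ennreal (?C / (\<beta> - ?\<Phi>))"
      unfolding nn_integral_exp_Ici using \<beta> C by (simp add: ennreal_mult''[symmetric])
    finally show ?thesis .
  qed
  have "plus_measure P1 P2 = Q"
  proof (rule laplace_transform_determines_measure[where b="?\<Phi>"])
    fix \<beta> assume \<beta>: "?\<Phi> < \<beta>"
    have "(\<integral>\<^sup>+x. ennreal (exp (- \<beta> * x)) \<partial>plus_measure P1 P2) = (\<integral>\<^sup>+x. ennreal (exp (- \<beta> * x)) \<partial>P1) + (\<integral>\<^sup>+x. ennreal (exp (- \<beta> * x)) \<partial>P2)"
      by (rule nn_integral_plus_measure) (auto simp: sets)
    also have "\<dots> = (\<integral>\<^sup>+z. ennreal (exp (\<beta> * z)) * indicator {..0} z \<partial>potential \<mu>) + ennreal (1 / (psi \<beta> - \<mu>))"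
      using nn_integral_exp_scale_function[OF \<mu> W \<beta>] by (simp add: int1 int2)
    also have "\<dots> = ennreal (?C / (\<beta> - ?\<Phi>))" by (rule laplace_potential_negative[OF \<mu> \<beta>])
    finally have *: "(\<integral>\<^sup>+x. ennreal (exp (- \<beta> * x)) \<partial>plus_measure P1 P2) = ennreal (?C / (\<beta> - ?\<Phi>))" .
    show "(\<integral>\<^sup>+x. ennreal (exp (- \<beta> * x)) \<partial>plus_measure P1 P2) < \<infinity>" unfolding * by simp
    show "(\<integral>\<^sup>+x. ennreal (exp (- \<beta> * x)) \<partial>plus_measure P1 P2) = (\<integral>\<^sup>+x. ennreal (exp (- \<beta> * x)) \<partial>Q)"
      unfolding * lapQ[OF \<beta>] ..
  next
    have "emeasure P1 {..<0} = 0"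
    proof -
      have "emeasure P1 {..<0} = (\<integral>\<^sup>+x. indicator {..<0} x \<partial>P1)" by (simp add: sets)
      also have "\<dots> = (\<integral>\<^sup>+z. indicator {..<0} (- z) * indicator {..0} z \<partial>potential \<mu>)"
        by (rule int1) simp
      also have "\<dots> = (\<integral>\<^sup>+z. 0 \<partial>potential \<mu>)"
        by (rule nn_integral_cong) (auto split: split_indicator)
      finally show ?thesis by simp
    qed
    moreover have "emeasure P2 {..<0} = 0"
    proof -
      have "emeasure P2 {..<0} = (\<integral>\<^sup>+x. indicator {..<0} x \<partial>P2)" by (simp add: sets)
      also have "\<dots> = (\<integral>\<^sup>+x. ennreal (W x) * indicator {..<0} x \<partial>lborel)"
        by (rule int2) simp
      also have "\<dots> = (\<integral>\<^sup>+z. 0 \<partial>(lborel :: real measure))"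
        by (rule nn_integral_cong) (use W in \<open>auto simp: scale_function_def split: split_indicator\<close>)
      finally show ?thesis by simp
    qed
    ultimately have "emeasure (plus_measure P1 P2) {..<0} = 0"
      by (subst emeasure_plus_measure) (auto simp: sets)
    then show "AE x in plus_measure P1 P2. 0 \<le> x"
      by (intro AE_I[of _ _ "{..<0}"]) (auto simp: sets)
    show "AE x in Q. 0 \<le> x" unfolding Q_def by (subst AE_density) (auto split: split_indicator)
  qed (simp_all add: sets)
  then have plus: "(\<integral>\<^sup>+x. h x \<partial>P1) + (\<integral>\<^sup>+x. h x \<partial>P2) = (\<integral>\<^sup>+x. h x \<partial>Q)" if [measurable]: "h \<in> borel_measurable borel" for h
    using nn_integral_plus_measure[of P2 P1 h] by (simp add: sets measurable_cong_sets[OF sets(1) refl])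
  have refl: "(\<integral>\<^sup>+z. h z \<partial>lborel) = (\<integral>\<^sup>+z. h (- z) \<partial>lborel)" if [measurable]: "h \<in> borel_measurable borel" for h :: "real \<Rightarrow> ennreal"
    by (subst nn_integral_real_affine[where c="-1" and t=0]) auto
  have "(\<integral>\<^sup>+z. g z \<partial>potential \<mu>) = (\<integral>\<^sup>+z. g z * indicator {..0} z + g z * indicator {0<..} z \<partial>potential \<mu>)"
    by (intro nn_integral_cong) (auto split: split_indicator)
  also have "\<dots> = (\<integral>\<^sup>+z. g z * indicator {..0} z \<partial>potential \<mu>) + (\<integral>\<^sup>+z. g z * indicator {0<..} z \<partial>potential \<mu>)"
    by (rule nn_integral_add) measurable
  also have "(\<integral>\<^sup>+z. g z * indicator {..0} z \<partial>potential \<mu>) = (\<integral>\<^sup>+x. g (- x) \<partial>P1)"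
    by (subst int1) auto
  finally have 1: "(\<integral>\<^sup>+z. g z \<partial>potential \<mu>) = (\<integral>\<^sup>+x. g (- x) \<partial>P1) + (\<integral>\<^sup>+z. g z * indicator {0<..} z \<partial>potential \<mu>)" .
  have 2: "(\<integral>\<^sup>+z. ennreal (W (- z)) * g z \<partial>lborel) = (\<integral>\<^sup>+x. g (- x) \<partial>P2)"
    by (subst int2) (auto simp: refl[of "\<lambda>z. ennreal (W (- z)) * g z"])
  have 3: "(\<integral>\<^sup>+x. g (- x) \<partial>Q) = (\<integral>\<^sup>+z. ennreal (?C * exp (- ?\<Phi> * z)) * indicator {..0} z * g z \<partial>lborel)"
    by (subst int3) (auto simp: refl[of "\<lambda>z. ennreal (?C * exp (- (?\<Phi> * z))) * indicator {..0} z * g z"] intro!: nn_integral_cong split: split_indicator)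
  have "(\<integral>\<^sup>+z. g z \<partial>potential \<mu>) + (\<integral>\<^sup>+z. ennreal (W (- z)) * g z \<partial>lborel) =
     (\<integral>\<^sup>+z. ennreal (?C * exp (- ?\<Phi> * z)) * indicator {..0} z * g z \<partial>lborel) + (\<integral>\<^sup>+z. g z * indicator {0<..} z \<partial>potential \<mu>)"
    unfolding 1 2 3[symmetric] by (subst plus[symmetric]) (auto simp: ac_simps)
  also have "(\<integral>\<^sup>+z. g z * indicator {0<..} z \<partial>potential \<mu>) = (\<integral>\<^sup>+z. ennreal (?C * exp (- ?\<Phi> * z)) * indicator {0<..} z * g z \<partial>lborel)"
    by (rule potential_density_positive[OF \<mu> g])
  also have "(\<integral>\<^sup>+z. ennreal (?C * exp (- ?\<Phi> * z)) * indicator {..0} z * g z \<partial>lborel) + \<dots> = (\<integral>\<^sup>+z. ennreal (?C * exp (- ?\<Phi> * z)) * g z \<partial>lborel)"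
    by (subst nn_integral_add[symmetric]) (auto intro!: nn_integral_cong split: split_indicator)
  finally show ?thesis .
qed

end

section \<open>Resolvents with killing on the negative half-line\<close>

lemma
  assumes a: "0 < (a::real)"
  shows integrable_exp_Ici: "integrable lborel (\<lambda>y. exp (- a * y) * indicator {0..} y)"
    and integral_exp_Ici: "(LINT y|lborel. exp (- a * y) * indicator {0..} y) = 1 / a"
proof -
  have *: "(\<integral>\<^sup>+y. ennreal (exp (- a * y) * indicator {0..} y) \<partial>lborel) = ennreal (1 / a)"
    using nn_integral_exp_Ici[of a] a by (simp add: ennreal_mult'' ennreal_indicator)
  show "integrable lborel (\<lambda>y. exp (- a * y) * indicator {0..} y)"
    by (rule integrableI_nonneg) (use * in auto)
  show "(LINT y|lborel. exp (- a * y) * indicator {0..} y) = 1 / a"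
    by (subst integral_eq_nn_integral) (use a * in auto)
qed

lemma
  assumes a: "0 < (a::real)"
  shows integrable_exp_Iio: "integrable lborel (\<lambda>y. exp (a * y) * indicator {..<0} y)"
    and integral_exp_Iio: "(LINT y|lborel. exp (a * y) * indicator {..<0} y) = 1 / a"
proof -
  have ae: "AE y in lborel. exp (- a * y) * indicator {0..} y = exp (a * (0 + - 1 * y)) * indicator {..<0} (0 + - 1 * y)"
    using AE_lborel_singleton[of 0] by eventually_elim (auto split: split_indicator)
  have "integrable lborel (\<lambda>y. exp (a * (0 + - 1 * y)) * indicator {..<0} (0 + - 1 * y))"
    by (rule integrable_cong_AE_imp[OF integrable_exp_Ici[OF a]]) (use ae in auto)
  then show "integrable lborel (\<lambda>y. exp (a * y) * indicator {..<0} y)"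
    by (subst (asm) lborel_integrable_real_affine_iff) auto
  have "(LINT y|lborel. exp (a * y) * indicator {..<0} y) = (LINT y|lborel. exp (a * (0 + - 1 * y)) * indicator {..<0} (0 + - 1 * y))"
    by (subst lborel_integral_real_affine[where c="-1" and t=0]) auto
  also have "\<dots> = (LINT y|lborel. exp (- a * y) * indicator {0..} y)"
    using ae by (intro integral_cong_AE) auto
  finally show "(LINT y|lborel. exp (a * y) * indicator {..<0} y) = 1 / a"
    unfolding integral_exp_Ici[OF a] .
qed

context spectrally_negative_levy
begin

definition resolvent :: "real \<Rightarrow> (real \<Rightarrow> real) \<Rightarrow> real \<Rightarrow> real" where
  "resolvent \<mu> g x = (LINT z|potential \<mu>. g (x + z))"

lemma potential_density_integral_nonneg:
  assumes \<mu>: "0 < \<mu>" and W: "scale_function psi \<mu> W" and g [measurable]: "g \<in> borel_measurable borel"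
    and int: "integrable lborel (\<lambda>z. exp (- passage_rate \<mu> * z) * g z)" and nn: "\<And>z. 0 \<le> g z"
  shows "integrable (potential \<mu>) g \<and> integrable lborel (\<lambda>z. W (- z) * g z) \<and>
    (LINT z|potential \<mu>. g z) = potential_const \<mu> * (LINT z|lborel. exp (- passage_rate \<mu> * z) * g z) - (LINT z|lborel. W (- z) * g z)"
proof -
  let ?\<Phi> = "passage_rate \<mu>" and ?C = "potential_const \<mu>"
  have C: "0 < ?C" by (rule potential_const_pos[OF \<mu>])
  note W_m [measurable] = scale_function_measurable[OF W]
  note W_nn = scale_function_nonneg[OF W]
  have "(\<integral>\<^sup>+z. ennreal (?C * exp (- ?\<Phi> * z)) * ennreal (g z) \<partial>lborel) = (\<integral>\<^sup>+z. ennreal (?C * (exp (- ?\<Phi> * z) * g z)) \<partial>lborel)"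
    using C nn by (intro nn_integral_cong) (simp add: ennreal_mult''[symmetric] mult.assoc)
  also have "\<dots> = ennreal (?C * (LINT z|lborel. exp (- ?\<Phi> * z) * g z))"
    using C nn int by (subst nn_integral_eq_integral) auto
  finally have eq: "(\<integral>\<^sup>+z. ennreal (g z) \<partial>potential \<mu>) + (\<integral>\<^sup>+z. ennreal (W (- z) * g z) \<partial>lborel) =
     ennreal (?C * (LINT z|lborel. exp (- ?\<Phi> * z) * g z))"
    using potential_density[OF \<mu> W, of "\<lambda>z. ennreal (g z)"] nn W_nn by (simp add: ennreal_mult'')
  then have "(\<integral>\<^sup>+z. ennreal (g z) \<partial>potential \<mu>) + (\<integral>\<^sup>+z. ennreal (W (- z) * g z) \<partial>lborel) < \<infinity>"
    by simp
  then have fin: "(\<integral>\<^sup>+z. ennreal (g z) \<partial>potential \<mu>) < \<infinity>" "(\<integral>\<^sup>+z. ennreal (W (- z) * g z) \<partial>lborel) < \<infinity>"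
    by (auto simp: less_top[symmetric])
  have i1: "integrable (potential \<mu>) g" using fin(1) nn by (intro integrableI_nonneg) auto
  have i2: "integrable lborel (\<lambda>z. W (- z) * g z)" using fin(2) nn W_nn by (intro integrableI_nonneg) auto
  have nn1: "0 \<le> (LINT z|potential \<mu>. g z)" using nn by (intro Bochner_Integration.integral_nonneg)
  have nn2: "0 \<le> (LINT z|lborel. W (- z) * g z)" using nn W_nn by (intro Bochner_Integration.integral_nonneg) auto
  have nn3: "0 \<le> (LINT z|lborel. exp (- ?\<Phi> * z) * g z)" using nn by (intro Bochner_Integration.integral_nonneg) auto
  have "ennreal ((LINT z|potential \<mu>. g z) + (LINT z|lborel. W (- z) * g z)) = ennreal (?C * (LINT z|lborel. exp (- ?\<Phi> * z) * g z))"
    using eq i1 i2 nn W_nn nn1 nn2 by (simp add: nn_integral_eq_integral ennreal_plus)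
  then have "(LINT z|potential \<mu>. g z) + (LINT z|lborel. W (- z) * g z) = ?C * (LINT z|lborel. exp (- ?\<Phi> * z) * g z)"
    using nn1 nn2 nn3 C by (subst (asm) ennreal_inj) auto
  then show ?thesis using i1 i2 by simp
qed

lemma potential_density_integral:
  assumes \<mu>: "0 < \<mu>" and W: "scale_function psi \<mu> W" and g [measurable]: "g \<in> borel_measurable borel"
    and int: "integrable lborel (\<lambda>z. exp (- passage_rate \<mu> * z) * g z)"
  shows "integrable (potential \<mu>) g \<and> integrable lborel (\<lambda>z. W (- z) * g z) \<and>
    (LINT z|potential \<mu>. g z) = potential_const \<mu> * (LINT z|lborel. exp (- passage_rate \<mu> * z) * g z) - (LINT z|lborel. W (- z) * g z)"
proof -
  let ?e = "\<lambda>z. exp (- passage_rate \<mu> * z)"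
  define g1 where "g1 z = max (g z) 0" for z
  define g2 where "g2 z = max (- g z) 0" for z
  have gm [measurable]: "g1 \<in> borel_measurable borel" "g2 \<in> borel_measurable borel"
    unfolding g1_def[abs_def] g2_def[abs_def] by measurable
  have gn: "0 \<le> g1 z" "0 \<le> g2 z" for z by (auto simp: g1_def g2_def)
  have g: "g z = g1 z - g2 z" for z by (auto simp: g1_def g2_def max_def)
  have e1: "integrable lborel (\<lambda>z. ?e z * g1 z)"
    by (rule Bochner_Integration.integrable_bound[OF int]) (auto simp: g1_def abs_mult)
  have e2: "integrable lborel (\<lambda>z. ?e z * g2 z)"
    by (rule Bochner_Integration.integrable_bound[OF int]) (auto simp: g2_def abs_mult)
  have 1: "integrable (potential \<mu>) g1" "integrable lborel (\<lambda>z. W (- z) * g1 z)"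
    "(LINT z|potential \<mu>. g1 z) = potential_const \<mu> * (LINT z|lborel. ?e z * g1 z) - (LINT z|lborel. W (- z) * g1 z)"
    using potential_density_integral_nonneg[OF \<mu> W gm(1) e1 gn(1)] by blast+
  have 2: "integrable (potential \<mu>) g2" "integrable lborel (\<lambda>z. W (- z) * g2 z)"
    "(LINT z|potential \<mu>. g2 z) = potential_const \<mu> * (LINT z|lborel. ?e z * g2 z) - (LINT z|lborel. W (- z) * g2 z)"
    using potential_density_integral_nonneg[OF \<mu> W gm(2) e2 gn(2)] by blast+
  have "integrable (potential \<mu>) (\<lambda>z. g1 z - g2 z)" using 1 2 by simp
  moreover have "integrable lborel (\<lambda>z. W (- z) * (g1 z - g2 z))"
    using 1 2 by (simp add: right_diff_distrib)
  moreover have "(LINT z|potential \<mu>. g1 z - g2 z) = potential_const \<mu> * (LINT z|lborel. ?e z * (g1 z - g2 z)) - (LINT z|lborel. W (- z) * (g1 z - g2 z))"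
    using 1 2 e1 e2 by (simp add: right_diff_distrib)
  ultimately show ?thesis by (simp add: g[symmetric])
qed

text \<open>The density of \<open>U\<^sub>\<mu>\<close> translated to the starting point \<open>x\<close>.\<close>

lemma
  assumes \<mu>: "0 < \<mu>" and W: "scale_function psi \<mu> W" and g [measurable]: "g \<in> borel_measurable borel"
    and int: "integrable lborel (\<lambda>y. exp (- passage_rate \<mu> * y) * g y)"
  shows integrable_resolvent_kernel: "integrable (potential \<mu>) (\<lambda>z. g (x + z))"
    and integrable_scale_convolution: "integrable lborel (\<lambda>y. W (x - y) * g y)"
    and resolvent_kernel: "resolvent \<mu> g x = potential_const \<mu> * exp (passage_rate \<mu> * x) * (LINT y|lborel. exp (- passage_rate \<mu> * y) * g y)
      - (LINT y|lborel. W (x - y) * g y)"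
proof -
  let ?\<Phi> = "passage_rate \<mu>"
  note W_m [measurable] = scale_function_measurable[OF W]
  have eq: "exp (- ?\<Phi> * z) * g (x + z) = exp (?\<Phi> * x) * (exp (- ?\<Phi> * (x + 1 * z)) * g (x + 1 * z))" for z
    by (simp add: exp_add[symmetric] mult.assoc[symmetric] algebra_simps)
  have "integrable lborel (\<lambda>z. exp (- ?\<Phi> * (x + 1 * z)) * g (x + 1 * z))"
    using int by (subst lborel_integrable_real_affine_iff[where f="\<lambda>y. exp (- ?\<Phi> * y) * g y"]) auto
  then have int': "integrable lborel (\<lambda>z. exp (- ?\<Phi> * z) * g (x + z))"
    unfolding eq by (rule integrable_mult_right)
  have val: "(LINT z|lborel. exp (- ?\<Phi> * z) * g (x + z)) = exp (?\<Phi> * x) * (LINT y|lborel. exp (- ?\<Phi> * y) * g y)"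
    unfolding eq by (subst lborel_integral_real_affine[where c=1 and t=x and f="\<lambda>y. exp (- ?\<Phi> * y) * g y"]) auto
  have D: "integrable (potential \<mu>) (\<lambda>z. g (x + z))" "integrable lborel (\<lambda>z. W (- z) * g (x + z))"
    "(LINT z|potential \<mu>. g (x + z)) = potential_const \<mu> * (LINT z|lborel. exp (- ?\<Phi> * z) * g (x + z)) - (LINT z|lborel. W (- z) * g (x + z))"
    using potential_density_integral[OF \<mu> W _ int'] by auto
  show "integrable (potential \<mu>) (\<lambda>z. g (x + z))" by fact
  have w: "W (- z) * g (x + z) = W (x - (x + 1 * z)) * g (x + 1 * z)" for z by simp
  show "integrable lborel (\<lambda>y. W (x - y) * g y)"
    using D(2) unfolding w by (subst (asm) lborel_integrable_real_affine_iff[where f="\<lambda>y. W (x - y) * g y"]) auto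
  have "(LINT z|lborel. W (- z) * g (x + z)) = (LINT y|lborel. W (x - y) * g y)"
    unfolding w by (subst lborel_integral_real_affine[where c=1 and t=x and f="\<lambda>y. W (x - y) * g y"]) auto
  then show "resolvent \<mu> g x = potential_const \<mu> * exp (?\<Phi> * x) * (LINT y|lborel. exp (- ?\<Phi> * y) * g y)
      - (LINT y|lborel. W (x - y) * g y)"
    unfolding resolvent_def D(3) val by simp
qed

text \<open>For \<open>\<theta> < \<Phi>(\<mu>)\<close> the full exponential has resolvent \<open>e\<^bsup>\<theta>x\<^esup> / (\<mu> - psi \<theta>)\<close>, from which the part on \<open>[0, \<infinity>)\<close>
  is subtracted; for \<open>\<theta> > \<Phi>(\<mu>)\<close> the kernel is applied directly, and the Laplace transform of \<open>W\<close> over the whole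
  half-line supplies the term with \<open>1 / (\<mu> - psi \<theta>)\<close>. Both give the same formula.\<close>

lemma resolvent_exp_negative:
  assumes \<mu>: "0 < \<mu>" and W: "scale_function psi \<mu> (W \<mu>)" and \<theta>: "0 \<le> \<theta>" "\<theta> \<noteq> passage_rate \<mu>"
  shows "resolvent \<mu> (\<lambda>y. exp (\<theta> * y) * indicator {..<0} y) x =
    scale_Z psi W \<mu> x \<theta> / (\<mu> - psi \<theta>) - potential_const \<mu> * exp (passage_rate \<mu> * x) / (passage_rate \<mu> - \<theta>)"
proof -
  let ?\<Phi> = "passage_rate \<mu>" and ?C = "potential_const \<mu>"
  note W_m [measurable] = scale_function_measurable[OF W]
  have W0: "W \<mu> y = 0" if "y < 0" for y using W that by (simp add: scale_function_def)
  define I where "I = (LBINT y:{0..x}. exp (- \<theta> * y) * W \<mu> y)"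
  have I: "I = (LINT z|lborel. indicator {..x} z * (exp (- \<theta> * z) * W \<mu> z))"
    unfolding I_def set_lebesgue_integral_def using W0
    by (intro Bochner_Integration.integral_cong) (auto split: split_indicator simp: not_le)
  have Z: "scale_Z psi W \<mu> x \<theta> = exp (\<theta> * x) * (1 + (\<mu> - psi \<theta>) * I)"
    by (auto simp: scale_Z_def I_def set_lebesgue_integral_def)
  have flip: "(LINT y|lborel. W \<mu> (x - y) * (exp (\<theta> * y) * h y)) = exp (\<theta> * x) * (LINT z|lborel. h (x - z) * (exp (- \<theta> * z) * W \<mu> z))"
    if [measurable]: "h \<in> borel_measurable borel" for h
  proof -
    have "(LINT y|lborel. W \<mu> (x - y) * (exp (\<theta> * y) * h y)) =
      (LINT z|lborel. W \<mu> (x - (x + - 1 * z)) * (exp (\<theta> * (x + - 1 * z)) * h (x + - 1 * z)))"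
      by (subst lborel_integral_real_affine[where c="-1" and t=x]) auto
    also have "\<dots> = (LINT z|lborel. exp (\<theta> * x) * (h (x - z) * (exp (- \<theta> * z) * W \<mu> z)))"
      by (intro Bochner_Integration.integral_cong) (simp_all add: exp_diff exp_minus right_diff_distrib field_simps)
    finally show ?thesis by simp
  qed
  show ?thesis
  proof (cases "\<theta> < ?\<Phi>")
    case True
    have psi: "psi \<theta> < \<mu>" using psi_less_iff[OF \<mu> \<theta>(1)] True by simp
    have nn: "(\<integral>\<^sup>+z. ennreal (exp (\<theta> * z)) \<partial>potential \<mu>) = ennreal (1 / (\<mu> - psi \<theta>))"
      using nn_integral_exp_potential[OF \<theta>(1), of \<mu>] psi by simp
    have i: "integrable (potential \<mu>) (\<lambda>z. exp (\<theta> * z))"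
      by (rule integrableI_nonneg) (use nn in auto)
    then have i1: "integrable (potential \<mu>) (\<lambda>z. exp (\<theta> * (x + z)))"
      by (simp add: distrib_left exp_add)
    have v: "(LINT z|potential \<mu>. exp (\<theta> * z)) = 1 / (\<mu> - psi \<theta>)"
      using psi by (subst integral_eq_nn_integral) (auto simp: nn)
    have v1: "(LINT z|potential \<mu>. exp (\<theta> * (x + z))) = exp (\<theta> * x) / (\<mu> - psi \<theta>)"
      using v by (simp add: distrib_left exp_add)
    let ?g = "\<lambda>y. exp (\<theta> * y) * indicator {0..} y"
    have gm: "?g \<in> borel_measurable borel" by measurable
    have e: "exp (- ?\<Phi> * y) * ?g y = exp (- (?\<Phi> - \<theta>) * y) * indicator {0..} y" for y
    proof -
      have "exp (- ?\<Phi> * y) * exp (\<theta> * y) = exp (- (?\<Phi> - \<theta>) * y)"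
        by (simp add: exp_add[symmetric] algebra_simps)
      then show ?thesis by (metis mult.assoc)
    qed
    have gi: "integrable lborel (\<lambda>y. exp (- ?\<Phi> * y) * ?g y)"
      unfolding e by (rule integrable_exp_Ici) (use True in simp)
    have gv: "(LINT y|lborel. exp (- ?\<Phi> * y) * ?g y) = 1 / (?\<Phi> - \<theta>)"
      unfolding e by (rule integral_exp_Ici) (use True in simp)
    have wv: "(LINT y|lborel. W \<mu> (x - y) * ?g y) = exp (\<theta> * x) * I"
    proof -
      have *: "indicator {0..} (x - z) = (indicator {..x} z :: real)" for z by (auto split: split_indicator)
      show ?thesis unfolding I by (subst flip) (auto simp: *)
    qed
    have R: "resolvent \<mu> ?g x = ?C * exp (?\<Phi> * x) * (1 / (?\<Phi> - \<theta>)) - exp (\<theta> * x) * I"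
      unfolding resolvent_kernel[OF \<mu> W gm gi, of x] gv wv by (rule refl)
    have i2: "integrable (potential \<mu>) (\<lambda>z. ?g (x + z))"
      by (rule integrable_resolvent_kernel[OF \<mu> W _ gi]) measurable
    have "resolvent \<mu> (\<lambda>y. exp (\<theta> * y) * indicator {..<0} y) x = (LINT z|potential \<mu>. exp (\<theta> * (x + z)) - ?g (x + z))"
      unfolding resolvent_def by (intro Bochner_Integration.integral_cong) (auto split: split_indicator)
    also have "\<dots> = exp (\<theta> * x) / (\<mu> - psi \<theta>) - resolvent \<mu> ?g x"
      using i1 i2 v1 by (simp add: resolvent_def)
    also have "\<dots> = scale_Z psi W \<mu> x \<theta> / (\<mu> - psi \<theta>) - ?C * exp (?\<Phi> * x) / (?\<Phi> - \<theta>)"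
      unfolding R Z using psi by (simp add: field_simps)
    finally show ?thesis .
  next
    case False
    then have less: "?\<Phi> < \<theta>" using \<theta> by simp
    have psi: "\<mu> < psi \<theta>" by (rule psi_greater[OF \<mu> less])
    let ?g = "\<lambda>y. exp (\<theta> * y) * indicator {..<0} y"
    have gm: "?g \<in> borel_measurable borel" by measurable
    have e: "exp (- ?\<Phi> * y) * ?g y = exp ((\<theta> - ?\<Phi>) * y) * indicator {..<0} y" for y
    proof -
      have "exp (- ?\<Phi> * y) * exp (\<theta> * y) = exp ((\<theta> - ?\<Phi>) * y)"
        by (simp add: exp_add[symmetric] algebra_simps)
      then show ?thesis by (metis mult.assoc)
    qed
    have gi: "integrable lborel (\<lambda>y. exp (- ?\<Phi> * y) * ?g y)"
      unfolding e by (rule integrable_exp_Iio) (use less in simp)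
    have gv: "(LINT y|lborel. exp (- ?\<Phi> * y) * ?g y) = 1 / (\<theta> - ?\<Phi>)"
      unfolding e by (rule integral_exp_Iio) (use less in simp)
    have full: "integrable lborel (\<lambda>z. exp (- \<theta> * z) * W \<mu> z)" "(LINT z|lborel. exp (- \<theta> * z) * W \<mu> z) = 1 / (psi \<theta> - \<mu>)"
    proof -
      have *: "set_integrable lborel {0..} (\<lambda>x. exp (- \<theta> * x) * W \<mu> x)" "(LBINT x:{0..}. exp (- \<theta> * x) * W \<mu> x) = 1 / (psi \<theta> - \<mu>)"
        using W less by (auto simp: scale_function_def right_inverse_psi[OF \<mu>])
      have **: "indicator {0..} z *\<^sub>R (exp (- \<theta> * z) * W \<mu> z) = exp (- \<theta> * z) * W \<mu> z" for z
        using W0 by (auto split: split_indicator simp: not_le)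
      show "integrable lborel (\<lambda>z. exp (- \<theta> * z) * W \<mu> z)" "(LINT z|lborel. exp (- \<theta> * z) * W \<mu> z) = 1 / (psi \<theta> - \<mu>)"
        using * unfolding set_integrable_def set_lebesgue_integral_def ** by auto
    qed
    have wv: "(LINT y|lborel. W \<mu> (x - y) * ?g y) = exp (\<theta> * x) * (1 / (psi \<theta> - \<mu>) - I)"
    proof -
      have ii: "integrable lborel (\<lambda>z. indicator {..x} z * (exp (- \<theta> * z) * W \<mu> z))"
        using integrable_real_mult_indicator[OF _ full(1), of "{..x}"] by (simp add: mult.commute)
      have "(LINT z|lborel. indicator {..<0} (x - z) * (exp (- \<theta> * z) * W \<mu> z)) =
        (LINT z|lborel. exp (- \<theta> * z) * W \<mu> z - indicator {..x} z * (exp (- \<theta> * z) * W \<mu> z))"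
        by (intro Bochner_Integration.integral_cong) (auto split: split_indicator)
      also have "\<dots> = 1 / (psi \<theta> - \<mu>) - I" using full ii by (simp add: I)
      finally show ?thesis by (subst flip) auto
    qed
    have "resolvent \<mu> ?g x = ?C * exp (?\<Phi> * x) * (1 / (\<theta> - ?\<Phi>)) - exp (\<theta> * x) * (1 / (psi \<theta> - \<mu>) - I)"
      unfolding resolvent_kernel[OF \<mu> W gm gi, of x] gv wv by (rule refl)
    also have "\<dots> = scale_Z psi W \<mu> x \<theta> / (\<mu> - psi \<theta>) - ?C * exp (?\<Phi> * x) / (?\<Phi> - \<theta>)"
    proof -
      have "1 / (\<theta> - ?\<Phi>) = - (1 / (?\<Phi> - \<theta>))" using less by (simp add: field_simps)
      moreover have "1 / (psi \<theta> - \<mu>) = - (1 / (\<mu> - psi \<theta>))" using psi by (simp add: field_simps)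
      moreover have "scale_Z psi W \<mu> x \<theta> / (\<mu> - psi \<theta>) = exp (\<theta> * x) * (1 / (\<mu> - psi \<theta>) + I)"
        unfolding Z using psi by (simp add: field_simps)
      ultimately show ?thesis by (simp add: algebra_simps)
    qed
    finally show ?thesis .
  qed
qed

lemma resolvent_add:
  assumes \<mu>: "0 < \<mu>" and [measurable]: "f \<in> borel_measurable borel" "g \<in> borel_measurable borel"
    and B: "\<And>y. \<bar>f y\<bar> \<le> A" "\<And>y. \<bar>g y\<bar> \<le> B"
  shows "resolvent \<mu> (\<lambda>y. f y + g y) x = resolvent \<mu> f x + resolvent \<mu> g x"
  unfolding resolvent_def
  using integrable_potential_bounded[OF \<mu>, of "\<lambda>z. f (x + z)" A] integrable_potential_bounded[OF \<mu>, of "\<lambda>z. g (x + z)" B] B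
  by simp

lemma resolvent_cmult: "resolvent \<mu> (\<lambda>y. c * f y) x = c * resolvent \<mu> f x"
  unfolding resolvent_def by simp

lemma resolvent_const: "0 < \<mu> \<Longrightarrow> resolvent \<mu> (\<lambda>y. c) x = c / \<mu>"
  unfolding resolvent_def using emeasure_potential_UNIV[of \<mu>] by (simp add: measure_def)

lemma measurable_resolvent [measurable]:
  assumes "0 < \<mu>" and [measurable]: "f \<in> borel_measurable borel"
  shows "resolvent \<mu> f \<in> borel_measurable borel"
proof -
  interpret finite_measure "potential \<mu>" by (rule finite_measure_potential[OF assms(1)])
  show ?thesis unfolding resolvent_def[abs_def] by measurable
qed

lemma resolvent_bound:
  assumes \<mu>: "0 < \<mu>" and [measurable]: "f \<in> borel_measurable borel" and B: "\<And>y. \<bar>f y\<bar> \<le> B"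
  shows "\<bar>resolvent \<mu> f x\<bar> \<le> B / \<mu>"
proof -
  have i: "integrable (potential \<mu>) (\<lambda>z. f (x + z))" using B by (intro integrable_potential_bounded[OF \<mu>, where B=B]) auto
  have "\<bar>resolvent \<mu> f x\<bar> \<le> (LINT z|potential \<mu>. \<bar>f (x + z)\<bar>)"
    unfolding resolvent_def by (rule integral_abs_bound)
  also have "\<dots> \<le> (LINT z|potential \<mu>. B)"
    using i B finite_measure.integrable_const[OF finite_measure_potential[OF \<mu>]]
    by (intro integral_mono integrable_abs) auto
  also have "\<dots> = B / \<mu>" using resolvent_const[OF \<mu>, of B 0] by (simp add: resolvent_def)
  finally show ?thesis .
qed

lemma resolvent_shift_nonneg:
  assumes \<kappa>: "0 < \<kappa>" "\<kappa> < \<mu>" and h [measurable]: "h \<in> borel_measurable borel" and B: "\<And>y. 0 \<le> h y" "\<And>y. h y \<le> B"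
  shows "resolvent \<kappa> h x = resolvent \<mu> (\<lambda>y. h y + (\<mu> - \<kappa>) * resolvent \<kappa> h y) x"
proof -
  have \<mu>: "0 < \<mu>" using \<kappa> by simp
  interpret L: finite_measure "potential \<kappa>" by (rule finite_measure_potential[OF \<kappa>(1)])
  interpret U: finite_measure "potential \<mu>" by (rule finite_measure_potential[OF \<mu>])
  interpret P: pair_sigma_finite "potential \<mu>" "potential \<kappa>" ..
  have ab: "\<bar>h y\<bar> \<le> B" for y using B[of y] by simp
  have nn: "(\<integral>\<^sup>+z. ennreal (h (y + z)) \<partial>potential \<nu>) = ennreal (resolvent \<nu> h y)" if "0 < \<nu>" for \<nu> y
    unfolding resolvent_def using B ab
    by (intro nn_integral_eq_integral integrable_potential_bounded[OF that, where B=B]) auto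
  have R0: "0 \<le> resolvent \<nu> h y" for \<nu> y
    unfolding resolvent_def using B by (intro Bochner_Integration.integral_nonneg)
  note [measurable] = measurable_resolvent[OF \<kappa>(1) h] measurable_resolvent[OF \<mu> h]
  have Rb: "\<bar>resolvent \<kappa> h y\<bar> \<le> B / \<kappa>" for y by (rule resolvent_bound[OF \<kappa>(1) h ab])
  have "ennreal (resolvent \<kappa> h x) = ennreal (resolvent \<mu> h x) +
     ennreal (\<mu> - \<kappa>) * (\<integral>\<^sup>+z. \<integral>\<^sup>+w. ennreal (h (x + (z + w))) \<partial>potential \<mu> \<partial>potential \<kappa>)"
    using resolvent_equation[of "\<lambda>z. ennreal (h (x + z))" \<kappa> \<mu>] \<kappa> by (simp add: nn \<mu>)
  also have "(\<integral>\<^sup>+z. \<integral>\<^sup>+w. ennreal (h (x + (z + w))) \<partial>potential \<mu> \<partial>potential \<kappa>) =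
      (\<integral>\<^sup>+w. \<integral>\<^sup>+z. ennreal (h (x + (z + w))) \<partial>potential \<kappa> \<partial>potential \<mu>)"
    by (rule P.Fubini') measurable
  also have "\<dots> = (\<integral>\<^sup>+w. ennreal (resolvent \<kappa> h (x + w)) \<partial>potential \<mu>)"
    by (intro nn_integral_cong) (simp add: nn[OF \<kappa>(1), symmetric] ac_simps)
  also have "\<dots> = ennreal (resolvent \<mu> (resolvent \<kappa> h) x)"
    unfolding resolvent_def[of \<mu> "resolvent \<kappa> h"]
    by (intro nn_integral_eq_integral integrable_potential_bounded[OF \<mu>, where B="B / \<kappa>"]) (auto simp: R0 abs_le_D1[OF Rb])
  also have "ennreal (resolvent \<mu> h x) + ennreal (\<mu> - \<kappa>) * ennreal (resolvent \<mu> (resolvent \<kappa> h) x) =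
     ennreal (resolvent \<mu> h x + (\<mu> - \<kappa>) * resolvent \<mu> (resolvent \<kappa> h) x)"
    using \<kappa> R0 Bochner_Integration.integral_nonneg[of "potential \<mu>" "\<lambda>z. resolvent \<kappa> h (x + z)"]
    by (simp add: ennreal_plus ennreal_mult resolvent_def[of \<mu> "resolvent \<kappa> h"])
  finally have "resolvent \<kappa> h x = resolvent \<mu> h x + (\<mu> - \<kappa>) * resolvent \<mu> (resolvent \<kappa> h) x"
    using \<kappa> R0 Bochner_Integration.integral_nonneg[of "potential \<mu>" "\<lambda>z. resolvent \<kappa> h (x + z)"]
    by (subst (asm) ennreal_inj) (auto simp: resolvent_def[of \<mu> "resolvent \<kappa> h"])
  moreover have "resolvent \<mu> (\<lambda>y. h y + (\<mu> - \<kappa>) * resolvent \<kappa> h y) x = resolvent \<mu> h x + (\<mu> - \<kappa>) * resolvent \<mu> (resolvent \<kappa> h) x"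
  proof (subst resolvent_add[OF \<mu>, where A=B and B="(\<mu> - \<kappa>) * (B / \<kappa>)"])
    show "\<bar>(\<mu> - \<kappa>) * resolvent \<kappa> h y\<bar> \<le> (\<mu> - \<kappa>) * (B / \<kappa>)" for y
      using \<kappa> Rb[of y] unfolding abs_mult by (intro mult_mono) auto
  qed (auto simp: ab resolvent_cmult)
  ultimately show ?thesis by simp
qed

text \<open>A solution of an equation for \<open>R\<^sub>\<kappa>\<close> solves one for \<open>R\<^sub>\<mu>\<close>: a constant killing rate can be moved between the
  resolvent and the equation. Adding a constant to \<open>h\<close> reduces the claim to nonnegative \<open>h\<close>.\<close>

lemma resolvent_shift:
  assumes \<kappa>: "0 < \<kappa>" "\<kappa> < \<mu>" and h [measurable]: "h \<in> borel_measurable borel" and B: "\<And>y. \<bar>h y\<bar> \<le> B"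
    and u: "\<And>x. u x = resolvent \<kappa> h x"
  shows "u x = resolvent \<mu> (\<lambda>y. h y + (\<mu> - \<kappa>) * u y) x"
proof -
  have \<mu>: "0 < \<mu>" using \<kappa> by simp
  have u': "u = resolvent \<kappa> h" using u by auto
  have [measurable]: "u \<in> borel_measurable borel" unfolding u' by (rule measurable_resolvent[OF \<kappa>(1) h])
  have ub: "\<bar>u y\<bar> \<le> B / \<kappa>" for y unfolding u by (rule resolvent_bound[OF \<kappa>(1) h B])
  have B0: "0 \<le> B" using B[of 0] by linarith
  have c: "resolvent \<kappa> (\<lambda>y. h y + B) y = u y + B / \<kappa>" for y
    using resolvent_add[OF \<kappa>(1) h _ B, of "\<lambda>_. B" B y] resolvent_const[OF \<kappa>(1)] B0 by (simp add: u)
  have "u x + B / \<kappa> = resolvent \<mu> (\<lambda>y. (h y + B) + (\<mu> - \<kappa>) * (u y + B / \<kappa>)) x"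
  proof -
    have hm: "(\<lambda>y. h y + B) \<in> borel_measurable borel" by measurable
    have h1: "0 \<le> h y + B" "h y + B \<le> B + B" for y
      using B[of y] by (auto simp: abs_le_iff)
    from resolvent_shift_nonneg[OF \<kappa> hm h1, of x] show ?thesis unfolding c .
  qed
  also have "(\<lambda>y. (h y + B) + (\<mu> - \<kappa>) * (u y + B / \<kappa>)) = (\<lambda>y. (h y + (\<mu> - \<kappa>) * u y) + (B + (\<mu> - \<kappa>) * (B / \<kappa>)))"
    by (auto simp: algebra_simps)
  also have "resolvent \<mu> \<dots> x = resolvent \<mu> (\<lambda>y. h y + (\<mu> - \<kappa>) * u y) x + (B + (\<mu> - \<kappa>) * (B / \<kappa>)) / \<mu>"
  proof (subst resolvent_add[OF \<mu>, where A="B + (\<mu> - \<kappa>) * (B / \<kappa>)" and B="B + (\<mu> - \<kappa>) * (B / \<kappa>)"])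
    show "\<bar>h y + (\<mu> - \<kappa>) * u y\<bar> \<le> B + (\<mu> - \<kappa>) * (B / \<kappa>)" for y
    proof -
      have "\<bar>(\<mu> - \<kappa>) * u y\<bar> \<le> (\<mu> - \<kappa>) * (B / \<kappa>)"
        using \<kappa> ub[of y] unfolding abs_mult by (intro mult_mono) auto
      with B[of y] show ?thesis by linarith
    qed
    show "\<bar>B + (\<mu> - \<kappa>) * (B / \<kappa>)\<bar> \<le> B + (\<mu> - \<kappa>) * (B / \<kappa>)" for y :: real
      using B0 \<kappa> by simp
  qed (auto simp: resolvent_const[OF \<mu>])
  also have "(B + (\<mu> - \<kappa>) * (B / \<kappa>)) / \<mu> = B / \<kappa>" using \<kappa> by (simp add: field_simps)
  finally show ?thesis by simp
qed

lemma integrable_exp_bounded_half_line: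
  assumes a: "0 < (a::real)" and [measurable]: "f \<in> borel_measurable borel" and f: "\<And>y. \<bar>f y\<bar> \<le> B" "\<And>y. y < 0 \<Longrightarrow> f y = 0"
  shows "integrable lborel (\<lambda>y. exp (- a * y) * f y)"
proof (rule Bochner_Integration.integrable_bound[OF integrable_mult_right[OF integrable_exp_Ici[OF a], of B]])
  show "AE y in lborel. norm (exp (- a * y) * f y) \<le> norm (B * (exp (- a * y) * indicator {0..} y))"
  proof (rule AE_I2)
    fix y
    have "\<bar>f y\<bar> \<le> \<bar>B\<bar>" using f(1)[of y] by linarith
    then show "norm (exp (- a * y) * f y) \<le> norm (B * (exp (- a * y) * indicator {0..} y))"
      using f(2)[of y] by (cases "y < 0") (auto simp: abs_mult mult.commute intro: mult_right_mono)
  qed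
qed measurable

text \<open>The equation for killing at rate \<open>\<kappa>\<close>, and at an additional rate \<open>q\<close> below zero. Rewritten for \<open>R\<^bsub>\<kappa>+q\<^esub>\<close>,
  the unknown \<open>u\<close> appears only on \<open>[0, \<infinity>)\<close>, which shows that \<open>u(x) = c e\<^bsup>\<theta>x\<^esup> + a e\<^bsup>\<Psi>x\<^esup>\<close> for \<open>x < 0\<close>, with
  \<open>\<Psi> = \<Phi>(\<kappa> + q)\<close> and \<open>a\<close> unknown. Inserted into the equation for \<open>R\<^sub>\<kappa>\<close> this gives \<open>u\<close> on the whole line up to a
  term \<open>C e\<^bsup>\<Phi>x\<^esup> G\<close> with \<open>\<Phi> = \<Phi>(\<kappa>)\<close>. Comparing the two forms at one negative point gives \<open>G = 0\<close>, an equation for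
  \<open>a\<close>.\<close>

lemma feynman_kac_solution:
  fixes W :: "real \<Rightarrow> real \<Rightarrow> real"
  assumes \<kappa>: "0 < \<kappa>" and q: "0 < q"
    and W: "scale_function psi \<kappa> (W \<kappa>)" "scale_function psi (\<kappa> + q) (W (\<kappa> + q))"
    and \<theta>: "0 \<le> \<theta>" "\<theta> \<noteq> passage_rate \<kappa>" "\<theta> \<noteq> passage_rate (\<kappa> + q)"
    and f [measurable]: "f \<in> borel_measurable borel" and f_bd: "\<And>y. \<bar>f y\<bar> \<le> B" and f0: "\<And>y. y < 0 \<Longrightarrow> f y = 0"
    and u_m [measurable]: "u \<in> borel_measurable borel" and u_bd: "\<And>y. \<bar>u y\<bar> \<le> D"
    and u: "\<And>x. u x = resolvent \<kappa> (\<lambda>y. \<rho> * (exp (\<theta> * y) * indicator {..<0} y) + f y - q * indicator {..<0} y * u y) x"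
  shows "u x = \<rho> / (\<kappa> + q - psi \<theta>) * scale_Z psi W \<kappa> x \<theta>
    + (passage_rate (\<kappa> + q) - passage_rate \<kappa>) / q *
       ((LINT y|lborel. exp (- passage_rate \<kappa> * y) * f y) - \<rho> / (\<kappa> + q - psi \<theta>) * (\<kappa> - psi \<theta>) / (passage_rate \<kappa> - \<theta>))
       * scale_Z psi W \<kappa> x (passage_rate (\<kappa> + q))
    - (LINT y|lborel. W \<kappa> (x - y) * f y)"
proof -
  define \<mu> where "\<mu> = \<kappa> + q"
  define \<Phi> where "\<Phi> = passage_rate \<kappa>"
  define \<Psi> where "\<Psi> = passage_rate \<mu>"
  define C where "C = potential_const \<kappa>"
  have \<mu>: "0 < \<mu>" "\<kappa> < \<mu>" using \<kappa> q by (auto simp: \<mu>_def)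
  note W' = W(2)[folded \<mu>_def]
  have C: "0 < C" unfolding C_def by (rule potential_const_pos[OF \<kappa>])
  have \<Phi>: "0 < \<Phi>" "\<Phi> < \<Psi>" "0 < \<Psi>"
    using passage_exponential(1)[OF \<kappa>] passage_exponential(1)[OF \<mu>(1)] passage_rate_strict_mono[OF \<kappa> \<mu>(2)]
    by (auto simp: \<Phi>_def \<Psi>_def)
  have psi_\<Psi>: "psi \<Psi> = \<mu>" unfolding \<Psi>_def by (rule psi_passage_rate[OF \<mu>(1)])
  have ne: "psi \<theta> \<noteq> \<nu>" if "0 < \<nu>" "\<theta> \<noteq> passage_rate \<nu>" for \<nu>
    using psi_less_iff[OF that(1) \<theta>(1)] psi_greater[OF that(1), of \<theta>] that(2) by linarith
  have ne1: "\<kappa> - psi \<theta> \<noteq> 0" using ne[OF \<kappa> \<theta>(2)] by simp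
  have ne2: "\<mu> - psi \<theta> \<noteq> 0" using ne[OF \<mu>(1)] \<theta>(3) by (simp add: \<mu>_def)
  let ?E = "\<lambda>\<theta> y. exp (\<theta> * y) * indicator {..<0} y :: real"
  have E_bd: "\<bar>?E \<theta> y\<bar> \<le> 1" if "0 \<le> \<theta>" for \<theta> y
    using that by (auto split: split_indicator simp: mult_nonneg_nonpos)
  have cE_bd: "\<bar>c * ?E \<theta> y\<bar> \<le> \<bar>c\<bar>" if "0 \<le> \<theta>" for c \<theta> y
    using mult_left_mono[OF E_bd[OF that, of y], of "\<bar>c\<bar>"] by (simp add: abs_mult)
  define h where "h y = \<rho> * ?E \<theta> y + f y - q * indicator {..<0} y * u y" for y
  have [measurable]: "h \<in> borel_measurable borel" unfolding h_def[abs_def] by measurable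
  have h_bd: "\<bar>h y\<bar> \<le> \<bar>\<rho>\<bar> + B + q * D" for y
  proof -
    have "\<bar>q * indicator {..<0} y * u y\<bar> \<le> q * 1 * D"
      using q u_bd[of y] unfolding abs_mult by (intro mult_mono) (auto split: split_indicator)
    then show ?thesis using cE_bd[OF \<theta>(1), of \<rho> y] f_bd[of y] unfolding h_def by linarith
  qed
  have u_h: "u x = resolvent \<kappa> h x" for x unfolding h_def[abs_def] by (rule u)
  \<comment> \<open>The inhomogeneity after passing to \<open>R\<^sub>\<mu>\<close>; it lives on \<open>[0, \<infinity>)\<close>, where the kernel \<open>W\<close> is not seen from
    \<open>x < 0\<close>.\<close>
  define k where "k y = f y + q * indicator {0..} y * u y" for y
  have [measurable]: "k \<in> borel_measurable borel" unfolding k_def[abs_def] by measurable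
  have k_bd: "\<bar>k y\<bar> \<le> B + q * D" for y
  proof -
    have "\<bar>q * indicator {0..} y * u y\<bar> \<le> q * 1 * D"
      using q u_bd[of y] unfolding abs_mult by (intro mult_mono) (auto split: split_indicator)
    then show ?thesis using f_bd[of y] unfolding k_def by linarith
  qed
  have k0: "k y = 0" if "y < 0" for y using that f0 by (simp add: k_def)
  have u_k: "u x = \<rho> * resolvent \<mu> (?E \<theta>) x + resolvent \<mu> k x" for x
  proof -
    have "u x = resolvent \<mu> (\<lambda>y. h y + (\<mu> - \<kappa>) * u y) x"
      by (rule resolvent_shift[OF \<kappa> \<mu>(2) _ h_bd u_h]) measurable
    also have "(\<lambda>y. h y + (\<mu> - \<kappa>) * u y) = (\<lambda>y. \<rho> * ?E \<theta> y + k y)"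
      by (auto simp: fun_eq_iff h_def k_def \<mu>_def split: split_indicator)
    also have "resolvent \<mu> \<dots> x = resolvent \<mu> (\<lambda>y. \<rho> * ?E \<theta> y) x + resolvent \<mu> k x"
      by (rule resolvent_add[OF \<mu>(1) _ _ cE_bd[OF \<theta>(1)] k_bd]) measurable
    finally show ?thesis by (simp add: resolvent_cmult)
  qed
  define c where "c = \<rho> / (\<mu> - psi \<theta>)"
  define a where "a = potential_const \<mu> * (LINT y|lborel. exp (- \<Psi> * y) * k y) - \<rho> * potential_const \<mu> / (\<Psi> - \<theta>)"
  have neg: "u x = c * exp (\<theta> * x) + a * exp (\<Psi> * x)" if x: "x < 0" for x
  proof -
    have ki: "integrable lborel (\<lambda>y. exp (- passage_rate \<mu> * y) * k y)"
      using \<Phi>(3) by (intro integrable_exp_bounded_half_line[OF _ _ k_bd k0]) (auto simp: \<Psi>_def)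
    have "(LINT y|lborel. W \<mu> (x - y) * k y) = (LINT y|(lborel :: real measure). 0)"
    proof (rule Bochner_Integration.integral_cong[OF refl])
      fix y show "W \<mu> (x - y) * k y = 0"
        using k0[of y] W' x by (cases "y < 0") (auto simp: scale_function_def)
    qed
    then have R1: "resolvent \<mu> k x = potential_const \<mu> * exp (\<Psi> * x) * (LINT y|lborel. exp (- \<Psi> * y) * k y)"
      using resolvent_kernel[OF \<mu>(1) W' _ ki, of x] by (simp add: \<Psi>_def)
    have R2: "resolvent \<mu> (?E \<theta>) x = exp (\<theta> * x) / (\<mu> - psi \<theta>) - potential_const \<mu> * exp (\<Psi> * x) / (\<Psi> - \<theta>)"
      using resolvent_exp_negative[where W=W, OF \<mu>(1) W' \<theta>(1), of x] \<theta>(3) x by (simp add: \<Psi>_def \<mu>_def scale_Z_def)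
    show ?thesis
      unfolding u_k R1 R2 by (simp add: c_def a_def algebra_simps)
  qed
  define b where "b = \<rho> - q * c"
  have b: "b = c * (\<kappa> - psi \<theta>)" using ne2 by (simp add: b_def c_def \<mu>_def field_simps)
  define K where "K = (LINT y|lborel. exp (- \<Phi> * y) * f y)"
  define cv where "cv x = (LINT y|lborel. W \<kappa> (x - y) * f y)" for x
  define G where "G = K - c * (\<kappa> - psi \<theta>) / (\<Phi> - \<theta>) + q * a / (\<Phi> - \<Psi>)"
  have sol: "u x = c * scale_Z psi W \<kappa> x \<theta> + a * scale_Z psi W \<kappa> x \<Psi> + C * exp (\<Phi> * x) * G - cv x" for x
  proof -
    have h_eq: "h = (\<lambda>y. (b * ?E \<theta> y + (- q * a) * ?E \<Psi> y) + f y)"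
    proof
      fix y show "h y = (b * ?E \<theta> y + (- q * a) * ?E \<Psi> y) + f y"
        by (cases "y < 0") (auto simp: h_def b_def neg algebra_simps)
    qed
    have bd2: "\<bar>b * ?E \<theta> y + (- q * a) * ?E \<Psi> y\<bar> \<le> \<bar>b\<bar> + \<bar>- q * a\<bar>" for y
      using cE_bd[OF \<theta>(1), of b y] cE_bd[of \<Psi> "- q * a" y] \<Phi> by linarith
    have "u x = resolvent \<kappa> (\<lambda>y. b * ?E \<theta> y + (- q * a) * ?E \<Psi> y) x + resolvent \<kappa> f x"
      unfolding u_h h_eq by (rule resolvent_add[OF \<kappa> _ f bd2 f_bd]) measurable
    also have "resolvent \<kappa> (\<lambda>y. b * ?E \<theta> y + (- q * a) * ?E \<Psi> y) x = resolvent \<kappa> (\<lambda>y. b * ?E \<theta> y) x + resolvent \<kappa> (\<lambda>y. (- q * a) * ?E \<Psi> y) x"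
      using \<Phi> by (intro resolvent_add[OF \<kappa> _ _ cE_bd[OF \<theta>(1)] cE_bd]) auto
    finally have 1: "u x = b * resolvent \<kappa> (?E \<theta>) x + (- q * a) * resolvent \<kappa> (?E \<Psi>) x + resolvent \<kappa> f x"
      by (simp only: resolvent_cmult)
    have 2: "resolvent \<kappa> (?E \<theta>) x = scale_Z psi W \<kappa> x \<theta> / (\<kappa> - psi \<theta>) - C * exp (\<Phi> * x) / (\<Phi> - \<theta>)"
      using resolvent_exp_negative[where W=W, OF \<kappa> W(1) \<theta>(1,2), of x] by (simp add: \<Phi>_def C_def)
    have 3: "resolvent \<kappa> (?E \<Psi>) x = scale_Z psi W \<kappa> x \<Psi> / (- q) - C * exp (\<Phi> * x) / (\<Phi> - \<Psi>)"
      using resolvent_exp_negative[where W=W, OF \<kappa> W(1), of \<Psi> x] \<Phi> psi_\<Psi> by (simp add: \<Phi>_def C_def \<mu>_def)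
    have 4: "resolvent \<kappa> f x = C * exp (\<Phi> * x) * K - cv x"
      using resolvent_kernel[OF \<kappa> W(1) f, of x] integrable_exp_bounded_half_line[OF _ f f_bd f0, of "passage_rate \<kappa>"] \<Phi>
      by (simp add: \<Phi>_def C_def K_def cv_def)
    have 5: "b * (scale_Z psi W \<kappa> x \<theta> / (\<kappa> - psi \<theta>) - C * exp (\<Phi> * x) / (\<Phi> - \<theta>)) =
       c * scale_Z psi W \<kappa> x \<theta> - C * exp (\<Phi> * x) * (c * (\<kappa> - psi \<theta>) / (\<Phi> - \<theta>))"
    proof -
      have "c * n * (z / n - t / (\<Phi> - \<theta>)) = c * z - t * (c * n / (\<Phi> - \<theta>))" if "n \<noteq> 0" for n z t :: real
        using that by (simp add: right_diff_distrib mult_ac)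
      from this[OF ne1] show ?thesis unfolding b .
    qed
    have 6: "(- q * a) * (scale_Z psi W \<kappa> x \<Psi> / (- q) - C * exp (\<Phi> * x) / (\<Phi> - \<Psi>)) =
       a * scale_Z psi W \<kappa> x \<Psi> + C * exp (\<Phi> * x) * (q * a / (\<Phi> - \<Psi>))"
      using q by (simp add: right_diff_distrib mult_ac)
    show ?thesis unfolding 1 2 3 4 5 6 G_def by (simp add: algebra_simps)
  qed
  \<comment> \<open>Any negative point would do.\<close>
  have "cv (- 1) = (LINT y|(lborel :: real measure). 0)"
    unfolding cv_def
  proof (rule Bochner_Integration.integral_cong[OF refl])
    fix y show "W \<kappa> (- 1 - y) * f y = 0"
      using f0[of y] W(1) by (cases "y < 0") (auto simp: scale_function_def)
  qed
  then have "C * exp (\<Phi> * (- 1)) * G = 0"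
    using sol[of "- 1"] neg[of "- 1"] by (simp add: scale_Z_def)
  then have G: "G = 0" using C by simp
  then have "q * a / (\<Psi> - \<Phi>) = K - c * (\<kappa> - psi \<theta>) / (\<Phi> - \<theta>)"
  proof -
    have "q * a / (\<Phi> - \<Psi>) = - (q * a / (\<Psi> - \<Phi>))"
      by (metis minus_diff_eq minus_divide_right)
    then show ?thesis using G by (simp add: G_def)
  qed
  then have "a = (\<Psi> - \<Phi>) / q * (K - c * (\<kappa> - psi \<theta>) / (\<Phi> - \<theta>))"
    using q \<Phi> by (simp add: field_simps)
  then show ?thesis
    using sol[of x] G unfolding c_def K_def cv_def \<Phi>_def \<Psi>_def \<mu>_def by simp
qed

end

section \<open>Path functionals at an independent exponential time\<close>

text \<open>Such a function has derivative zero everywhere.\<close>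

lemma quadratic_increments_constant:
  fixes D :: "real \<Rightarrow> real"
  assumes "\<And>u v. u \<le> v \<Longrightarrow> \<bar>D v - D u\<bar> \<le> M * (v - u)^2"
  shows "D x = D y"
proof (rule DERIV_isconst_all[where f=D])
  have b: "\<bar>D v - D u\<bar> \<le> M * (v - u)^2" for u v
    using assms[of u v] assms[of v u] by (cases "u \<le> v") (auto simp: abs_minus_commute power2_commute)
  show "\<forall>x. DERIV D x :> 0"
  proof
    fix x
    have "((\<lambda>h. (D (x + h) - D x) / h) \<longlongrightarrow> 0) (at 0)"
    proof (rule Lim_null_comparison)
      show "\<forall>\<^sub>F h in at 0. norm ((D (x + h) - D x) / h) \<le> M * \<bar>h\<bar>"
      proof -
        have "norm ((D (x + h) - D x) / h) \<le> M * \<bar>h\<bar>" if "h \<noteq> 0" for h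
          using b[of "x + h" x] that by (simp add: abs_divide divide_le_eq power2_eq_square mult.assoc)
        then show ?thesis by (auto simp: eventually_at_filter)
      qed
      show "((\<lambda>h. M * \<bar>h\<bar>) \<longlongrightarrow> 0) (at 0)" by (auto intro!: tendsto_eq_intros)
    qed
    then show "DERIV D x :> 0" by (simp add: DERIV_def)
  qed
qed

text \<open>The fundamental theorem of calculus for \<open>e\<^sup>A\<close>, where the density \<open>a\<close> of \<open>A\<close> is only bounded and
  measurable, so that \<open>A\<close> need not be differentiable. The difference of the two sides has increments of second
  order in the length of the interval, and is therefore constant.\<close>

lemma exp_integral_identity:
  fixes a :: "real \<Rightarrow> real"
  assumes [measurable]: "a \<in> borel_measurable borel" and a: "\<And>s. 0 \<le> a s" "\<And>s. a s \<le> K" and t: "0 \<le> t"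
    and A_eq: "\<And>v. 0 \<le> v \<Longrightarrow> v \<le> t \<Longrightarrow> A v = (LINT s|lborel. a s * indicator {0..v} s)"
  shows "integrable lborel (\<lambda>s. a s * exp (- (A t - A s)) * indicator {0..t} s)"
    and "(LINT s|lborel. a s * exp (- (A t - A s)) * indicator {0..t} s) = 1 - exp (- A t)"
proof -
  have K: "0 \<le> K" using a[of 0] by linarith
  define b where "b s = a s * indicator {0..t} s" for s
  have [measurable]: "b \<in> borel_measurable borel" unfolding b_def[abs_def] by measurable
  have b: "0 \<le> b s" "b s \<le> K" "b s \<le> K * indicator {0..t} s" for s using a K by (auto simp: b_def split: split_indicator)
  have ind_int: "integrable lborel (\<lambda>s. indicator {0..t} s :: real)" using t by simp
  have int: "integrable lborel (\<lambda>s. b s * g s)" if [measurable]: "g \<in> borel_measurable borel" and g: "\<And>s. \<bar>g s\<bar> \<le> G" for g G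
  proof (rule Bochner_Integration.integrable_bound[OF integrable_mult_right[OF ind_int, of "K * G"]])
    show "AE s in lborel. norm (b s * g s) \<le> norm (K * G * indicator {0..t} s)"
    proof (rule AE_I2)
      fix s
      have G: "0 \<le> G" using g[of s] by linarith
      have "\<bar>b s * g s\<bar> \<le> K * indicator {0..t} s * G"
        unfolding abs_mult using b[of s] g[of s] K by (intro mult_mono) (auto split: split_indicator)
      then show "norm (b s * g s) \<le> norm (K * G * indicator {0..t} s)"
        using K G by (simp add: abs_mult mult_ac)
    qed
  qed measurable
  define A' where "A' v = (LINT s|lborel. b s * indicator {..v} s)" for v
  have A'_diff: "A' v - A' u = (LINT s|lborel. b s * indicator {u<..v} s)" if "u \<le> v" for u v
  proof -
    have "A' v - A' u = (LINT s|lborel. b s * indicator {..v} s - b s * indicator {..u} s)"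
      unfolding A'_def by (rule Bochner_Integration.integral_diff[symmetric]; rule int[where G=1]) (auto split: split_indicator)
    also have "\<dots> = (LINT s|lborel. b s * indicator {u<..v} s)"
      using that by (intro Bochner_Integration.integral_cong) (auto split: split_indicator)
    finally show ?thesis .
  qed
  have incr: "0 \<le> A' v - A' u \<and> A' v - A' u \<le> K * (v - u)" if uv: "u \<le> v" for u v
  proof
    show "0 \<le> A' v - A' u" unfolding A'_diff[OF uv] using b by (intro Bochner_Integration.integral_nonneg) auto
    have "(LINT s|lborel. b s * indicator {u<..v} s) \<le> (LINT s|lborel. K * indicator {u<..v} s)"
      using uv b by (intro integral_mono int[where G=1]) (auto split: split_indicator)
    also have "\<dots> = K * (v - u)" using uv by simp
    finally show "A' v - A' u \<le> K * (v - u)" unfolding A'_diff[OF uv] .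
  qed
  have mono: "A' u \<le> A' v" if "u \<le> v" for u v using incr[OF that] by simp
  have [measurable]: "A' \<in> borel_measurable borel"
    by (rule borel_measurable_mono) (auto simp: mono_def mono)
  have A'_neg: "A' u = 0" if "u < 0" for u
  proof -
    have "A' u = (LINT s|(lborel :: real measure). 0)" unfolding A'_def
      by (rule Bochner_Integration.integral_cong) (use that in \<open>auto simp: b_def split: split_indicator\<close>)
    then show ?thesis by simp
  qed
  have A'_t: "A' v \<le> A' t" for v
  proof (cases "v \<le> t")
    case False
    have "A' v = A' t" unfolding A'_def
      by (rule Bochner_Integration.integral_cong) (use False in \<open>auto simp: b_def split: split_indicator\<close>)
    then show ?thesis by simp
  qed (rule mono)
  have A'_nonneg: "0 \<le> A' v" for v
    using mono[of "min v (- 1)" v] A'_neg[of "min v (- 1)"] by simp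
  define E where "E = exp (A' t)"
  have expb: "\<bar>exp (A' s) * indicator S s\<bar> \<le> E" for s and S :: "real set"
    using A'_t[of s] by (auto simp: E_def split: split_indicator)
  define B where "B v = (LINT s|lborel. b s * (exp (A' s) * indicator {..v} s))" for v
  \<comment> \<open>Up to a constant, the difference of the two sides after multiplication by \<open>e\<^bsup>A(t)\<^esup>\<close>.\<close>
  define D where "D v = exp (A' v) - B v" for v
  have "D t = D (- 1)"
  proof (rule quadratic_increments_constant[where D=D and M="E * K^2"])
    fix u v :: real assume uv: "u \<le> v"
    let ?d = "A' v - A' u"
    have d: "0 \<le> ?d" "?d \<le> K * (v - u)" using incr[OF uv] by auto
    have "B v - B u = (LINT s|lborel. b s * (exp (A' s) * indicator {..v} s) - b s * (exp (A' s) * indicator {..u} s))"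
      unfolding B_def by (rule Bochner_Integration.integral_diff[symmetric]; rule int[OF _ expb]) measurable
    also have "\<dots> = (LINT s|lborel. b s * (exp (A' s) * indicator {u<..v} s))"
      using uv by (intro Bochner_Integration.integral_cong) (auto split: split_indicator)
    finally have Bd: "B v - B u = (LINT s|lborel. b s * (exp (A' s) * indicator {u<..v} s))" .
    have "(LINT s|lborel. exp (A' u) * (b s * indicator {u<..v} s)) \<le> B v - B u"
      unfolding Bd
    proof (intro integral_mono)
      show "integrable lborel (\<lambda>s. b s * (exp (A' s) * indicator {u<..v} s))" by (rule int[OF _ expb]) measurable
      show "integrable lborel (\<lambda>s. exp (A' u) * (b s * indicator {u<..v} s))"
        by (intro integrable_mult_right int[where G=1]) (auto split: split_indicator)
      show "exp (A' u) * (b s * indicator {u<..v} s) \<le> b s * (exp (A' s) * indicator {u<..v} s)" for s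
        using b(1)[of s] mono[of u s] by (auto split: split_indicator simp: mult.commute intro!: mult_left_mono)
    qed
    then have lo: "exp (A' u) * ?d \<le> B v - B u" by (simp add: A'_diff[OF uv])
    have "B v - B u \<le> (LINT s|lborel. exp (A' v) * (b s * indicator {u<..v} s))"
      unfolding Bd
    proof (intro integral_mono)
      show "integrable lborel (\<lambda>s. b s * (exp (A' s) * indicator {u<..v} s))" by (rule int[OF _ expb]) measurable
      show "integrable lborel (\<lambda>s. exp (A' v) * (b s * indicator {u<..v} s))"
        by (intro integrable_mult_right int[where G=1]) (auto split: split_indicator)
      show "b s * (exp (A' s) * indicator {u<..v} s) \<le> exp (A' v) * (b s * indicator {u<..v} s)" for s
        using b(1)[of s] mono[of s v] by (auto split: split_indicator simp: mult.commute intro!: mult_left_mono)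
    qed
    then have hi: "B v - B u \<le> exp (A' v) * ?d" by (simp add: A'_diff[OF uv])
    have lo': "exp (A' u) * ?d \<le> exp (A' v) - exp (A' u)"
    proof -
      have "exp (A' u) * (1 + ?d) \<le> exp (A' u) * exp ?d" by (intro mult_left_mono) auto
      then show ?thesis by (simp add: exp_add[symmetric] algebra_simps)
    qed
    have hi': "exp (A' v) - exp (A' u) \<le> exp (A' v) * ?d"
    proof -
      have "exp (A' v) * (1 + - ?d) \<le> exp (A' v) * exp (- ?d)"
        by (intro mult_left_mono exp_ge_add_one_self) auto
      then show ?thesis by (simp add: exp_add[symmetric] algebra_simps)
    qed
    have "\<bar>D v - D u\<bar> \<le> (exp (A' v) - exp (A' u)) * ?d"
      using lo hi lo' hi' unfolding D_def left_diff_distrib by linarith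
    also have "\<dots> \<le> (exp (A' v) * ?d) * ?d" using d hi' by (intro mult_right_mono)
    also have "\<dots> = exp (A' v) * ?d\<^sup>2" by (simp add: power2_eq_square)
    also have "\<dots> \<le> E * (K * (v - u))\<^sup>2"
      using d A'_t[of v] by (intro mult_mono power_mono) (auto simp: E_def)
    finally show "\<bar>D v - D u\<bar> \<le> E * K^2 * (v - u)^2" by (simp add: power_mult_distrib mult.assoc)
  qed
  moreover have "D (- 1) = 1"
  proof -
    have "B (- 1) = (LINT s|(lborel :: real measure). 0)" unfolding B_def
      by (rule Bochner_Integration.integral_cong) (auto simp: b_def split: split_indicator)
    then show ?thesis by (simp add: D_def A'_neg)
  qed
  ultimately have key: "exp (A' t) - 1 = B t" by (simp add: D_def)
  have AA: "A v = A' v" if "0 \<le> v" "v \<le> t" for v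
    unfolding A_eq[OF that] A'_def by (rule Bochner_Integration.integral_cong) (use that in \<open>auto simp: b_def split: split_indicator\<close>)
  have eq: "a s * exp (- (A t - A s)) * indicator {0..t} s = exp (- A' t) * (b s * (exp (A' s) * indicator {..t} s))" for s
    using t by (auto simp: AA b_def exp_diff exp_minus field_simps split: split_indicator)
  show "integrable lborel (\<lambda>s. a s * exp (- (A t - A s)) * indicator {0..t} s)"
    unfolding eq by (intro integrable_mult_right int[OF _ expb]) measurable
  have "(LINT s|lborel. a s * exp (- (A t - A s)) * indicator {0..t} s) = exp (- A' t) * B t"
    unfolding eq B_def by simp
  also have "\<dots> = 1 - exp (- A' t)"
    unfolding key[symmetric] by (simp add: right_diff_distrib exp_add[symmetric] del: exp_minus)
  finally show "(LINT s|lborel. a s * exp (- (A t - A s)) * indicator {0..t} s) = 1 - exp (- A t)"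
    using AA[of t] t by simp
qed

text \<open>Time below zero of the path \<open>x + w\<close>. With the strict inequality it is the integral of \<open>1\<^bsub>(-\<infinity>,0)\<^esub>\<close>, the
  function that occurs in the equations on half-lines; the difference from the time at or below zero is almost
  surely zero.\<close>

definition negative_time :: "real \<Rightarrow> real \<Rightarrow> (real \<Rightarrow> real) \<Rightarrow> real" where
  "negative_time x t w = (LINT s|lborel. (if 0 \<le> s \<and> s \<le> t \<and> x + path_value s w < 0 then 1 else 0))"

text \<open>A jointly measurable form of the last negative time: by right-continuity a negative value is accompanied
  by negative values at rational times just after it, except at the end point \<open>t\<close>, which is treated separately.\<close>

definition last_negative :: "real \<Rightarrow> real \<Rightarrow> (real \<Rightarrow> real) \<Rightarrow> real" where
  "last_negative x t w = (if x + path_value t w < 0 then max t 0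
     else (SUP u\<in>\<rat>. if 0 < u \<and> u < t \<and> x + path_value u w < 0 then u else 0))"

definition shift_path :: "real \<Rightarrow> (real \<Rightarrow> real) \<Rightarrow> real \<Rightarrow> real" where
  "shift_path s w = (\<lambda>u\<in>{0..}. path_value (s + u) w - path_value s w)"

lemma measurable_negative_time [measurable (raw)]:
  assumes [measurable]: "f \<in> borel_measurable N" "g \<in> borel_measurable N" "h \<in> measurable N path_space"
  shows "(\<lambda>z. negative_time (f z) (g z) (h z)) \<in> borel_measurable N"
  unfolding negative_time_def by measurable

lemma measurable_last_negative [measurable (raw)]:
  assumes [measurable]: "f \<in> borel_measurable N" "g \<in> borel_measurable N" "h \<in> measurable N path_space"
  shows "(\<lambda>z. last_negative (f z) (g z) (h z)) \<in> borel_measurable N"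
proof -
  have "(\<lambda>z. SUP u\<in>\<rat>. if 0 < u \<and> u < g z \<and> f z + path_value u (h z) < 0 then u else 0) \<in> borel_measurable N"
  proof (rule borel_measurable_cSUP)
    show "countable (\<rat> :: real set)" by (rule countable_rat)
    show "bdd_above ((\<lambda>u. if 0 < u \<and> u < g z \<and> f z + path_value u (h z) < 0 then u else 0) ` \<rat>)" for z
      by (rule bdd_aboveI2[where M="max (g z) 0"]) auto
  qed measurable
  then show ?thesis unfolding last_negative_def by measurable
qed

lemma measurable_shift_path [measurable (raw)]:
  assumes [measurable]: "f \<in> borel_measurable N" "h \<in> measurable N path_space"
  shows "(\<lambda>z. shift_path (f z) (h z)) \<in> measurable N path_space"
  unfolding shift_path_def by (rule measurable_restrict) measurable

abbreviation exp_law :: "real \<Rightarrow> real measure" where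
  "exp_law r \<equiv> density lborel (\<lambda>x. ennreal (exponential_density r x))"

lemma nn_integral_exp_law:
  assumes [measurable]: "g \<in> borel_measurable borel" and r: "0 < r"
  shows "(\<integral>\<^sup>+t. g t \<partial>exp_law r) = ennreal r * (\<integral>\<^sup>+t. ennreal (exp (- r * t)) * indicator {0..} t * g t \<partial>lborel)"
proof -
  have "(\<integral>\<^sup>+t. g t \<partial>exp_law r) = (\<integral>\<^sup>+t. ennreal r * (ennreal (exp (- r * t)) * indicator {0..} t * g t) \<partial>lborel)"
    using r by (subst nn_integral_density)
      (auto intro!: nn_integral_cong simp: exponential_density_def ennreal_mult mult_ac split: split_indicator)
  also have "\<dots> = ennreal r * (\<integral>\<^sup>+t. ennreal (exp (- r * t)) * indicator {0..} t * g t \<partial>lborel)"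
    by (rule nn_integral_cmult) measurable
  finally show ?thesis .
qed

context spectrally_negative_levy
begin

lemma shift_path_path:
  assumes "\<omega> \<in> space M" "0 \<le> s" shows "shift_path s (path \<omega>) = future s \<omega>"
  using assms by (auto simp: shift_path_def future_def path_value_path fun_eq_iff)

text \<open>The expectation of \<open>F(t, x, X)\<close> for an independent exponential time \<open>t\<close> of rate \<open>r\<close>, as a function of the
  starting point \<open>x\<close>.\<close>

definition expect_at :: "real \<Rightarrow> (real \<times> real \<times> (real \<Rightarrow> real) \<Rightarrow> real) \<Rightarrow> real \<Rightarrow> real" where
  "expect_at r F x = enn2real (\<integral>\<^sup>+t. \<integral>\<^sup>+\<omega>. ennreal (F (t, x, path \<omega>)) \<partial>M \<partial>exp_law r)"

lemma
  assumes r: "0 < r" and F: "\<And>z. F z \<le> 1"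
  shows ennreal_expect_at: "ennreal (expect_at r F x) = (\<integral>\<^sup>+t. \<integral>\<^sup>+\<omega>. ennreal (F (t, x, path \<omega>)) \<partial>M \<partial>exp_law r)"
    and expect_at_bounds: "0 \<le> expect_at r F x" "expect_at r F x \<le> 1"
proof -
  interpret E: prob_space "exp_law r" by (rule prob_space_exponential_density[OF r])
  have "(\<integral>\<^sup>+t. \<integral>\<^sup>+\<omega>. ennreal (F (t, x, path \<omega>)) \<partial>M \<partial>exp_law r) \<le> (\<integral>\<^sup>+t. \<integral>\<^sup>+\<omega>. 1 \<partial>M \<partial>exp_law r)"
    using F by (intro nn_integral_mono) (simp add: ennreal_le_1)
  also have "\<dots> = 1" using E.emeasure_space_1 by (simp add: emeasure_space_1)
  finally have le: "(\<integral>\<^sup>+t. \<integral>\<^sup>+\<omega>. ennreal (F (t, x, path \<omega>)) \<partial>M \<partial>exp_law r) \<le> 1" .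
  then show eq: "ennreal (expect_at r F x) = (\<integral>\<^sup>+t. \<integral>\<^sup>+\<omega>. ennreal (F (t, x, path \<omega>)) \<partial>M \<partial>exp_law r)"
    unfolding expect_at_def by (intro ennreal_enn2real) (auto simp: le_less_trans)
  show "0 \<le> expect_at r F x" by (simp add: expect_at_def)
  show "expect_at r F x \<le> 1" using le unfolding eq[symmetric] by (simp add: ennreal_le_1)
qed

lemma measurable_expect_at [measurable]:
  assumes "0 < r" and [measurable]: "F \<in> borel_measurable (borel \<Otimes>\<^sub>M borel \<Otimes>\<^sub>M path_space)"
  shows "expect_at r F \<in> borel_measurable borel"
proof -
  interpret E: prob_space "exp_law r" by (rule prob_space_exponential_density) fact
  show ?thesis unfolding expect_at_def[abs_def] by measurable
qed

text \<open>The Markov property at a fixed time \<open>s\<close>, combined with the lack of memory of the exponential time, and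
  integrated over \<open>s\<close>: a functional of the path shifted by \<open>s\<close> with remaining time \<open>t - s\<close> becomes
  \<open>expect_at r F\<close> at the present position, weighted with the potential measure.\<close>

lemma nn_integral_markov_resolvent:
  assumes r: "0 < r" and k [measurable]: "k \<in> borel_measurable borel"
    and F [measurable]: "F \<in> borel_measurable (borel \<Otimes>\<^sub>M borel \<Otimes>\<^sub>M path_space)"
    and k_bd: "\<And>y. 0 \<le> k y" "\<And>y. k y \<le> K" and F_bd: "\<And>z. 0 \<le> F z" "\<And>z. F z \<le> 1"
  shows "(\<integral>\<^sup>+t. \<integral>\<^sup>+\<omega>. \<integral>\<^sup>+s. ennreal (if 0 \<le> s \<and> s \<le> t then k (x + path_value s (path \<omega>)) *
      F (t - s, x + path_value s (path \<omega>), shift_path s (path \<omega>)) else 0) \<partial>lborel \<partial>M \<partial>exp_law r) =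
     ennreal (resolvent r (\<lambda>y. k y * expect_at r F y) x)"
proof -
  let ?K = "\<lambda>s v. \<integral>\<^sup>+\<omega>. ennreal (k (x + path_value s (path \<omega>))) * (\<integral>\<^sup>+\<omega>'. ennreal (F (v, x + path_value s (path \<omega>), path \<omega>')) \<partial>M) \<partial>M"
  note [measurable] = measurable_expect_at[OF r F]
  let ?G = "\<lambda>t s \<omega>. ennreal (if 0 \<le> s \<and> s \<le> t then k (x + path_value s (path \<omega>)) *
      F (t - s, x + path_value s (path \<omega>), shift_path s (path \<omega>)) else 0)"
  let ?e = "\<lambda>t. ennreal (exp (- r * t)) * indicator {0..} t"
  let ?H = "\<lambda>y. \<integral>\<^sup>+t. \<integral>\<^sup>+\<omega>. ennreal (F (t, y, path \<omega>)) \<partial>M \<partial>exp_law r"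
  have H: "?H y = ennreal (expect_at r F y)" for y using ennreal_expect_at[OF r F_bd(2)] by simp
  have fix_s: "(\<integral>\<^sup>+t. (\<integral>\<^sup>+\<omega>. ?G t s \<omega> \<partial>M) \<partial>exp_law r) = ?e s * mean (\<lambda>z. ennreal (k (x + z) * expect_at r F (x + z))) s" for s
  proof (cases "0 \<le> s")
    case False
    then show ?thesis by simp
  next
    case s: True
    have markov_s: "(\<integral>\<^sup>+\<omega>. ?G (s + v) s \<omega> \<partial>M) = ?K s v"
      if v: "0 \<le> v" for v
    proof -
      define Q where "Q a w = ennreal (k (x + a s) * F (v, x + a s, w))" for a w :: "real \<Rightarrow> real"
      have Q: "case_prod Q \<in> borel_measurable (path_space \<Otimes>\<^sub>M path_space)"
      proof -
        have [measurable]: "(\<lambda>z. fst z s) \<in> borel_measurable (path_space \<Otimes>\<^sub>M path_space)"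
          using s by (intro measurable_compose[OF measurable_fst measurable_component_singleton]) auto
        show ?thesis unfolding Q_def case_prod_beta by measurable
      qed
      have "(\<integral>\<^sup>+\<omega>. ?G (s + v) s \<omega> \<partial>M) = (\<integral>\<^sup>+\<omega>. Q (past s \<omega>) (future s \<omega>) \<partial>M)"
        using s v by (intro nn_integral_cong) (simp add: Q_def past_def path_value_path shift_path_path)
      also have "\<dots> = (\<integral>\<^sup>+\<omega>. \<integral>\<^sup>+\<omega>'. Q (past s \<omega>) (path \<omega>') \<partial>M \<partial>M)"
        by (rule markov_past_future[OF s Q])
      also have "\<dots> = ?K s v"
      proof (rule nn_integral_cong)
        fix \<omega> assume \<omega>: "\<omega> \<in> space M"
        have "(\<integral>\<^sup>+\<omega>'. Q (past s \<omega>) (path \<omega>') \<partial>M) = (\<integral>\<^sup>+\<omega>'. ennreal (k (x + path_value s (path \<omega>))) * ennreal (F (v, x + path_value s (path \<omega>), path \<omega>')) \<partial>M)"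
          using s \<omega> k_bd by (intro nn_integral_cong) (simp add: Q_def past_def path_value_path ennreal_mult')
        also have "\<dots> = ennreal (k (x + path_value s (path \<omega>))) * (\<integral>\<^sup>+\<omega>'. ennreal (F (v, x + path_value s (path \<omega>), path \<omega>')) \<partial>M)"
          by (rule nn_integral_cmult) measurable
        finally show "(\<integral>\<^sup>+\<omega>'. Q (past s \<omega>) (path \<omega>') \<partial>M) = \<dots>" .
      qed
      finally show ?thesis .
    qed
    have "(\<integral>\<^sup>+t. (\<integral>\<^sup>+\<omega>. ?G t s \<omega> \<partial>M) \<partial>exp_law r) = ennreal r * (\<integral>\<^sup>+t. ?e t * (\<integral>\<^sup>+\<omega>. ?G t s \<omega> \<partial>M) \<partial>lborel)"
      by (rule nn_integral_exp_law[OF _ r]) measurable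
    also have "(\<integral>\<^sup>+t. ?e t * (\<integral>\<^sup>+\<omega>. ?G t s \<omega> \<partial>M) \<partial>lborel) = (\<integral>\<^sup>+v. ?e (s + 1 * v) * (\<integral>\<^sup>+\<omega>. ?G (s + 1 * v) s \<omega> \<partial>M) \<partial>lborel)"
      by (subst nn_integral_real_affine[where c=1 and t=s]) auto
    also have "\<dots> = (\<integral>\<^sup>+v. ennreal (exp (- r * s)) * (?e v * ?K s v) \<partial>lborel)"
    proof (rule nn_integral_cong)
      fix v :: real
      show "?e (s + 1 * v) * (\<integral>\<^sup>+\<omega>. ?G (s + 1 * v) s \<omega> \<partial>M) = ennreal (exp (- r * s)) * (?e v * ?K s v)"
      proof (cases "0 \<le> v")
        case True
        have e: "?e (s + 1 * v) = ennreal (exp (- r * s)) * ?e v"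
          using s True by (simp add: ennreal_mult'[symmetric] exp_add[symmetric] algebra_simps)
        show ?thesis unfolding e using markov_s[OF True] by (simp only: mult_1 mult.assoc)
      qed simp
    qed
    also have "\<dots> = ennreal (exp (- r * s)) * (\<integral>\<^sup>+v. ?e v * ?K s v \<partial>lborel)"
      by (rule nn_integral_cmult) measurable
    also have "ennreal r * \<dots> = ennreal (exp (- r * s)) * (ennreal r * (\<integral>\<^sup>+v. ?e v * ?K s v \<partial>lborel))"
      by (simp only: mult.left_commute)
    also have "ennreal r * (\<integral>\<^sup>+v. ?e v * ?K s v \<partial>lborel) =
      (\<integral>\<^sup>+v. ?K s v \<partial>exp_law r)"
      by (rule nn_integral_exp_law[OF _ r, symmetric]) measurable
    also have "\<dots> = (\<integral>\<^sup>+\<omega>. (\<integral>\<^sup>+v. ennreal (k (x + path_value s (path \<omega>))) * (\<integral>\<^sup>+\<omega>'. ennreal (F (v, x + path_value s (path \<omega>), path \<omega>')) \<partial>M) \<partial>exp_law r) \<partial>M)"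
    proof -
      interpret E: prob_space "exp_law r" by (rule prob_space_exponential_density[OF r])
      interpret ME: pair_sigma_finite M "exp_law r" ..
      show ?thesis by (rule ME.Fubini') measurable
    qed
    also have "\<dots> = (\<integral>\<^sup>+\<omega>. ennreal (k (x + path_value s (path \<omega>))) * ?H (x + path_value s (path \<omega>)) \<partial>M)"
      by (intro nn_integral_cong nn_integral_cmult) measurable
    also have "\<dots> = mean (\<lambda>z. ennreal (k (x + z) * expect_at r F (x + z))) s"
      unfolding mean_def H using k_bd by (intro nn_integral_cong) (simp add: ennreal_mult')
    finally show ?thesis using s by simp
  qed
  have "(\<integral>\<^sup>+t. \<integral>\<^sup>+\<omega>. \<integral>\<^sup>+s. ?G t s \<omega> \<partial>lborel \<partial>M \<partial>exp_law r) = (\<integral>\<^sup>+t. \<integral>\<^sup>+s. \<integral>\<^sup>+\<omega>. ?G t s \<omega> \<partial>M \<partial>lborel \<partial>exp_law r)"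
  proof (rule nn_integral_cong)
    interpret LM: pair_sigma_finite lborel M ..
    fix t
    show "(\<integral>\<^sup>+\<omega>. \<integral>\<^sup>+s. ?G t s \<omega> \<partial>lborel \<partial>M) = (\<integral>\<^sup>+s. \<integral>\<^sup>+\<omega>. ?G t s \<omega> \<partial>M \<partial>lborel)"
      by (rule LM.Fubini') measurable
  qed
  also have "\<dots> = (\<integral>\<^sup>+s. \<integral>\<^sup>+t. \<integral>\<^sup>+\<omega>. ?G t s \<omega> \<partial>M \<partial>exp_law r \<partial>lborel)"
  proof -
    interpret E: prob_space "exp_law r" by (rule prob_space_exponential_density[OF r])
    interpret LE: pair_sigma_finite lborel "exp_law r" ..
    show ?thesis by (rule LE.Fubini') measurable
  qed
  also have "\<dots> = (\<integral>\<^sup>+s. ?e s * mean (\<lambda>z. ennreal (k (x + z) * expect_at r F (x + z))) s \<partial>lborel)"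
    unfolding fix_s ..
  also have "\<dots> = (\<integral>\<^sup>+z. ennreal (k (x + z) * expect_at r F (x + z)) \<partial>potential r)"
    by (rule nn_integral_potential[symmetric]) measurable
  also have "\<dots> = ennreal (resolvent r (\<lambda>y. k y * expect_at r F y) x)"
    unfolding resolvent_def
  proof (rule nn_integral_eq_integral)
    have "\<bar>k (x + z) * expect_at r F (x + z)\<bar> \<le> K" for z
    proof -
      have "k (x + z) * expect_at r F (x + z) \<le> K * 1"
        using k_bd expect_at_bounds[OF r F_bd(2)] by (intro mult_mono) (auto intro: order_trans[OF k_bd])
      then show ?thesis using k_bd expect_at_bounds[OF r F_bd(2)] by (simp add: abs_mult)
    qed
    then show "integrable (potential r) (\<lambda>z. k (x + z) * expect_at r F (x + z))"
      by (intro integrable_potential_bounded[OF r]) measurable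
    show "AE z in potential r. 0 \<le> k (x + z) * expect_at r F (x + z)"
      using k_bd expect_at_bounds[OF r F_bd(2)] by auto
  qed
  finally show ?thesis .
qed

lemma expect_at_terminal_value:
  assumes r: "0 < r" and [measurable]: "f \<in> borel_measurable borel" and f: "\<And>y. 0 \<le> f y" "\<And>y. f y \<le> 1"
  shows "expect_at r (\<lambda>(t, y, w). f (y + path_value t w)) x = r * resolvent r f x"
proof -
  have "ennreal (expect_at r (\<lambda>(t, y, w). f (y + path_value t w)) x) = (\<integral>\<^sup>+t. mean (\<lambda>z. ennreal (f (x + z))) t \<partial>exp_law r)"
    using f by (subst ennreal_expect_at[OF r]) (auto simp: mean_def[abs_def])
  also have "\<dots> = ennreal r * (\<integral>\<^sup>+z. ennreal (f (x + z)) \<partial>potential r)"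
    by (subst nn_integral_exp_law[OF _ r]) (auto simp: nn_integral_potential)
  also have "(\<integral>\<^sup>+z. ennreal (f (x + z)) \<partial>potential r) = ennreal (resolvent r f x)"
    unfolding resolvent_def using f by (intro nn_integral_eq_integral integrable_potential_bounded[OF r, where B=1]) auto
  also have "ennreal r * ennreal (resolvent r f x) = ennreal (r * resolvent r f x)"
    using r by (simp add: ennreal_mult')
  finally show ?thesis
    using r f expect_at_bounds(1)[OF r, of "\<lambda>(t, y, w). f (y + path_value t w)" x]
      Bochner_Integration.integral_nonneg[of "potential r" "\<lambda>z. f (x + z)"]
    by (subst (asm) ennreal_inj) (auto simp: resolvent_def)
qed

end

section \<open>The last negative time\<close>

text \<open>A characterisation of the last negative time by inequalities; it determines the time uniquely and behaves
  well under shifts of the path.\<close>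

definition is_last_negative :: "(real \<Rightarrow> real) \<Rightarrow> real \<Rightarrow> real \<Rightarrow> bool" where
  "is_last_negative Y t L \<longleftrightarrow> 0 \<le> L \<and> L \<le> t \<and> (\<forall>u. L < u \<and> u \<le> t \<longrightarrow> 0 \<le> Y u) \<and>
     (\<forall>a. 0 \<le> a \<and> a < L \<longrightarrow> (\<exists>u. a < u \<and> u \<le> t \<and> Y u < 0))"

lemma is_last_negative_unique:
  assumes "is_last_negative Y t L" "is_last_negative Y t L'" shows "L = L'"
proof (rule ccontr)
  assume "L \<noteq> L'"
  moreover have False if h: "is_last_negative Y t L" "is_last_negative Y t L'" "L < L'" for L L'
  proof -
    have "\<exists>u. L < u \<and> u \<le> t \<and> Y u < 0" using h unfolding is_last_negative_def by blast
    then show False using h(1) unfolding is_last_negative_def by force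
  qed
  ultimately show False using assms by (metis linorder_neqE)
qed

lemma is_last_negative_time:
  assumes t: "0 \<le> t" shows "is_last_negative Y t (last_negative_time Y t)"
proof -
  let ?S = "{u. 0 < u \<and> u \<le> t \<and> Y u < 0}"
  show ?thesis
  proof (cases "?S = {}")
    case True
    have L0: "last_negative_time Y t = 0" unfolding last_negative_time_def using True by (rule if_P)
    have "0 \<le> Y u" if "0 < u" "u \<le> t" for u using True that by (auto simp: not_less[symmetric])
    then show ?thesis using t by (simp add: L0 is_last_negative_def)
  next
    case False
    have bdd: "bdd_above ?S" by (rule bdd_aboveI[of _ t]) auto
    have L: "last_negative_time Y t = Sup ?S" unfolding last_negative_time_def using False by (rule if_not_P)
    obtain v where v: "v \<in> ?S" using False by blast
    have "v \<le> Sup ?S" using bdd v by (intro cSup_upper) auto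
    then have 1: "0 \<le> Sup ?S" using v by simp
    have 2: "Sup ?S \<le> t" using False by (intro cSup_least) auto
    have 3: "0 \<le> Y u" if "Sup ?S < u" "u \<le> t" for u
    proof (rule ccontr)
      assume "\<not> 0 \<le> Y u"
      then have "u \<in> ?S" using that 1 by auto
      then have "u \<le> Sup ?S" using bdd by (intro cSup_upper) auto
      then show False using that by simp
    qed
    have 4: "\<exists>u. a < u \<and> u \<le> t \<and> Y u < 0" if "a < Sup ?S" for a
      using less_cSupD[OF False that] by blast
    show ?thesis unfolding L is_last_negative_def using 1 2 3 4 by blast
  qed
qed

lemma is_last_negative_shift:
  assumes L: "is_last_negative Y t L" and s: "0 \<le> s" "s \<le> t"
  shows "is_last_negative (\<lambda>u. Y (s + u)) (t - s) (max (L - s) 0)"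
  unfolding is_last_negative_def
proof (intro conjI allI impI)
  show "0 \<le> max (L - s) 0" by simp
  show "max (L - s) 0 \<le> t - s" using L s by (auto simp: is_last_negative_def)
  fix u assume "max (L - s) 0 < u \<and> u \<le> t - s"
  then show "0 \<le> Y (s + u)" using L by (auto simp: is_last_negative_def)
next
  fix a assume a: "0 \<le> a \<and> a < max (L - s) 0"
  then have "0 \<le> s + a" "s + a < L" using s by auto
  then obtain u where "s + a < u" "u \<le> t" "Y u < 0" using L unfolding is_last_negative_def by blast
  then show "\<exists>u. a < u \<and> u \<le> t - s \<and> Y (s + u) < 0" by (intro exI[of _ "u - s"]) auto
qed

lemma last_negative_nonneg: "0 \<le> last_negative x t w"
proof (cases "x + path_value t w < 0")
  case False
  have bdd: "bdd_above ((\<lambda>u. if 0 < u \<and> u < t \<and> x + path_value u w < 0 then u else 0) ` \<rat>)"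
    by (rule bdd_aboveI2[where M="max t 0"]) auto
  have "0 \<le> (SUP u\<in>\<rat>. if 0 < u \<and> u < t \<and> x + path_value u w < 0 then u else 0)"
    by (rule cSUP_upper2[where x=0, OF bdd]) auto
  then show ?thesis using False by (simp add: last_negative_def)
qed (simp add: last_negative_def)

lemma is_last_negative_right_continuous:
  assumes t: "0 \<le> t" and v: "\<And>s. 0 \<le> s \<Longrightarrow> x + path_value s w = Y s"
    and rc: "\<And>s. 0 \<le> s \<Longrightarrow> (Y \<longlongrightarrow> Y s) (at_right s)"
  shows "is_last_negative Y t (last_negative x t w)"
proof (cases "Y t < 0")
  case True
  then show ?thesis using t by (auto simp: last_negative_def v is_last_negative_def)
next
  case False
  let ?f = "\<lambda>u. if 0 < u \<and> u < t \<and> x + path_value u w < 0 then u else 0"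
  have L: "last_negative x t w = (SUP u\<in>\<rat>. ?f u)" using False t by (simp add: last_negative_def v)
  have bdd: "bdd_above (?f ` \<rat>)" by (rule bdd_aboveI2[where M=t]) (use t in auto)
  show ?thesis
    unfolding is_last_negative_def
  proof (intro conjI allI impI)
    show "0 \<le> last_negative x t w" by (rule last_negative_nonneg)
    show "last_negative x t w \<le> t" unfolding L using t by (intro cSUP_least) auto
  next
    fix u assume u: "last_negative x t w < u \<and> u \<le> t"
    show "0 \<le> Y u"
    proof (rule ccontr)
      assume "\<not> 0 \<le> Y u"
      then have Yu: "Y u < 0" by simp
      have u0: "0 < u" using u last_negative_nonneg[of x t w] by simp
      have ut: "u < t" using u False Yu by (cases "u = t") auto
      have "\<forall>\<^sub>F s in at_right u. Y s < 0"
        using rc[of u] u0 Yu by (intro order_tendstoD) auto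
      then obtain d where d: "u < d" "\<And>s. u < s \<Longrightarrow> s < d \<Longrightarrow> Y s < 0"
        by (auto simp: eventually_at_right[OF ut])
      obtain s where s: "s \<in> \<rat>" "u < s" "s < min d t" using Rats_dense_in_real[of u "min d t"] d(1) ut by auto
      have "?f s = s" using s u0 d(2)[of s] by (simp add: v)
      then have "s \<le> (SUP u\<in>\<rat>. ?f u)" using cSUP_upper[OF s(1) bdd] by simp
      then show False using u s(2) unfolding L by simp
    qed
  next
    fix a assume a: "0 \<le> a \<and> a < last_negative x t w"
    then obtain u where u: "u \<in> \<rat>" "a < ?f u"
      unfolding L using less_cSUP_iff[of "\<rat> :: real set" ?f a] bdd by auto
    then show "\<exists>u. a < u \<and> u \<le> t \<and> Y u < 0"
      using a by (intro exI[of _ u]) (auto split: if_splits simp: v)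
  qed
qed

lemma negative_time_integrable:
  "w \<in> space path_space \<Longrightarrow> integrable lborel (\<lambda>s. if 0 \<le> s \<and> s \<le> t \<and> x + path_value s w < 0 then 1 else 0 :: real)"
proof -
  assume [measurable]: "w \<in> space path_space"
  show ?thesis
  proof (rule Bochner_Integration.integrable_bound[of lborel "\<lambda>s. indicator {0..max t 0} s :: real"])
    show "integrable lborel (\<lambda>s. indicator {0..max t 0} s :: real)" by simp
  qed (auto split: split_indicator)
qed

lemma negative_time_nonneg: "0 \<le> negative_time x t w"
  unfolding negative_time_def by (intro Bochner_Integration.integral_nonneg) auto

lemma negative_time_0: "negative_time x 0 w = 0"
proof -
  have "negative_time x 0 w = (LINT s|(lborel :: real measure). 0)"
    unfolding negative_time_def
  proof (rule integral_cong_AE)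
    have *: "(if 0 \<le> s \<and> s \<le> 0 \<and> x + path_value s w < 0 then 1 else 0 :: real) = (if s = 0 \<and> x + path_value 0 w < 0 then 1 else 0)" for s
      by auto
    show "(\<lambda>s. if 0 \<le> s \<and> s \<le> 0 \<and> x + path_value s w < 0 then 1 else 0 :: real) \<in> borel_measurable lborel"
      unfolding * by measurable
    show "AE s in lborel. (if 0 \<le> s \<and> s \<le> 0 \<and> x + path_value s w < 0 then 1 else 0 :: real) = 0"
      using AE_lborel_singleton[of 0] by eventually_elim auto
  qed auto
  then show ?thesis by simp
qed

context spectrally_negative_levy
begin

lemma resolvent_diff:
  assumes \<mu>: "0 < \<mu>" and [measurable]: "f \<in> borel_measurable borel" "g \<in> borel_measurable borel"
    and B: "\<And>y. \<bar>f y\<bar> \<le> A" "\<And>y. \<bar>g y\<bar> \<le> B"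
  shows "resolvent \<mu> (\<lambda>y. f y - g y) x = resolvent \<mu> f x - resolvent \<mu> g x"
  unfolding resolvent_def
  using integrable_potential_bounded[OF \<mu>, of "\<lambda>z. f (x + z)" A] integrable_potential_bounded[OF \<mu>, of "\<lambda>z. g (x + z)" B] B
  by simp

lemma path_in_path_space: "\<omega> \<in> space M \<Longrightarrow> path \<omega> \<in> space path_space"
  using measurable_space[OF measurable_path] .

lemma path_value_shift_path:
  assumes "\<omega> \<in> space M" "0 \<le> s" "0 \<le> u"
  shows "x + path_value s (path \<omega>) + path_value u (shift_path s (path \<omega>)) = x + X (s + u) \<omega>"
  using assms by (simp add: shift_path_path path_value_future path_value_path)

lemma negative_time_shift:
  assumes \<omega>: "\<omega> \<in> space M" and s: "0 \<le> s" and v: "0 \<le> v"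
  shows "negative_time (x + path_value s (path \<omega>)) v (shift_path s (path \<omega>)) =
    negative_time x (s + v) (path \<omega>) - negative_time x s (path \<omega>)"
proof -
  let ?i = "\<lambda>t u. if 0 \<le> u \<and> u \<le> t \<and> x + path_value u (path \<omega>) < 0 then 1 else 0 :: real"
  have [measurable]: "path \<omega> \<in> space path_space" by (rule path_in_path_space[OF \<omega>])
  have "negative_time (x + path_value s (path \<omega>)) v (shift_path s (path \<omega>)) =
    (LINT u|lborel. (if s \<le> s + 1 * u \<and> s + 1 * u \<le> s + v \<and> x + path_value (s + 1 * u) (path \<omega>) < 0 then 1 else 0))"
    unfolding negative_time_def
    by (rule Bochner_Integration.integral_cong[OF refl]) (use \<omega> s in \<open>auto simp: shift_path_path path_value_future path_value_path\<close>)
  also have "\<dots> = (LINT u|lborel. (if s \<le> u \<and> u \<le> s + v \<and> x + path_value u (path \<omega>) < 0 then 1 else 0))"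
    by (subst lborel_integral_real_affine[where c=1 and t=s and f="\<lambda>u. if s \<le> u \<and> u \<le> s + v \<and> x + path_value u (path \<omega>) < 0 then 1 else 0"]) auto
  also have "\<dots> = (LINT u|lborel. ?i (s + v) u - ?i s u)"
  proof (rule integral_cong_AE)
    show "AE u in lborel. (if s \<le> u \<and> u \<le> s + v \<and> x + path_value u (path \<omega>) < 0 then 1 else 0) = ?i (s + v) u - ?i s u"
      using AE_lborel_singleton[of s] by eventually_elim (use s v in auto)
  qed measurable
  also have "\<dots> = (LINT u|lborel. ?i (s + v) u) - (LINT u|lborel. ?i s u)"
    using \<omega> by (intro Bochner_Integration.integral_diff negative_time_integrable path_in_path_space)
  finally show ?thesis by (simp add: negative_time_def)
qed

text \<open>\<open>exp_integral_identity\<close> with the killing rate along a path as density.\<close>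

lemma discount_identity:
  fixes x :: real
  assumes \<omega>: "\<omega> \<in> space M" and pq: "0 \<le> p" "0 \<le> q" and t: "0 \<le> t"
  defines "a \<equiv> \<lambda>s. p + q * indicator {..<0} (x + path_value s (path \<omega>))"
    and "A \<equiv> \<lambda>v. p * v + q * negative_time x v (path \<omega>)"
  shows "(\<integral>\<^sup>+s. ennreal (a s * exp (- (A t - A s)) * indicator {0..t} s) \<partial>lborel) = ennreal (1 - exp (- A t))"
proof -
  have [measurable]: "path \<omega> \<in> space path_space" by (rule path_in_path_space[OF \<omega>])
  have [measurable]: "a \<in> borel_measurable borel" unfolding a_def by measurable
  have a: "0 \<le> a s" "a s \<le> p + q" for s using pq by (auto simp: a_def split: split_indicator)
  have A: "A v = (LINT s|lborel. a s * indicator {0..v} s)" if v: "0 \<le> v" "v \<le> t" for v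
  proof -
    have "(LINT s|lborel. a s * indicator {0..v} s) =
      (LINT s|lborel. p * indicator {0..v} s + q * (if 0 \<le> s \<and> s \<le> v \<and> x + path_value s (path \<omega>) < 0 then 1 else 0))"
      by (rule Bochner_Integration.integral_cong[OF refl]) (auto simp: a_def split: split_indicator)
    also have "\<dots> = (LINT s|lborel. p * indicator {0..v} s) + (LINT s|lborel. q * (if 0 \<le> s \<and> s \<le> v \<and> x + path_value s (path \<omega>) < 0 then 1 else 0))"
      using v by (intro Bochner_Integration.integral_add integrable_mult_right negative_time_integrable path_in_path_space[OF \<omega>]) simp
    also have "\<dots> = A v" using v by (simp add: A_def negative_time_def)
    finally show ?thesis by simp
  qed
  note E = exp_integral_identity[of a "p + q" t A, OF _ a t A]
  show ?thesis
    using E a by (subst nn_integral_eq_integral) (auto intro!: mult_nonneg_nonneg)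
qed

lemma AE_exp_law_pos: "0 < r \<Longrightarrow> AE t in exp_law r. 0 < t"
  using AE_lborel_singleton[of 0]
  by (subst AE_density) (auto elim!: eventually_mono simp: exponential_density_def)

text \<open>The Feynman-Kac equation. By \<open>discount_identity\<close>, \<open>f(X\<^sub>t)\<close> is the discounted terminal value plus an
  integral over \<open>s\<close> of the killing rate at \<open>X\<^sub>s\<close> times the discounted terminal value of the path shifted by \<open>s\<close>;
  the expectation of the integral is a resolvent.\<close>

lemma expect_at_discounted:
  fixes f :: "real \<Rightarrow> real"
  assumes r: "0 < r" and pq: "0 \<le> p" "0 \<le> q" and f_m [measurable]: "f \<in> borel_measurable borel" and f: "\<And>y. 0 \<le> f y" "\<And>y. f y \<le> 1"
  defines "F \<equiv> \<lambda>(t, y, w). exp (- p * max t 0 - q * negative_time y t w) * f (y + path_value t w)"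
  shows "expect_at r F x = resolvent r (\<lambda>y. r * f y - (p + q * indicator {..<0} y) * expect_at r F y) x"
proof -
  let ?k = "\<lambda>y. p + q * indicator {..<0} y :: real"
  have [measurable]: "F \<in> borel_measurable (borel \<Otimes>\<^sub>M borel \<Otimes>\<^sub>M path_space)"
    unfolding F_def case_prod_beta by measurable
  note [measurable] = measurable_expect_at[OF r this]
  have F_bd: "0 \<le> F z" "F z \<le> 1" for z
  proof -
    obtain t y w where z: "z = (t, y, w)" by (cases z)
    have "0 \<le> p * max t 0" "0 \<le> q * negative_time y t w"
      using pq negative_time_nonneg[of y t w] by (auto intro!: mult_nonneg_nonneg)
    then have "exp (- p * max t 0 - q * negative_time y t w) \<le> 1" by simp
    then have "exp (- p * max t 0 - q * negative_time y t w) * f (y + path_value t w) \<le> 1 * 1"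
      using f by (intro mult_mono) auto
    then show "0 \<le> F z" "F z \<le> 1" using f by (auto simp: F_def z)
  qed
  let ?G = "\<lambda>t \<omega>. \<integral>\<^sup>+s. ennreal (if 0 \<le> s \<and> s \<le> t then ?k (x + path_value s (path \<omega>)) *
      F (t - s, x + path_value s (path \<omega>), shift_path s (path \<omega>)) else 0) \<partial>lborel"
  have k_bd: "0 \<le> ?k y" "?k y \<le> p + q" for y using pq by (auto split: split_indicator)
  have pathwise: "ennreal (f (x + path_value t (path \<omega>))) = ennreal (F (t, x, path \<omega>)) + ?G t \<omega>" if \<omega>: "\<omega> \<in> space M" and t: "0 \<le> t" for t \<omega>
  proof -
    have [measurable]: "path \<omega> \<in> space path_space" by (rule path_in_path_space[OF \<omega>])
    define A where "A v = p * v + q * negative_time x v (path \<omega>)" for v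
    define c where "c = f (x + path_value t (path \<omega>))"
    have "?G t \<omega> = (\<integral>\<^sup>+s. ennreal c * ennreal (?k (x + path_value s (path \<omega>)) * exp (- (A t - A s)) * indicator {0..t} s) \<partial>lborel)"
    proof (rule nn_integral_cong)
      fix s :: real
      show "ennreal (if 0 \<le> s \<and> s \<le> t then ?k (x + path_value s (path \<omega>)) * F (t - s, x + path_value s (path \<omega>), shift_path s (path \<omega>)) else 0) =
        ennreal c * ennreal (?k (x + path_value s (path \<omega>)) * exp (- (A t - A s)) * indicator {0..t} s)"
      proof (cases "0 \<le> s \<and> s \<le> t")
        case True
        have v: "x + path_value s (path \<omega>) + path_value (t - s) (shift_path s (path \<omega>)) = x + path_value t (path \<omega>)"
          using path_value_shift_path[OF \<omega>, of s "t - s" x] True t by (simp add: path_value_path[OF \<omega>])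
        have n: "negative_time (x + path_value s (path \<omega>)) (t - s) (shift_path s (path \<omega>)) = negative_time x t (path \<omega>) - negative_time x s (path \<omega>)"
          using negative_time_shift[OF \<omega>, of s "t - s" x] True by simp
        have "F (t - s, x + path_value s (path \<omega>), shift_path s (path \<omega>)) =
            exp (- p * max (t - s) 0 - q * (negative_time x t (path \<omega>) - negative_time x s (path \<omega>))) * c"
          unfolding F_def prod.case v n c_def ..
        also have "- p * max (t - s) 0 - q * (negative_time x t (path \<omega>) - negative_time x s (path \<omega>)) = - (A t - A s)"
          using True by (simp add: A_def algebra_simps)
        finally have "F (t - s, x + path_value s (path \<omega>), shift_path s (path \<omega>)) = exp (- (A t - A s)) * c" .
        then show ?thesis using True f k_bd(1)[of "x + path_value s (path \<omega>)"]
          by (simp add: ennreal_mult'[symmetric] c_def mult_ac)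
      qed auto
    qed
    also have "\<dots> = ennreal c * (\<integral>\<^sup>+s. ennreal (?k (x + path_value s (path \<omega>)) * exp (- (A t - A s)) * indicator {0..t} s) \<partial>lborel)"
      unfolding A_def by (rule nn_integral_cmult) measurable
    also have "\<dots> = ennreal c * ennreal (1 - exp (- A t))"
      unfolding A_def discount_identity[OF \<omega> pq t] ..
    also have "\<dots> = ennreal (c * (1 - exp (- A t)))"
      using f by (simp add: ennreal_mult' c_def)
    finally have G: "?G t \<omega> = ennreal (c * (1 - exp (- A t)))" .
    have A0: "0 \<le> A t" using pq t negative_time_nonneg by (simp add: A_def)
    have "F (t, x, path \<omega>) = c * exp (- A t)" using t by (simp add: F_def A_def c_def algebra_simps)
    moreover have "0 \<le> c * exp (- A t)" "0 \<le> c * (1 - exp (- A t))"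
      using A0 f by (auto simp: c_def intro!: mult_nonneg_nonneg)
    then have "ennreal (c * exp (- A t)) + ennreal (c * (1 - exp (- A t))) = ennreal (c * exp (- A t) + c * (1 - exp (- A t)))"
      by (rule ennreal_plus[symmetric])
    moreover have "c * exp (- A t) + c * (1 - exp (- A t)) = c" by (simp add: right_diff_distrib)
    ultimately show ?thesis unfolding G by (simp only: c_def)
  qed
  interpret E: prob_space "exp_law r" by (rule prob_space_exponential_density[OF r])
  have "ennreal (expect_at r (\<lambda>(t, y, w). f (y + path_value t w)) x) = (\<integral>\<^sup>+t. \<integral>\<^sup>+\<omega>. ennreal (f (x + path_value t (path \<omega>))) \<partial>M \<partial>exp_law r)"
    using f by (subst ennreal_expect_at[OF r]) auto
  also have "\<dots> = (\<integral>\<^sup>+t. (\<integral>\<^sup>+\<omega>. ennreal (F (t, x, path \<omega>)) \<partial>M) + (\<integral>\<^sup>+\<omega>. ?G t \<omega> \<partial>M) \<partial>exp_law r)"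
  proof (rule nn_integral_cong_AE)
    show "AE t in exp_law r. (\<integral>\<^sup>+\<omega>. ennreal (f (x + path_value t (path \<omega>))) \<partial>M) = (\<integral>\<^sup>+\<omega>. ennreal (F (t, x, path \<omega>)) \<partial>M) + (\<integral>\<^sup>+\<omega>. ?G t \<omega> \<partial>M)"
      using AE_exp_law_pos[OF r]
    proof eventually_elim
      case (elim t)
      have "(\<integral>\<^sup>+\<omega>. ennreal (f (x + path_value t (path \<omega>))) \<partial>M) = (\<integral>\<^sup>+\<omega>. ennreal (F (t, x, path \<omega>)) + ?G t \<omega> \<partial>M)"
        by (rule nn_integral_cong) (use pathwise elim in auto)
      also have "\<dots> = (\<integral>\<^sup>+\<omega>. ennreal (F (t, x, path \<omega>)) \<partial>M) + (\<integral>\<^sup>+\<omega>. ?G t \<omega> \<partial>M)"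
        by (rule nn_integral_add) measurable
      finally show ?case .
    qed
  qed
  also have "\<dots> = (\<integral>\<^sup>+t. \<integral>\<^sup>+\<omega>. ennreal (F (t, x, path \<omega>)) \<partial>M \<partial>exp_law r) + (\<integral>\<^sup>+t. \<integral>\<^sup>+\<omega>. ?G t \<omega> \<partial>M \<partial>exp_law r)"
    by (rule nn_integral_add) measurable
  also have "(\<integral>\<^sup>+t. \<integral>\<^sup>+\<omega>. ennreal (F (t, x, path \<omega>)) \<partial>M \<partial>exp_law r) = ennreal (expect_at r F x)"
    using ennreal_expect_at[where F=F, OF r F_bd(2)] by simp
  also have "(\<integral>\<^sup>+t. \<integral>\<^sup>+\<omega>. ?G t \<omega> \<partial>M \<partial>exp_law r) = ennreal (resolvent r (\<lambda>y. ?k y * expect_at r F y) x)"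
    by (rule nn_integral_markov_resolvent[OF r _ _ k_bd F_bd]) measurable
  finally have sum: "ennreal (r * resolvent r f x) = ennreal (expect_at r F x) + ennreal (resolvent r (\<lambda>y. ?k y * expect_at r F y) x)"
    by (simp only: expect_at_terminal_value[OF r f_m f])
  note eb = expect_at_bounds[where F=F, OF r F_bd(2)]
  have nn: "0 \<le> resolvent r f x" "0 \<le> resolvent r (\<lambda>y. ?k y * expect_at r F y) x"
    unfolding resolvent_def using f eb k_bd by (auto intro!: Bochner_Integration.integral_nonneg mult_nonneg_nonneg)
  have "ennreal (r * resolvent r f x) = ennreal (expect_at r F x + resolvent r (\<lambda>y. ?k y * expect_at r F y) x)"
    unfolding sum by (rule ennreal_plus[OF eb(1) nn(2), symmetric])
  then have eq: "r * resolvent r f x = expect_at r F x + resolvent r (\<lambda>y. ?k y * expect_at r F y) x"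
    using nn r eb(1)[of x] by (subst (asm) ennreal_inj) (auto intro: add_nonneg_nonneg)
  have "resolvent r (\<lambda>y. r * f y - ?k y * expect_at r F y) x = resolvent r (\<lambda>y. r * f y) x - resolvent r (\<lambda>y. ?k y * expect_at r F y) x"
  proof (rule resolvent_diff[OF r, where A=r and B="p + q"])
    show "\<bar>r * f y\<bar> \<le> r" for y using r f[of y] by (simp add: abs_mult mult_left_le)
    show "\<bar>?k y * expect_at r F y\<bar> \<le> p + q" for y
    proof -
      have "?k y * expect_at r F y \<le> (p + q) * 1"
        using k_bd eb pq by (intro mult_mono) auto
      then show ?thesis using k_bd(1)[of y] eb(1)[of y] by (simp add: abs_mult)
    qed
  qed measurable
  then show ?thesis unfolding resolvent_cmult eq by simp
qed

lemma path_is_last_negative: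
  assumes \<omega>: "\<omega> \<in> space M" and t: "0 \<le> t"
  shows "is_last_negative (\<lambda>s. x + X s \<omega>) t (last_negative x t (path \<omega>))"
proof (rule is_last_negative_right_continuous[OF t])
  show "x + path_value s (path \<omega>) = x + X s \<omega>" if "0 \<le> s" for s using path_value_path[OF \<omega> that] by simp
  show "((\<lambda>s. x + X s \<omega>) \<longlongrightarrow> x + X s \<omega>) (at_right s)" if "0 \<le> s" for s
    by (intro tendsto_add tendsto_const right_continuous_paths[OF \<omega> that])
qed

lemma last_negative_shift:
  assumes \<omega>: "\<omega> \<in> space M" and s: "0 \<le> s" "s \<le> t"
  shows "last_negative (x + path_value s (path \<omega>)) (t - s) (shift_path s (path \<omega>)) = max (last_negative x t (path \<omega>) - s) 0"
proof (rule is_last_negative_unique)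
  show "is_last_negative (\<lambda>u. x + X (s + u) \<omega>) (t - s) (max (last_negative x t (path \<omega>) - s) 0)"
    using is_last_negative_shift[OF path_is_last_negative[OF \<omega>, of t x] s] s by simp
  show "is_last_negative (\<lambda>u. x + X (s + u) \<omega>) (t - s) (last_negative (x + path_value s (path \<omega>)) (t - s) (shift_path s (path \<omega>)))"
  proof (rule is_last_negative_right_continuous)
    show "0 \<le> t - s" using s by simp
    show "x + path_value s (path \<omega>) + path_value u (shift_path s (path \<omega>)) = x + X (s + u) \<omega>" if "0 \<le> u" for u
      by (rule path_value_shift_path[OF \<omega> s(1) that])
    show "((\<lambda>u. x + X (s + u) \<omega>) \<longlongrightarrow> x + X (s + u) \<omega>) (at_right u)" if "0 \<le> u" for u
    proof -
      have "filterlim (\<lambda>v. s + v) (at_right (s + u)) (at_right u)"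
        unfolding filterlim_at by (auto simp: eventually_at_filter intro!: tendsto_intros)
      moreover have "((\<lambda>v. X v \<omega>) \<longlongrightarrow> X (s + u) \<omega>) (at_right (s + u))"
        using s that by (intro right_continuous_paths[OF \<omega>]) auto
      ultimately have "((\<lambda>v. X (s + v) \<omega>) \<longlongrightarrow> X (s + u) \<omega>) (at_right u)"
        by (rule filterlim_compose[rotated])
      then show ?thesis by (intro tendsto_add tendsto_const)
    qed
  qed
qed

text \<open>If the path is positive at time \<open>t\<close>, then also shortly before \<open>t\<close>, as there are no positive jumps.\<close>

lemma last_negative_eq_end:
  assumes \<omega>: "\<omega> \<in> space M" and t: "0 < t" and ne: "x + X t \<omega> \<noteq> 0"
  shows "last_negative x t (path \<omega>) < t \<longleftrightarrow> 0 \<le> x + X t \<omega>"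
proof -
  let ?L = "last_negative x t (path \<omega>)"
  have L: "is_last_negative (\<lambda>s. x + X s \<omega>) t ?L" using path_is_last_negative[OF \<omega>] t by simp
  show ?thesis
  proof
    assume "?L < t" then show "0 \<le> x + X t \<omega>" using L unfolding is_last_negative_def by blast
  next
    assume "0 \<le> x + X t \<omega>"
    then have pos: "- x < X t \<omega>" using ne by simp
    obtain l where l: "((\<lambda>s. X s \<omega>) \<longlongrightarrow> l) (at_left t)" "X t \<omega> \<le> l"
      using no_positive_jumps[OF \<omega> t] by blast
    have "\<forall>\<^sub>F s in at_left t. - x < X s \<omega>"
      using pos l(2) by (intro order_tendstoD(1)[OF l(1)]) simp
    then obtain d where d: "d < t" "\<And>s. d < s \<Longrightarrow> s < t \<Longrightarrow> - x < X s \<omega>"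
      by (auto simp: eventually_at_left[OF t])
    show "?L < t"
    proof (rule ccontr)
      assume "\<not> ?L < t"
      then have "?L = t" using L unfolding is_last_negative_def by simp
      then have "0 \<le> max d 0" "max d 0 < ?L" using d(1) t by auto
      then obtain u where u: "max d 0 < u" "u \<le> t" "x + X u \<omega> < 0"
        using L unfolding is_last_negative_def by blast
      then show False using d(2)[of u] pos by (cases "u = t") auto
    qed
  qed
qed

end

text \<open>The functional of the first identity, with the strict version of the occupation time.\<close>

definition discount_at_last :: "real \<Rightarrow> real \<Rightarrow> real \<times> real \<times> (real \<Rightarrow> real) \<Rightarrow> real" where
  "discount_at_last p q = (\<lambda>(t, y, w). if last_negative y t w < t
     then exp (- p * last_negative y t w - q * negative_time y (last_negative y t w) w) else 0)"

definition stays_nonneg :: "real \<times> real \<times> (real \<Rightarrow> real) \<Rightarrow> real" where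
  "stays_nonneg = (\<lambda>(t, y, w). if last_negative y t w = 0 then 1 else 0)"

lemma measurable_discount_at_last [measurable]:
  "discount_at_last p q \<in> borel_measurable (borel \<Otimes>\<^sub>M borel \<Otimes>\<^sub>M path_space)"
  unfolding discount_at_last_def case_prod_beta by measurable

lemma measurable_stays_nonneg [measurable]:
  "stays_nonneg \<in> borel_measurable (borel \<Otimes>\<^sub>M borel \<Otimes>\<^sub>M path_space)"
  unfolding stays_nonneg_def case_prod_beta by measurable

lemma discount_at_last_bounds:
  assumes "0 \<le> p" "0 \<le> q" shows "0 \<le> discount_at_last p q z" "discount_at_last p q z \<le> 1"
proof -
  obtain t y w where z: "z = (t, y, w)" by (cases z)
  have "0 \<le> p * last_negative y t w" "0 \<le> q * negative_time y (last_negative y t w) w"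
    using assms last_negative_nonneg negative_time_nonneg by auto
  then show "0 \<le> discount_at_last p q z" "discount_at_last p q z \<le> 1"
    by (auto simp: discount_at_last_def z)
qed

lemma stays_nonneg_bounds: "0 \<le> stays_nonneg z" "stays_nonneg z \<le> 1"
  by (auto simp: stays_nonneg_def split: prod.split)

context spectrally_negative_levy
begin

lemma potential_no_atoms:
  assumes \<mu>: "0 < \<mu>" and W: "scale_function psi \<mu> W"
  shows "emeasure (potential \<mu>) {a} = 0"
proof -
  have "(\<integral>\<^sup>+z. ennreal (potential_const \<mu> * exp (- passage_rate \<mu> * z)) * indicator {a} z \<partial>lborel) = (\<integral>\<^sup>+z. 0 \<partial>(lborel :: real measure))"
  proof (rule nn_integral_cong_AE)
    show "AE z in lborel. ennreal (potential_const \<mu> * exp (- passage_rate \<mu> * z)) * indicator {a} z = 0"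
      using AE_lborel_singleton[of a] by (rule eventually_mono) (simp split: split_indicator)
  qed
  then show ?thesis using potential_density[OF \<mu> W, of "indicator {a}"] by simp
qed

lemma AE_mean_singleton:
  assumes \<mu>: "0 < \<mu>" and W: "scale_function psi \<mu> W"
  shows "AE t in lborel. 0 \<le> t \<longrightarrow> (AE \<omega> in M. X t \<omega> \<noteq> a)"
proof -
  have "(\<integral>\<^sup>+t. ennreal (exp (- \<mu> * t)) * indicator {0..} t * mean (indicator {a}) t \<partial>lborel) = 0"
    using nn_integral_potential[of "indicator {a}" \<mu>] potential_no_atoms[OF \<mu> W] by simp
  then have "AE t in lborel. 0 \<le> t \<longrightarrow> mean (indicator {a}) t = 0"
    by (subst (asm) nn_integral_0_iff_AE) (auto elim!: eventually_mono split: split_indicator_asm)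
  then show ?thesis
  proof eventually_elim
    case (elim t)
    show ?case
    proof
      assume t: "0 \<le> t"
      note [measurable] = measurable_X[OF t]
      have "(\<integral>\<^sup>+\<omega>. indicator {a} (X t \<omega>) \<partial>M) = 0" using elim t mean_eq[OF t] by simp
      then show "AE \<omega> in M. X t \<omega> \<noteq> a"
        by (subst (asm) nn_integral_0_iff_AE) (auto elim!: eventually_mono split: split_indicator_asm)
    qed
  qed
qed

text \<open>A path spends no time at a given level, because \<open>U\<^sub>\<mu>\<close> has a density.\<close>

lemma AE_zero_set_null:
  assumes \<mu>: "0 < \<mu>" and W: "scale_function psi \<mu> W"
  shows "AE \<omega> in M. AE t in lborel. 0 \<le> t \<longrightarrow> X t \<omega> \<noteq> a"
proof -
  have "(\<integral>\<^sup>+\<omega>. \<integral>\<^sup>+t. ennreal (exp (- \<mu> * t)) * indicator {0..} t * indicator {a} (path_value t (path \<omega>)) \<partial>lborel \<partial>M) = 0"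
    using nn_integral_potential_swap[of "indicator {a}" \<mu>] potential_no_atoms[OF \<mu> W] by simp
  then have "AE \<omega> in M. (\<integral>\<^sup>+t. ennreal (exp (- \<mu> * t)) * indicator {0..} t * indicator {a} (path_value t (path \<omega>)) \<partial>lborel) = 0"
    by (subst (asm) nn_integral_0_iff_AE) auto
  then show ?thesis using AE_space
  proof eventually_elim
    case (elim \<omega>)
    have [measurable]: "path \<omega> \<in> space path_space" by (rule path_in_path_space[OF elim(2)])
    have "AE t in lborel. ennreal (exp (- \<mu> * t)) * indicator {0..} t * indicator {a} (path_value t (path \<omega>)) = (0 :: ennreal)"
      using elim(1) by (subst (asm) nn_integral_0_iff_AE) auto
    then show ?case
      by (rule eventually_mono) (use elim(2) in \<open>auto simp: path_value_path split: split_indicator_asm\<close>)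
  qed
qed

lemma AE_exp_law: "AE t in lborel. 0 \<le> t \<longrightarrow> P t \<Longrightarrow> AE t in exp_law r. P t"
  by (subst AE_density) (auto elim!: eventually_mono simp: exponential_density_def)

text \<open>A path that starts below zero is negative at small positive times.\<close>

lemma stays_nonneg_negative_start:
  assumes r: "0 < r" and y: "y < 0" shows "expect_at r stays_nonneg y = 0"
proof -
  have "(\<integral>\<^sup>+t. \<integral>\<^sup>+\<omega>. ennreal (stays_nonneg (t, y, path \<omega>)) \<partial>M \<partial>exp_law r) = (\<integral>\<^sup>+t. 0 \<partial>exp_law r)"
  proof (rule nn_integral_cong_AE)
    show "AE t in exp_law r. (\<integral>\<^sup>+\<omega>. ennreal (stays_nonneg (t, y, path \<omega>)) \<partial>M) = 0"
      using AE_exp_law_pos[OF r]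
    proof eventually_elim
      case (elim t)
      have "(\<integral>\<^sup>+\<omega>. ennreal (stays_nonneg (t, y, path \<omega>)) \<partial>M) = (\<integral>\<^sup>+\<omega>. 0 \<partial>M)"
      proof (rule nn_integral_cong_AE)
        show "AE \<omega> in M. ennreal (stays_nonneg (t, y, path \<omega>)) = 0"
          using AE_start
        proof eventually_elim
          case (elim \<omega>)
          have L: "is_last_negative (\<lambda>s. y + X s \<omega>) t (last_negative y t (path \<omega>))"
            using path_is_last_negative elim \<open>0 < t\<close> by simp
          have "((\<lambda>s. X s \<omega>) \<longlongrightarrow> X 0 \<omega>) (at_right 0)"
            using elim by (intro right_continuous_paths) auto
          then have "\<forall>\<^sub>F s in at_right 0. X s \<omega> < - y"
            using y elim by (intro order_tendstoD) auto
          then obtain d where d: "0 < d" "\<And>s. 0 < s \<Longrightarrow> s < d \<Longrightarrow> X s \<omega> < - y"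
            using \<open>0 < t\<close> by (auto simp: eventually_at_right)
          define s where "s = min (d / 2) t"
          have s: "0 < s" "s < d" "s \<le> t" using d(1) \<open>0 < t\<close> by (auto simp: s_def)
          have "last_negative y t (path \<omega>) \<noteq> 0"
          proof
            assume "last_negative y t (path \<omega>) = 0"
            then have "0 \<le> y + X s \<omega>" using L s unfolding is_last_negative_def by auto
            then show False using d(2)[OF s(1,2)] by simp
          qed
          then show ?case by (simp add: stays_nonneg_def)
        qed
      qed
      then show ?case by simp
    qed
  qed
  then show ?thesis by (simp add: expect_at_def)
qed

text \<open>Let \<open>L\<close> be the last negative time. If \<open>L < t\<close>, the identity for discounting is applied on \<open>[0, L]\<close>; the
  path shifted by \<open>s\<close> has last negative time \<open>L - s\<close> if \<open>s \<le> L\<close>, and stays nonnegative if \<open>s > L\<close>. The latter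
  times account for the additional term with \<open>stays_nonneg\<close>, in which only the rate \<open>p\<close> is seen because the
  probability vanishes for negative starting points.\<close>

lemma expect_at_before_end:
  assumes r: "0 < r" and pq: "0 \<le> p" "0 \<le> q" and W: "scale_function psi r W"
  shows "expect_at r (discount_at_last p q) x =
    resolvent r (\<lambda>y. (r * indicator {0..} y + p * expect_at r stays_nonneg y) - (p + q * indicator {..<0} y) * expect_at r (discount_at_last p q) y) x"
proof -
  let ?shift = "\<lambda>t s \<omega>. (t - s, x + path_value s (path \<omega>), shift_path s (path \<omega>))"
  interpret E: prob_space "exp_law r" by (rule prob_space_exponential_density[OF r])
  let ?k = "\<lambda>y. p + q * indicator {..<0} y :: real"
  let ?F = "discount_at_last p q"
  let ?P = "\<lambda>(t, y, w). if last_negative y t w < t then 1 else 0 :: real"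
  note F_bd = discount_at_last_bounds[OF pq] and N_bd = stays_nonneg_bounds
  have k_bd: "0 \<le> ?k y" "?k y \<le> p + q" for y using pq by (auto split: split_indicator)
  note [measurable] = measurable_expect_at[OF r measurable_discount_at_last] measurable_expect_at[OF r measurable_stays_nonneg]
  let ?G = "\<lambda>H t \<omega>. \<integral>\<^sup>+s. ennreal (if 0 \<le> s \<and> s \<le> t then ?k (x + path_value s (path \<omega>)) *
      H (?shift t s \<omega>) else 0) \<partial>lborel"
  \<comment> \<open>The times \<open>s > L\<close> contribute equally to both sides, since there the shifted path has discount \<open>1\<close> and stays
    nonnegative; so the identity for discounting on \<open>[0, L]\<close> remains.\<close>
  have pathwise: "ennreal (?P (t, x, path \<omega>)) + ?G stays_nonneg t \<omega> = ennreal (?F (t, x, path \<omega>)) + ?G ?F t \<omega>"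
    if \<omega>: "\<omega> \<in> space M" and t: "0 < t" for t \<omega>
  proof -
    have [measurable]: "path \<omega> \<in> space path_space" by (rule path_in_path_space[OF \<omega>])
    define L where "L = last_negative x t (path \<omega>)"
    have L: "0 \<le> L" "L \<le> t"
      using path_is_last_negative[OF \<omega>, of t x] t by (auto simp: L_def is_last_negative_def)
    define A where "A v = p * v + q * negative_time x v (path \<omega>)" for v
    define c where "c = (if L < t then 1 else 0 :: real)"
    have "?G ?F t \<omega> = (\<integral>\<^sup>+s. ennreal (if 0 \<le> s \<and> s \<le> t then ?k (x + path_value s (path \<omega>)) *
        stays_nonneg (?shift t s \<omega>) else 0) +
        ennreal c * ennreal (?k (x + path_value s (path \<omega>)) * exp (- (A L - A s)) * indicator {0..L} s) \<partial>lborel)"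
    proof (rule nn_integral_cong_AE)
      show "AE s in lborel. ennreal (if 0 \<le> s \<and> s \<le> t then ?k (x + path_value s (path \<omega>)) *
          ?F (?shift t s \<omega>) else 0) =
        ennreal (if 0 \<le> s \<and> s \<le> t then ?k (x + path_value s (path \<omega>)) *
          stays_nonneg (?shift t s \<omega>) else 0) +
        ennreal c * ennreal (?k (x + path_value s (path \<omega>)) * exp (- (A L - A s)) * indicator {0..L} s)"
        using AE_lborel_singleton[of t] AE_lborel_singleton[of L]
      proof eventually_elim
        case (elim s)
        let ?k' = "?k (x + path_value s (path \<omega>))"
        consider "s < 0 \<or> t < s" | "0 \<le> s" "s < L" | "0 \<le> s" "L < s" "s < t"
          using elim by linarith
        then show ?case
        proof cases
          case 1
          then show ?thesis using L by auto
        next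
          case 2
          have st: "0 \<le> s" "s \<le> t" using 2 L by auto
          have l: "last_negative (x + path_value s (path \<omega>)) (t - s) (shift_path s (path \<omega>)) = L - s"
            using last_negative_shift[OF \<omega> st, of x] 2 by (simp add: L_def)
          have n: "negative_time (x + path_value s (path \<omega>)) (L - s) (shift_path s (path \<omega>)) = negative_time x L (path \<omega>) - negative_time x s (path \<omega>)"
            using negative_time_shift[OF \<omega>, of s "L - s" x] 2 by simp
          have N: "stays_nonneg (?shift t s \<omega>) = 0"
            unfolding stays_nonneg_def prod.case l using 2 by simp
          have "?F (?shift t s \<omega>) =
              (if L - s < t - s then exp (- p * (L - s) - q * (negative_time x L (path \<omega>) - negative_time x s (path \<omega>))) else 0)"
            unfolding discount_at_last_def prod.case l n ..
          also have "- p * (L - s) - q * (negative_time x L (path \<omega>) - negative_time x s (path \<omega>)) = - (A L - A s)"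
            by (simp add: A_def algebra_simps)
          finally have F: "?F (?shift t s \<omega>) = c * exp (- (A L - A s))"
            by (simp add: c_def)
          have "ennreal (?k' * (c * exp (- (A L - A s)))) = ennreal c * ennreal (?k' * exp (- (A L - A s)))"
            by (subst ennreal_mult'[symmetric]) (auto simp: c_def)
          then show ?thesis unfolding F N using st 2 by simp
        next
          case 3
          have st: "0 \<le> s" "s \<le> t" using 3 by auto
          have l: "last_negative (x + path_value s (path \<omega>)) (t - s) (shift_path s (path \<omega>)) = 0"
            using last_negative_shift[OF \<omega> st, of x] 3 by (simp add: L_def)
          have N: "stays_nonneg (?shift t s \<omega>) = 1"
            unfolding stays_nonneg_def prod.case l by simp
          have F: "?F (?shift t s \<omega>) = 1"
            unfolding discount_at_last_def prod.case l using 3 by (simp add: negative_time_0)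
          show ?thesis unfolding F N using 3 by simp
        qed
      qed
    qed
    also have "\<dots> = ?G stays_nonneg t \<omega> + (\<integral>\<^sup>+s. ennreal c * ennreal (?k (x + path_value s (path \<omega>)) * exp (- (A L - A s)) * indicator {0..L} s) \<partial>lborel)"
      unfolding A_def by (rule nn_integral_add) measurable
    also have "(\<integral>\<^sup>+s. ennreal c * ennreal (?k (x + path_value s (path \<omega>)) * exp (- (A L - A s)) * indicator {0..L} s) \<partial>lborel) =
      ennreal c * (\<integral>\<^sup>+s. ennreal (?k (x + path_value s (path \<omega>)) * exp (- (A L - A s)) * indicator {0..L} s) \<partial>lborel)"
      unfolding A_def by (rule nn_integral_cmult) measurable
    also have "\<dots> = ennreal c * ennreal (1 - exp (- A L))"
      unfolding A_def discount_identity[OF \<omega> pq L(1)] ..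
    finally have G: "?G ?F t \<omega> = ?G stays_nonneg t \<omega> + ennreal c * ennreal (1 - exp (- A L))" .
    have A0: "0 \<le> A L" using pq L negative_time_nonneg by (simp add: A_def)
    have F: "?F (t, x, path \<omega>) = c * exp (- A L)"
      unfolding discount_at_last_def prod.case L_def[symmetric] by (simp add: c_def A_def)
    have P: "?P (t, x, path \<omega>) = c" by (simp add: c_def L_def)
    have c0: "0 \<le> c" by (simp add: c_def)
    have "ennreal (c * exp (- A L)) + ennreal c * ennreal (1 - exp (- A L)) = ennreal (c * exp (- A L)) + ennreal (c * (1 - exp (- A L)))"
      using c0 by (simp add: ennreal_mult')
    also have "\<dots> = ennreal (c * exp (- A L) + c * (1 - exp (- A L)))"
      by (rule ennreal_plus[symmetric]) (use c0 A0 in \<open>auto intro!: mult_nonneg_nonneg\<close>)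
    also have "c * exp (- A L) + c * (1 - exp (- A L)) = c" by (simp add: right_diff_distrib)
    finally have cs: "ennreal (c * exp (- A L)) + ennreal c * ennreal (1 - exp (- A L)) = ennreal c" .
    have alg: "(a + b) + g = a + (g + b)" for a b g :: ennreal by (simp add: ac_simps)
    show ?thesis unfolding G F P by (subst cs[symmetric]) (rule alg)
  qed
  have [measurable]: "?P \<in> borel_measurable (borel \<Otimes>\<^sub>M borel \<Otimes>\<^sub>M path_space)"
    unfolding case_prod_beta by measurable
  have P_bd: "0 \<le> ?P z" "?P z \<le> 1" for z by (auto split: prod.split)
  have split: "(\<integral>\<^sup>+t. \<integral>\<^sup>+\<omega>. ennreal (H (t, x, path \<omega>)) + ?G H' t \<omega> \<partial>M \<partial>exp_law r) =
      ennreal (expect_at r H x) + ennreal (resolvent r (\<lambda>y. ?k y * expect_at r H' y) x)"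
    if [measurable]: "H \<in> borel_measurable (borel \<Otimes>\<^sub>M borel \<Otimes>\<^sub>M path_space)" "H' \<in> borel_measurable (borel \<Otimes>\<^sub>M borel \<Otimes>\<^sub>M path_space)"
      and H: "\<And>z. H z \<le> 1" and H': "\<And>z. 0 \<le> H' z" "\<And>z. H' z \<le> 1" for H H'
  proof -
    have "(\<integral>\<^sup>+t. \<integral>\<^sup>+\<omega>. ennreal (H (t, x, path \<omega>)) + ?G H' t \<omega> \<partial>M \<partial>exp_law r) =
      (\<integral>\<^sup>+t. (\<integral>\<^sup>+\<omega>. ennreal (H (t, x, path \<omega>)) \<partial>M) + (\<integral>\<^sup>+\<omega>. ?G H' t \<omega> \<partial>M) \<partial>exp_law r)"
      by (intro nn_integral_cong nn_integral_add) measurable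
    also have "\<dots> = (\<integral>\<^sup>+t. \<integral>\<^sup>+\<omega>. ennreal (H (t, x, path \<omega>)) \<partial>M \<partial>exp_law r) + (\<integral>\<^sup>+t. \<integral>\<^sup>+\<omega>. ?G H' t \<omega> \<partial>M \<partial>exp_law r)"
      by (rule nn_integral_add) measurable
    also have "(\<integral>\<^sup>+t. \<integral>\<^sup>+\<omega>. ennreal (H (t, x, path \<omega>)) \<partial>M \<partial>exp_law r) = ennreal (expect_at r H x)"
      using ennreal_expect_at[where F=H, OF r H] by simp
    also have "(\<integral>\<^sup>+t. \<integral>\<^sup>+\<omega>. ?G H' t \<omega> \<partial>M \<partial>exp_law r) = ennreal (resolvent r (\<lambda>y. ?k y * expect_at r H' y) x)"
      by (rule nn_integral_markov_resolvent[where F=H', OF r _ _ k_bd H']) measurable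
    finally show ?thesis .
  qed
  have "(\<integral>\<^sup>+t. \<integral>\<^sup>+\<omega>. ennreal (?P (t, x, path \<omega>)) + ?G stays_nonneg t \<omega> \<partial>M \<partial>exp_law r) =
    (\<integral>\<^sup>+t. \<integral>\<^sup>+\<omega>. ennreal (?F (t, x, path \<omega>)) + ?G ?F t \<omega> \<partial>M \<partial>exp_law r)"
  proof (rule nn_integral_cong_AE)
    show "AE t in exp_law r. (\<integral>\<^sup>+\<omega>. ennreal (?P (t, x, path \<omega>)) + ?G stays_nonneg t \<omega> \<partial>M) = (\<integral>\<^sup>+\<omega>. ennreal (?F (t, x, path \<omega>)) + ?G ?F t \<omega> \<partial>M)"
      using AE_exp_law_pos[OF r]
    proof eventually_elim
      case (elim t)
      show ?case by (rule nn_integral_cong) (rule pathwise[OF _ elim])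
    qed
  qed
  then have sum: "ennreal (expect_at r ?P x) + ennreal (resolvent r (\<lambda>y. ?k y * expect_at r stays_nonneg y) x) =
    ennreal (expect_at r ?F x) + ennreal (resolvent r (\<lambda>y. ?k y * expect_at r ?F y) x)"
    by (subst (asm) split[OF _ _ P_bd(2) N_bd], measurable)
       (subst (asm) split[OF _ _ F_bd(2) F_bd], measurable)
  note eP = expect_at_bounds[where F="?P", OF r P_bd(2)] and eF = expect_at_bounds[where F="?F", OF r F_bd(2)]
    and eN = expect_at_bounds[where F=stays_nonneg, OF r N_bd(2)]
  have nn: "0 \<le> resolvent r (\<lambda>y. ?k y * expect_at r stays_nonneg y) x" "0 \<le> resolvent r (\<lambda>y. ?k y * expect_at r ?F y) x"
    unfolding resolvent_def using eF eN k_bd by (auto intro!: Bochner_Integration.integral_nonneg mult_nonneg_nonneg)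
  have "ennreal (expect_at r ?P x + resolvent r (\<lambda>y. ?k y * expect_at r stays_nonneg y) x) = ennreal (expect_at r ?F x + resolvent r (\<lambda>y. ?k y * expect_at r ?F y) x)"
    unfolding ennreal_plus[OF eP(1) nn(1)] ennreal_plus[OF eF(1) nn(2)] by (rule sum)
  then have eq: "expect_at r ?P x + resolvent r (\<lambda>y. ?k y * expect_at r stays_nonneg y) x = expect_at r ?F x + resolvent r (\<lambda>y. ?k y * expect_at r ?F y) x"
    using nn eP(1)[of x] eF(1)[of x] by (subst (asm) ennreal_inj) (auto intro: add_nonneg_nonneg)
  have P: "expect_at r ?P x = r * resolvent r (indicator {0..}) x"
  proof -
    have "expect_at r ?P x = expect_at r (\<lambda>(t, y, w). indicator {0..} (y + path_value t w)) x"
    proof -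
      have "(\<integral>\<^sup>+t. \<integral>\<^sup>+\<omega>. ennreal (?P (t, x, path \<omega>)) \<partial>M \<partial>exp_law r) = (\<integral>\<^sup>+t. \<integral>\<^sup>+\<omega>. ennreal (indicator {0..} (x + path_value t (path \<omega>))) \<partial>M \<partial>exp_law r)"
      proof (rule nn_integral_cong_AE)
        show "AE t in exp_law r. (\<integral>\<^sup>+\<omega>. ennreal (?P (t, x, path \<omega>)) \<partial>M) = (\<integral>\<^sup>+\<omega>. ennreal (indicator {0..} (x + path_value t (path \<omega>))) \<partial>M)"
          using AE_exp_law_pos[OF r] AE_exp_law[OF AE_mean_singleton[OF r W, of "- x"]]
        proof eventually_elim
          case (elim t)
          show ?case
          proof (rule nn_integral_cong_AE)
            show "AE \<omega> in M. ennreal (?P (t, x, path \<omega>)) = ennreal (indicator {0..} (x + path_value t (path \<omega>)))"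
              using elim(2) AE_space
            proof eventually_elim
              case (elim \<omega>)
              have "x + X t \<omega> \<noteq> 0" using elim(1) by linarith
              from last_negative_eq_end[OF elim(2) \<open>0 < t\<close> this] show ?case
                using elim(2) \<open>0 < t\<close> by (auto simp: path_value_path split: split_indicator)
            qed
          qed
        qed
      qed
      then show ?thesis by (simp add: expect_at_def)
    qed
    also have "\<dots> = r * resolvent r (indicator {0..}) x"
      by (rule expect_at_terminal_value[OF r]) (auto split: split_indicator)
    finally show ?thesis .
  qed
  have kN: "?k y * expect_at r stays_nonneg y = p * expect_at r stays_nonneg y" for y
    using stays_nonneg_negative_start[OF r, of y] by (cases "y < 0") auto
  have F_abs: "\<bar>?k y * expect_at r ?F y\<bar> \<le> p + q" for y
  proof -
    have "?k y * expect_at r ?F y \<le> (p + q) * 1"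
      using k_bd eF pq by (intro mult_mono) auto
    then show ?thesis using k_bd(1)[of y] eF(1)[of y] by (simp add: abs_mult)
  qed
  have I_abs: "\<bar>r * indicator {0..} y\<bar> \<le> r" for y using r by (auto split: split_indicator)
  have N_abs: "\<bar>p * expect_at r stays_nonneg y\<bar> \<le> p" for y
    using pq eN[of y] by (simp add: abs_mult mult_left_le)
  have "resolvent r (\<lambda>y. (r * indicator {0..} y + p * expect_at r stays_nonneg y) - ?k y * expect_at r ?F y) x =
    resolvent r (\<lambda>y. r * indicator {0..} y + p * expect_at r stays_nonneg y) x - resolvent r (\<lambda>y. ?k y * expect_at r ?F y) x"
  proof (rule resolvent_diff[OF r _ _ _ F_abs, where A="r + p"])
    show "\<bar>r * indicator {0..} y + p * expect_at r stays_nonneg y\<bar> \<le> r + p" for y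
      using I_abs[of y] N_abs[of y] by linarith
  qed measurable
  also have "resolvent r (\<lambda>y. r * indicator {0..} y + p * expect_at r stays_nonneg y) x =
      resolvent r (\<lambda>y. r * indicator {0..} y) x + resolvent r (\<lambda>y. p * expect_at r stays_nonneg y) x"
    by (rule resolvent_add[OF r _ _ I_abs N_abs]) measurable
  finally show ?thesis using eq unfolding P kN resolvent_cmult by simp
qed

text \<open>As the rate grows, the discount tends to the indicator of the event that no time is spent below zero. By
  right-continuity this is the event that the path stays nonnegative, except when it becomes negative for the
  first time exactly at \<open>t\<close>; for a given path there is at most one such \<open>t\<close>, so the exponential time avoids it.\<close>

lemma stays_nonneg_limit:
  assumes r: "0 < r"
  shows "(\<lambda>n. expect_at r (\<lambda>(t, y, w). exp (- 0 * max t 0 - real (Suc n) * negative_time y t w) * 1) y) \<longlonglongrightarrow> expect_at r stays_nonneg y"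
proof -
  interpret E: prob_space "exp_law r" by (rule prob_space_exponential_density[OF r])
  interpret EM: pair_sigma_finite "exp_law r" M ..
  let ?f = "\<lambda>n t \<omega>. ennreal (exp (- 0 * max t 0 - real (Suc n) * negative_time y t (path \<omega>)) * 1)"
  let ?g = "\<lambda>t \<omega>. if negative_time y t (path \<omega>) = 0 then 1 else 0 :: ennreal"
  have f_le: "?f n t \<omega> \<le> 1" for n t \<omega>
    using negative_time_nonneg[of y t "path \<omega>"] by (simp add: ennreal_le_1)
  have f_lim: "(\<lambda>n. ?f n t \<omega>) \<longlonglongrightarrow> ?g t \<omega>" for t \<omega>
  proof (cases "negative_time y t (path \<omega>) = 0")
    case False
    then have pos: "negative_time y t (path \<omega>) > 0" using negative_time_nonneg[of y t "path \<omega>"] by simp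
    have "filterlim (\<lambda>n. real (Suc n)) at_top sequentially"
      by (rule filterlim_sequentially_Suc[THEN iffD2, OF filterlim_real_sequentially])
    then have "filterlim (\<lambda>n. - negative_time y t (path \<omega>) * real (Suc n)) at_bot sequentially"
      using pos by (intro filterlim_tendsto_neg_mult_at_bot[OF tendsto_const]) auto
    then have "(\<lambda>n. exp (- negative_time y t (path \<omega>) * real (Suc n))) \<longlonglongrightarrow> 0"
      by (rule filterlim_compose[OF exp_at_bot])
    then have "(\<lambda>n. ennreal (exp (- negative_time y t (path \<omega>) * real (Suc n)))) \<longlonglongrightarrow> ennreal 0"
      by (rule tendsto_ennrealI)
    then show ?thesis using False by (simp add: mult.commute)
  qed simp
  have "(\<lambda>n. \<integral>\<^sup>+t. \<integral>\<^sup>+\<omega>. ?f n t \<omega> \<partial>M \<partial>exp_law r) \<longlonglongrightarrow> (\<integral>\<^sup>+t. \<integral>\<^sup>+\<omega>. ?g t \<omega> \<partial>M \<partial>exp_law r)"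
  proof (rule nn_integral_dominated_convergence[where w="\<lambda>_. 1"])
    show "AE t in exp_law r. (\<integral>\<^sup>+\<omega>. ?f n t \<omega> \<partial>M) \<le> 1" for n
    proof (rule AE_I2)
      fix t
      have "(\<integral>\<^sup>+\<omega>. ?f n t \<omega> \<partial>M) \<le> (\<integral>\<^sup>+\<omega>. 1 \<partial>M)" by (intro nn_integral_mono f_le)
      then show "(\<integral>\<^sup>+\<omega>. ?f n t \<omega> \<partial>M) \<le> 1" by (simp add: emeasure_space_1)
    qed
    show "(\<integral>\<^sup>+t. 1 \<partial>exp_law r) < \<infinity>" using E.emeasure_space_1 by simp
    show "AE t in exp_law r. (\<lambda>n. \<integral>\<^sup>+\<omega>. ?f n t \<omega> \<partial>M) \<longlonglongrightarrow> (\<integral>\<^sup>+\<omega>. ?g t \<omega> \<partial>M)"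
    proof (rule AE_I2)
      fix t
      show "(\<lambda>n. \<integral>\<^sup>+\<omega>. ?f n t \<omega> \<partial>M) \<longlonglongrightarrow> (\<integral>\<^sup>+\<omega>. ?g t \<omega> \<partial>M)"
      proof (rule nn_integral_dominated_convergence[where w="\<lambda>_. 1"])
        show "AE \<omega> in M. (\<lambda>n. ?f n t \<omega>) \<longlonglongrightarrow> ?g t \<omega>" by (rule AE_I2) (rule f_lim)
        show "AE \<omega> in M. ?f n t \<omega> \<le> 1" for n by (rule AE_I2) (rule f_le)
      qed (auto simp: emeasure_space_1)
    qed
  qed measurable
  also have "(\<integral>\<^sup>+t. \<integral>\<^sup>+\<omega>. ?g t \<omega> \<partial>M \<partial>exp_law r) = (\<integral>\<^sup>+\<omega>. \<integral>\<^sup>+t. ?g t \<omega> \<partial>exp_law r \<partial>M)"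
    by (rule EM.Fubini'[symmetric]) measurable
  also have "\<dots> = (\<integral>\<^sup>+\<omega>. \<integral>\<^sup>+t. ennreal (stays_nonneg (t, y, path \<omega>)) \<partial>exp_law r \<partial>M)"
  proof (rule nn_integral_cong)
    fix \<omega> assume \<omega>: "\<omega> \<in> space M"
    have [measurable]: "path \<omega> \<in> space path_space" by (rule path_in_path_space[OF \<omega>])
    define Y where "Y s = y + X s \<omega>" for s
    \<comment> \<open>The times at which the path is negative for the first time; two of them would contradict each other.\<close>
    define Ex where "Ex = {t. 0 < t \<and> Y t < 0 \<and> (\<forall>u. 0 \<le> u \<and> u < t \<longrightarrow> 0 \<le> Y u)}"
    have "countable Ex"
    proof -
      have *: "\<not> s < t" if "s \<in> Ex" "t \<in> Ex" for s t
      proof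
        assume "s < t"
        then have "0 \<le> Y s" using that by (auto simp: Ex_def)
        then show False using that(1) by (auto simp: Ex_def)
      qed
      have "Ex \<subseteq> {t}" if "t \<in> Ex" for t
        using *[OF _ that] *[OF that] by (force simp: not_less intro: antisym)
      then have "Ex = {} \<or> (\<exists>t. Ex \<subseteq> {t})" by blast
      then show ?thesis by (metis countable_empty countable_insert countable_subset)
    qed
    then have "AE t in lborel. t \<notin> Ex"
      by (intro AE_not_in countable_imp_null_set_lborel)
    then have ae: "AE t in exp_law r. t \<notin> Ex"
      by (intro AE_exp_law) (auto elim: eventually_mono)
    show "(\<integral>\<^sup>+t. ?g t \<omega> \<partial>exp_law r) = (\<integral>\<^sup>+t. ennreal (stays_nonneg (t, y, path \<omega>)) \<partial>exp_law r)"
    proof (rule nn_integral_cong_AE)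
      show "AE t in exp_law r. ?g t \<omega> = ennreal (stays_nonneg (t, y, path \<omega>))"
        using AE_exp_law_pos[OF r] ae
      proof eventually_elim
        case (elim t)
        define L where "L = last_negative y t (path \<omega>)"
        have L: "is_last_negative Y t L"
          unfolding Y_def L_def using path_is_last_negative[OF \<omega>] elim(1) by simp
        have pv: "y + path_value s (path \<omega>) = Y s" if "0 \<le> s" for s
          using path_value_path[OF \<omega> that] by (simp add: Y_def)
        have "negative_time y t (path \<omega>) = 0 \<longleftrightarrow> L = 0"
        proof
          assume L0: "L = 0"
          have nonneg: "0 \<le> Y u" if "0 < u" "u \<le> t" for u
            using L that unfolding L0 is_last_negative_def by blast
          have "negative_time y t (path \<omega>) = (LINT s|(lborel :: real measure). 0)"
            unfolding negative_time_def
          proof (rule integral_cong_AE)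
            show "AE s in lborel. (if 0 \<le> s \<and> s \<le> t \<and> y + path_value s (path \<omega>) < 0 then 1 else 0 :: real) = 0"
              using AE_lborel_singleton[of 0]
            proof eventually_elim
              case (elim s)
              then show ?case using nonneg[of s] pv[of s] by (cases "0 \<le> s \<and> s \<le> t") auto
            qed
          qed measurable
          then show "negative_time y t (path \<omega>) = 0" by simp
        next
          assume nt: "negative_time y t (path \<omega>) = 0"
          have nonneg: "0 \<le> Y u" if u: "0 \<le> u" "u < t" for u
          proof (rule ccontr)
            assume "\<not> 0 \<le> Y u"
            then have "X u \<omega> < - y" by (simp add: Y_def)
            then have "\<forall>\<^sub>F s in at_right u. X s \<omega> < - y"
              using right_continuous_paths[OF \<omega> u(1)] by (intro order_tendstoD) auto
            then obtain d where d: "u < d" "\<And>s. u < s \<Longrightarrow> s < d \<Longrightarrow> X s \<omega> < - y"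
              by (auto simp: eventually_at_right[OF u(2)])
            define b where "b = min d t"
            have b: "u < b" using d(1) u by (simp add: b_def)
            have "(LINT s|lborel. indicator {u<..<b} s :: real) \<le> negative_time y t (path \<omega>)"
              unfolding negative_time_def
            proof (intro integral_mono negative_time_integrable path_in_path_space[OF \<omega>])
              show "integrable lborel (\<lambda>s. indicator {u<..<b} s :: real)" using b by simp
              show "indicator {u<..<b} s \<le> (if 0 \<le> s \<and> s \<le> t \<and> y + path_value s (path \<omega>) < 0 then 1 else 0 :: real)" for s
                using u d(2)[of s] pv[of s] by (auto simp: b_def Y_def split: split_indicator)
            qed
            then show False using nt b by simp
          qed
          have Yt: "0 \<le> Y t" using elim nonneg unfolding Ex_def by force
          show "L = 0"
          proof (rule ccontr)
            assume "L \<noteq> 0"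
            then have "0 \<le> (0::real) \<and> 0 < L" using L unfolding is_last_negative_def by simp
            then obtain u where "0 < u" "u \<le> t" "Y u < 0" using L unfolding is_last_negative_def by blast
            then show False using nonneg[of u] Yt by (cases "u = t") auto
          qed
        qed
        then show ?case by (simp add: stays_nonneg_def L_def)
      qed
    qed
  qed
  also have "\<dots> = (\<integral>\<^sup>+t. \<integral>\<^sup>+\<omega>. ennreal (stays_nonneg (t, y, path \<omega>)) \<partial>M \<partial>exp_law r)"
    by (rule EM.Fubini') measurable
  finally have lim: "(\<lambda>n. \<integral>\<^sup>+t. \<integral>\<^sup>+\<omega>. ?f n t \<omega> \<partial>M \<partial>exp_law r) \<longlonglongrightarrow> ennreal (expect_at r stays_nonneg y)"
    using ennreal_expect_at[where F=stays_nonneg, OF r stays_nonneg_bounds(2)] by simp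
  then show ?thesis
    unfolding expect_at_def[of _ "\<lambda>(t, y, w). exp (- 0 * max t 0 - real (Suc _) * negative_time y t w) * 1"] prod.case
    using tendsto_enn2real[OF lim] expect_at_bounds(1)[where F=stays_nonneg, OF r stays_nonneg_bounds(2), of y] by simp
qed

section \<open>The probability of staying nonnegative\<close>

lemma psi_0: "psi 0 = 0"
  using integral_exp[of 0 1] by (simp add: prob_space)

text \<open>By monotonicity \<open>W(z) e\<^bsup>-\<beta>z\<^esup> / \<beta>\<close> is at most the integral of \<open>W(s) e\<^bsup>-\<beta>s\<^esup>\<close> over \<open>(z, \<infinity>)\<close>.\<close>

lemma scale_function_growth:
  assumes \<mu>: "0 < \<mu>" and W: "scale_function psi \<mu> W" and \<beta>: "passage_rate \<mu> < \<beta>" and z: "0 \<le> z"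
  shows "W z \<le> \<beta> / (psi \<beta> - \<mu>) * exp (\<beta> * z)"
proof -
  have \<beta>0: "0 < \<beta>" using \<beta> passage_exponential(1)[OF \<mu>] by simp
  have psi: "\<mu> < psi \<beta>" by (rule psi_greater[OF \<mu> \<beta>])
  note W_m [measurable] = scale_function_measurable[OF W]
  note W_nn = scale_function_nonneg[OF W]
  have mono: "W z \<le> W s" if "z < s" for s
    using W that z by (auto simp: scale_function_def mono_on_def)
  have "ennreal (W z * (exp (- \<beta> * z) / \<beta>)) = ennreal (W z) * ennreal (exp (- \<beta> * z) / \<beta>)"
    using W_nn[of z] by (rule ennreal_mult')
  also have "\<dots> = (\<integral>\<^sup>+s. ennreal (W z) * (ennreal (exp (- \<beta> * s)) * indicator {z<..} s) \<partial>lborel)"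
    by (subst nn_integral_cmult) (auto simp: nn_integral_exp_above[OF \<beta>0, simplified])
  also have "\<dots> \<le> (\<integral>\<^sup>+s. ennreal (W s) * ennreal (exp (- \<beta> * s)) \<partial>lborel)"
    by (intro nn_integral_mono) (auto split: split_indicator intro!: mult_right_mono ennreal_leI mono)
  also have "\<dots> = ennreal (1 / (psi \<beta> - \<mu>))" by (rule nn_integral_exp_scale_function[OF \<mu> W \<beta>])
  finally have "W z * (exp (- \<beta> * z) / \<beta>) \<le> 1 / (psi \<beta> - \<mu>)"
    using psi by (subst (asm) ennreal_le_iff) auto
  then have "W z * (exp (- \<beta> * z) / \<beta>) * (\<beta> * exp (\<beta> * z)) \<le> 1 / (psi \<beta> - \<mu>) * (\<beta> * exp (\<beta> * z))"
    using \<beta>0 by (intro mult_right_mono) auto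
  moreover have "W z * (exp (- \<beta> * z) / \<beta>) * (\<beta> * exp (\<beta> * z)) = W z"
    using \<beta>0 by (simp add: exp_minus field_simps)
  ultimately show ?thesis by (simp add: mult_ac)
qed

text \<open>For \<open>\<theta> = \<Phi>(\<mu> + q)\<close> the full Laplace integral of \<open>W\<close> is \<open>1 / q\<close>, so \<open>Z\<close> is \<open>q e\<^bsup>\<theta>y\<^esup>\<close> times its remainder
  over \<open>(y, \<infinity>)\<close>. The substitution \<open>v = \<theta>(z - y)\<close> shows the behaviour for large \<open>q\<close>: the integral tends to
  \<open>W(y)\<close>.\<close>

lemma scale_Z_rescaled:
  assumes \<mu>: "0 < \<mu>" and W: "scale_function psi \<mu> (W \<mu>)" and q: "0 < q" and y: "0 \<le> y"
  defines "\<theta> \<equiv> passage_rate (\<mu> + q)"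
  shows "scale_Z psi W \<mu> y \<theta> = q / \<theta> * (LINT v|lborel. exp (- v) * W \<mu> (y + v / \<theta>) * indicator {0<..} v)"
proof -
  have \<mu>q: "0 < \<mu> + q" using \<mu> q by simp
  have \<theta>0: "0 < \<theta>" unfolding \<theta>_def by (rule passage_exponential(1)[OF \<mu>q])
  have \<theta>\<Phi>: "passage_rate \<mu> < \<theta>" unfolding \<theta>_def using q by (intro passage_rate_strict_mono[OF \<mu>]) simp
  have psi\<theta>: "psi \<theta> = \<mu> + q" unfolding \<theta>_def by (rule psi_passage_rate[OF \<mu>q])
  note W_m [measurable] = scale_function_measurable[OF W]
  have full: "set_integrable lborel {0..} (\<lambda>x. exp (- \<theta> * x) * W \<mu> x)" "(LBINT x:{0..}. exp (- \<theta> * x) * W \<mu> x) = 1 / q"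
    using W \<theta>\<Phi> by (auto simp: scale_function_def right_inverse_psi[OF \<mu>] psi\<theta>)
  have part: "set_integrable lborel A (\<lambda>x. exp (- \<theta> * x) * W \<mu> x)" if "A \<subseteq> {0..}" "A \<in> sets borel" for A
    by (rule set_integrable_subset[OF full(1)]) (use that in auto)
  have "(LBINT x:{0..}. exp (- \<theta> * x) * W \<mu> x) = (LBINT x:{0..y} \<union> {y<..}. exp (- \<theta> * x) * W \<mu> x)"
    using y by (intro arg_cong[where f="\<lambda>A. set_lebesgue_integral lborel A _"]) auto
  also have "\<dots> = (LBINT x:{0..y}. exp (- \<theta> * x) * W \<mu> x) + (LBINT x:{y<..}. exp (- \<theta> * x) * W \<mu> x)"
    using y by (intro set_integral_Un part) auto
  finally have "1 - q * (LBINT x:{0..y}. exp (- \<theta> * x) * W \<mu> x) = q * (LBINT x:{y<..}. exp (- \<theta> * x) * W \<mu> x)"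
    using full(2) q by (simp add: field_simps)
  then have "scale_Z psi W \<mu> y \<theta> = exp (\<theta> * y) * (q * (LBINT x:{y<..}. exp (- \<theta> * x) * W \<mu> x))"
    using y by (simp add: scale_Z_def psi\<theta>)
  also have "(LBINT x:{y<..}. exp (- \<theta> * x) * W \<mu> x) = (LINT x|lborel. indicator {y<..} x * (exp (- \<theta> * x) * W \<mu> x))"
    by (simp add: set_lebesgue_integral_def)
  also have "\<dots> = \<bar>1 / \<theta>\<bar> *\<^sub>R (LINT v|lborel. indicator {y<..} (y + 1 / \<theta> * v) * (exp (- \<theta> * (y + 1 / \<theta> * v)) * W \<mu> (y + 1 / \<theta> * v)))"
    using \<theta>0 by (intro lborel_integral_real_affine) auto
  also have "(LINT v|lborel. indicator {y<..} (y + 1 / \<theta> * v) * (exp (- \<theta> * (y + 1 / \<theta> * v)) * W \<mu> (y + 1 / \<theta> * v))) =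
     (LINT v|lborel. exp (- \<theta> * y) * (exp (- v) * W \<mu> (y + v / \<theta>) * indicator {0<..} v))"
  proof (intro Bochner_Integration.integral_cong refl)
    fix v :: real
    have 1: "exp (- \<theta> * (y + 1 / \<theta> * v)) = exp (- \<theta> * y) * exp (- v)"
      using \<theta>0 by (simp add: exp_add[symmetric] algebra_simps del: exp_minus)
    have 2: "indicator {y<..} (y + 1 / \<theta> * v) = (indicator {0<..} v :: real)"
      using \<theta>0 by (auto split: split_indicator simp: zero_less_divide_iff)
    show "indicator {y<..} (y + 1 / \<theta> * v) * (exp (- \<theta> * (y + 1 / \<theta> * v)) * W \<mu> (y + 1 / \<theta> * v)) =
       exp (- \<theta> * y) * (exp (- v) * W \<mu> (y + v / \<theta>) * indicator {0<..} v)"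
      unfolding 1 2 by (simp add: mult_ac)
  qed
  also have "(LINT v|lborel. exp (- \<theta> * y) * (exp (- v) * W \<mu> (y + v / \<theta>) * indicator {0<..} v)) =
      exp (- \<theta> * y) * (LINT v|lborel. exp (- v) * W \<mu> (y + v / \<theta>) * indicator {0<..} v)"
    by (rule Bochner_Integration.integral_mult_right_zero)
  also have "exp (\<theta> * y) * (q * (\<bar>1 / \<theta>\<bar> *\<^sub>R (exp (- \<theta> * y) * J))) = q / \<theta> * J" for J
    using \<theta>0 by (simp add: exp_minus)
  finally show ?thesis .
qed

text \<open>The Feynman-Kac solution for terminal value \<open>1\<close>, killing at rate \<open>q\<close> below zero only, has the right-hand
  side as its limit as \<open>q \<rightarrow> \<infinity>\<close>; on the left this is \<open>stays_nonneg_limit\<close>.\<close>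

lemma stays_nonneg_formula:
  fixes W :: "real \<Rightarrow> real \<Rightarrow> real"
  assumes r: "0 < r" and W: "\<And>\<alpha>. 0 \<le> \<alpha> \<Longrightarrow> scale_function psi \<alpha> (W \<alpha>)" and y: "0 \<le> y"
  shows "expect_at r stays_nonneg y = r / passage_rate r * W r y - r * (LINT s|lborel. W r (y - s) * indicator {0..} s)"
proof -
  define \<Phi> where "\<Phi> = passage_rate r"
  have \<Phi>: "0 < \<Phi>" unfolding \<Phi>_def by (rule passage_exponential(1)[OF r])
  have Wr: "scale_function psi r (W r)" using W r by simp
  note W_m [measurable] = scale_function_measurable[OF Wr]
  define V where "V = (LINT s|lborel. W r (y - s) * indicator {0..} s)"
  define q where "q n = real (Suc n)" for n
  have q: "0 < q n" for n by (simp add: q_def)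
  define \<theta> where "\<theta> n = passage_rate (r + q n)" for n
  have \<theta>0: "0 < \<theta> n" for n unfolding \<theta>_def using r q[of n] by (intro passage_exponential(1)) simp
  have q_lim: "filterlim q at_top sequentially"
    unfolding q_def[abs_def] by (rule filterlim_sequentially_Suc[THEN iffD2, OF filterlim_real_sequentially])
  have \<theta>_lim: "filterlim \<theta> at_top sequentially"
    unfolding \<theta>_def[abs_def]
  proof (rule passage_rate_at_top)
    show "filterlim (\<lambda>n. r + q n) at_top sequentially"
      by (rule filterlim_tendsto_add_at_top[OF tendsto_const q_lim])
    show "0 < r + q n" for n using r q[of n] by simp
  qed
  define J where "J n = (LINT v|lborel. exp (- v) * W r (y + v / \<theta> n) * indicator {0<..} v)" for n
  define \<beta> where "\<beta> = \<Phi> + 1"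
  define D where "D = \<beta> / (psi \<beta> - r)"
  \<comment> \<open>Growth at rate \<open>\<beta>\<close> is dominated by \<open>e\<^sup>-\<^sup>v\<close> once \<open>\<theta> \<ge> 2 \<beta>\<close>.\<close>
  have growth: "W r z \<le> D * exp (\<beta> * z)" if "0 \<le> z" for z
    unfolding D_def by (rule scale_function_growth[OF r Wr _ that]) (simp add: \<beta>_def \<Phi>_def)
  have D0: "0 \<le> D" using growth[of 0] scale_function_nonneg[OF Wr, of 0] by simp
  have J_lim: "J \<longlonglongrightarrow> W r y"
  proof -
    have "\<forall>\<^sub>F n in sequentially. 2 * \<beta> \<le> \<theta> n" using \<theta>_lim by (auto simp: filterlim_at_top)
    then obtain n0 where n0: "\<And>n. n0 \<le> n \<Longrightarrow> 2 * \<beta> \<le> \<theta> n" by (auto simp: eventually_sequentially)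
    have wint: "integrable lborel (\<lambda>v. D * exp (\<beta> * y) * (exp (- (1/2) * v) * indicator {0..} v))"
      by (intro integrable_mult_right integrable_exp_Ici) simp
    have "(\<lambda>n. J (n + n0)) \<longlonglongrightarrow> (LINT v|lborel. exp (- v) * W r y * indicator {0<..} v)"
      unfolding J_def
    proof (rule integral_dominated_convergence[OF _ _ wint])
      show "AE v in lborel. (\<lambda>n. exp (- v) * W r (y + v / \<theta> (n + n0)) * indicator {0<..} v) \<longlonglongrightarrow> exp (- v) * W r y * indicator {0<..} v"
      proof (rule AE_I2)
        fix v :: real
        show "(\<lambda>n. exp (- v) * W r (y + v / \<theta> (n + n0)) * indicator {0<..} v) \<longlonglongrightarrow> exp (- v) * W r y * indicator {0<..} v"
        proof (cases "0 < v")
          case True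
          have "(\<lambda>n. v / \<theta> n) \<longlonglongrightarrow> 0"
            using \<theta>_lim by (intro tendsto_divide_0[OF tendsto_const] filterlim_at_top_imp_at_infinity)
          then have "(\<lambda>n. v / \<theta> (n + n0)) \<longlonglongrightarrow> 0" by (rule LIMSEQ_ignore_initial_segment)
          then have "(\<lambda>n. y + v / \<theta> (n + n0)) \<longlonglongrightarrow> y" by (auto intro: tendsto_eq_intros)
          then have "(\<lambda>n. W r (y + v / \<theta> (n + n0))) \<longlonglongrightarrow> W r y"
            using Wr y True \<theta>0 by (intro continuous_on_tendsto_compose[of "{0..}" "W r"])
              (auto simp: scale_function_def intro!: always_eventually less_imp_le add_nonneg_pos divide_pos_pos)
          then show ?thesis by (intro tendsto_intros)
        qed simp
      qed
      show "AE v in lborel. norm (exp (- v) * W r (y + v / \<theta> (n + n0)) * indicator {0<..} v) \<le> D * exp (\<beta> * y) * (exp (- (1/2) * v) * indicator {0..} v)" for n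
      proof (rule AE_I2)
        fix v :: real
        show "norm (exp (- v) * W r (y + v / \<theta> (n + n0)) * indicator {0<..} v) \<le> D * exp (\<beta> * y) * (exp (- (1/2) * v) * indicator {0..} v)"
        proof (cases "0 < v")
          case True
          let ?t = "\<theta> (n + n0)"
          have t: "2 * \<beta> \<le> ?t" "0 < ?t" using n0[of "n + n0"] \<theta>0 by auto
          have "W r (y + v / ?t) \<le> D * exp (\<beta> * (y + v / ?t))"
            using y True t by (intro growth) (simp add: add_nonneg_nonneg)
          also have "\<dots> \<le> D * exp (\<beta> * y + v / 2)"
          proof -
            have "\<beta> * (v / ?t) = v * (\<beta> / ?t)" by simp
            also have "\<dots> \<le> v * (1 / 2)" using t True by (intro mult_left_mono) (auto simp: field_simps)
            finally show ?thesis using D0 by (intro mult_left_mono) (auto simp: distrib_left)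
          qed
          finally have "exp (- v) * W r (y + v / ?t) \<le> exp (- v) * (D * exp (\<beta> * y + v / 2))"
            by (intro mult_left_mono) auto
          also have "\<dots> = D * exp (\<beta> * y) * exp (- (1/2) * v)"
          proof -
            have "exp (- v) * exp (\<beta> * y + v / 2) = exp (\<beta> * y) * exp (- (1/2) * v)"
              by (simp add: exp_add[symmetric] del: exp_minus)
            then show ?thesis by (simp only: mult.left_commute mult.assoc)
          qed
          finally show ?thesis using True scale_function_nonneg[OF Wr, of "y + v / ?t"] by (simp add: abs_mult)
        qed (use D0 in auto)
      qed
    qed measurable
    also have "(LINT v|lborel. exp (- v) * W r y * indicator {0<..} v) = W r y"
    proof -
      have "(LINT v|lborel. exp (- v) * W r y * indicator {0<..} v) = (LINT v|lborel. W r y * (exp (- 1 * v) * indicator {0..} v))"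
      proof (rule integral_cong_AE)
        show "AE v in lborel. exp (- v) * W r y * indicator {0<..} v = W r y * (exp (- 1 * v) * indicator {0..} v)"
          using AE_lborel_singleton[of 0] by (rule eventually_mono) (auto split: split_indicator)
      qed measurable
      also have "\<dots> = W r y" using integral_exp_Ici[of 1] by simp
      finally show ?thesis .
    qed
    finally show ?thesis by (rule LIMSEQ_offset)
  qed
  let ?u = "\<lambda>n. expect_at r (\<lambda>(t, y, w). exp (- 0 * max t 0 - real (Suc n) * negative_time y t w) * 1)"
  have u: "?u n y = r / (r + q n) * scale_Z psi W r y 0 + r / \<Phi> * ((\<theta> n - \<Phi>) / \<theta> n) * (q n / (r + q n)) * J n - r * V" for n
  proof -
    let ?F = "\<lambda>(t, y, w). exp (- 0 * max t 0 - real (Suc n) * negative_time y t w) * 1"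
    have F_le: "?F z \<le> 1" for z
      using negative_time_nonneg by (auto split: prod.split)
    have F_m: "?F \<in> borel_measurable (borel \<Otimes>\<^sub>M borel \<Otimes>\<^sub>M path_space)"
      unfolding case_prod_beta by measurable
    have rq: "0 < r + q n" using r q[of n] by simp
    have eq: "?u n x = resolvent r (\<lambda>y. r * (exp (0 * y) * indicator {..<0} y) + r * indicator {0..} y - q n * indicator {..<0} y * ?u n y) x" for x
    proof -
      have "?u n x = resolvent r (\<lambda>y. r * 1 - (0 + real (Suc n) * indicator {..<0} y) * ?u n y) x"
        by (rule expect_at_discounted[where f="\<lambda>_. 1" and p=0, OF r]) auto
      also have "(\<lambda>y. r * 1 - (0 + real (Suc n) * indicator {..<0} y) * ?u n y) =
        (\<lambda>y. r * (exp (0 * y) * indicator {..<0} y) + r * indicator {0..} y - q n * indicator {..<0} y * ?u n y)"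
        by (auto simp: q_def fun_eq_iff split: split_indicator)
      finally show ?thesis .
    qed
    have K: "(LINT y|lborel. exp (- \<Phi> * y) * (r * indicator {0..} y)) = r / \<Phi>"
    proof -
      have "(LINT y|lborel. exp (- \<Phi> * y) * (r * indicator {0..} y)) = (LINT y|lborel. r * (exp (- \<Phi> * y) * indicator {0..} y))"
        by (intro Bochner_Integration.integral_cong refl) (simp add: mult_ac)
      also have "\<dots> = r * (LINT y|lborel. exp (- \<Phi> * y) * indicator {0..} y)"
        by (rule Bochner_Integration.integral_mult_right_zero)
      finally show ?thesis unfolding integral_exp_Ici[OF \<Phi>] by simp
    qed
    have VV: "(LINT s|lborel. W r (y - s) * (r * indicator {0..} s)) = r * V"
    proof -
      have "(LINT s|lborel. W r (y - s) * (r * indicator {0..} s)) = (LINT s|lborel. r * (W r (y - s) * indicator {0..} s))"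
        by (intro Bochner_Integration.integral_cong refl) (simp add: mult_ac)
      then show ?thesis by (simp add: V_def)
    qed
    have "?u n y = r / (r + q n - psi 0) * scale_Z psi W r y 0
      + (passage_rate (r + q n) - passage_rate r) / q n *
       ((LINT y|lborel. exp (- passage_rate r * y) * (r * indicator {0..} y)) - r / (r + q n - psi 0) * (r - psi 0) / (passage_rate r - 0))
       * scale_Z psi W r y (passage_rate (r + q n))
      - (LINT s|lborel. W r (y - s) * (r * indicator {0..} s))"
    proof (rule feynman_kac_solution[where W=W and B=r and D=1, OF r q])
      show "scale_function psi r (W r)" by (rule Wr)
      show "scale_function psi (r + q n) (W (r + q n))" using W rq by simp
      show "0 \<noteq> passage_rate r" using \<Phi> by (simp add: \<Phi>_def)
      show "0 \<noteq> passage_rate (r + q n)" using passage_exponential(1)[OF rq] by simp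
      show "?u n \<in> borel_measurable borel" by (rule measurable_expect_at[OF r F_m])
      show "\<bar>?u n y\<bar> \<le> 1" for y using expect_at_bounds[where F="?F", OF r F_le] by simp
      show "?u n x = resolvent r (\<lambda>y. r * (exp (0 * y) * indicator {..<0} y) + r * indicator {0..} y - q n * indicator {..<0} y * ?u n y) x" for x
        by (rule eq)
    qed (use r in \<open>auto split: split_indicator\<close>)
    then have "?u n y = r / (r + q n) * scale_Z psi W r y 0
      + (\<theta> n - \<Phi>) / q n * (r / \<Phi> - r / (r + q n) * r / \<Phi>) * scale_Z psi W r y (\<theta> n) - r * V"
      unfolding \<Phi>_def[symmetric] \<theta>_def[symmetric] K VV psi_0 by simp
    also have "scale_Z psi W r y (\<theta> n) = q n / \<theta> n * J n"
      unfolding \<theta>_def J_def by (rule scale_Z_rescaled[where W=W, OF r Wr q y])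
    also have "(\<theta> n - \<Phi>) / q n * (r / \<Phi> - r / (r + q n) * r / \<Phi>) * (q n / \<theta> n * J n) = r / \<Phi> * ((\<theta> n - \<Phi>) / \<theta> n) * (q n / (r + q n)) * J n"
    proof -
      have a: "r / \<Phi> - r / (r + q n) * r / \<Phi> = r / \<Phi> * (q n / (r + q n))"
      proof -
        have "r / (r + q n) = 1 - q n / (r + q n)" using rq by (simp add: field_simps)
        then show ?thesis by (simp only: left_diff_distrib diff_divide_distrib mult_1 times_divide_eq_right) (simp add: mult.commute)
      qed
      have "c / q n * (a * b) * (q n / t * j) = a * (c / t) * b * j" for a b c t j :: real using q[of n] by simp
      then show ?thesis unfolding a .
    qed
    finally show ?thesis .
  qed
  have l1: "(\<lambda>n. r / (r + q n)) \<longlonglongrightarrow> 0"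
    by (intro tendsto_divide_0[OF tendsto_const] filterlim_at_top_imp_at_infinity filterlim_tendsto_add_at_top[OF tendsto_const q_lim])
  have l2: "(\<lambda>n. q n / (r + q n)) \<longlonglongrightarrow> 1"
  proof -
    have "q n / (r + q n) = 1 - r / (r + q n)" for n using r q[of n] by (simp add: field_simps)
    then show ?thesis using tendsto_diff[OF tendsto_const[of 1] l1] by simp
  qed
  have l3: "(\<lambda>n. (\<theta> n - \<Phi>) / \<theta> n) \<longlonglongrightarrow> 1"
  proof -
    have "(\<lambda>n. \<Phi> / \<theta> n) \<longlonglongrightarrow> 0"
      by (intro tendsto_divide_0[OF tendsto_const] filterlim_at_top_imp_at_infinity \<theta>_lim)
    moreover have "(\<theta> n - \<Phi>) / \<theta> n = 1 - \<Phi> / \<theta> n" for n using \<theta>0[of n] by (simp add: field_simps)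
    ultimately show ?thesis using tendsto_diff[OF tendsto_const[of 1], of "\<lambda>n. \<Phi> / \<theta> n" 0] by simp
  qed
  have "(\<lambda>n. ?u n y) \<longlonglongrightarrow> 0 * scale_Z psi W r y 0 + r / \<Phi> * 1 * 1 * W r y - r * V"
    unfolding u by (intro tendsto_intros l1 l2 l3 J_lim)
  with stays_nonneg_limit[OF r, of y] have "expect_at r stays_nonneg y = 0 * scale_Z psi W r y 0 + r / \<Phi> * 1 * 1 * W r y - r * V"
    by (rule LIMSEQ_unique)
  then show ?thesis by (simp add: \<Phi>_def V_def)
qed

lemma nn_laplace_convolution:
  fixes f g :: "real \<Rightarrow> real"
  assumes [measurable]: "f \<in> borel_measurable borel" "g \<in> borel_measurable borel" and nn: "\<And>x. 0 \<le> f x" "\<And>x. 0 \<le> g x"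
  shows "(\<integral>\<^sup>+x. (\<integral>\<^sup>+y. ennreal (f (x - y) * g y) \<partial>lborel) * ennreal (exp (- \<beta> * x)) \<partial>lborel) =
    (\<integral>\<^sup>+x. ennreal (f x) * ennreal (exp (- \<beta> * x)) \<partial>lborel) * (\<integral>\<^sup>+x. ennreal (g x) * ennreal (exp (- \<beta> * x)) \<partial>lborel)"
proof -
  let ?e = "\<lambda>x. ennreal (exp (- \<beta> * x))"
  have "(\<integral>\<^sup>+x. (\<integral>\<^sup>+y. ennreal (f (x - y) * g y) \<partial>lborel) * ?e x \<partial>lborel) = (\<integral>\<^sup>+x. \<integral>\<^sup>+y. ennreal (f (x - y) * g y) * ?e x \<partial>lborel \<partial>lborel)"
    by (intro nn_integral_cong nn_integral_multc[symmetric]) measurable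
  also have "\<dots> = (\<integral>\<^sup>+y. \<integral>\<^sup>+x. ennreal (f (x - y) * g y) * ?e x \<partial>lborel \<partial>lborel)"
    by (rule lborel_pair.Fubini'[symmetric]) measurable
  also have "\<dots> = (\<integral>\<^sup>+y. (\<integral>\<^sup>+x. ennreal (f x) * ?e x \<partial>lborel) * (ennreal (g y) * ?e y) \<partial>lborel)"
  proof (rule nn_integral_cong)
    fix y
    have "(\<integral>\<^sup>+x. ennreal (f (x - y) * g y) * ?e x \<partial>lborel) = (\<integral>\<^sup>+x. ennreal (f (y + 1 * x - y) * g y) * ?e (y + 1 * x) \<partial>lborel)"
      by (subst nn_integral_real_affine[where c=1 and t=y]) auto
    also have "\<dots> = (\<integral>\<^sup>+x. (ennreal (f x) * ?e x) * (ennreal (g y) * ?e y) \<partial>lborel)"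
    proof (rule nn_integral_cong)
      fix x
      have e: "?e (y + 1 * x) = ?e x * ?e y"
        by (simp add: ennreal_mult'[symmetric] exp_add[symmetric] algebra_simps)
      have f: "ennreal (f (y + 1 * x - y) * g y) = ennreal (f x) * ennreal (g y)"
        using nn by (simp add: ennreal_mult)
      show "ennreal (f (y + 1 * x - y) * g y) * ?e (y + 1 * x) = (ennreal (f x) * ?e x) * (ennreal (g y) * ?e y)"
        unfolding e f by (simp only: ac_simps)
    qed
    also have "\<dots> = (\<integral>\<^sup>+x. ennreal (f x) * ?e x \<partial>lborel) * (ennreal (g y) * ?e y)"
      by (rule nn_integral_multc) measurable
    finally show "(\<integral>\<^sup>+x. ennreal (f (x - y) * g y) * ?e x \<partial>lborel) = \<dots>" .
  qed
  also have "\<dots> = (\<integral>\<^sup>+x. ennreal (f x) * ?e x \<partial>lborel) * (\<integral>\<^sup>+x. ennreal (g x) * ?e x \<partial>lborel)"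
    by (rule nn_integral_cmult) measurable
  finally show ?thesis .
qed

text \<open>The bounds \<open>xs n \<le> x + 1\<close> and monotonicity of \<open>W\<close> give a common integrable majorant.\<close>

lemma scale_convolution_right_limit:
  assumes W: "scale_function psi \<mu> W" and [measurable]: "g \<in> borel_measurable borel"
    and g: "\<And>y. \<bar>g y\<bar> \<le> B" "\<And>y. y < 0 \<Longrightarrow> g y = 0"
    and x: "0 \<le> x" and xs: "\<And>n. x \<le> xs n" "\<And>n. xs n \<le> x + 1" "xs \<longlonglongrightarrow> x"
  shows "(\<lambda>n. LINT y|lborel. W (xs n - y) * g y) \<longlonglongrightarrow> (LINT y|lborel. W (x - y) * g y)"
proof (rule integral_dominated_convergence[where w="\<lambda>y. W (x + 1) * B * indicator {0..x + 1} y"])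
  note W_m [measurable] = scale_function_measurable[OF W]
  note W_nn = scale_function_nonneg[OF W]
  have W0: "W z = 0" if "z < 0" for z using W that by (simp add: scale_function_def)
  show "(\<lambda>y. W (x - y) * g y) \<in> borel_measurable lborel" "\<And>n. (\<lambda>y. W (xs n - y) * g y) \<in> borel_measurable lborel"
    by measurable
  show "integrable lborel (\<lambda>y. W (x + 1) * B * indicator {0..x + 1} y)" using x by simp
  show "AE y in lborel. (\<lambda>n. W (xs n - y) * g y) \<longlonglongrightarrow> W (x - y) * g y"
  proof (rule AE_I2)
    fix y
    have "(\<lambda>n. W (xs n - y)) \<longlonglongrightarrow> W (x - y)"
    proof (cases "y \<le> x")
      case True
      have "(\<lambda>n. xs n - y) \<longlonglongrightarrow> x - y" by (intro tendsto_intros xs)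
      then show ?thesis
        using W True xs(1) by (intro continuous_on_tendsto_compose[of "{0..}" W])
          (auto simp: scale_function_def intro!: always_eventually order_trans[OF True])
    next
      case False
      then have "\<forall>\<^sub>F n in sequentially. xs n < y" using xs(3) by (intro order_tendstoD) auto
      then have "\<forall>\<^sub>F n in sequentially. W (xs n - y) = W (x - y)"
        by (rule eventually_mono) (use False in \<open>simp add: W0\<close>)
      then show ?thesis by (rule tendsto_eventually)
    qed
    then show "(\<lambda>n. W (xs n - y) * g y) \<longlonglongrightarrow> W (x - y) * g y" by (intro tendsto_intros)
  qed
  show "AE y in lborel. norm (W (xs n - y) * g y) \<le> W (x + 1) * B * indicator {0..x + 1} y" for n
  proof (rule AE_I2)
    fix y
    have B0: "0 \<le> B" using g(1)[of 0] by linarith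
    consider "y < 0" | "xs n < y" | "0 \<le> y" "y \<le> xs n" by linarith
    then show "norm (W (xs n - y) * g y) \<le> W (x + 1) * B * indicator {0..x + 1} y"
    proof cases
      case 1 then show ?thesis using g(2) by simp
    next
      case 2 then show ?thesis using W0 W_nn B0 by (auto split: split_indicator)
    next
      case 3
      have "W (xs n - y) \<le> W (x + 1)"
        using W 3 xs(2)[of n] x by (auto simp: scale_function_def mono_on_def)
      then have "\<bar>W (xs n - y)\<bar> * \<bar>g y\<bar> \<le> W (x + 1) * B"
        using W_nn g(1)[of y] B0 by (intro mult_mono) auto
      moreover have "indicator {0..x + 1} y = (1::real)" using 3 xs(2)[of n] by simp
      ultimately show ?thesis by (simp add: abs_mult)
    qed
  qed
qed

end

section \<open>Closed forms of the two expectations\<close>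

lemma ennreal_cancel_right:
  assumes "a + ennreal b = ennreal c" "0 \<le> b" "0 \<le> c"
  shows "a = ennreal (c - b)"
proof -
  have "a \<le> a + ennreal b" by simp
  then have "a \<noteq> top" using assms by (auto simp: top_unique)
  then obtain a' where a: "a = ennreal a'" "0 \<le> a'" by (cases a) auto
  then have "ennreal (a' + b) = ennreal c" using assms by simp
  then show ?thesis using a assms by (subst (asm) ennreal_inj) auto
qed

lemma ennreal_sum_of_products:
  assumes "0 \<le> a" "0 \<le> b" "0 \<le> c" "0 \<le> d"
  shows "ennreal a * ennreal b + ennreal c * ennreal d = ennreal (a * b + c * d)"
  using assms by (simp add: ennreal_mult ennreal_plus)

context spectrally_negative_levy
begin

text \<open>Equality of Laplace transforms gives equality almost everywhere, and limits from the right along points of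
  equality extend it to every \<open>x \<ge> 0\<close>. Right-continuity is asked only along sequences in \<open>[x, x + 1]\<close>, the form
  in which dominated convergence yields it.\<close>

lemma nonneg_eq_of_laplace_transform_eq:
  fixes F G :: "real \<Rightarrow> real"
  assumes [measurable]: "F \<in> borel_measurable borel" "G \<in> borel_measurable borel"
    and nn: "\<And>x. 0 \<le> F x" "\<And>x. 0 \<le> G x" and supp: "\<And>x. x < 0 \<Longrightarrow> F x = 0" "\<And>x. x < 0 \<Longrightarrow> G x = 0"
    and fin: "\<And>\<beta>. b < \<beta> \<Longrightarrow> (\<integral>\<^sup>+x. ennreal (F x) * ennreal (exp (- \<beta> * x)) \<partial>lborel) < \<infinity>"
    and eq: "\<And>\<beta>. b < \<beta> \<Longrightarrow> (\<integral>\<^sup>+x. ennreal (F x) * ennreal (exp (- \<beta> * x)) \<partial>lborel) = (\<integral>\<^sup>+x. ennreal (G x) * ennreal (exp (- \<beta> * x)) \<partial>lborel)"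
    and right: "\<And>x xs. 0 \<le> x \<Longrightarrow> (\<And>n. x \<le> xs n) \<Longrightarrow> (\<And>n. xs n \<le> x + 1) \<Longrightarrow> xs \<longlonglongrightarrow> x \<Longrightarrow> (\<lambda>n. F (xs n)) \<longlonglongrightarrow> F x"
      "\<And>x xs. 0 \<le> x \<Longrightarrow> (\<And>n. x \<le> xs n) \<Longrightarrow> (\<And>n. xs n \<le> x + 1) \<Longrightarrow> xs \<longlonglongrightarrow> x \<Longrightarrow> (\<lambda>n. G (xs n)) \<longlonglongrightarrow> G x"
    and x: "0 \<le> x"
  shows "F x = G x"
proof -
  have "density lborel (\<lambda>x. ennreal (F x)) = density lborel (\<lambda>x. ennreal (G x))"
  proof (rule laplace_transform_determines_measure[where b=b])
    show "AE x in density lborel (\<lambda>x. ennreal (F x)). 0 \<le> x" "AE x in density lborel (\<lambda>x. ennreal (G x)). 0 \<le> x"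
      by (auto simp: AE_density supp intro!: AE_I2 intro: ccontr)
    show "(\<integral>\<^sup>+x. ennreal (exp (- \<beta> * x)) \<partial>density lborel (\<lambda>x. ennreal (F x))) < \<infinity>" if "b < \<beta>" for \<beta>
      using fin[OF that] by (simp add: nn_integral_density)
    show "(\<integral>\<^sup>+x. ennreal (exp (- \<beta> * x)) \<partial>density lborel (\<lambda>x. ennreal (F x))) =
      (\<integral>\<^sup>+x. ennreal (exp (- \<beta> * x)) \<partial>density lborel (\<lambda>x. ennreal (G x)))" if "b < \<beta>" for \<beta>
      using eq[OF that] by (simp add: nn_integral_density)
  qed auto
  then have "AE x in lborel. ennreal (F x) = ennreal (G x)"
    by (subst (asm) sigma_finite_measure.density_unique_iff[OF sigma_finite_lborel]) auto
  then have ae: "AE x in lborel. F x = G x" by (rule eventually_mono) (simp add: nn)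
  have "\<exists>y. x < y \<and> y < x + 1 / real (Suc n) \<and> F y = G y" for n
    by (rule AE_lborel_exists[OF ae]) simp
  then obtain xs where xs: "\<And>n. x < xs n" "\<And>n. xs n < x + 1 / real (Suc n)" "\<And>n. F (xs n) = G (xs n)" by metis
  have "xs \<longlonglongrightarrow> x"
  proof (rule tendsto_sandwich)
    show "(\<lambda>n. x) \<longlonglongrightarrow> x" by simp
    show "(\<lambda>n. x + 1 / real (Suc n)) \<longlonglongrightarrow> x"
      using tendsto_add[OF tendsto_const[of x] LIMSEQ_inverse_real_of_nat] by (simp add: inverse_eq_divide)
  qed (use xs in \<open>auto intro!: always_eventually less_imp_le\<close>)
  moreover have "xs n \<le> x + 1" for n
  proof -
    have "1 / real (Suc n) \<le> 1" by simp
    then show ?thesis using xs(2)[of n] by linarith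
  qed
  ultimately have "(\<lambda>n. F (xs n)) \<longlonglongrightarrow> F x" "(\<lambda>n. F (xs n)) \<longlonglongrightarrow> G x"
    using right[OF x, of xs] xs by (auto intro: less_imp_le)
  then show ?thesis by (rule LIMSEQ_unique)
qed

lemma scale_convolution_0: "scale_function psi \<mu> W \<Longrightarrow> \<forall>y<0. g y = 0 \<Longrightarrow> x < 0 \<Longrightarrow> (LINT y|lborel. W (x - y) * g y) = 0"
proof -
  assume W: "scale_function psi \<mu> W" and g: "\<forall>y<0. g y = 0" and x: "x < 0"
  have eq: "W (x - y) * g y = 0" for y
    using W g x by (cases "y < 0") (auto simp: scale_function_def)
  show ?thesis unfolding eq by simp
qed

lemma scale_convolution_nonneg:
  assumes \<mu>: "0 < \<mu>" and W: "scale_function psi \<mu> W" and [measurable]: "g \<in> borel_measurable borel"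
    and g: "\<And>y. 0 \<le> g y" "\<And>y. g y \<le> B" "\<forall>y<0. g y = 0"
  shows "0 \<le> (LINT y|lborel. W (x - y) * g y)"
    and "ennreal (LINT y|lborel. W (x - y) * g y) = (\<integral>\<^sup>+y. ennreal (W (x - y) * g y) \<partial>lborel)"
    and "(\<lambda>x. LINT y|lborel. W (x - y) * g y) \<in> borel_measurable borel"
proof -
  note W_m [measurable] = scale_function_measurable[OF W]
  note W_nn = scale_function_nonneg[OF W]
  show "0 \<le> (LINT y|lborel. W (x - y) * g y)"
    using W_nn g by (intro Bochner_Integration.integral_nonneg) auto
  have "integrable lborel (\<lambda>y. W (x - y) * g y)"
    using passage_exponential(1)[OF \<mu>] g
    by (intro integrable_scale_convolution[OF \<mu> W assms(3)] integrable_exp_bounded_half_line[where B=B]) auto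
  then show "ennreal (LINT y|lborel. W (x - y) * g y) = (\<integral>\<^sup>+y. ennreal (W (x - y) * g y) \<partial>lborel)"
    using W_nn g by (intro nn_integral_eq_integral[symmetric]) auto
  show "(\<lambda>x. LINT y|lborel. W (x - y) * g y) \<in> borel_measurable borel" by measurable
qed

lemma nn_laplace_scale_convolution:
  assumes \<mu>: "0 < \<mu>" and W: "scale_function psi \<mu> W" and [measurable]: "g \<in> borel_measurable borel"
    and g: "\<And>y. 0 \<le> g y" "\<And>y. g y \<le> B" "\<forall>y<0. g y = 0" and \<beta>: "passage_rate \<mu> < \<beta>"
  shows "(\<integral>\<^sup>+x. ennreal (LINT y|lborel. W (x - y) * g y) * ennreal (exp (- \<beta> * x)) \<partial>lborel) =
    ennreal (1 / (psi \<beta> - \<mu>)) * (\<integral>\<^sup>+x. ennreal (g x) * ennreal (exp (- \<beta> * x)) \<partial>lborel)"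
  unfolding scale_convolution_nonneg(2)[OF \<mu> W assms(3) g] nn_integral_exp_scale_function[OF \<mu> W \<beta>, symmetric]
  by (rule nn_laplace_convolution) (use g scale_function_nonneg[OF W] scale_function_measurable[OF W] in auto)

context
  fixes W :: "real \<Rightarrow> real \<Rightarrow> real" and p r :: real
  assumes r: "0 < r" and p: "0 < p" and W: "\<And>\<alpha>. 0 \<le> \<alpha> \<Longrightarrow> scale_function psi \<alpha> (W \<alpha>)"
begin

text \<open>The function \<open>g = r 1\<^bsub>[0,\<infinity>)\<^esub> + p N\<close> in the equation for the first expectation, where \<open>N(y)\<close> is the
  probability of staying nonnegative when started at \<open>y\<close>.\<close>

definition source :: "real \<Rightarrow> real" where
  "source y = r * indicator {0..} y + p * expect_at r stays_nonneg y"

lemma measurable_source [measurable]: "source \<in> borel_measurable borel"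
  using measurable_expect_at[OF r measurable_stays_nonneg] unfolding source_def[abs_def] by measurable

lemma source_bounds: "0 \<le> source y" "source y \<le> r + p" "\<forall>y<0. source y = 0"
proof -
  note b = expect_at_bounds[where F=stays_nonneg, OF r stays_nonneg_bounds(2), of y]
  have "0 \<le> p * expect_at r stays_nonneg y" "p * expect_at r stays_nonneg y \<le> p"
    using b p by auto
  then show "0 \<le> source y" "source y \<le> r + p"
    using r unfolding source_def by (auto split: split_indicator)
  show "\<forall>y<0. source y = 0" by (simp add: source_def stays_nonneg_negative_start[OF r])
qed

text \<open>Written without subtraction, as both sides are to be integrated as nonnegative functions.\<close>

lemma source_formula:
  "source y + p * r * (LINT s|lborel. W r (y - s) * indicator {0..} s) = r * indicator {0..} y + p * (r / passage_rate r) * W r y"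
proof (cases "y < 0")
  case True
  have Wr: "scale_function psi r (W r)" using W r by simp
  have "(LINT s|lborel. W r (y - s) * indicator {0..} s) = 0"
    by (rule scale_convolution_0[OF Wr _ True]) simp
  moreover have "W r y = 0" using Wr True by (simp add: scale_function_def)
  ultimately show ?thesis using source_bounds(3) True by simp
next
  case False
  then have "expect_at r stays_nonneg y + r * (LINT s|lborel. W r (y - s) * indicator {0..} s) = r / passage_rate r * W r y"
    using stays_nonneg_formula[where W=W, OF r W, of y] by simp
  then have "p * (expect_at r stays_nonneg y + r * (LINT s|lborel. W r (y - s) * indicator {0..} s)) = p * (r / passage_rate r * W r y)"
    by (rule arg_cong)
  then show ?thesis unfolding source_def by (simp only: distrib_left mult.assoc add.assoc)
qed

lemma laplace_source:
  assumes \<beta>: "passage_rate r < \<beta>"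
  shows "(\<integral>\<^sup>+y. ennreal (source y) * ennreal (exp (- \<beta> * y)) \<partial>lborel) =
    ennreal (r / \<beta> + p * (r / passage_rate r) / (psi \<beta> - r) - p * r / ((psi \<beta> - r) * \<beta>))"
proof -
  have \<Phi>0: "0 < passage_rate r" by (rule passage_exponential(1)[OF r])
  have \<beta>0: "0 < \<beta>" using \<Phi>0 \<beta> by simp
  have s0: "0 < psi \<beta> - r" using psi_greater[OF r \<beta>] by simp
  define K where "K = r / passage_rate r"
  have K: "0 \<le> K" unfolding K_def using \<Phi>0 r by simp
  have Wr: "scale_function psi r (W r)" using W r by simp
  note [measurable] = scale_function_measurable[OF Wr]
  note W_nn = scale_function_nonneg[OF Wr]
  let ?e = "\<lambda>y. ennreal (exp (- \<beta> * y))" let ?V = "\<lambda>y. LINT s|lborel. W r (y - s) * indicator {0..} s"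
  note V = scale_convolution_nonneg[OF r Wr, of "indicator {0..}" 1]
  have [measurable]: "?V \<in> borel_measurable borel" by (rule V(3)) (auto split: split_indicator)
  have V0: "0 \<le> ?V y" for y by (rule V(1)) (auto split: split_indicator)
  have one: "(\<integral>\<^sup>+y. ennreal (indicator {0..} y) * ?e y \<partial>lborel) = ennreal (1 / \<beta>)"
    using nn_integral_exp_Ici[of \<beta>] \<beta>0 by (simp add: ennreal_indicator mult.commute)
  have LV: "(\<integral>\<^sup>+y. ennreal (?V y) * ?e y \<partial>lborel) = ennreal (1 / (psi \<beta> - r)) * ennreal (1 / \<beta>)"
    unfolding one[symmetric] by (rule nn_laplace_scale_convolution[OF r Wr _ _ _ _ \<beta>, where B=1]) (auto split: split_indicator)
  have "(\<integral>\<^sup>+y. ennreal (source y) * ?e y \<partial>lborel) + ennreal (p * r) * (\<integral>\<^sup>+y. ennreal (?V y) * ?e y \<partial>lborel) =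
      (\<integral>\<^sup>+y. ennreal (source y) * ?e y + ennreal (p * r) * (ennreal (?V y) * ?e y) \<partial>lborel)"
    by (subst nn_integral_add) (auto simp: nn_integral_cmult)
  also have "\<dots> = (\<integral>\<^sup>+y. ennreal r * (ennreal (indicator {0..} y) * ?e y) + ennreal (p * K) * (ennreal (W r y) * ?e y) \<partial>lborel)"
  proof (rule nn_integral_cong)
    fix y
    have V0: "0 \<le> ?V y" by (rule V0)
    have "ennreal (source y) + ennreal (p * r) * ennreal (?V y) = ennreal (source y + p * r * ?V y)"
      using source_bounds(1) p r V0 by (subst ennreal_plus) (auto simp: ennreal_mult)
    also have "\<dots> = ennreal (r * indicator {0..} y) + ennreal (p * K * W r y)"
      unfolding source_formula K_def[symmetric] using p r W_nn K by (intro ennreal_plus) auto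
    also have "\<dots> = ennreal r * ennreal (indicator {0..} y) + ennreal (p * K) * ennreal (W r y)"
      using p r W_nn K by (simp add: ennreal_mult)
    finally show "ennreal (source y) * ?e y + ennreal (p * r) * (ennreal (?V y) * ?e y) =
      ennreal r * (ennreal (indicator {0..} y) * ?e y) + ennreal (p * K) * (ennreal (W r y) * ?e y)"
      by (simp only: mult.assoc[symmetric] distrib_right[symmetric])
  qed
  also have "\<dots> = ennreal r * (\<integral>\<^sup>+y. ennreal (indicator {0..} y) * ?e y \<partial>lborel) + ennreal (p * K) * (\<integral>\<^sup>+y. ennreal (W r y) * ?e y \<partial>lborel)"
    by (subst nn_integral_add) (auto simp: nn_integral_cmult)
  also have "\<dots> = ennreal r * ennreal (1 / \<beta>) + ennreal (p * K) * ennreal (1 / (psi \<beta> - r))"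
    unfolding one nn_integral_exp_scale_function[OF r Wr \<beta>] ..
  also have "\<dots> = ennreal (r * (1 / \<beta>)) + ennreal (p * K * (1 / (psi \<beta> - r)))"
    unfolding ennreal_mult'[OF less_imp_le[OF r]] using p K by (subst ennreal_mult'[of "p * K"]) auto
  also have "\<dots> = ennreal (r * (1 / \<beta>) + p * K * (1 / (psi \<beta> - r)))"
    using r p K \<beta>0 s0 by (intro ennreal_plus[symmetric]) auto
  finally have eq: "(\<integral>\<^sup>+y. ennreal (source y) * ?e y \<partial>lborel) + ennreal (p * r) * (ennreal (1 / (psi \<beta> - r)) * ennreal (1 / \<beta>)) =
      ennreal (r * (1 / \<beta>) + p * K * (1 / (psi \<beta> - r)))"
    unfolding LV .
  also have "ennreal (p * r) * (ennreal (1 / (psi \<beta> - r)) * ennreal (1 / \<beta>)) = ennreal (p * r * (1 / (psi \<beta> - r) * (1 / \<beta>)))"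
    using r p \<beta>0 s0 by (simp add: ennreal_mult'[symmetric])
  finally have "(\<integral>\<^sup>+y. ennreal (source y) * ?e y \<partial>lborel) =
      ennreal (r * (1 / \<beta>) + p * K * (1 / (psi \<beta> - r)) - p * r * (1 / (psi \<beta> - r) * (1 / \<beta>)))"
    by (rule ennreal_cancel_right) (use r p K \<beta>0 s0 in auto)
  then show ?thesis by (simp add: K_def)
qed

text \<open>At \<open>\<beta> = \<Phi>(p + r)\<close> one has \<open>psi \<beta> - r = p\<close>, and two of the three terms cancel.\<close>

lemma laplace_source_at_passage_rate:
  "(LINT y|lborel. exp (- passage_rate (p + r) * y) * source y) = r / passage_rate r"
proof -
  have pr: "0 < p + r" using p r by simp
  have \<Phi>0: "0 < passage_rate r" by (rule passage_exponential(1)[OF r])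
  have less: "passage_rate r < passage_rate (p + r)" using p by (intro passage_rate_strict_mono[OF r]) simp
  have "(\<integral>\<^sup>+y. ennreal (exp (- passage_rate (p + r) * y) * source y) \<partial>lborel) = ennreal (r / passage_rate r)"
  proof -
    have "(\<integral>\<^sup>+y. ennreal (exp (- passage_rate (p + r) * y) * source y) \<partial>lborel) =
        (\<integral>\<^sup>+y. ennreal (source y) * ennreal (exp (- passage_rate (p + r) * y)) \<partial>lborel)"
      using source_bounds(1) by (intro nn_integral_cong) (simp add: ennreal_mult mult.commute)
    also have "\<dots> = ennreal (r / passage_rate (p + r) + p * (r / passage_rate r) / p - p * r / (p * passage_rate (p + r)))"
      unfolding laplace_source[OF less] psi_passage_rate[OF pr] by simp
    also have "r / passage_rate (p + r) + p * (r / passage_rate r) / p - p * r / (p * passage_rate (p + r)) = r / passage_rate r"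
      using p by simp
    finally show ?thesis .
  qed
  then show ?thesis
    using source_bounds(1) r \<Phi>0 by (subst integral_eq_nn_integral) (auto intro!: mult_nonneg_nonneg)
qed

text \<open>Both sides are nonnegative and right-continuous on \<open>[0, \<infinity>)\<close>, and with \<open>a = psi \<beta> - r\<close> their Laplace
  transforms at \<open>\<beta>\<close> agree by partial fractions in \<open>a\<close>.\<close>

lemma scale_convolution_source:
  "(LINT y|lborel. W (p + r) (x - y) * source y) + r / passage_rate r * W r x =
    r / passage_rate r * W (p + r) x + r * (LINT s|lborel. W r (x - s) * indicator {0..} s)"
proof (cases "x < 0")
  case True
  have Wr: "scale_function psi r (W r)" "scale_function psi (p + r) (W (p + r))" using W r p by simp_all
  have "(LINT s|lborel. W r (x - s) * indicator {0..} s) = 0" by (rule scale_convolution_0[OF Wr(1) _ True]) simp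
  moreover have "(LINT y|lborel. W (p + r) (x - y) * source y) = 0" by (rule scale_convolution_0[OF Wr(2) source_bounds(3) True])
  ultimately show ?thesis using Wr True by (simp add: scale_function_def)
next
  case False
  define K where "K = r / passage_rate r"
  have K: "0 \<le> K" unfolding K_def using passage_exponential(1)[OF r] r by simp
  have pr: "0 < p + r" using p r by simp
  have Wr: "scale_function psi r (W r)" and Wpr: "scale_function psi (p + r) (W (p + r))" using W r p by simp_all
  note [measurable] = scale_function_measurable[OF Wr] scale_function_measurable[OF Wpr]
  note W_nn = scale_function_nonneg[OF Wr] scale_function_nonneg[OF Wpr]
  let ?C = "\<lambda>x. LINT y|lborel. W (p + r) (x - y) * source y"
  let ?V = "\<lambda>x. LINT s|lborel. W r (x - s) * indicator {0..} s"
  note C = scale_convolution_nonneg[OF pr Wpr measurable_source source_bounds]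
  have [measurable]: "?C \<in> borel_measurable borel" by (rule C(3))
  have ind: "0 \<le> (indicator {0..} y :: real)" "(indicator {0..} y :: real) \<le> 1" "\<forall>y<0. (indicator {0..} (y::real) :: real) = 0" for y :: real
    by (auto simp: indicator_def)
  have ind_m: "(indicator {0..} :: real \<Rightarrow> real) \<in> borel_measurable borel" by simp
  note V = scale_convolution_nonneg[OF r Wr ind_m ind]
  have [measurable]: "?V \<in> borel_measurable borel" by (rule V(3))
  let ?F = "\<lambda>x. ?C x + K * W r x" and ?G = "\<lambda>x. K * W (p + r) x + r * ?V x"
  have cont: "(\<lambda>n. W \<mu> (xs n)) \<longlonglongrightarrow> W \<mu> x" if "0 < \<mu>" "0 \<le> x" "\<And>n. x \<le> xs n" "xs \<longlonglongrightarrow> x" for \<mu> x and xs :: "nat \<Rightarrow> real"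
    using W[of \<mu>] that by (intro continuous_on_tendsto_compose[of "{0..}" "W \<mu>"])
      (auto simp: scale_function_def intro!: always_eventually intro: order_trans)
  define f where "f \<beta> = 1 / (psi \<beta> - (p + r)) * (r / \<beta> + p * K / (psi \<beta> - r) - p * r / ((psi \<beta> - r) * \<beta>)) + K * (1 / (psi \<beta> - r))" for \<beta>
  define g where "g \<beta> = K * (1 / (psi \<beta> - (p + r))) + r * (1 / (psi \<beta> - r) * (1 / \<beta>))" for \<beta>
  have LF: "(\<integral>\<^sup>+x. ennreal (?F x) * ennreal (exp (- \<beta> * x)) \<partial>lborel) =
      ennreal (f \<beta>)"
    and LG: "(\<integral>\<^sup>+x. ennreal (?G x) * ennreal (exp (- \<beta> * x)) \<partial>lborel) =
      ennreal (g \<beta>)"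
    and fg: "f \<beta> = g \<beta>"
    if \<beta>: "passage_rate (p + r) < \<beta>" for \<beta>
  proof -
    let ?e = "\<lambda>y. ennreal (exp (- \<beta> * y))"
    have \<beta>r: "passage_rate r < \<beta>" using \<beta> passage_rate_strict_mono[OF r, of "p + r"] p by simp
    have \<beta>0: "0 < \<beta>" using \<beta>r passage_exponential(1)[OF r] by simp
    have s: "p + r < psi \<beta>" by (rule psi_greater[OF pr \<beta>])
    have one: "(\<integral>\<^sup>+y. ennreal (indicator {0..} y) * ?e y \<partial>lborel) = ennreal (1 / \<beta>)"
      using nn_integral_exp_Ici[of \<beta>] \<beta>0 by (simp add: ennreal_indicator mult.commute)
    have src: "0 \<le> r / \<beta> + p * K / (psi \<beta> - r) - p * r / ((psi \<beta> - r) * \<beta>)"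
    proof -
      have "p * r / ((psi \<beta> - r) * \<beta>) = p / (psi \<beta> - r) * (r / \<beta>)" by simp
      also have "\<dots> \<le> 1 * (r / \<beta>)" using s p r \<beta>0 by (intro mult_right_mono) (auto simp: field_simps)
      finally have 1: "p * r / ((psi \<beta> - r) * \<beta>) \<le> r / \<beta>" by simp
      have "0 \<le> p * K / (psi \<beta> - r)" using s p K by simp
      with 1 show ?thesis by linarith
    qed
    have "(\<integral>\<^sup>+x. ennreal (?F x) * ?e x \<partial>lborel) = (\<integral>\<^sup>+x. ennreal (?C x) * ?e x + ennreal K * (ennreal (W r x) * ?e x) \<partial>lborel)"
      using C(1) K W_nn by (intro nn_integral_cong) (simp add: ennreal_plus ennreal_mult distrib_right mult.assoc)
    also have "\<dots> = (\<integral>\<^sup>+x. ennreal (?C x) * ?e x \<partial>lborel) + ennreal K * (\<integral>\<^sup>+x. ennreal (W r x) * ?e x \<partial>lborel)"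
      by (subst nn_integral_add) (auto simp: nn_integral_cmult)
    also have "\<dots> = ennreal (1 / (psi \<beta> - (p + r))) * ennreal (r / \<beta> + p * K / (psi \<beta> - r) - p * r / ((psi \<beta> - r) * \<beta>)) + ennreal K * ennreal (1 / (psi \<beta> - r))"
      unfolding nn_laplace_scale_convolution[OF pr Wpr measurable_source source_bounds \<beta>] laplace_source[OF \<beta>r]
        nn_integral_exp_scale_function[OF r Wr \<beta>r] K_def ..
    also have "\<dots> = ennreal (f \<beta>)"
      unfolding f_def using s p K src by (intro ennreal_sum_of_products) auto
    finally show "(\<integral>\<^sup>+x. ennreal (?F x) * ?e x \<partial>lborel) = ennreal (f \<beta>)" .
    have "(\<integral>\<^sup>+x. ennreal (?G x) * ?e x \<partial>lborel) = (\<integral>\<^sup>+x. ennreal K * (ennreal (W (p + r) x) * ?e x) + ennreal r * (ennreal (?V x) * ?e x) \<partial>lborel)"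
      using V(1) K W_nn r by (intro nn_integral_cong) (simp add: ennreal_plus ennreal_mult distrib_right mult.assoc)
    also have "\<dots> = ennreal K * (\<integral>\<^sup>+x. ennreal (W (p + r) x) * ?e x \<partial>lborel) + ennreal r * (\<integral>\<^sup>+x. ennreal (?V x) * ?e x \<partial>lborel)"
      by (subst nn_integral_add) (auto simp: nn_integral_cmult)
    also have "\<dots> = ennreal K * ennreal (1 / (psi \<beta> - (p + r))) + ennreal r * (ennreal (1 / (psi \<beta> - r)) * ennreal (1 / \<beta>))"
      unfolding nn_laplace_scale_convolution[OF r Wr ind_m ind \<beta>r] nn_integral_exp_scale_function[OF pr Wpr \<beta>] one ..
    also have "\<dots> = ennreal (g \<beta>)"
      proof -
      have "ennreal (1 / (psi \<beta> - r)) * ennreal (1 / \<beta>) = ennreal (1 / (psi \<beta> - r) * (1 / \<beta>))"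
        using s p \<beta>0 by (intro ennreal_mult[symmetric]) auto
      then show ?thesis
        unfolding g_def using s p K r \<beta>0 by (simp only:) (intro ennreal_sum_of_products, auto)
    qed
    finally show "(\<integral>\<^sup>+x. ennreal (?G x) * ?e x \<partial>lborel) = ennreal (g \<beta>)" .
    define a where "a = psi \<beta> - r"
    have a: "0 < a - p" "0 < a" "psi \<beta> - (p + r) = a - p" "psi \<beta> - r = a" using s p by (auto simp: a_def)
    have "1 / (a - p) * (r / \<beta> + p * K / a - p * r / (a * \<beta>)) + K * (1 / a) = K * (1 / (a - p)) + r * (1 / a * (1 / \<beta>))"
    proof -
      have "r / \<beta> + p * K / a - p * r / (a * \<beta>) = (a - p) * (r / (a * \<beta>)) + p * K / a"
        using a \<beta>0 by (simp add: field_simps)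
      then have "1 / (a - p) * (r / \<beta> + p * K / a - p * r / (a * \<beta>)) = r / (a * \<beta>) + p * K / (a * (a - p))"
        using a by (simp add: field_simps)
      moreover have "p * K / (a * (a - p)) = K * (1 / (a - p)) - K * (1 / a)"
        using a by (simp add: field_simps)
      ultimately show ?thesis by simp
    qed
    then show "f \<beta> = g \<beta>" unfolding f_def g_def a .
  qed
  have "?F x = ?G x"
  proof (rule nonneg_eq_of_laplace_transform_eq[where F="?F" and G="?G" and b="passage_rate (p + r)"])
    show "0 \<le> ?F x" "0 \<le> ?G x" for x using C(1) V(1) K W_nn r by (auto intro!: add_nonneg_nonneg mult_nonneg_nonneg)
    show "?F x = 0" if "x < 0" for x
      using scale_convolution_0[OF Wpr source_bounds(3) that] Wr that by (simp add: scale_function_def)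
    show "?G x = 0" if "x < 0" for x
      using scale_convolution_0[OF Wr ind(3) that] Wpr that by (simp add: scale_function_def)
    show "(\<integral>\<^sup>+x. ennreal (?F x) * ennreal (exp (- \<beta> * x)) \<partial>lborel) < \<infinity>" if "passage_rate (p + r) < \<beta>" for \<beta>
      unfolding LF[OF that] by simp
    show "(\<integral>\<^sup>+x. ennreal (?F x) * ennreal (exp (- \<beta> * x)) \<partial>lborel) = (\<integral>\<^sup>+x. ennreal (?G x) * ennreal (exp (- \<beta> * x)) \<partial>lborel)"
      if "passage_rate (p + r) < \<beta>" for \<beta>
      unfolding LF[OF that] LG[OF that] fg[OF that] ..
    show "(\<lambda>n. ?F (xs n)) \<longlonglongrightarrow> ?F x" if "0 \<le> x" "\<And>n. x \<le> xs n" "\<And>n. xs n \<le> x + 1" "xs \<longlonglongrightarrow> x" for x xs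
    proof (intro tendsto_add tendsto_mult tendsto_const)
      show "(\<lambda>n. ?C (xs n)) \<longlonglongrightarrow> ?C x"
        by (rule scale_convolution_right_limit[OF Wpr measurable_source _ _ that, where B="r + p"])
          (use source_bounds in auto)
      show "(\<lambda>n. W r (xs n)) \<longlonglongrightarrow> W r x" by (rule cont[OF r]) (use that in auto)
    qed
    show "(\<lambda>n. ?G (xs n)) \<longlonglongrightarrow> ?G x" if "0 \<le> x" "\<And>n. x \<le> xs n" "\<And>n. xs n \<le> x + 1" "xs \<longlonglongrightarrow> x" for x xs
    proof (intro tendsto_add tendsto_mult tendsto_const)
      show "(\<lambda>n. ?V (xs n)) \<longlonglongrightarrow> ?V x"
        by (rule scale_convolution_right_limit[OF Wr ind_m _ _ that, where B=1]) (auto split: split_indicator)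
      show "(\<lambda>n. W (p + r) (xs n)) \<longlonglongrightarrow> W (p + r) x" by (rule cont[OF pr]) (use that in auto)
    qed
  qed (use False in auto)
  then show ?thesis by (simp add: K_def)
qed

lemma expect_before_end_formula:
  assumes q: "0 < q"
  shows "expect_at r (discount_at_last p q) x =
      r * (W r x - W (p + r) x) / passage_rate r
       + r * (passage_rate (p + q + r) - passage_rate (p + r)) / (q * passage_rate r) * scale_Z psi W (p + r) x (passage_rate (p + q + r))
       - r * (LBINT y:{0..x}. W r y)"
proof -
  let ?u = "expect_at r (discount_at_last p q)"
  have pq: "0 \<le> p" "0 \<le> q" using p q by auto
  have pr: "0 < p + r" "r < p + r" and prq: "0 < p + r + q" using p q r by auto
  have Wr: "scale_function psi r (W r)" using W r by simp
  note u_m [measurable] = measurable_expect_at[OF r measurable_discount_at_last[of p q]]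
  note u_bd = expect_at_bounds[where F="discount_at_last p q", OF r discount_at_last_bounds(2)[OF pq]]
  have eq1: "?u x = resolvent r (\<lambda>y. source y - (p + q * indicator {..<0} y) * ?u y) x" for x
    unfolding source_def by (rule expect_at_before_end[OF r pq Wr])
  \<comment> \<open>The constant rate \<open>p\<close> is absorbed by the resolvent.\<close>
  have eq2: "?u x = resolvent (p + r) (\<lambda>y. 0 * (exp (0 * y) * indicator {..<0} y) + source y - q * indicator {..<0} y * ?u y) x" for x
  proof -
    have "?u x = resolvent (p + r) (\<lambda>y. source y - (p + q * indicator {..<0} y) * ?u y + (p + r - r) * ?u y) x"
    proof (rule resolvent_shift[OF r pr(2) _ _ eq1, where B="r + p + (p + q)"])
      show "\<bar>source y - (p + q * indicator {..<0} y) * ?u y\<bar> \<le> r + p + (p + q)" for y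
      proof -
        have "0 \<le> (p + q * indicator {..<0} y) * ?u y" using pq u_bd by (intro mult_nonneg_nonneg add_nonneg_nonneg) auto
        moreover have "(p + q * indicator {..<0} y) * ?u y \<le> (p + q) * 1"
          using pq u_bd by (intro mult_mono) (auto split: split_indicator)
        ultimately show ?thesis using source_bounds(1,2)[of y] pq r by (simp add: abs_le_iff)
      qed
    qed measurable
    also have "(\<lambda>y. source y - (p + q * indicator {..<0} y) * ?u y + (p + r - r) * ?u y) =
        (\<lambda>y. 0 * (exp (0 * y) * indicator {..<0} y) + source y - q * indicator {..<0} y * ?u y)"
      by (auto simp: fun_eq_iff algebra_simps)
    finally show ?thesis .
  qed
  have "?u x = 0 / (p + r + q - psi 0) * scale_Z psi W (p + r) x 0
    + (passage_rate (p + r + q) - passage_rate (p + r)) / q *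
       ((LINT y|lborel. exp (- passage_rate (p + r) * y) * source y) - 0 / (p + r + q - psi 0) * (p + r - psi 0) / (passage_rate (p + r) - 0))
       * scale_Z psi W (p + r) x (passage_rate (p + r + q))
    - (LINT y|lborel. W (p + r) (x - y) * source y)"
  proof (rule feynman_kac_solution[where W=W and B="r + p" and D=1, OF pr(1) q _ _ _ _ _ _ _ _ _ _ eq2])
    show "scale_function psi (p + r) (W (p + r))" "scale_function psi (p + r + q) (W (p + r + q))" using W pr prq by simp_all
    show "0 \<noteq> passage_rate (p + r)" "0 \<noteq> passage_rate (p + r + q)"
      using passage_exponential(1)[OF pr(1)] passage_exponential(1)[OF prq] by simp_all
    show "\<bar>source y\<bar> \<le> r + p" "y < 0 \<Longrightarrow> source y = 0" for y using source_bounds(1,2)[of y] source_bounds(3) by auto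
    show "\<bar>?u y\<bar> \<le> 1" for y using u_bd[of y] by simp
  qed simp_all
  also have "\<dots> = (passage_rate (p + q + r) - passage_rate (p + r)) / q * (r / passage_rate r) * scale_Z psi W (p + r) x (passage_rate (p + q + r))
    - (LINT y|lborel. W (p + r) (x - y) * source y)"
    unfolding laplace_source_at_passage_rate by (simp add: add_ac)
  also have "(LINT y|lborel. W (p + r) (x - y) * source y) =
     r / passage_rate r * W (p + r) x + r * (LINT s|lborel. W r (x - s) * indicator {0..} s) - r / passage_rate r * W r x"
    using scale_convolution_source[of x] by simp
  also have "(LINT s|lborel. W r (x - s) * indicator {0..} s) = (LBINT y:{0..x}. W r y)"
  proof -
    have "(LINT s|lborel. W r (x - s) * indicator {0..} s) = \<bar>- 1\<bar> *\<^sub>R (LINT s|lborel. W r (x - (x + (- 1) * s)) * indicator {0..} (x + (- 1) * s))"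
      by (rule lborel_integral_real_affine) simp
    also have "\<dots> = (LBINT y:{0..x}. W r y)"
    proof -
      have eq: "W r s * indicator {0..} (x - s) = indicator {0..x} s * W r s" for s
        using Wr by (cases "s < 0") (auto simp: scale_function_def split: split_indicator)
      have "(LINT s|lborel. W r s * indicator {0..} (x - s)) = (LINT s|lborel. indicator {0..x} s * W r s)"
        unfolding eq ..
      then show ?thesis by (simp add: set_lebesgue_integral_def)
    qed
    finally show ?thesis .
  qed
  finally show ?thesis by (simp add: right_diff_distrib diff_divide_distrib mult_ac)
qed

lemma expect_at_end_formula:
  assumes q: "0 < q" and \<theta>: "0 \<le> \<theta>" "\<theta> \<noteq> passage_rate (p + r)" "\<theta> \<noteq> passage_rate (p + q + r)"
  defines "F \<equiv> \<lambda>(t, y, w). exp (- p * max t 0 - q * negative_time y t w) * (exp (\<theta> * (y + path_value t w)) * indicator {..<0} (y + path_value t w))"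
  shows "expect_at r F x =
      r / (p + q + r - psi \<theta>)
             * (- ((p + r - psi \<theta>) / q * ((passage_rate (p + q + r) - passage_rate (p + r)) / (passage_rate (p + r) - \<theta>))))
             * scale_Z psi W (p + r) x (passage_rate (p + q + r))
           + r / (p + q + r - psi \<theta>) * scale_Z psi W (p + r) x \<theta>"
proof -
  let ?u = "expect_at r F"
  let ?f = "\<lambda>y. exp (\<theta> * y) * indicator {..<0} y :: real"
  have pq: "0 \<le> p" "0 \<le> q" using p q by auto
  have pr: "0 < p + r" "r < p + r" and prq: "0 < p + r + q" "p + q + r = p + r + q" using p q r by auto
  have f: "0 \<le> ?f y" "?f y \<le> 1" for y using \<theta>(1) by (auto split: split_indicator simp: mult_nonneg_nonpos)
  have F_m: "F \<in> borel_measurable (borel \<Otimes>\<^sub>M borel \<Otimes>\<^sub>M path_space)" unfolding F_def case_prod_beta by measurable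
  note u_m [measurable] = measurable_expect_at[OF r F_m]
  have F_le: "F z \<le> 1" for z
  proof -
    obtain t y w where z: "z = (t, y, w)" by (cases z)
    have "0 \<le> p * max t 0" "0 \<le> q * negative_time y t w"
      using pq negative_time_nonneg[of y t w] by (auto intro!: mult_nonneg_nonneg)
    then have "exp (- p * max t 0 - q * negative_time y t w) * ?f (y + path_value t w) \<le> 1 * 1"
      using f by (intro mult_mono) auto
    then show ?thesis by (simp add: F_def z)
  qed
  note u_bd = expect_at_bounds[where F=F, OF r F_le]
  have eq1: "?u x = resolvent r (\<lambda>y. r * ?f y - (p + q * indicator {..<0} y) * ?u y) x" for x
    unfolding F_def by (rule expect_at_discounted[where f="?f", OF r pq _ f]) measurable
  have eq2: "?u x = resolvent (p + r) (\<lambda>y. r * (exp (\<theta> * y) * indicator {..<0} y) + 0 - q * indicator {..<0} y * ?u y) x" for x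
  proof -
    have "?u x = resolvent (p + r) (\<lambda>y. r * ?f y - (p + q * indicator {..<0} y) * ?u y + (p + r - r) * ?u y) x"
    proof (rule resolvent_shift[OF r pr(2) _ _ eq1, where B="r + (p + q)"])
      show "\<bar>r * ?f y - (p + q * indicator {..<0} y) * ?u y\<bar> \<le> r + (p + q)" for y
      proof -
        have "0 \<le> (p + q * indicator {..<0} y) * ?u y" using pq u_bd by (intro mult_nonneg_nonneg add_nonneg_nonneg) auto
        moreover have "(p + q * indicator {..<0} y) * ?u y \<le> (p + q) * 1"
          using pq u_bd by (intro mult_mono) (auto split: split_indicator)
        moreover have "0 \<le> r * ?f y" "r * ?f y \<le> r * 1" using f[of y] r by (intro mult_nonneg_nonneg mult_left_mono; simp)+
        ultimately show ?thesis
        proof -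
          have "0 \<le> a \<Longrightarrow> a \<le> r * 1 \<Longrightarrow> 0 \<le> b \<Longrightarrow> b \<le> (p + q) * 1 \<Longrightarrow> \<bar>a - b\<bar> \<le> r + (p + q)" for a b
            using pq r by (auto simp: abs_le_iff)
          from this[OF \<open>0 \<le> r * ?f y\<close> \<open>r * ?f y \<le> r * 1\<close> \<open>0 \<le> (p + q * indicator {..<0} y) * ?u y\<close> \<open>(p + q * indicator {..<0} y) * ?u y \<le> (p + q) * 1\<close>]
          show ?thesis .
        qed
      qed
    qed measurable
    also have "(\<lambda>y. r * ?f y - (p + q * indicator {..<0} y) * ?u y + (p + r - r) * ?u y) =
        (\<lambda>y. r * (exp (\<theta> * y) * indicator {..<0} y) + 0 - q * indicator {..<0} y * ?u y)"
      by (auto simp: fun_eq_iff algebra_simps)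
    finally show ?thesis .
  qed
  have "?u x = r / (p + r + q - psi \<theta>) * scale_Z psi W (p + r) x \<theta>
    + (passage_rate (p + r + q) - passage_rate (p + r)) / q *
       ((LINT y|lborel. exp (- passage_rate (p + r) * y) * 0) - r / (p + r + q - psi \<theta>) * (p + r - psi \<theta>) / (passage_rate (p + r) - \<theta>))
       * scale_Z psi W (p + r) x (passage_rate (p + r + q))
    - (LINT y|lborel. W (p + r) (x - y) * 0)"
  proof (rule feynman_kac_solution[where W=W and B=0 and D=1 and f="\<lambda>_. 0", OF pr(1) q _ _ _ _ _ _ _ _ _ _ eq2])
    show "scale_function psi (p + r) (W (p + r))" "scale_function psi (p + r + q) (W (p + r + q))" using W pr prq by simp_all
    show "\<theta> \<noteq> passage_rate (p + r + q)" using \<theta>(3) prq(2) by simp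
    show "\<bar>?u y\<bar> \<le> 1" for y using u_bd[of y] by simp
  qed (use \<theta> in simp_all)
  also have "\<dots> = r / (p + r + q - psi \<theta>)
             * (- ((p + r - psi \<theta>) / q * ((passage_rate (p + r + q) - passage_rate (p + r)) / (passage_rate (p + r) - \<theta>))))
             * scale_Z psi W (p + r) x (passage_rate (p + r + q))
           + r / (p + r + q - psi \<theta>) * scale_Z psi W (p + r) x \<theta>"
    by (simp add: mult_ac)
  finally show ?thesis unfolding prq(2) .
qed

end

end

section \<open>The identities at the exponential time\<close>

text \<open>The occupation time of \<open>(-\<infinity>, 0]\<close> as a measurable function of the path; it agrees with \<open>occupation_time\<close>
  along every path of \<open>X\<close>.\<close>

definition nonpos_time :: "real \<Rightarrow> real \<Rightarrow> (real \<Rightarrow> real) \<Rightarrow> real" where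
  "nonpos_time x t w = (LINT s|lborel. (if 0 \<le> s \<and> s \<le> t \<and> x + path_value s w \<le> 0 then 1 else 0))"

lemma measurable_nonpos_time [measurable (raw)]:
  assumes [measurable]: "f \<in> borel_measurable N" "g \<in> borel_measurable N" "h \<in> measurable N path_space"
  shows "(\<lambda>z. nonpos_time (f z) (g z) (h z)) \<in> borel_measurable N"
  unfolding nonpos_time_def by measurable

text \<open>The functional of the second identity: the restriction to \<open>T = e\<close> is replaced by the restriction to a
  negative terminal value, and the maximum with \<open>0\<close> keeps the functional bounded at negative times.\<close>

definition end_functional :: "real \<Rightarrow> real \<Rightarrow> real \<Rightarrow> real \<times> real \<times> (real \<Rightarrow> real) \<Rightarrow> real" where
  "end_functional p q \<theta> = (\<lambda>(t, y, w). exp (- p * max t 0 - q * negative_time y t w) *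
     (exp (\<theta> * (y + path_value t w)) * indicator {..<0} (y + path_value t w)))"

lemma measurable_end_functional [measurable]:
  "end_functional p q \<theta> \<in> borel_measurable (borel \<Otimes>\<^sub>M borel \<Otimes>\<^sub>M path_space)"
  unfolding end_functional_def case_prod_beta by measurable

lemma end_functional_bounds:
  assumes "0 \<le> p" "0 \<le> q" "0 \<le> \<theta>" shows "0 \<le> end_functional p q \<theta> z" "end_functional p q \<theta> z \<le> 1"
proof -
  obtain t y w where z: "z = (t, y, w)" by (cases z)
  have "0 \<le> p * max t 0" "0 \<le> q * negative_time y t w"
    using assms negative_time_nonneg[of y t w] by (auto intro!: mult_nonneg_nonneg)
  moreover have "exp (\<theta> * (y + path_value t w)) * indicator {..<0} (y + path_value t w) \<le> (1::real)"
    using assms by (auto split: split_indicator simp: mult_nonneg_nonpos)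
  ultimately have "end_functional p q \<theta> z \<le> 1 * 1"
    unfolding end_functional_def z prod.case by (intro mult_mono) auto
  then show "0 \<le> end_functional p q \<theta> z" "end_functional p q \<theta> z \<le> 1" by (auto simp: end_functional_def z)
qed

context spectrally_negative_levy
begin

text \<open>For \<open>t < 0\<close> both sides are \<open>0\<close>.\<close>

lemma last_negative_time_path:
  assumes \<omega>: "\<omega> \<in> space M"
  shows "last_negative_time (path_from x X \<omega>) t = last_negative x t (path \<omega>)"
proof (cases "0 \<le> t")
  case True
  have "path_from x X \<omega> = (\<lambda>s. x + X s \<omega>)" by (simp add: path_from_def[abs_def])
  then show ?thesis
    using is_last_negative_unique[OF is_last_negative_time[OF True, of "\<lambda>s. x + X s \<omega>"] path_is_last_negative[OF \<omega> True]] by simp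
next
  case False
  have L: "(\<lambda>u. if 0 < u \<and> u < t \<and> x + path_value u (path \<omega>) < 0 then u else 0) = (\<lambda>u. 0)"
    using False by auto
  have ne: "(\<rat> :: real set) \<noteq> {}" using Rats_0 by blast
  have "last_negative x t (path \<omega>) = 0" unfolding last_negative_def L using False ne by simp
  moreover have "{s. 0 < s \<and> s \<le> t \<and> path_from x X \<omega> s < 0} = {}" using False by auto
  ultimately show ?thesis by (simp add: last_negative_time_def)
qed

lemma occupation_time_path:
  assumes \<omega>: "\<omega> \<in> space M"
  shows "occupation_time (path_from x X \<omega>) t = nonpos_time x t (path \<omega>)"
  unfolding occupation_time_def nonpos_time_def set_lebesgue_integral_def
  by (intro Bochner_Integration.integral_cong refl) (auto simp: path_from_def path_value_path[OF \<omega>] split: split_indicator)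

lemma nonpos_time_eq_negative_time:
  assumes \<omega>: "\<omega> \<in> space M" and null: "AE s in lborel. 0 \<le> s \<longrightarrow> X s \<omega> \<noteq> - x"
  shows "nonpos_time x t (path \<omega>) = negative_time x t (path \<omega>)"
  unfolding nonpos_time_def negative_time_def
proof (rule integral_cong_AE)
  have [measurable]: "path \<omega> \<in> space path_space" by (rule path_in_path_space[OF \<omega>])
  show "(\<lambda>s. if 0 \<le> s \<and> s \<le> t \<and> x + path_value s (path \<omega>) \<le> 0 then 1 else 0 :: real) \<in> borel_measurable lborel"
    "(\<lambda>s. if 0 \<le> s \<and> s \<le> t \<and> x + path_value s (path \<omega>) < 0 then 1 else 0 :: real) \<in> borel_measurable lborel"
    by measurable
  show "AE s in lborel. (if 0 \<le> s \<and> s \<le> t \<and> x + path_value s (path \<omega>) \<le> 0 then 1 else 0 :: real) =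
      (if 0 \<le> s \<and> s \<le> t \<and> x + path_value s (path \<omega>) < 0 then 1 else 0)"
    using null by eventually_elim (auto simp: path_value_path[OF \<omega>])
qed

context
  fixes e :: "'a \<Rightarrow> real" and r :: real and W :: "real \<Rightarrow> real"
  assumes r: "0 < r" and exponential: "distributed M lborel e (exponential_density r)"
    and independent: "indep_set (sets (vimage_algebra (space M) e borel))
         (sets (vimage_algebra (space M) (\<lambda>\<omega>. \<lambda>t\<in>{0..}. X t \<omega>) (\<Pi>\<^sub>M t\<in>{0..}. borel)))"
    and W: "scale_function psi r W"
begin

lemma measurable_e [measurable]: "e \<in> borel_measurable M"
  using distributed_measurable[OF exponential] by simp

lemma distr_e: "distr M borel e = exp_law r"
proof -
  have "distr M borel e = distr M lborel e" by (rule distr_cong) auto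
  also have "\<dots> = exp_law r" by (rule distributed_distr_eq_density[OF exponential])
  finally show ?thesis .
qed

text \<open>Independence of \<open>e\<close> and the path makes their joint law a product, so the expectation is the iterated one
  in \<open>expect_at\<close>.\<close>

lemma expect_at_independent:
  assumes F [measurable]: "F \<in> borel_measurable (borel \<Otimes>\<^sub>M borel \<Otimes>\<^sub>M path_space)" and F_nn: "\<And>z. 0 \<le> F z"
  shows "(LINT \<omega>|M. F (e \<omega>, x, path \<omega>)) = expect_at r F x"
proof -
  interpret P: prob_space "distr M path_space path" by (rule prob_space_distr) measurable
  interpret E: prob_space "exp_law r" by (rule prob_space_exponential_density[OF r])
  have "exp_law r \<Otimes>\<^sub>M distr M path_space path = distr M (borel \<Otimes>\<^sub>M path_space) (\<lambda>\<omega>. (e \<omega>, path \<omega>))"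
  proof (rule pair_measure_eqI[OF E.sigma_finite_measure_axioms P.sigma_finite_measure_axioms])
    fix A B assume "A \<in> sets (exp_law r)" and "B \<in> sets (distr M path_space path)"
    then have A [measurable]: "A \<in> sets borel" and B [measurable]: "B \<in> sets path_space" by simp_all
    have "prob ((e -` A \<inter> space M) \<inter> (path -` B \<inter> space M)) = prob (e -` A \<inter> space M) * prob (path -` B \<inter> space M)"
      using independent A B by (intro indep_setD) (auto simp: path_def[abs_def] intro: in_vimage_algebra)
    then have "emeasure M ((e -` A \<inter> space M) \<inter> (path -` B \<inter> space M)) = emeasure M (e -` A \<inter> space M) * emeasure M (path -` B \<inter> space M)"
      by (simp add: emeasure_eq_measure ennreal_mult)
    moreover have "(e -` A \<inter> space M) \<inter> (path -` B \<inter> space M) = (\<lambda>\<omega>. (e \<omega>, path \<omega>)) -` (A \<times> B) \<inter> space M" by auto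
    ultimately show "emeasure (exp_law r) A * emeasure (distr M path_space path) B =
        emeasure (distr M (borel \<Otimes>\<^sub>M path_space) (\<lambda>\<omega>. (e \<omega>, path \<omega>))) (A \<times> B)"
      unfolding distr_e[symmetric] by (simp add: emeasure_distr)
  qed (auto intro!: sets_pair_measure_cong)
  note prod = this[symmetric]
  have "(\<integral>\<^sup>+\<omega>. ennreal (F (e \<omega>, x, path \<omega>)) \<partial>M) = (\<integral>\<^sup>+z. ennreal (F (fst z, x, snd z)) \<partial>distr M (borel \<Otimes>\<^sub>M path_space) (\<lambda>\<omega>. (e \<omega>, path \<omega>)))"
    by (subst nn_integral_distr) auto
  also have "\<dots> = (\<integral>\<^sup>+t. \<integral>\<^sup>+w. ennreal (F (t, x, w)) \<partial>distr M path_space path \<partial>exp_law r)"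
    unfolding prod by (subst P.nn_integral_fst[symmetric]) auto
  also have "\<dots> = (\<integral>\<^sup>+t. \<integral>\<^sup>+\<omega>. ennreal (F (t, x, path \<omega>)) \<partial>M \<partial>exp_law r)"
    by (intro nn_integral_cong nn_integral_distr) auto
  finally have "(\<integral>\<^sup>+\<omega>. ennreal (F (e \<omega>, x, path \<omega>)) \<partial>M) = (\<integral>\<^sup>+t. \<integral>\<^sup>+\<omega>. ennreal (F (t, x, path \<omega>)) \<partial>M \<partial>exp_law r)" .
  then show ?thesis unfolding expect_at_def using F_nn by (subst integral_eq_nn_integral) auto
qed

lemma AE_e_pos: "AE \<omega> in M. 0 < e \<omega>"
  using AE_exp_law_pos[OF r] unfolding distr_e[symmetric] by (subst (asm) AE_distr_iff) auto

text \<open>The probability that the path is at zero at time \<open>e\<close> is \<open>r U\<^sub>r {-x}\<close>, and \<open>U\<^sub>r\<close> has no atoms.\<close>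

lemma AE_end_nonzero: "AE \<omega> in M. x + path_value (e \<omega>) (path \<omega>) \<noteq> 0"
proof -
  let ?F = "\<lambda>(t, y, w). indicator {0} (y + path_value t w) :: real"
  have F_m [measurable]: "?F \<in> borel_measurable (borel \<Otimes>\<^sub>M borel \<Otimes>\<^sub>M path_space)"
    unfolding case_prod_beta by measurable
  have "(LINT \<omega>|M. ?F (e \<omega>, x, path \<omega>)) = expect_at r ?F x"
    by (rule expect_at_independent[OF F_m]) (auto split: prod.split)
  also have "\<dots> = r * resolvent r (indicator {0}) x"
    by (rule expect_at_terminal_value[OF r]) (auto split: split_indicator)
  also have "resolvent r (indicator {0}) x = (LINT z|potential r. indicator {- x} z)"
    unfolding resolvent_def by (intro Bochner_Integration.integral_cong refl) (auto split: split_indicator)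
  also have "\<dots> = 0" using potential_no_atoms[OF r W, of "- x"] by (simp add: measure_def)
  finally have 0: "(LINT \<omega>|M. indicator {0} (x + path_value (e \<omega>) (path \<omega>)) :: real) = 0" by simp
  have "integrable M (\<lambda>\<omega>. indicator {0} (x + path_value (e \<omega>) (path \<omega>)) :: real)"
    by (rule integrable_const_bound[where B=1]) (auto split: split_indicator)
  then have "AE \<omega> in M. indicator {0} (x + path_value (e \<omega>) (path \<omega>)) = (0::real)"
    using 0 by (subst (asm) integral_nonneg_eq_0_iff_AE) auto
  then show ?thesis by (rule eventually_mono) (auto split: split_indicator_asm)
qed

lemma AE_path_regular:
  "AE \<omega> in M. \<omega> \<in> space M \<and> 0 < e \<omega> \<and> x + X (e \<omega>) \<omega> \<noteq> 0 \<and> (AE s in lborel. 0 \<le> s \<longrightarrow> X s \<omega> \<noteq> - x)"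
  using AE_space AE_e_pos AE_end_nonzero[of x] AE_zero_set_null[OF r W, of "- x"]
  by eventually_elim (auto simp: path_value_path)

lemma expectation_before_end:
  fixes x :: real
  assumes pq: "0 \<le> p" "0 \<le> q"
  defines "T \<equiv> \<lambda>\<omega>. last_negative_time (path_from x X \<omega>) (e \<omega>)"
  shows "(LINT \<omega>:{\<omega> \<in> space M. T \<omega> < e \<omega>}|M. exp (- p * T \<omega> - q * occupation_time (path_from x X \<omega>) (T \<omega>))) =
    expect_at r (discount_at_last p q) x"
proof -
  let ?L = "\<lambda>\<omega>. last_negative x (e \<omega>) (path \<omega>)"
  have "(LINT \<omega>:{\<omega> \<in> space M. T \<omega> < e \<omega>}|M. exp (- p * T \<omega> - q * occupation_time (path_from x X \<omega>) (T \<omega>))) =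
      (LINT \<omega>|M. (if ?L \<omega> < e \<omega> then exp (- p * ?L \<omega> - q * nonpos_time x (?L \<omega>) (path \<omega>)) else 0))"
    unfolding set_lebesgue_integral_def
    by (intro Bochner_Integration.integral_cong refl) (simp add: T_def last_negative_time_path occupation_time_path)
  also have "\<dots> = (LINT \<omega>|M. discount_at_last p q (e \<omega>, x, path \<omega>))"
  proof (rule integral_cong_AE)
    show "AE \<omega> in M. (if ?L \<omega> < e \<omega> then exp (- p * ?L \<omega> - q * nonpos_time x (?L \<omega>) (path \<omega>)) else 0) = discount_at_last p q (e \<omega>, x, path \<omega>)"
      using AE_path_regular[of x] by eventually_elim (auto simp: discount_at_last_def nonpos_time_eq_negative_time)
  qed measurable
  also have "\<dots> = expect_at r (discount_at_last p q) x"
    by (rule expect_at_independent[OF measurable_discount_at_last discount_at_last_bounds(1)[OF pq]])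
  finally show ?thesis .
qed

lemma expectation_at_end:
  fixes x :: real
  defines "T \<equiv> \<lambda>\<omega>. last_negative_time (path_from x X \<omega>) (e \<omega>)"
  shows "(LINT \<omega>:{\<omega> \<in> space M. T \<omega> = e \<omega>}|M.
      exp (- p * T \<omega> - q * occupation_time (path_from x X \<omega>) (T \<omega>) + \<theta> * path_from x X \<omega> (T \<omega>))) =
    (LINT \<omega>|M. end_functional p q \<theta> (e \<omega>, x, path \<omega>))"
proof -
  let ?L = "\<lambda>\<omega>. last_negative x (e \<omega>) (path \<omega>)"
  let ?h = "\<lambda>\<omega>. if ?L \<omega> = e \<omega> then exp (- p * ?L \<omega> - q * nonpos_time x (?L \<omega>) (path \<omega>) + \<theta> * (x + path_value (?L \<omega>) (path \<omega>))) else 0"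
  have "(LINT \<omega>:{\<omega> \<in> space M. T \<omega> = e \<omega>}|M.
      exp (- p * T \<omega> - q * occupation_time (path_from x X \<omega>) (T \<omega>) + \<theta> * path_from x X \<omega> (T \<omega>))) =
      (LINT \<omega>|M. ?h \<omega>)"
    unfolding set_lebesgue_integral_def
  proof (intro Bochner_Integration.integral_cong refl)
    fix \<omega> assume \<omega>: "\<omega> \<in> space M"
    have "path_value (?L \<omega>) (path \<omega>) = X (?L \<omega>) \<omega>" by (rule path_value_path[OF \<omega> last_negative_nonneg])
    then have "?L \<omega> = e \<omega> \<Longrightarrow> path_value (e \<omega>) (path \<omega>) = X (e \<omega>) \<omega>" by simp
    then show "indicator {\<omega> \<in> space M. T \<omega> = e \<omega>} \<omega> *\<^sub>R exp (- p * T \<omega> - q * occupation_time (path_from x X \<omega>) (T \<omega>) + \<theta> * path_from x X \<omega> (T \<omega>)) =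
      ?h \<omega>"
      using \<omega> by (auto simp: T_def last_negative_time_path occupation_time_path path_from_def)
  qed
  also have "\<dots> = (LINT \<omega>|M. end_functional p q \<theta> (e \<omega>, x, path \<omega>))"
  proof (rule integral_cong_AE)
    show "AE \<omega> in M. ?h \<omega> =
      end_functional p q \<theta> (e \<omega>, x, path \<omega>)"
      using AE_path_regular[of x]
    proof eventually_elim
      case (elim \<omega>)
      then have \<omega>: "\<omega> \<in> space M" and e: "0 < e \<omega>" and ne: "x + X (e \<omega>) \<omega> \<noteq> 0" by auto
      have v: "path_value (e \<omega>) (path \<omega>) = X (e \<omega>) \<omega>" using e by (intro path_value_path[OF \<omega>]) simp
      have "?L \<omega> \<le> e \<omega>" using path_is_last_negative[OF \<omega>, of "e \<omega>" x] e by (auto simp: is_last_negative_def)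
      then have "?L \<omega> = e \<omega> \<longleftrightarrow> x + X (e \<omega>) \<omega> < 0"
        using last_negative_eq_end[OF \<omega> e ne] by linarith
      moreover have "nonpos_time x (e \<omega>) (path \<omega>) = negative_time x (e \<omega>) (path \<omega>)"
        using elim by (intro nonpos_time_eq_negative_time) auto
      ultimately show ?case
        using e by (auto simp: end_functional_def v exp_add[symmetric])
    qed
  qed measurable
  finally show ?thesis .
qed

text \<open>The maximum with \<open>0\<close> makes the functional bounded for every real parameter; near a positive \<open>\<theta>\<close> it has no
  effect.\<close>

lemma end_functional_continuous:
  assumes pq: "0 \<le> p" "0 \<le> q"
  shows "((\<lambda>\<theta>'. LINT \<omega>|M. end_functional p q (max \<theta>' 0) (e \<omega>, x, path \<omega>)) \<longlongrightarrow>
    (LINT \<omega>|M. end_functional p q (max \<theta> 0) (e \<omega>, x, path \<omega>))) (at \<theta>)"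
  unfolding tendsto_at_iff_sequentially comp_def
proof (intro allI impI)
  fix \<theta>' :: "nat \<Rightarrow> real"
  assume lim: "\<theta>' \<longlonglongrightarrow> \<theta>"
  show "(\<lambda>n. LINT \<omega>|M. end_functional p q (max (\<theta>' n) 0) (e \<omega>, x, path \<omega>)) \<longlonglongrightarrow> (LINT \<omega>|M. end_functional p q (max \<theta> 0) (e \<omega>, x, path \<omega>))"
  proof (rule integral_dominated_convergence[where w="\<lambda>_. 1"])
    show "AE \<omega> in M. (\<lambda>n. end_functional p q (max (\<theta>' n) 0) (e \<omega>, x, path \<omega>)) \<longlonglongrightarrow> end_functional p q (max \<theta> 0) (e \<omega>, x, path \<omega>)"
      unfolding end_functional_def prod.case by (intro AE_I2 tendsto_intros lim)
    show "AE \<omega> in M. norm (end_functional p q (max (\<theta>' n) 0) (e \<omega>, x, path \<omega>)) \<le> 1" for n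
      using end_functional_bounds[OF pq, of "max (\<theta>' n) 0"] by (intro AE_I2) auto
  qed measurable
qed

end

end

theorem theorem3p1:
  fixes M :: "'a measure"
    and X :: "real \<Rightarrow> 'a \<Rightarrow> real"
    and e :: "'a \<Rightarrow> real"
    and \<psi> \<Phi> :: "real \<Rightarrow> real"
    and W :: "real \<Rightarrow> real \<Rightarrow> real"
    and Y :: "'a \<Rightarrow> real \<Rightarrow> real"
    and T :: "'a \<Rightarrow> real"
    and p q r \<theta> x :: real
  assumes X: "spectrally_negative_levy M X"
    and positive: "p > 0" "q > 0" "r > 0" "\<theta> > 0"
    and exponential: "distributed M lborel e (exponential_density r)"
    and independent:
      "prob_space.indep_set M (sets (vimage_algebra (space M) e borel))
         (sets (vimage_algebra (space M) (\<lambda>\<omega>. \<lambda>t\<in>{0..}. X t \<omega>) (\<Pi>\<^sub>M t\<in>{0..}. borel)))"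
    and psi: "\<psi> = laplace_exponent M X"
    and Phi: "\<Phi> = right_inverse \<psi>"
    and scale: "\<And>\<alpha>. \<alpha> \<ge> 0 \<Longrightarrow> scale_function \<psi> \<alpha> (W \<alpha>)"
    and path: "Y = path_from x X"
    and last_time: "T = (\<lambda>\<omega>. last_negative_time (Y \<omega>) (e \<omega>))"
  shows
    "(LINT \<omega>:{\<omega> \<in> space M. T \<omega> < e \<omega>}|M.
        exp (- p * T \<omega> - q * occupation_time (Y \<omega>) (T \<omega>)))
     = r * (W r x - W (p + r) x) / \<Phi> r
       + r * (\<Phi> (p + q + r) - \<Phi> (p + r)) / (q * \<Phi> r) * scale_Z \<psi> W (p + r) x (\<Phi> (p + q + r))
       - r * (LBINT y:{0..x}. W r y)
     \<and>
     value_or_limit {\<Phi> (p + r), \<Phi> (p + q + r)}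
       (\<lambda>\<theta>. r / (p + q + r - \<psi> \<theta>)
             * (- ((p + r - \<psi> \<theta>) / q * ((\<Phi> (p + q + r) - \<Phi> (p + r)) / (\<Phi> (p + r) - \<theta>))))
             * scale_Z \<psi> W (p + r) x (\<Phi> (p + q + r))
           + r / (p + q + r - \<psi> \<theta>) * scale_Z \<psi> W (p + r) x \<theta>)
       \<theta>
       (LINT \<omega>:{\<omega> \<in> space M. T \<omega> = e \<omega>}|M.
          exp (- p * T \<omega> - q * occupation_time (Y \<omega>) (T \<omega>) + \<theta> * Y \<omega> (T \<omega>)))"
proof -
  interpret spectrally_negative_levy M X by (rule X)
  note p = positive(1) and q = positive(2) and r = positive(3) and \<theta> = positive(4)
  have pq: "0 \<le> p" "0 \<le> q" using p q by auto
  have W: "scale_function psi \<alpha> (W \<alpha>)" if "0 \<le> \<alpha>" for \<alpha> using scale[OF that] by (simp add: psi)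
  have Wr: "scale_function psi r (W r)" using W r by simp
  have \<Phi>: "\<Phi> r = passage_rate r" "\<Phi> (p + r) = passage_rate (p + r)" "\<Phi> (p + q + r) = passage_rate (p + q + r)"
    using right_inverse_psi p q r by (simp_all add: Phi psi)
  note setting = r exponential independent Wr
  have first: "(LINT \<omega>:{\<omega> \<in> space M. T \<omega> < e \<omega>}|M.
        exp (- p * T \<omega> - q * occupation_time (Y \<omega>) (T \<omega>)))
     = r * (W r x - W (p + r) x) / \<Phi> r
       + r * (\<Phi> (p + q + r) - \<Phi> (p + r)) / (q * \<Phi> r) * scale_Z \<psi> W (p + r) x (\<Phi> (p + q + r))
       - r * (LBINT y:{0..x}. W r y)"
    unfolding last_time path \<Phi> psi expectation_before_end[OF setting pq]
    by (rule expect_before_end_formula[where W=W, OF r p W q])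
  let ?S = "{\<Phi> (p + r), \<Phi> (p + q + r)}"
  let ?f = "\<lambda>\<theta>. r / (p + q + r - \<psi> \<theta>)
             * (- ((p + r - \<psi> \<theta>) / q * ((\<Phi> (p + q + r) - \<Phi> (p + r)) / (\<Phi> (p + r) - \<theta>))))
             * scale_Z \<psi> W (p + r) x (\<Phi> (p + q + r))
           + r / (p + q + r - \<psi> \<theta>) * scale_Z \<psi> W (p + r) x \<theta>"
  let ?v = "\<lambda>\<theta>. LINT \<omega>|M. end_functional p q \<theta> (e \<omega>, x, path \<omega>)"
  have formula: "?v \<theta>' = ?f \<theta>'" if "0 \<le> \<theta>'" "\<theta>' \<notin> ?S" for \<theta>'
  proof -
    have "?v \<theta>' = expect_at r (end_functional p q \<theta>') x"
      by (rule expect_at_independent[OF setting measurable_end_functional end_functional_bounds(1)[OF pq that(1)]])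
    also have "\<dots> = ?f \<theta>'"
      unfolding end_functional_def \<Phi> psi
      by (rule expect_at_end_formula[where W=W, OF r p W q that(1)]) (use that(2) \<Phi> in auto)
    finally show ?thesis .
  qed
  have "value_or_limit ?S ?f \<theta> (?v \<theta>)"
  proof (cases "\<theta> \<in> ?S")
    case False
    then show ?thesis using formula[OF less_imp_le[OF \<theta>] False] by (simp only: value_or_limit_def if_False)
  next
    case True
    \<comment> \<open>Near \<open>\<theta>\<close> only \<open>\<theta>\<close> itself and finitely many other points are exceptional, so the formula holds in a
      punctured neighbourhood.\<close>
    have "((\<lambda>\<theta>'. ?v (max \<theta>' 0)) \<longlongrightarrow> ?v (max \<theta> 0)) (at \<theta>)"
      by (rule end_functional_continuous[OF setting pq])
    moreover have "\<forall>\<^sub>F \<theta>' in at \<theta>. ?v (max \<theta>' 0) = ?f \<theta>'"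
    proof -
      have "\<forall>\<^sub>F \<theta>' in at \<theta>. 0 < \<theta>'" using \<theta> by (intro order_tendstoD(1)[OF tendsto_ident_at])
      then show ?thesis
        using eventually_neq_at_within[of "\<Phi> (p + r)" \<theta> UNIV] eventually_neq_at_within[of "\<Phi> (p + q + r)" \<theta> UNIV]
      proof eventually_elim
        case (elim \<theta>')
        then show ?case using formula[of \<theta>'] by (simp only: max_absorb1 less_imp_le) simp
      qed
    qed
    ultimately have "(?f \<longlongrightarrow> ?v (max \<theta> 0)) (at \<theta>)" by (rule Lim_transform_eventually)
    then show ?thesis using True \<theta> by (simp only: value_or_limit_def if_True max_absorb1 less_imp_le)
  qed
  then have "value_or_limit ?S ?f \<theta> (LINT \<omega>:{\<omega> \<in> space M. T \<omega> = e \<omega>}|M.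
          exp (- p * T \<omega> - q * occupation_time (Y \<omega>) (T \<omega>) + \<theta> * Y \<omega> (T \<omega>)))"
    unfolding last_time path expectation_at_end[OF setting] .
  with first show ?thesis by blast
qed

end
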